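(* Let $(\mathcal U\to\mathcal X\to B)$ be a $gtm$-family of supermanifolds of splitting type $j'$ over a connected, Stein base $B$. For $b\in B$ let $j_b$ denote the splitting type of the fiber $(\mathcal U_b\to\mathcal X_b)$ over $b$. Let $b\in B$ and suppose that the family is analytic and that $j_b<\infty$. Then the assignment $b\mapsto j_b$ defines a function that is locally constant at $b$, i.e. there is an open neighbourhood $V$ of $b$ in $B$ on which the splitting type of the fibers is constant.
   Context: Everything is holomorphic over $\mathbb C$ and abelian sheaves are locally free. A model $(Y,T^*_{Y,-})$ is a complex manifold $Y$ with a holomorphic vector bundle $T^*_{Y,-}$ (odd cotangent bundle). For $j\ge 2$, $\mathcal G^{(j)}_{T^*_{Y,-}}$ is the sheaf of groups of parity-preserving $\mathbb C$-algebra automorphisms $\alpha$ of $\wedge^\bullet T^*_{Y,-}$ with $\alpha(u)-u\in\bigoplus_{k\ge j}\wedge^kT^*_{Y,-}$ for all local sections $u$. A supermanifold modelled on $(Y,T^*_{Y,-})$ with splitting type $j$, written $(\mathcal U\to\mathcal X)$, is a representative (open cover and 1-cocycle) of a class in the pointed set $\check H^1(Y,\mathcal G^{(j)}_{T^*_{Y,-}})$; it glues to a locally ringed space $\mathcal X=(Y,\mathcal O_{\mathcal X})$ with $\mathcal O_{\mathcal X}$ locally isomorphic to $\wedge^\bullet T^*_{Y,-}$. For $j>\mathrm{rank}\,T^*_{Y,-}$ the sheaf is trivial, one writes $j=\infty$, and the supermanifold is the split model $S(Y,T^*_{Y,-})$. Standing assumption: a supermanifold of splitting type $j$ does not have splitting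 type $j+1$ unless $j=\infty$. The $j$-th obstruction sheaf is $\mathcal A^{(j)}_{T^*_{Y,-}}=\mathcal Hom_{\mathcal O_Y}(T^*_{Y,(\pm)^j},\wedge^jT^*_{Y,-})$, where $T^*_{Y,(\pm)^j}$ is $T^*_Y$ if $j$ is even and $T^*_{Y,-}$ if $j$ is odd. It is the quotient $\mathcal G^{(j)}_{T^*_{Y,-}}/\mathcal G^{(j+1)}_{T^*_{Y,-}}$, which induces $\omega:\check H^1(Y,\mathcal G^{(j)}_{T^*_{Y,-}})\to H^1(Y,\mathcal A^{(j)}_{T^*_{Y,-}})$ (target: the $j$-th obstruction space); the image $\omega(\mathcal U\to\mathcal X)$ is the obstruction to splitting, nonzero unless $j=\infty$ by the standing assumption. Put $\mathcal A_{T^*_{Y,-}}=\bigoplus_j\mathcal A^{(j)}_{T^*_{Y,-}}$. An embedding of models $(X,T^*_{X,-})\subset(Y,T^*_{Y,-})$ is an inclusion $i:X\subset Y$ of a submanifold with a surjection $i^*T^*_{Y,-}\to T^*_{X,-}$. Let $\mathcal G^{(j)}_{T^*_{X,-};T^*_{Y,-}}\subset\mathcal G^{(j)}_{T^*_{Y,-}}$ be the automorphisms restricting to automorphisms in $\mathcal G^{(j)}_{T^*_{X,-}}$, with induced maps $u_*$ to $\check H^1(Y,\mathcal G^{(j)}_{T^*_{Y,-}})$ and $r_*$ to $\check H^1(X,\mathcal G^{(j)}_{T^*_{X,-}})$. An embedding of a supermanifold of splitting type $j$ modelled on $(X,T^*_{X,-})$ into one of splitting type $j'$ modelled on $(Y,T^*_{Y,-})$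 is, for some $j''\le j,j'$, a class in $\check H^1(Y,\mathcal G^{(j'')}_{T^*_{X,-};T^*_{Y,-}})$ whose images under $r_*$ and $u_*$ are the images of the classes of the two supermanifolds. A family of supermanifolds $(\mathcal U\to\mathcal X\to B)$ modelled on $(X,T^*_{X,-})$ is a supermanifold $(\mathcal U\to\mathcal X)$ (the total space; its model $(Y,T^*_{Y,-})$ is the total space model and its splitting type is the splitting type of the family) with a morphism $f:\mathcal X\to B$ whose reduced part $Y\to B$ is an analytic family of compact complex manifolds (surjective holomorphic submersion with compact fibers), and for each $b\in B$ a supermanifold $(\mathcal U_b\to\mathcal X_b)$ modelled on $(X,T^*_{X,-})$ with some splitting type $j_b$ (the fiber over $b$), embedded in $(\mathcal U\to\mathcal X)$ over the inclusion of the fiber of $Y\to B$ over $b$. It is a $gtm$-family if $Y=X\times B$ (projections $p_X,p_B$) and $T^*_{Y,-}=p_X^*T^*_{X,-}$. The splitting type differential of the family is the map $B\to H^1(X,\mathcal A_{T^*_{X,-}})$, $b\mapsto\omega(\mathcal U_b\to\mathcal X_b)$. The family is analytic if this map is analytic as a map of complex analytic spaces. *)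

theory Defs
  imports "HOL-Analysis.Analysis" "HOL-Library.Function_Algebras"
begin

text \<open>
  Spaces are types: a complex manifold is a topological type with an atlas. Sums, differences and
  zero of functions are the pointwise ones.
\<close>

section \<open>Holomorphic functions and complex manifolds\<close>

text \<open>
  \<open>\<complex>\<^sup>n\<close> is the set of sequences vanishing from index \<open>n\<close> on; the product topology induces on it the
  Euclidean topology. This allows \<open>n = 0\<close> and makes dimensions add in products.
\<close>

definition Cn :: "nat \<Rightarrow> (nat \<Rightarrow> complex) set" where
  "Cn n = {z. \<forall>i\<ge>n. z i = 0}"

text \<open>Holomorphy in several variables: continuous and holomorphic in each variable separately.\<close>

definition holomorphic_Cn :: "nat \<Rightarrow> (nat \<Rightarrow> complex) set \<Rightarrow> ((nat \<Rightarrow> complex) \<Rightarrow> complex) \<Rightarrow> bool" where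
  "holomorphic_Cn n D f \<longleftrightarrow>
     continuous_on D f \<and>
     (\<forall>z\<in>D. \<forall>i<n. (\<lambda>w. f (z(i := w))) field_differentiable (at (z i)))"

definition partial_deriv :: "nat \<Rightarrow> ((nat \<Rightarrow> complex) \<Rightarrow> complex) \<Rightarrow> (nat \<Rightarrow> complex) \<Rightarrow> complex" where
  "partial_deriv i f z = deriv (\<lambda>w. f (z(i := w))) (z i)"

text \<open>A chart is its domain together with its coordinate map.\<close>

type_synonym 'x chart = "'x set \<times> ('x \<Rightarrow> nat \<Rightarrow> complex)"

abbreviation chart_inv :: "'x chart \<Rightarrow> (nat \<Rightarrow> complex) \<Rightarrow> 'x" where
  "chart_inv c \<equiv> inv_into (fst c) (snd c)"

record 'x cmfd =
  mdim :: nat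
  charts :: "'x chart set"

definition complex_manifold :: "'x::{t2_space,second_countable_topology} cmfd \<Rightarrow> bool" where
  "complex_manifold M \<longleftrightarrow>
     (\<forall>(U, \<phi>)\<in>charts M. open U \<and>
        openin (top_of_set (Cn (mdim M))) (\<phi> ` U) \<and>
        homeomorphism U (\<phi> ` U) \<phi> (inv_into U \<phi>)) \<and>
     (\<Union>(fst ` charts M)) = UNIV \<and>
     (\<forall>c\<in>charts M. \<forall>c'\<in>charts M. \<forall>i<mdim M.
        holomorphic_Cn (mdim M) (snd c ` (fst c \<inter> fst c')) (\<lambda>z. snd c' (chart_inv c z) i))"

definition holo_fun :: "'x::topological_space cmfd \<Rightarrow> 'x set \<Rightarrow> ('x \<Rightarrow> complex) \<Rightarrow> bool" where
  "holo_fun M W f \<longleftrightarrow>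
     (\<forall>c\<in>charts M. holomorphic_Cn (mdim M) (snd c ` (fst c \<inter> W)) (f \<circ> chart_inv c))"

text \<open>Sections over \<open>W\<close> of any sheaf of functions are extended by zero outside \<open>W\<close>.\<close>

definition osec :: "'x::topological_space cmfd \<Rightarrow> 'x set \<Rightarrow> ('x \<Rightarrow> complex) set" where
  "osec M W = {f. holo_fun M W f \<and> (\<forall>x. x \<notin> W \<longrightarrow> f x = 0)}"

definition rsec :: "'x set \<Rightarrow> ('x \<Rightarrow> 'v::zero) \<Rightarrow> 'x \<Rightarrow> 'v" where
  "rsec V s = (\<lambda>x. if x \<in> V then s x else 0)"

definition holo_map ::
  "'x::topological_space cmfd \<Rightarrow> 'y::topological_space cmfd \<Rightarrow> ('x \<Rightarrow> 'y) \<Rightarrow> bool" where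
  "holo_map M N f \<longleftrightarrow>
     continuous_on UNIV f \<and>
     (\<forall>(V, \<psi>)\<in>charts N. \<forall>k<mdim N. holo_fun M (f -` V) (\<lambda>x. \<psi> (f x) k))"

definition prod_mfd :: "'x cmfd \<Rightarrow> 'b cmfd \<Rightarrow> ('x \<times> 'b) cmfd" where
  "prod_mfd M N = \<lparr> mdim = mdim M + mdim N,
     charts = {(U \<times> V, \<lambda>(x, b) i. if i < mdim M then \<phi> x i else \<psi> b (i - mdim M)) | U \<phi> V \<psi>.
                 (U, \<phi>) \<in> charts M \<and> (V, \<psi>) \<in> charts N} \<rparr>"

definition stein :: "'x::topological_space cmfd \<Rightarrow> bool" where
  "stein M \<longleftrightarrow>
     (\<forall>K. compact K \<longrightarrow> compact {x. \<forall>f\<in>osec M UNIV. \<exists>y\<in>K. cmod (f x) \<le> cmod (f y)}) \<and>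
     (\<forall>x y. x \<noteq> y \<longrightarrow> (\<exists>f\<in>osec M UNIV. f x \<noteq> f y))"


section \<open>Holomorphic vector bundles\<close>

text \<open>
  Every fibre is \<open>\<complex>\<^sup>r\<close> as an abstract vector space (no loss of generality up to isomorphism); the
  topology and the holomorphic structure are carried by the local frames
  \<open>(U, e)\<close>, \<open>e k x\<close> being the value at \<open>x\<close> of the \<open>k\<close>-th frame section.
\<close>

record 'x vbundle =
  brank :: nat
  frames :: "('x set \<times> (nat \<Rightarrow> 'x \<Rightarrow> nat \<Rightarrow> complex)) set"

definition lin_indep :: "nat \<Rightarrow> (nat \<Rightarrow> nat \<Rightarrow> complex) \<Rightarrow> bool" where
  "lin_indep r v \<longleftrightarrow> (\<forall>c. (\<forall>i. (\<Sum>k<r. c k * v k i) = 0) \<longrightarrow> (\<forall>k<r. c k = 0))"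

definition vsec ::
  "'x::topological_space cmfd \<Rightarrow> 'x vbundle \<Rightarrow> 'x set \<Rightarrow> ('x \<Rightarrow> nat \<Rightarrow> complex) set" where
  "vsec M E W = {s. (\<forall>x. s x \<in> Cn (brank E)) \<and> (\<forall>x. x \<notin> W \<longrightarrow> s x = 0) \<and>
     (\<forall>(U, e)\<in>frames E. \<exists>c. (\<forall>k<brank E. holo_fun M (U \<inter> W) (c k)) \<and>
        (\<forall>x\<in>U \<inter> W. s x = (\<lambda>i. \<Sum>k<brank E. c k x * e k x i)))}"

definition holo_vbundle :: "'x::topological_space cmfd \<Rightarrow> 'x vbundle \<Rightarrow> bool" where
  "holo_vbundle M E \<longleftrightarrow>
     (\<forall>(U, e)\<in>frames E. open U \<and>
        (\<forall>x\<in>U. lin_indep (brank E) (\<lambda>k. e k x)) \<and>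
        (\<forall>k<brank E. rsec U (e k) \<in> vsec M E U)) \<and>
     (\<Union>(fst ` frames E)) = UNIV"

definition pullback_bundle :: "('y \<Rightarrow> 'x) \<Rightarrow> 'x vbundle \<Rightarrow> 'y vbundle" where
  "pullback_bundle p E = \<lparr> brank = brank E, frames = (\<lambda>(U, e). (p -` U, \<lambda>k y. e k (p y))) ` frames E \<rparr>"

text \<open>
  The cotangent space at \<open>x\<close> is identified with \<open>\<complex>\<^sup>n\<close> by the coordinate differentials of a chart
  chosen at \<open>x\<close>; the local frames are the coordinate differentials of all charts.
\<close>

definition ref_chart :: "'x cmfd \<Rightarrow> 'x \<Rightarrow> 'x chart" where
  "ref_chart M x = (SOME c. c \<in> charts M \<and> x \<in> fst c)"

definition differential :: "'x cmfd \<Rightarrow> ('x \<Rightarrow> complex) \<Rightarrow> 'x \<Rightarrow> nat \<Rightarrow> complex" where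
  "differential M f x = (\<lambda>i. if i < mdim M
     then partial_deriv i (f \<circ> chart_inv (ref_chart M x)) (snd (ref_chart M x) x) else 0)"

definition cotangent :: "'x cmfd \<Rightarrow> 'x vbundle" where
  "cotangent M = \<lparr> brank = mdim M,
     frames = (\<lambda>(U, \<phi>). (U, \<lambda>k. differential M (\<lambda>y. \<phi> y k))) ` charts M \<rparr>"

definition holo_submersion ::
  "'x::topological_space cmfd \<Rightarrow> 'y::topological_space cmfd \<Rightarrow> ('x \<Rightarrow> 'y) \<Rightarrow> bool" where
  "holo_submersion M N f \<longleftrightarrow> holo_map M N f \<and>
     (\<forall>x. \<forall>(V, \<psi>)\<in>charts N. f x \<in> V \<longrightarrow>
        lin_indep (mdim N) (\<lambda>k. differential M (\<lambda>y. \<psi> (f y) k) x))"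

definition holo_embedding ::
  "'x::topological_space cmfd \<Rightarrow> 'y::topological_space cmfd \<Rightarrow> ('x \<Rightarrow> 'y) \<Rightarrow> bool" where
  "holo_embedding M N f \<longleftrightarrow> holo_map M N f \<and>
     (\<exists>g. homeomorphism UNIV (range f) f g) \<and>
     (\<forall>x. \<forall>(V, \<psi>)\<in>charts N. f x \<in> V \<longrightarrow>
        (\<forall>v\<in>Cn (mdim M). \<exists>c. \<forall>i.
           v i = (\<Sum>k<mdim N. c k * differential M (\<lambda>y. \<psi> (f y) k) x i)))"


section \<open>The exterior algebra\<close>

text \<open>
  The exterior algebra of \<open>\<complex>\<^sup>r\<close>: coefficient functions with respect to the basis
  \<open>\<epsilon>\<^sub>S = \<epsilon>\<^sub>s\<^sub>1 \<and> \<dots> \<and> \<epsilon>\<^sub>s\<^sub>k\<close>, \<open>s\<^sub>1 < \<dots> < s\<^sub>k\<close> the elements of \<open>S \<subseteq> {..<r}\<close>.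
\<close>

type_synonym ext = "nat set \<Rightarrow> complex"
type_synonym 'x extsec = "'x \<Rightarrow> ext"

definition wedge :: "ext \<Rightarrow> ext \<Rightarrow> ext" where
  "wedge a b = (\<lambda>S. \<Sum>T\<in>Pow S.
     (-1) ^ card {(i, j). i \<in> T \<and> j \<in> S - T \<and> j < i} * a T * b (S - T))"

definition ext_const :: "complex \<Rightarrow> ext" where
  "ext_const c = (\<lambda>S. if S = {} then c else 0)"

definition ext_vec :: "(nat \<Rightarrow> complex) \<Rightarrow> ext" where
  "ext_vec v = (\<lambda>S. if card S = 1 then v (the_elem S) else 0)"

definition wedge_family :: "(nat \<Rightarrow> nat \<Rightarrow> complex) \<Rightarrow> nat set \<Rightarrow> ext" where
  "wedge_family v S = foldr (\<lambda>k. wedge (ext_vec (v k))) (sorted_list_of_set S) (ext_const 1)"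

definition ext_map :: "nat \<Rightarrow> ((nat \<Rightarrow> complex) \<Rightarrow> nat \<Rightarrow> complex) \<Rightarrow> ext \<Rightarrow> ext" where
  "ext_map r L a = (\<lambda>T. \<Sum>S\<in>Pow {..<r}.
     a S * wedge_family (\<lambda>k. L (\<lambda>i. if i = k then 1 else 0)) S T)"

definition esec :: "'x::topological_space cmfd \<Rightarrow> 'x vbundle \<Rightarrow> 'x set \<Rightarrow> 'x extsec set" where
  "esec M E W = {s. (\<forall>x S. \<not> S \<subseteq> {..<brank E} \<longrightarrow> s x S = 0) \<and> (\<forall>x. x \<notin> W \<longrightarrow> s x = 0) \<and>
     (\<forall>(U, e)\<in>frames E. \<exists>c. (\<forall>S\<in>Pow {..<brank E}. holo_fun M (U \<inter> W) (c S)) \<and>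
        (\<forall>x\<in>U \<inter> W. s x =
           (\<lambda>T. \<Sum>S\<in>Pow {..<brank E}. c S x * wedge_family (\<lambda>k. e k x) S T)))}"

definition fun_sec :: "('x \<Rightarrow> complex) \<Rightarrow> 'x extsec" where
  "fun_sec f = (\<lambda>x. ext_const (f x))"

definition vec_sec :: "('x \<Rightarrow> nat \<Rightarrow> complex) \<Rightarrow> 'x extsec" where
  "vec_sec s = (\<lambda>x. ext_vec (s x))"

definition wedge_sec :: "'x extsec \<Rightarrow> 'x extsec \<Rightarrow> 'x extsec" where
  "wedge_sec s t = (\<lambda>x. wedge (s x) (t x))"

definition scale_sec :: "('x \<Rightarrow> complex) \<Rightarrow> ('x \<Rightarrow> 'i \<Rightarrow> complex) \<Rightarrow> 'x \<Rightarrow> 'i \<Rightarrow> complex" where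
  "scale_sec f s = (\<lambda>x i. f x * s x i)"

definition even_sec :: "'x extsec \<Rightarrow> bool" where
  "even_sec s \<longleftrightarrow> (\<forall>x S. s x S \<noteq> 0 \<longrightarrow> even (card S))"

definition odd_sec :: "'x extsec \<Rightarrow> bool" where
  "odd_sec s \<longleftrightarrow> (\<forall>x S. s x S \<noteq> 0 \<longrightarrow> odd (card S))"

definition deg_ge :: "enat \<Rightarrow> 'x extsec \<Rightarrow> bool" where
  "deg_ge j s \<longleftrightarrow> (\<forall>x S. s x S \<noteq> 0 \<longrightarrow> j \<le> enat (card S))"

definition deg_part :: "nat \<Rightarrow> 'x extsec \<Rightarrow> 'x extsec" where
  "deg_part k s = (\<lambda>x S. if card S = k then s x S else 0)"


section \<open>First \v{C}ech cohomology of sheaves of groups\<close>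

text \<open>
  A section \<open>a\<close> over \<open>W\<close> is always a family indexed by the open subsets of \<open>W\<close>, so that its
  restriction to \<open>W' \<subseteq> W\<close> is \<open>a\<close> itself; \<open>grp_eq W a b\<close> says that \<open>a\<close> and \<open>b\<close> agree over \<open>W\<close>.
  The group law is not assumed to be commutative.
\<close>

record ('x, 'g) grp_sheaf =
  grp_sec :: "'x set \<Rightarrow> 'g set"
  grp_eq :: "'x set \<Rightarrow> 'g \<Rightarrow> 'g \<Rightarrow> bool"
  grp_mul :: "'g \<Rightarrow> 'g \<Rightarrow> 'g"

text \<open>
  Open covers are sets of open sets, indexed by themselves. This is enough: an arbitrarily indexed
  cocycle is refined by one of this kind, choosing an index for each occurring open set.
\<close>

type_synonym ('x, 'g) cochain = "'x set set \<times> ('x set \<Rightarrow> 'x set \<Rightarrow> 'g)"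

definition open_cover :: "'x::topological_space set set \<Rightarrow> bool" where
  "open_cover \<U> \<longleftrightarrow> (\<forall>U\<in>\<U>. open U) \<and> \<Union>\<U> = UNIV"

definition cech_cocycles :: "('x::topological_space, 'g) grp_sheaf \<Rightarrow> ('x, 'g) cochain set" where
  "cech_cocycles G = {(\<U>, g). open_cover \<U> \<and>
     (\<forall>U\<in>\<U>. \<forall>V\<in>\<U>. g U V \<in> grp_sec G (U \<inter> V)) \<and>
     (\<forall>U\<in>\<U>. \<forall>V\<in>\<U>. \<forall>W\<in>\<U>. grp_eq G (U \<inter> V \<inter> W) (grp_mul G (g U V) (g V W)) (g U W))}"

definition refinement :: "'x::topological_space set set \<Rightarrow> ('x set \<Rightarrow> 'x set) \<Rightarrow> 'x set set \<Rightarrow> bool" where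
  "refinement \<V> \<tau> \<U> \<longleftrightarrow> open_cover \<V> \<and> (\<forall>V\<in>\<V>. \<tau> V \<in> \<U> \<and> V \<subseteq> \<tau> V)"

text \<open>
  Two cocycles are related if they become cohomologous on a common refinement:
  \<open>g'\<^sub>V\<^sub>W = h\<^sub>V g\<^sub>V\<^sub>W h\<^sub>W\<^sup>-\<^sup>1\<close>.
\<close>

definition cech_rel ::
  "('x::topological_space, 'g) grp_sheaf \<Rightarrow> (('x, 'g) cochain \<times> ('x, 'g) cochain) set" where
  "cech_rel G = {((\<U>, g), (\<U>', g')).
     (\<U>, g) \<in> cech_cocycles G \<and> (\<U>', g') \<in> cech_cocycles G \<and>
     (\<exists>\<V> \<tau> \<tau>' h. refinement \<V> \<tau> \<U> \<and> refinement \<V> \<tau>' \<U>' \<and>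
        (\<forall>V\<in>\<V>. h V \<in> grp_sec G V) \<and>
        (\<forall>V\<in>\<V>. \<forall>W\<in>\<V>. grp_eq G (V \<inter> W)
           (grp_mul G (g' (\<tau>' V) (\<tau>' W)) (h W)) (grp_mul G (h V) (g (\<tau> V) (\<tau> W)))))}"

definition cech_H1 :: "('x::topological_space, 'g) grp_sheaf \<Rightarrow> ('x, 'g) cochain set set" where
  "cech_H1 G = cech_cocycles G // cech_rel G"

definition cech_class ::
  "('x::topological_space, 'g) grp_sheaf \<Rightarrow> ('x, 'g) cochain \<Rightarrow> ('x, 'g) cochain set" where
  "cech_class G p = cech_rel G `` {p}"

text \<open>The map on classes induced by an inclusion of a subsheaf of groups into \<open>G\<close>.\<close>

definition cech_incl ::
  "('x::topological_space, 'g) grp_sheaf \<Rightarrow> ('x, 'g) cochain set \<Rightarrow> ('x, 'g) cochain set" where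
  "cech_incl G \<xi> = cech_rel G `` \<xi>"


section \<open>Supermanifolds and obstructions to splitting\<close>

type_synonym 'x alg_aut = "'x set \<Rightarrow> 'x extsec \<Rightarrow> 'x extsec"
type_synonym 'x bundle_hom = "'x set \<Rightarrow> ('x \<Rightarrow> nat \<Rightarrow> complex) \<Rightarrow> 'x extsec"
type_synonym 'x supermfd = "('x, 'x alg_aut) cochain"

text \<open>The sheaf of groups \<open>\<G>\<^sup>(\<^sup>j\<^sup>)\<close>; for \<open>j = \<infinity>\<close> it consists of identities only.\<close>

definition aut_sheaf ::
  "'x::topological_space cmfd \<Rightarrow> 'x vbundle \<Rightarrow> enat \<Rightarrow> ('x, 'x alg_aut) grp_sheaf" where
  "aut_sheaf M E j = \<lparr>
     grp_sec = (\<lambda>W. {\<alpha>. \<forall>V. open V \<and> V \<subseteq> W \<longrightarrow>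
        bij_betw (\<alpha> V) (esec M E V) (esec M E V) \<and>
        \<alpha> V (fun_sec (indicator V)) = fun_sec (indicator V) \<and>
        (\<forall>s\<in>esec M E V. \<forall>t\<in>esec M E V. \<alpha> V (s + t) = \<alpha> V s + \<alpha> V t) \<and>
        (\<forall>s\<in>esec M E V. \<forall>t\<in>esec M E V. \<alpha> V (wedge_sec s t) = wedge_sec (\<alpha> V s) (\<alpha> V t)) \<and>
        (\<forall>s\<in>esec M E V. \<forall>c. \<alpha> V (scale_sec (\<lambda>x. c) s) = scale_sec (\<lambda>x. c) (\<alpha> V s)) \<and>
        (\<forall>s\<in>esec M E V. (even_sec s \<longrightarrow> even_sec (\<alpha> V s)) \<and> (odd_sec s \<longrightarrow> odd_sec (\<alpha> V s))) \<and>
        (\<forall>s\<in>esec M E V. \<forall>V'. open V' \<and> V' \<subseteq> V \<longrightarrow> \<alpha> V' (rsec V' s) = rsec V' (\<alpha> V s)) \<and>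
        (\<forall>s\<in>esec M E V. deg_ge j (\<alpha> V s - s))}),
     grp_eq = (\<lambda>W \<alpha> \<beta>. \<forall>V. open V \<and> V \<subseteq> W \<longrightarrow> (\<forall>s\<in>esec M E V. \<alpha> V s = \<beta> V s)),
     grp_mul = (\<lambda>\<alpha> \<beta> V s. \<alpha> V (\<beta> V s)) \<rparr>"

text \<open>
  A supermanifold modelled on \<open>(M, E)\<close> of splitting type \<open>j\<close>, under the standing convention that it
  does not also have splitting type \<open>j + 1\<close> unless \<open>j = \<infinity>\<close>. All finite \<open>j\<close> beyond the rank are
  written \<open>\<infinity>\<close>.
\<close>

definition supermanifold ::
  "'x::topological_space cmfd \<Rightarrow> 'x vbundle \<Rightarrow> enat \<Rightarrow> 'x supermfd \<Rightarrow> bool" where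
  "supermanifold M E j p \<longleftrightarrow>
     p \<in> cech_cocycles (aut_sheaf M E j) \<and>
     (j = \<infinity> \<or>
      2 \<le> j \<and> j \<le> enat (brank E) \<and>
      cech_class (aut_sheaf M E j) p
        \<notin> cech_incl (aut_sheaf M E j) ` cech_H1 (aut_sheaf M E (j + 1)))"

text \<open>Sections over \<open>V\<close> of the structure sheaf glued from a cocycle: compatible families.\<close>

definition structure_sheaf ::
  "'x::topological_space cmfd \<Rightarrow> 'x vbundle \<Rightarrow> 'x supermfd \<Rightarrow> 'x set \<Rightarrow> ('x set \<Rightarrow> 'x extsec) set" where
  "structure_sheaf M E p W = {s. (\<forall>U\<in>fst p. s U \<in> esec M E (U \<inter> W)) \<and>
     (\<forall>U\<in>fst p. \<forall>V\<in>fst p.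
        rsec (U \<inter> V) (s U) = snd p U V (U \<inter> V \<inter> W) (rsec (U \<inter> V) (s V)))}"

text \<open>The \<open>k\<close>-th obstruction sheaf: homomorphisms of sheaves of modules into \<open>\<and>\<^sup>k E\<close>.\<close>

definition obs_dom :: "'x cmfd \<Rightarrow> 'x vbundle \<Rightarrow> nat \<Rightarrow> 'x vbundle" where
  "obs_dom M E k = (if even k then cotangent M else E)"

definition obs_sheaf ::
  "'x::topological_space cmfd \<Rightarrow> 'x vbundle \<Rightarrow> nat \<Rightarrow> ('x, 'x bundle_hom) grp_sheaf" where
  "obs_sheaf M E k = \<lparr>
     grp_sec = (\<lambda>W. {\<phi>. \<forall>V. open V \<and> V \<subseteq> W \<longrightarrow>
        (\<forall>s\<in>vsec M (obs_dom M E k) V.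
           \<phi> V s \<in> esec M E V \<and> deg_part k (\<phi> V s) = \<phi> V s \<and>
           (\<forall>t\<in>vsec M (obs_dom M E k) V. \<phi> V (s + t) = \<phi> V s + \<phi> V t) \<and>
           (\<forall>f\<in>osec M V. \<phi> V (scale_sec f s) = scale_sec f (\<phi> V s)) \<and>
           (\<forall>V'. open V' \<and> V' \<subseteq> V \<longrightarrow> \<phi> V' (rsec V' s) = rsec V' (\<phi> V s)))}),
     grp_eq = (\<lambda>W \<phi> \<psi>. \<forall>V. open V \<and> V \<subseteq> W \<longrightarrow>
        (\<forall>s\<in>vsec M (obs_dom M E k) V. \<phi> V s = \<psi> V s)),
     grp_mul = (+) \<rparr>"

text \<open>The direct sum of the obstruction sheaves; those beyond the rank of \<open>E\<close> vanish.\<close>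

definition total_obs_sheaf ::
  "'x::topological_space cmfd \<Rightarrow> 'x vbundle \<Rightarrow> ('x, nat \<Rightarrow> 'x bundle_hom) grp_sheaf" where
  "total_obs_sheaf M E = \<lparr>
     grp_sec = (\<lambda>W. {a. \<forall>k\<in>{2..brank E}. a k \<in> grp_sec (obs_sheaf M E k) W}),
     grp_eq = (\<lambda>W a b. \<forall>k\<in>{2..brank E}. grp_eq (obs_sheaf M E k) W (a k) (b k)),
     grp_mul = (+) \<rparr>"

text \<open>
  \<open>\<phi>\<close> is the image of \<open>\<alpha>\<close> under \<open>\<G>\<^sup>(\<^sup>k\<^sup>) \<rightarrow> \<G>\<^sup>(\<^sup>k\<^sup>) / \<G>\<^sup>(\<^sup>k\<^sup>+\<^sup>1\<^sup>) = \<A>\<^sup>(\<^sup>k\<^sup>)\<close>. For even \<open>k\<close> the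
  degree \<open>k\<close> part of \<open>\<alpha> - id\<close> is a derivation on functions, i.e. a homomorphism on differentials;
  for odd \<open>k\<close> it is a homomorphism on \<open>E\<close>.
\<close>

definition obs_symbol ::
  "'x::topological_space cmfd \<Rightarrow> 'x vbundle \<Rightarrow> nat \<Rightarrow> 'x set \<Rightarrow> 'x alg_aut \<Rightarrow> 'x bundle_hom \<Rightarrow> bool" where
  "obs_symbol M E k W \<alpha> \<phi> \<longleftrightarrow>
     \<phi> \<in> grp_sec (obs_sheaf M E k) W \<and>
     (\<forall>V. open V \<and> V \<subseteq> W \<longrightarrow>
        (if even k
         then \<forall>f\<in>osec M V. \<phi> V (rsec V (differential M f)) = deg_part k (\<alpha> V (fun_sec f) - fun_sec f)
         else \<forall>s\<in>vsec M E V. \<phi> V s = deg_part k (\<alpha> V (vec_sec s) - vec_sec s)))"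

definition obs_map ::
  "'x::topological_space cmfd \<Rightarrow> 'x vbundle \<Rightarrow> nat \<Rightarrow>
   ('x, 'x alg_aut) cochain set \<Rightarrow> ('x, 'x bundle_hom) cochain set" where
  "obs_map M E k \<xi> = cech_rel (obs_sheaf M E k) ``
     {(\<U>, a). \<exists>g. (\<U>, g) \<in> \<xi> \<and> (\<forall>U\<in>\<U>. \<forall>V\<in>\<U>. obs_symbol M E k (U \<inter> V) (g U V) (a U V))}"

definition obs_incl ::
  "'x::topological_space cmfd \<Rightarrow> 'x vbundle \<Rightarrow> nat \<Rightarrow>
   ('x, 'x bundle_hom) cochain set \<Rightarrow> ('x, nat \<Rightarrow> 'x bundle_hom) cochain set" where
  "obs_incl M E k \<xi> = cech_rel (total_obs_sheaf M E) ``
     {(\<U>, \<lambda>U V. (\<lambda>l. 0)(k := a U V)) | \<U> a. (\<U>, a) \<in> \<xi>}"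

definition obstruction ::
  "'x::topological_space cmfd \<Rightarrow> 'x vbundle \<Rightarrow> enat \<Rightarrow> 'x supermfd \<Rightarrow>
   ('x, nat \<Rightarrow> 'x bundle_hom) cochain set" where
  "obstruction M E j p = (case j of
       enat k \<Rightarrow> obs_incl M E k (obs_map M E k (cech_class (aut_sheaf M E j) p))
     | \<infinity> \<Rightarrow> cech_class (total_obs_sheaf M E) ({UNIV}, \<lambda>U V. 0))"


section \<open>Embeddings\<close>

text \<open>An embedding of models is given by \<open>i\<close> and, fibrewise, the surjection \<open>\<sigma> x : E\<^sub>Y\<^sub>,\<^sub>i\<^sub>(\<^sub>x\<^sub>) \<rightarrow> E\<^sub>X\<^sub>,\<^sub>x\<close>.\<close>

definition model_embedding ::
  "'x::topological_space cmfd \<Rightarrow> 'x vbundle \<Rightarrow> 'y::topological_space cmfd \<Rightarrow> 'y vbundle \<Rightarrow>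
   ('x \<Rightarrow> 'y) \<Rightarrow> ('x \<Rightarrow> (nat \<Rightarrow> complex) \<Rightarrow> nat \<Rightarrow> complex) \<Rightarrow> bool" where
  "model_embedding MX TX MY TY i \<sigma> \<longleftrightarrow>
     holo_embedding MX MY i \<and>
     (\<forall>x. \<sigma> x ` Cn (brank TY) = Cn (brank TX) \<and>
        (\<forall>v\<in>Cn (brank TY). \<forall>w\<in>Cn (brank TY). \<sigma> x (v + w) = \<sigma> x v + \<sigma> x w) \<and>
        (\<forall>v\<in>Cn (brank TY). \<forall>c. \<sigma> x (\<lambda>k. c * v k) = (\<lambda>k. c * \<sigma> x v k))) \<and>
     (\<forall>(U, e)\<in>frames TY. \<forall>k<brank TY.
        rsec (i -` U) (\<lambda>x. \<sigma> x (e k (i x))) \<in> vsec MX TX (i -` U))"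

definition pull_sec ::
  "'y vbundle \<Rightarrow> ('x \<Rightarrow> 'y) \<Rightarrow> ('x \<Rightarrow> (nat \<Rightarrow> complex) \<Rightarrow> nat \<Rightarrow> complex) \<Rightarrow> 'y extsec \<Rightarrow> 'x extsec" where
  "pull_sec TY i \<sigma> s = (\<lambda>x. ext_map (brank TY) (\<sigma> x) (s (i x)))"

text \<open>\<open>\<beta>\<close> over \<open>W' \<subseteq> i\<^sup>-\<^sup>1(W)\<close> is the automorphism induced by \<open>\<alpha>\<close> over \<open>W\<close>.\<close>

definition restricts_to ::
  "'y::topological_space cmfd \<Rightarrow> 'y vbundle \<Rightarrow> ('x::topological_space \<Rightarrow> 'y) \<Rightarrow>
   ('x \<Rightarrow> (nat \<Rightarrow> complex) \<Rightarrow> nat \<Rightarrow> complex) \<Rightarrow> 'y set \<Rightarrow> 'x set \<Rightarrow> 'y alg_aut \<Rightarrow> 'x alg_aut \<Rightarrow> bool" where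
  "restricts_to MY TY i \<sigma> W W' \<alpha> \<beta> \<longleftrightarrow>
     (\<forall>V V'. open V \<and> V \<subseteq> W \<and> open V' \<and> V' \<subseteq> W' \<and> V' \<subseteq> i -` V \<longrightarrow>
        (\<forall>s\<in>esec MY TY V.
           \<beta> V' (rsec V' (pull_sec TY i \<sigma> s)) = rsec V' (pull_sec TY i \<sigma> (\<alpha> V s))))"

definition rel_aut_sheaf ::
  "'x::topological_space cmfd \<Rightarrow> 'x vbundle \<Rightarrow> 'y::topological_space cmfd \<Rightarrow> 'y vbundle \<Rightarrow>
   ('x \<Rightarrow> 'y) \<Rightarrow> ('x \<Rightarrow> (nat \<Rightarrow> complex) \<Rightarrow> nat \<Rightarrow> complex) \<Rightarrow> enat \<Rightarrow> ('y, 'y alg_aut) grp_sheaf" where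
  "rel_aut_sheaf MX TX MY TY i \<sigma> j = (aut_sheaf MY TY j)\<lparr>
     grp_sec := (\<lambda>W. {\<alpha> \<in> grp_sec (aut_sheaf MY TY j) W.
        \<exists>\<beta> \<in> grp_sec (aut_sheaf MX TX j) (i -` W). restricts_to MY TY i \<sigma> W (i -` W) \<alpha> \<beta>}) \<rparr>"

text \<open>
  The map \<open>r\<^sub>*\<close>. A refinement map \<open>\<tau>\<close> is used since distinct members of a cover of \<open>Y\<close> may have
  the same preimage in \<open>X\<close>.
\<close>

definition restrict_class ::
  "'x::topological_space cmfd \<Rightarrow> 'x vbundle \<Rightarrow> 'y::topological_space cmfd \<Rightarrow> 'y vbundle \<Rightarrow>
   ('x \<Rightarrow> 'y) \<Rightarrow> ('x \<Rightarrow> (nat \<Rightarrow> complex) \<Rightarrow> nat \<Rightarrow> complex) \<Rightarrow> enat \<Rightarrow>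
   ('y, 'y alg_aut) cochain set \<Rightarrow> ('x, 'x alg_aut) cochain set" where
  "restrict_class MX TX MY TY i \<sigma> j \<xi> = cech_rel (aut_sheaf MX TX j) ``
     {(\<W>, \<beta>). \<exists>\<U> \<gamma> \<tau>. (\<U>, \<gamma>) \<in> \<xi> \<and> (\<forall>W\<in>\<W>. \<tau> W \<in> \<U> \<and> W \<subseteq> i -` \<tau> W) \<and>
        (\<forall>W\<in>\<W>. \<forall>W'\<in>\<W>.
           restricts_to MY TY i \<sigma> (\<tau> W \<inter> \<tau> W') (W \<inter> W') (\<gamma> (\<tau> W) (\<tau> W')) (\<beta> W W'))}"

definition super_embedding ::
  "'x::topological_space cmfd \<Rightarrow> 'x vbundle \<Rightarrow> 'y::topological_space cmfd \<Rightarrow> 'y vbundle \<Rightarrow>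
   ('x \<Rightarrow> 'y) \<Rightarrow> ('x \<Rightarrow> (nat \<Rightarrow> complex) \<Rightarrow> nat \<Rightarrow> complex) \<Rightarrow>
   enat \<Rightarrow> 'x supermfd \<Rightarrow> enat \<Rightarrow> 'y supermfd \<Rightarrow> bool" where
  "super_embedding MX TX MY TY i \<sigma> j p j' q \<longleftrightarrow>
     model_embedding MX TX MY TY i \<sigma> \<and>
     (\<exists>j''. 2 \<le> j'' \<and> j'' \<le> j \<and> j'' \<le> j' \<and>
        (\<exists>\<xi> \<in> cech_H1 (rel_aut_sheaf MX TX MY TY i \<sigma> j'').
           restrict_class MX TX MY TY i \<sigma> j'' \<xi>
             = cech_incl (aut_sheaf MX TX j'') (cech_class (aut_sheaf MX TX j) p) \<and>
           cech_incl (aut_sheaf MY TY j'') \<xi>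
             = cech_incl (aut_sheaf MY TY j'') (cech_class (aut_sheaf MY TY j') q)))"


section \<open>Families\<close>

record ('x, 'y, 'b) super_family =
  fib_mfd :: "'x cmfd"
  fib_odd :: "'x vbundle"
  tot_mfd :: "'y cmfd"
  tot_odd :: "'y vbundle"
  base :: "'b cmfd"
  tot_super :: "'y supermfd"
  tot_type :: enat
  proj :: "'y \<Rightarrow> 'b"
  proj_sharp :: "'b set \<Rightarrow> ('b \<Rightarrow> complex) \<Rightarrow> 'y set \<Rightarrow> 'y extsec"
  fib_super :: "'b \<Rightarrow> 'x supermfd"
  fib_type :: "'b \<Rightarrow> enat"
  fib_incl :: "'b \<Rightarrow> 'x \<Rightarrow> 'y"
  fib_surj :: "'b \<Rightarrow> 'x \<Rightarrow> (nat \<Rightarrow> complex) \<Rightarrow> nat \<Rightarrow> complex"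

text \<open>
  A morphism \<open>(f, f\<^sup>\<sharp>)\<close> from the supermanifold glued from \<open>p\<close> to the manifold \<open>B\<close>, with reduced part
  \<open>f\<close>: a morphism \<open>f\<^sup>\<sharp> : \<O>\<^sub>B \<rightarrow> f\<^sub>* \<O>\<^sub>X\<close> of sheaves of \<open>\<complex>\<close>-algebras, with even values, that
  induces the pullback of functions modulo odd sections.
\<close>

definition super_morphism ::
  "'y::topological_space cmfd \<Rightarrow> 'y vbundle \<Rightarrow> 'y supermfd \<Rightarrow> 'b::topological_space cmfd \<Rightarrow>
   ('y \<Rightarrow> 'b) \<Rightarrow> ('b set \<Rightarrow> ('b \<Rightarrow> complex) \<Rightarrow> 'y set \<Rightarrow> 'y extsec) \<Rightarrow> bool" where
  "super_morphism MY TY p MB f F \<longleftrightarrow> holo_map MY MB f \<and>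
     (\<forall>W. open W \<longrightarrow>
        (\<forall>h\<in>osec MB W. F W h \<in> structure_sheaf MY TY p (f -` W)) \<and>
        (\<forall>U\<in>fst p.
           F W (indicator W) U = fun_sec (indicator (U \<inter> f -` W)) \<and>
           (\<forall>h\<in>osec MB W.
              even_sec (F W h U) \<and>
              (\<forall>y\<in>U. F W h U y {} = h (f y)) \<and>
              (\<forall>c. F W (\<lambda>b. c * h b) U = scale_sec (\<lambda>y. c) (F W h U)) \<and>
              (\<forall>h'\<in>osec MB W. F W (h + h') U = F W h U + F W h' U \<and>
                 F W (\<lambda>b. h b * h' b) U = wedge_sec (F W h U) (F W h' U)) \<and>
              (\<forall>W'. open W' \<and> W' \<subseteq> W \<longrightarrow> F W' (rsec W' h) U = rsec (f -` W') (F W h U)))))"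

definition super_family ::
  "('x::{t2_space,second_countable_topology}, 'y::{t2_space,second_countable_topology},
    'b::{t2_space,second_countable_topology}) super_family \<Rightarrow> bool" where
  "super_family \<F> \<longleftrightarrow>
     complex_manifold (fib_mfd \<F>) \<and> holo_vbundle (fib_mfd \<F>) (fib_odd \<F>) \<and>
     complex_manifold (tot_mfd \<F>) \<and> holo_vbundle (tot_mfd \<F>) (tot_odd \<F>) \<and>
     complex_manifold (base \<F>) \<and>
     supermanifold (tot_mfd \<F>) (tot_odd \<F>) (tot_type \<F>) (tot_super \<F>) \<and>
     super_morphism (tot_mfd \<F>) (tot_odd \<F>) (tot_super \<F>) (base \<F>) (proj \<F>) (proj_sharp \<F>) \<and>
     surj (proj \<F>) \<and> holo_submersion (tot_mfd \<F>) (base \<F>) (proj \<F>) \<and>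
     (\<forall>b. compact (proj \<F> -` {b})) \<and>
     (\<forall>b. supermanifold (fib_mfd \<F>) (fib_odd \<F>) (fib_type \<F> b) (fib_super \<F> b) \<and>
        range (fib_incl \<F> b) = proj \<F> -` {b} \<and>
        super_embedding (fib_mfd \<F>) (fib_odd \<F>) (tot_mfd \<F>) (tot_odd \<F>)
          (fib_incl \<F> b) (fib_surj \<F> b)
          (fib_type \<F> b) (fib_super \<F> b) (tot_type \<F>) (tot_super \<F>))"

definition gtm_family ::
  "('x::{t2_space,second_countable_topology}, 'x \<times> 'b, 'b::{t2_space,second_countable_topology})
     super_family \<Rightarrow> bool" where
  "gtm_family \<F> \<longleftrightarrow> super_family \<F> \<and>
     tot_mfd \<F> = prod_mfd (fib_mfd \<F>) (base \<F>) \<and>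
     tot_odd \<F> = pullback_bundle fst (fib_odd \<F>) \<and>
     proj \<F> = snd \<and>
     (\<forall>b x. fib_incl \<F> b x = (x, b))"

definition splitting_type_differential ::
  "('x::topological_space, 'y, 'b) super_family \<Rightarrow> 'b \<Rightarrow> ('x, nat \<Rightarrow> 'x bundle_hom) cochain set" where
  "splitting_type_differential \<F> b =
     obstruction (fib_mfd \<F>) (fib_odd \<F>) (fib_type \<F> b) (fib_super \<F> b)"

text \<open>
  Linear combinations of cochains with values in the total obstruction sheaf, and bases of its
  first cohomology. The members of a finite basis can be represented on one common cover.
\<close>

definition obs_lincomb ::
  "nat \<Rightarrow> (nat \<Rightarrow> complex) \<Rightarrow> (nat \<Rightarrow> 'x set \<Rightarrow> 'x set \<Rightarrow> nat \<Rightarrow> 'x bundle_hom) \<Rightarrow>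
   'x set \<Rightarrow> 'x set \<Rightarrow> nat \<Rightarrow> 'x bundle_hom" where
  "obs_lincomb m c \<beta> = (\<lambda>U V k W s x S. \<Sum>i<m. c i * \<beta> i U V k W s x S)"

definition obs_H1_basis ::
  "'x::topological_space cmfd \<Rightarrow> 'x vbundle \<Rightarrow> nat \<Rightarrow> 'x set set \<Rightarrow>
   (nat \<Rightarrow> 'x set \<Rightarrow> 'x set \<Rightarrow> nat \<Rightarrow> 'x bundle_hom) \<Rightarrow> bool" where
  "obs_H1_basis M E m \<U> \<beta> \<longleftrightarrow>
     (\<forall>i<m. (\<U>, \<beta> i) \<in> cech_cocycles (total_obs_sheaf M E)) \<and>
     (\<forall>\<xi>\<in>cech_H1 (total_obs_sheaf M E). \<exists>!c. c \<in> Cn m \<and>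
        \<xi> = cech_class (total_obs_sheaf M E) (\<U>, obs_lincomb m c \<beta>))"

text \<open>
  Since the fibres are compact, \<open>H\<^sup>1(X, \<A>)\<close> is a finite-dimensional vector space. A map into it is
  analytic if its coordinates with respect to a basis are holomorphic.
\<close>

definition analytic_family ::
  "('x::topological_space, 'y, 'b::topological_space) super_family \<Rightarrow> bool" where
  "analytic_family \<F> \<longleftrightarrow>
     (\<exists>m \<U> \<beta> c. open_cover \<U> \<and> obs_H1_basis (fib_mfd \<F>) (fib_odd \<F>) m \<U> \<beta> \<and>
        (\<forall>i<m. c i \<in> osec (base \<F>) UNIV) \<and>
        (\<forall>b. splitting_type_differential \<F> b =
           cech_class (total_obs_sheaf (fib_mfd \<F>) (fib_odd \<F>))
             (\<U>, obs_lincomb m (\<lambda>i. c i b) \<beta>)))"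

end

theory Submission
  imports Defs "HOL-Complex_Analysis.Complex_Analysis"
begin

text \<open>
  Let \<open>k\<close> be the splitting type at \<open>b\<close>. The coordinates of the obstruction classes whose component in
  \<open>H\<^sup>1(X, \<A>\<^sup>(\<^sup>k\<^sup>))\<close> vanishes form a linear subspace of \<open>\<complex>\<^sup>m\<close>, hence a closed one. A fibre of splitting
  type different from \<open>k\<close> has its obstruction in this subspace. The fibre over \<open>b\<close> does not: if its
  obstruction vanished, its class would come from \<open>\<G>\<^sup>(\<^sup>k\<^sup>+\<^sup>1\<^sup>)\<close>, because \<open>\<G>\<^sup>(\<^sup>k\<^sup>) \<rightarrow> \<A>\<^sup>(\<^sup>k\<^sup>)\<close> is locally
  surjective with kernel \<open>\<G>\<^sup>(\<^sup>k\<^sup>+\<^sup>1\<^sup>)\<close>. Since the coordinates of the obstruction depend continuously on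
  the base point, the fibres near \<open>b\<close> have splitting type \<open>k\<close>.
\<close>

section \<open>Holomorphic functions of several variables\<close>

text \<open>If the obstruction cocycle is a coboundary, a_VW = h_V - h_W, one seeks local
  automorphisms H_V with symbol h_V; the modified transition \<open>H_V^-1 g H_W\<close> then has
  symbol 0. For odd \<open>k\<close> such lifts exist because the exterior algebra is free on a
  frame: the generators may be sent to arbitrary odd elements. For even \<open>k\<close> functions
  have to go to f + h(df), and identity plus a derivation is not multiplicative. The derivation is
  therefore cut into components e_T \<and> D_T along the frame products of degree \<open>k\<close>.
  Each e_T is central with square zero, which makes every piece multiplicative, and composition adds
  the symbols. For h(df) to make sense, df must be a holomorphic section. Since holomorphy means
  continuity plus separate differentiability, this calls for the chain rule and for holomorphy of
  partial derivatives. Closedness of the subspace enters through a linear functional that vanishes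
  on it but not at \<open>b\<close>: along the family it is a finite combination of holomorphic
  coordinate functions.\<close>

definition cbox_Cn :: "nat \<Rightarrow> (nat \<Rightarrow> complex) \<Rightarrow> real \<Rightarrow> (nat \<Rightarrow> complex) set" where
  "cbox_Cn n z r = {y \<in> Cn n. \<forall>i<n. cmod (y i - z i) \<le> r}"

abbreviation open_Cn :: "nat \<Rightarrow> (nat \<Rightarrow> complex) set \<Rightarrow> bool" where
  "open_Cn n D \<equiv> openin (top_of_set (Cn n)) D"

text \<open>A basic open box of the product topology may constrain coordinates beyond
  \<open>n\<close>, but there every point of \<open>Cn n\<close> agrees with \<open>z\<close>, so
  \<open>n\<close> radii decide.\<close>

lemma open_contains_cbox_Cn:
  assumes "open_Cn n D" "z \<in> D"
  obtains r where "r > 0" "cbox_Cn n z r \<subseteq> D"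
proof -
  obtain O' where O': "open O'" "D = Cn n \<inter> O'"
    using assms(1) by (auto simp: openin_open)
  have zO: "z \<in> O'" "z \<in> Cn n" using assms O' by auto
  have "openin (product_topology (\<lambda>i. euclidean) UNIV) O'"
    using O'(1) by (simp add: open_fun_def)
  from product_topology_open_contains_basis[OF this zO(1)]
  obtain X where X: "z \<in> PiE UNIV X" "\<And>i. open (X i)" "PiE UNIV X \<subseteq> O'"
    by auto
  have "\<exists>r>0. cball (z i) r \<subseteq> X i" for i
    using X(1) X(2)[of i] open_contains_cball by (metis PiE_mem UNIV_I)
  then obtain R where R: "\<And>i. R i > 0" "\<And>i. cball (z i) (R i) \<subseteq> X i" by metis
  \<comment> \<open>The \<open>1\<close> keeps the set nonempty when \<open>n = 0\<close>.\<close>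
  define r where "r = Min (insert 1 (R ` {..<n}))"
  have r: "r > 0" "\<And>i. i < n \<Longrightarrow> r \<le> R i"
    unfolding r_def using R(1) by (auto simp: Min_gr_iff)
  have "cbox_Cn n z r \<subseteq> D"
  proof
    fix y assume y: "y \<in> cbox_Cn n z r"
    have "y i \<in> X i" for i
    proof (cases "i < n")
      case True
      then have "y i \<in> cball (z i) (R i)" using y r(2)[of i]
        by (force simp: cbox_Cn_def dist_norm norm_minus_commute)
      then show ?thesis using R(2)[of i] by blast
    next
      case False
      then have "y i = z i" using y zO by (auto simp: cbox_Cn_def Cn_def)
      then show ?thesis using X(1) by auto
    qed
    then have "y \<in> O'" using X(3) by auto
    then show "y \<in> D" using y O'(2) by (auto simp: cbox_Cn_def)
  qed
  then show ?thesis using r(1) that by blast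
qed

lemma Cn_upd: "z \<in> Cn n \<Longrightarrow> i < n \<Longrightarrow> z(i := w) \<in> Cn n"
  by (auto simp: Cn_def)

lemma open_Cn_subset: "open_Cn n D \<Longrightarrow> D \<subseteq> Cn n"
  by (auto simp: openin_open)

lemma cbox_Cn_upd:
  "z \<in> cbox_Cn n y r \<Longrightarrow> i < n \<Longrightarrow> cmod (w - y i) \<le> r \<Longrightarrow> z(i := w) \<in> cbox_Cn n y r"
  by (auto simp: cbox_Cn_def Cn_upd)

lemma eventually_cbox_Cn:
  assumes "r > 0"
  shows "eventually (\<lambda>y. y \<in> cbox_Cn n z r) (at z within Cn n)"
proof -
  have "eventually (\<lambda>y. \<forall>i\<in>{..<n}. dist (y i) (z i) < r) (at z within Cn n)"
  proof (rule eventually_ball_finite)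
    show "\<forall>i\<in>{..<n}. \<forall>\<^sub>F y in at z within Cn n. dist (y i) (z i) < r"
    proof
      fix i
      have "continuous_on UNIV (\<lambda>y::nat\<Rightarrow>complex. y i)" by simp
      then have "((\<lambda>y. y i) \<longlongrightarrow> z i) (at z)"
        by (auto simp: continuous_on_def)
      then have "((\<lambda>y. y i) \<longlongrightarrow> z i) (at z within Cn n)"
        by (rule tendsto_within_subset) simp
      then show "\<forall>\<^sub>F y in at z within Cn n. dist (y i) (z i) < r"
        using assms tendstoD by blast
    qed
  qed simp
  moreover have "eventually (\<lambda>y. y \<in> Cn n) (at z within Cn n)"
    by (simp add: eventually_at_filter)
  ultimately show ?thesis
    by eventually_elim (auto simp: cbox_Cn_def dist_norm less_imp_le)
qed

section \<open>Partial derivatives, total differential and chain rule\<close>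

lemma holomorphic_Cn_line:
  assumes "holomorphic_Cn n D f" "z \<in> D" "i < n" 
  shows "((\<lambda>w. f (z(i := w))) has_field_derivative partial_deriv i f z) (at (z i))"
  using assms unfolding holomorphic_Cn_def partial_deriv_def
  by (simp add: DERIV_deriv_iff_field_differentiable)

lemma holomorphic_Cn_line':
  assumes "holomorphic_Cn n D f" "z(i := u) \<in> D" "i < n" 
  shows "((\<lambda>w. f (z(i := w))) has_field_derivative partial_deriv i f (z(i := u))) (at u)"
  using holomorphic_Cn_line[OF assms] by simp

lemma continuous_on_fun_upd:
  fixes g :: "'a::topological_space \<Rightarrow> nat \<Rightarrow> 'c::topological_space"
  assumes "continuous_on S g" "continuous_on S h"
  shows "continuous_on S (\<lambda>x. (g x)(i := h x))"
proof (rule continuous_on_coordinatewise_then_product)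
  fix j
  show "continuous_on S (\<lambda>x. ((g x)(i := h x)) j)"
    using assms continuous_on_product_then_coordinatewise[OF assms(1), of j]
    by (cases "j = i") auto
qed

text \<open>The functions \<open>g y\<close> of one variable, recentred at \<open>y\<close>, live on
  a fixed disc and converge uniformly to \<open>g z\<close> as \<open>y\<close> tends to
  \<open>z\<close>, by compactness of the closed disc. Uniform limits of holomorphic functions pass
  to derivatives at 0.\<close>

lemma continuous_on_partial_deriv:
  assumes f: "holomorphic_Cn n D f" and D: "open_Cn n D" and i: "i < n"
  shows "continuous_on D (partial_deriv i f)"
  unfolding continuous_on_def
proof
  fix z assume z: "z \<in> D"
  obtain r where r: "r > 0" "cbox_Cn n z r \<subseteq> D"
    using open_contains_cbox_Cn[OF D z] .
  have zC: "z \<in> Cn n" using z D open_Cn_subset by auto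
  define g where "g y w = f (y(i := y i + w))" for y w
  \<comment> \<open>Half the radius for the base point and half for the shift: together they stay
    inside the polydisc of radius \<open>r\<close>.\<close>
  define C where "C = cball (0::complex) (r/2)"
  define U where "U = cbox_Cn n z (r/2)"
  have UD: "y(i := y i + w) \<in> D" if "y \<in> U" "w \<in> C" for y w
  proof -
    have "cmod (y i + w - z i) \<le> cmod (y i - z i) + cmod w"
      by (metis norm_triangle_ineq add_diff_eq add.commute add_diff_cancel_left diff_add_eq)
    also have "\<dots> \<le> r/2 + r/2" using that i by (auto simp: U_def C_def cbox_Cn_def intro!: add_mono)
    finally have 1: "cmod (y i + w - z i) \<le> r" by simp
    have "y \<in> cbox_Cn n z r" using that(1) r(1) by (force simp: U_def cbox_Cn_def)
    from cbox_Cn_upd[OF this i 1] show ?thesis using r(2) by auto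
  qed
  have U_D: "U \<subseteq> D" using r by (force simp: U_def cbox_Cn_def)
  have zU: "z \<in> U" using r zC by (auto simp: U_def cbox_Cn_def)
  have cont: "continuous_on (U \<times> C) (\<lambda>(y, w). g y w)"
  proof -
    have cf: "continuous_on D f" using f by (simp add: holomorphic_Cn_def)
    have "continuous_on (U \<times> C) (\<lambda>p. (fst p)(i := fst p i + snd p))"
    proof (rule continuous_on_fun_upd)
      have "continuous_on (U \<times> C) (\<lambda>p. fst p i)"
        by (rule continuous_on_product_then_coordinatewise) (intro continuous_intros)
      then show "continuous_on (U \<times> C) (\<lambda>p. fst p i + snd p)"
        by (intro continuous_intros)
    qed (intro continuous_intros)
    from continuous_on_compose2[OF cf this] UD
    have "continuous_on (U \<times> C) (\<lambda>p. f ((fst p)(i := fst p i + snd p)))" by force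
    then show ?thesis by (simp add: g_def case_prod_unfold)
  qed
  have evU: "eventually (\<lambda>y. y \<in> U) (at z within D)"
  proof -
    have "eventually (\<lambda>y. y \<in> U) (at z within Cn n)"
      unfolding U_def using r by (intro eventually_cbox_Cn) auto
    then show ?thesis
      by (meson D filter_leD at_le open_Cn_subset)
  qed
  have ul: "uniform_limit (ball 0 (r/2)) g (g z) (at z within D)"
  proof (rule uniform_limitI)
    fix e :: real assume e: "e > 0"
    have cC: "compact C" by (simp add: C_def)
    obtain X0 where X0: "z \<in> X0" "open X0"
      "\<forall>x\<in>X0 \<inter> U. \<forall>t\<in>C. dist ((\<lambda>(y, w). g y w) (x, t)) ((\<lambda>(y, w). g y w) (z, t)) \<le> e/2"
      by (rule continuous_on_prod_compactE[OF cont cC zU, of "e/2"]) (use e in auto)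
    have "eventually (\<lambda>y. y \<in> X0) (at z within D)"
      using X0 by (auto simp: eventually_at_topological)
    with evU show "\<forall>\<^sub>F y in at z within D. \<forall>w\<in>ball 0 (r/2). dist (g y w) (g z w) < e"
    proof eventually_elim
      case (elim y)
      show ?case
      proof
        fix w assume "w \<in> ball (0::complex) (r/2)"
        then have "dist (g y w) (g z w) \<le> e/2"
          using X0(3) elim by (auto simp: C_def)
        then show "dist (g y w) (g z w) < e" using e by simp
      qed
    qed
  qed
  have der: "((\<lambda>w. g y w) has_field_derivative partial_deriv i f (y(i := y i + w))) (at w)"
    if "y \<in> U" "w \<in> C" for y w
  proof -
    have "((\<lambda>u. f (y(i := u))) has_field_derivative partial_deriv i f (y(i := y i + w))) (at (y i + w))"
      using holomorphic_Cn_line'[OF f UD[OF that] i] .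
    moreover have "((\<lambda>w. y i + w) has_field_derivative 1) (at w)"
      by (auto intro!: derivative_eq_intros)
    ultimately show ?thesis
      unfolding g_def
      using DERIV_chain2[of "\<lambda>u. f (y(i := u))" _ "\<lambda>w. y i + w" w 1 UNIV] by simp
  qed
  have hol: "g y holomorphic_on ball 0 (r/2)" if "y \<in> U" for y
    unfolding holomorphic_on_def
    using der[OF that] by (metis C_def ball_subset_cball field_differentiable_at_within
        field_differentiable_def in_mono)
  show "(partial_deriv i f \<longlongrightarrow> partial_deriv i f z) (at z within D)"
  proof (cases "at z within D = bot")
    case False
    have "eventually (\<lambda>y. g y holomorphic_on ball 0 (r/2)) (at z within D)"
      using evU by eventually_elim (rule hol)
    from higher_deriv_complex_uniform_limit[OF ul this False, of 0 1]
    have *: "((\<lambda>y. deriv (g y) 0) \<longlongrightarrow> deriv (g z) 0) (at z within D)" using r by simp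
    have dd: "deriv (g y) 0 = partial_deriv i f y" if "y \<in> U" for y
      using der[OF that, of 0] r by (auto simp: C_def intro!: DERIV_imp_deriv)
    have "eventually (\<lambda>y. deriv (g y) 0 = partial_deriv i f y) (at z within D)"
      using evU by eventually_elim (rule dd)
    from tendsto_cong[OF this] * dd[OF zU] show ?thesis by simp
  qed simp
qed

text \<open>Total differentiability from continuity of the partial derivatives: on a polydisc where
  these vary by less than \<open>e\<close>, the coordinates are changed one at a time and each
  change is estimated by the mean value inequality.\<close>

lemma holomorphic_Cn_linear_approx:
  assumes f: "holomorphic_Cn n D f" and D: "open_Cn n D" and z: "z \<in> D" and e: "e > 0"
  obtains r where "r > 0" "cbox_Cn n z r \<subseteq> D"
    "\<And>y. y \<in> cbox_Cn n z r \<Longrightarrow>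
       cmod (f y - f z - (\<Sum>l<n. (y l - z l) * partial_deriv l f z)) \<le> e * (\<Sum>l<n. cmod (y l - z l))"
proof -
  have zC: "z \<in> Cn n" using z D open_Cn_subset by auto
  have "open_Cn n {y \<in> D. \<forall>l\<in>{..<n}. partial_deriv l f y \<in> ball (partial_deriv l f z) e}" 
  proof -
    have "open_Cn n {y \<in> D. partial_deriv l f y \<in> ball (partial_deriv l f z) e}" if "l < n" for l
    proof -
      have "openin (top_of_set D) (D \<inter> partial_deriv l f -` ball (partial_deriv l f z) e)"
        using continuous_openin_preimage_gen[OF continuous_on_partial_deriv[OF f D that]] by blast
      then have "open_Cn n (D \<inter> partial_deriv l f -` ball (partial_deriv l f z) e)"
        using D by (rule openin_trans)
      also have "D \<inter> partial_deriv l f -` ball (partial_deriv l f z) e =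
        {y \<in> D. partial_deriv l f y \<in> ball (partial_deriv l f z) e}" by auto
      finally show ?thesis .
    qed
    then have "open_Cn n (D \<inter> (\<Inter>l\<in>{..<n}. {y \<in> D. partial_deriv l f y \<in> ball (partial_deriv l f z) e}))"
    proof (cases "n = 0")
      case False
      assume a: "\<And>l. l < n \<Longrightarrow> open_Cn n {y \<in> D. partial_deriv l f y \<in> ball (partial_deriv l f z) e}"
      show ?thesis using D False a by (intro openin_Int openin_Inter) auto
    qed (use D in simp)
    also have "D \<inter> (\<Inter>l\<in>{..<n}. {y \<in> D. partial_deriv l f y \<in> ball (partial_deriv l f z) e}) =
       {y \<in> D. \<forall>l\<in>{..<n}. partial_deriv l f y \<in> ball (partial_deriv l f z) e}" by auto
    finally show ?thesis .
  qed
  moreover have "z \<in> {y \<in> D. \<forall>l\<in>{..<n}. partial_deriv l f y \<in> ball (partial_deriv l f z) e}"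
    using z e by auto
  ultimately obtain r where r: "r > 0"
    "cbox_Cn n z r \<subseteq> {y \<in> D. \<forall>l\<in>{..<n}. partial_deriv l f y \<in> ball (partial_deriv l f z) e}"
    by (rule open_contains_cbox_Cn)
  have "cmod (f y - f z - (\<Sum>l<n. (y l - z l) * partial_deriv l f z)) \<le> e * (\<Sum>l<n. cmod (y l - z l))"
    if y: "y \<in> cbox_Cn n z r" for y
  proof -
    \<comment> \<open>A path of points from \<open>z\<close> to \<open>y\<close>, the first
      \<open>l\<close> coordinates being already exchanged.\<close>
    define Z where "Z l = (\<lambda>i. if i < l then y i else z i)" for l
    have Z0: "Z 0 = z" by (auto simp: Z_def)
    have Zn: "Z n = y" using y zC by (auto simp: Z_def cbox_Cn_def Cn_def fun_eq_iff)
    have ZB: "Z l \<in> cbox_Cn n z r" for l 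
      using y zC r(1) by (auto simp: Z_def cbox_Cn_def Cn_def)
    have ZS: "Z (Suc l) = (Z l)(l := y l)" for l by (auto simp: Z_def)
    have Zl: "Z l = (Z l)(l := z l)" for l by (auto simp: Z_def)
    have step: "cmod (f (Z (Suc l)) - f (Z l) - (y l - z l) * partial_deriv l f z) \<le> e * cmod (y l - z l)"
      if l: "l < n" for l
    proof -
      have ZlB: "(Z l)(l := w) \<in> cbox_Cn n z r" if "w \<in> cball (z l) r" for w
        using cbox_Cn_upd[OF ZB l] that by (simp add: dist_norm norm_minus_commute)
      \<comment> \<open>Subtracting the linear term leaves a function whose derivative is bounded by
        \<open>e\<close>.\<close>
      define F where "F w = f ((Z l)(l := w)) - w * partial_deriv l f z" for w
      have d: "(F has_field_derivative partial_deriv l f ((Z l)(l := w)) - partial_deriv l f z)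
          (at w within cball (z l) r)" if "w \<in> cball (z l) r" for w
      proof -
        have "(Z l)(l := w) \<in> D" using ZlB[OF that] r(2) by auto
        from holomorphic_Cn_line'[OF f this l] show ?thesis
          unfolding F_def by (auto intro!: derivative_eq_intros intro: has_field_derivative_at_within)
      qed
      have b: "cmod (partial_deriv l f ((Z l)(l := w)) - partial_deriv l f z) \<le> e"
        if "w \<in> cball (z l) r" for w
        using ZlB[OF that] r(2) l by (force simp: dist_norm norm_minus_commute)
      have "cmod (F (y l) - F (z l)) \<le> e * cmod (y l - z l)"
      proof (rule field_differentiable_bound[OF _ d b])
        show "y l \<in> cball (z l) r" using y l by (simp add: cbox_Cn_def dist_norm norm_minus_commute)
      qed (use r in auto)
      also have "F (y l) - F (z l) = f (Z (Suc l)) - f (Z l) - (y l - z l) * partial_deriv l f z"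
        unfolding F_def ZS using Zl[of l] by (simp add: algebra_simps)
      finally show ?thesis .
    qed
    have "f y - f z = (\<Sum>l<n. f (Z (Suc l)) - f (Z l))"
      using sum_lessThan_telescope[of "\<lambda>l. f (Z l)" n] Z0 Zn by simp
    then have "f y - f z - (\<Sum>l<n. (y l - z l) * partial_deriv l f z) =
      (\<Sum>l<n. f (Z (Suc l)) - f (Z l) - (y l - z l) * partial_deriv l f z)"
      by (simp add: sum_subtractf)
    also have "cmod \<dots> \<le> (\<Sum>l<n. e * cmod (y l - z l))"
      by (rule order_trans[OF norm_sum]) (auto intro!: sum_mono step)
    finally show ?thesis by (simp add: sum_distrib_left)
  qed
  with r that show ?thesis by blast
qed

text \<open>The remainder \<open>R\<close> of the linear approximation is small compared with the
  coordinate increments of \<open>\<gamma>\<close>, and these are comparable to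
  \<open>w - w0\<close> because the difference quotients converge.\<close>

lemma holomorphic_Cn_chain:
  assumes f: "holomorphic_Cn n D f" and D: "open_Cn n D" and zD: "\<gamma> w0 \<in> D"
    and gC: "eventually (\<lambda>w. \<gamma> w \<in> Cn n) (at w0)"
    and g: "\<And>i. i < n \<Longrightarrow> ((\<lambda>w. \<gamma> w i) has_field_derivative \<gamma>' i) (at w0)"
  shows "((\<lambda>w. f (\<gamma> w)) has_field_derivative (\<Sum>i<n. partial_deriv i f (\<gamma> w0) * \<gamma>' i)) (at w0)"
proof -
  let ?z = "\<gamma> w0"
  define R where "R w = f (\<gamma> w) - f ?z - (\<Sum>l<n. (\<gamma> w l - ?z l) * partial_deriv l f ?z)" for w
  have "(R has_field_derivative 0) (at w0)"
    unfolding has_field_derivative_iff tendsto_iff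
  proof (intro allI impI)
    fix e :: real assume e: "e > 0"
    \<comment> \<open>A bound valid near \<open>w0\<close> for the sum of the difference quotients;
      adding 1 makes it strictly larger than the limit, and positive. The factor 2 in
      \<open>e'\<close> yields a strict final inequality.\<close>
    define K where "K = (\<Sum>l<n. cmod (\<gamma>' l)) + 1"
    have K: "K > 0" unfolding K_def by (intro add_nonneg_pos sum_nonneg) auto
    define e' where "e' = e / (2 * K)"
    have e': "e' > 0" using e K by (simp add: e'_def)
    obtain r where r: "r > 0" "cbox_Cn n ?z r \<subseteq> D" "\<And>y. y \<in> cbox_Cn n ?z r \<Longrightarrow>
       cmod (f y - f ?z - (\<Sum>l<n. (y l - ?z l) * partial_deriv l f ?z)) \<le> e' * (\<Sum>l<n. cmod (y l - ?z l))"
      by (rule holomorphic_Cn_linear_approx[OF f D zD e']) blast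
    have "((\<lambda>w. \<Sum>l<n. cmod ((\<gamma> w l - ?z l) / (w - w0))) \<longlongrightarrow> (\<Sum>l<n. cmod (\<gamma>' l))) (at w0)"
      using g by (intro tendsto_intros) (auto simp: has_field_derivative_iff)
    then have 1: "eventually (\<lambda>w. (\<Sum>l<n. cmod ((\<gamma> w l - ?z l) / (w - w0))) < K) (at w0)"
      by (rule order_tendstoD) (simp add: K_def)
    have "eventually (\<lambda>w. \<forall>i\<in>{..<n}. dist (\<gamma> w i) (?z i) < r) (at w0)"
    proof (rule eventually_ball_finite)
      show "\<forall>i\<in>{..<n}. \<forall>\<^sub>F w in at w0. dist (\<gamma> w i) (?z i) < r"
      proof
        fix i assume "i \<in> {..<n}"
        then have "((\<lambda>w. \<gamma> w i) \<longlongrightarrow> ?z i) (at w0)"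
          using DERIV_isCont[OF g, of i] by (simp add: isCont_def)
        then show "\<forall>\<^sub>F w in at w0. dist (\<gamma> w i) (?z i) < r" using r(1) by (rule tendstoD)
      qed
    qed simp
    with gC have 2: "eventually (\<lambda>w. \<gamma> w \<in> cbox_Cn n ?z r) (at w0)"
      by eventually_elim (auto simp: cbox_Cn_def dist_norm less_imp_le)
    have 3: "eventually (\<lambda>w. w \<noteq> w0) (at w0)" by (simp add: eventually_at_filter)
    from 1 2 3 show "\<forall>\<^sub>F w in at w0. dist ((R w - R w0) / (w - w0)) 0 < e"
    proof eventually_elim
      case (elim w)
      have "cmod (R w) \<le> e' * (\<Sum>l<n. cmod (\<gamma> w l - ?z l))"
        unfolding R_def using r(3)[OF elim(2)] .
      then have "cmod (R w) / cmod (w - w0) \<le> e' * (\<Sum>l<n. cmod (\<gamma> w l - ?z l)) / cmod (w - w0)"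
        by (simp add: divide_right_mono)
      also have "\<dots> = e' * (\<Sum>l<n. cmod ((\<gamma> w l - ?z l) / (w - w0)))"
        by (simp add: norm_divide flip: sum_divide_distrib)
      also have "\<dots> \<le> e' * K" using elim(1) e' by (intro mult_left_mono) auto
      also have "\<dots> < e" using e K by (simp add: e'_def)
      finally show ?case by (simp add: R_def norm_divide)
    qed
  qed
  moreover have "((\<lambda>w. \<Sum>l<n. (\<gamma> w l - ?z l) * partial_deriv l f ?z) has_field_derivative
      (\<Sum>i<n. partial_deriv i f ?z * \<gamma>' i)) (at w0)"
    using g by (auto intro!: derivative_eq_intros simp: mult.commute)
  ultimately have "((\<lambda>w. R w + (\<Sum>l<n. (\<gamma> w l - ?z l) * partial_deriv l f ?z) + f ?z) has_field_derivative
      0 + (\<Sum>i<n. partial_deriv i f ?z * \<gamma>' i) + 0) (at w0)"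
    by (intro DERIV_add) auto
  then show ?thesis by (simp add: R_def)
qed

text \<open>Meant for coordinate changes \<open>T\<close>. One derivative computation along
  coordinate lines yields both separate differentiability of the composite and the formula for its
  partial derivatives.\<close>

lemma holomorphic_Cn_compose:
  assumes f: "holomorphic_Cn n D f" and D: "open_Cn n D" 
    and D': "open_Cn m D'" and T: "\<And>z. z \<in> D' \<Longrightarrow> T z \<in> D"
    and hT: "\<And>k. k < n \<Longrightarrow> holomorphic_Cn m D' (\<lambda>z. T z k)"
  shows "holomorphic_Cn m D' (\<lambda>z. f (T z))"
    and "\<And>z i. z \<in> D' \<Longrightarrow> i < m \<Longrightarrow> partial_deriv i (\<lambda>z. f (T z)) z =
       (\<Sum>k<n. partial_deriv k f (T z) * partial_deriv i (\<lambda>z. T z k) z)"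
proof -
  have DC: "D \<subseteq> Cn n" using D open_Cn_subset by auto
  have cT: "continuous_on D' T"
  proof (rule continuous_on_coordinatewise_then_product)
    fix k
    show "continuous_on D' (\<lambda>z. T z k)"
    proof (cases "k < n")
      case False
      \<comment> \<open>Values of \<open>T\<close> lie in \<open>Cn n\<close>, so the coordinates
        from \<open>n\<close> on are constant.\<close>
      then have "T z k = 0" if "z \<in> D'" for z
        using T[OF that] DC by (auto simp: Cn_def)
      then show ?thesis by (auto intro: continuous_on_eq[of _ "\<lambda>z. 0"])
    qed (use hT in \<open>auto simp: holomorphic_Cn_def\<close>)
  qed
  have c: "continuous_on D' (\<lambda>z. f (T z))"
    using continuous_on_compose2[OF _ cT, of D f] f T by (auto simp: holomorphic_Cn_def)
  have der: "((\<lambda>w. f (T (z(i := w)))) has_field_derivative 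
       (\<Sum>k<n. partial_deriv k f (T z) * partial_deriv i (\<lambda>z. T z k) z)) (at (z i))"
    if z: "z \<in> D'" and i: "i < m" for z i
  proof -
    obtain r where r: "r > 0" "cbox_Cn m z r \<subseteq> D'" using open_contains_cbox_Cn[OF D' z] .
    have zb: "z \<in> cbox_Cn m z r" using z D' r open_Cn_subset by (force simp: cbox_Cn_def)
    have "eventually (\<lambda>w. w \<in> ball (z i) r) (at (z i))"
      using eventually_at_ball[OF r(1), of _ UNIV] by simp
    then have "eventually (\<lambda>w. T (z(i := w)) \<in> Cn n) (at (z i))"
    proof eventually_elim
      case (elim w)
      then have "z(i := w) \<in> cbox_Cn m z r"
        by (intro cbox_Cn_upd[OF zb i]) (auto simp: dist_norm norm_minus_commute)
      then show ?case using r T DC by auto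
    qed
    from holomorphic_Cn_chain[OF f D _ this] holomorphic_Cn_line[OF hT z i] T[OF z]
    show ?thesis by simp
  qed
  show "holomorphic_Cn m D' (\<lambda>z. f (T z))"
    unfolding holomorphic_Cn_def using c der field_differentiable_def by blast
  show "\<And>z i. z \<in> D' \<Longrightarrow> i < m \<Longrightarrow> partial_deriv i (\<lambda>z. f (T z)) z =
       (\<Sum>k<n. partial_deriv k f (T z) * partial_deriv i (\<lambda>z. T z k) z)"
    using der by (simp add: partial_deriv_def DERIV_imp_deriv)
qed

text \<open>In the direction \<open>i\<close> itself this is holomorphy of a one-variable
  derivative. In another direction \<open>j\<close>, the difference quotients in direction
  \<open>i\<close> are holomorphic in the \<open>j\<close>-th variable and converge locally
  uniformly, since the partial derivative is jointly continuous; the limit is holomorphic.\<close>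

lemma holomorphic_Cn_partial_deriv:
  assumes f: "holomorphic_Cn n D f" and D: "open_Cn n D" and i: "i < n"
  shows "holomorphic_Cn n D (partial_deriv i f)"
  unfolding holomorphic_Cn_def
proof (intro conjI ballI allI impI)
  show c: "continuous_on D (partial_deriv i f)" by (rule continuous_on_partial_deriv[OF assms])
  fix z j assume z: "z \<in> D" and j: "j < n"
  obtain r where r: "r > 0" "cbox_Cn n z r \<subseteq> D" using open_contains_cbox_Cn[OF D z] .
  have zb: "z \<in> cbox_Cn n z r" using z D r open_Cn_subset by (force simp: cbox_Cn_def)
  have upd: "z(j := w, i := u) \<in> D" if "w \<in> cball (z j) r" "u \<in> cball (z i) r" for w u
    using cbox_Cn_upd[OF cbox_Cn_upd[OF zb j] i, of w u] that r(2)
    by (auto simp: dist_norm norm_minus_commute)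
  show "(\<lambda>w. partial_deriv i f (z(j := w))) field_differentiable (at (z j))"
  proof (cases "j = i")
    case True
    have d: "((\<lambda>w. f (z(i := w))) has_field_derivative partial_deriv i f (z(i := w))) (at w)"
      if "w \<in> ball (z i) r" for w
    proof -
      have "z(i := w) \<in> D" using cbox_Cn_upd[OF zb i, of w] that r(2) 
        by (auto simp: dist_norm norm_minus_commute)
      then show ?thesis by (rule holomorphic_Cn_line'[OF f _ i])
    qed
    then have "(\<lambda>w. f (z(i := w))) holomorphic_on ball (z i) r"
      unfolding holomorphic_on_def by (meson field_differentiable_at_within field_differentiable_def)
    then have "deriv (\<lambda>w. f (z(i := w))) holomorphic_on ball (z i) r"
      by (simp add: holomorphic_deriv)
    then have "(\<lambda>w. partial_deriv i f (z(i := w))) holomorphic_on ball (z i) r"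
      by (rule holomorphic_transform) (use d in \<open>auto intro!: DERIV_imp_deriv\<close>)
    then show ?thesis using r True
      by (metis centre_in_ball holomorphic_on_imp_differentiable_at open_ball)
  next
    case False
    \<comment> \<open>At \<open>t = 0\<close> the quotient is 0 by convention; the limit is taken
      over punctured neighbourhoods and never sees this value.\<close>
    define Q where "Q t w = (f (z(j := w, i := z i + t)) - f (z(j := w))) / t" for t w
    define G where "G w = partial_deriv i f (z(j := w))" for w
    let ?C = "cball (z j) (r/2)"
    have zi: "z(j := w, i := z i) = z(j := w)" for w using False by auto
    have hol: "continuous_on ?C (Q t) \<and> Q t holomorphic_on ball (z j) (r/2)"
      if t: "t \<in> cball 0 r" for t
    proof -
      have 1: "((\<lambda>w. f (z(j := w, i := u))) has_field_derivative partial_deriv j f (z(j := w, i := u))) (at w)"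
        if "w \<in> cball (z j) r" "u \<in> cball (z i) r" for w u
        using holomorphic_Cn_line'[OF f, of "z(i := u)" j w] upd[OF that] j False
        by (simp add: fun_upd_twist)
      have 2: "(\<lambda>w. f (z(j := w, i := u))) holomorphic_on cball (z j) r" if "u \<in> cball (z i) r" for u
        unfolding holomorphic_on_def using 1[OF _ that]
        by (meson field_differentiable_at_within field_differentiable_def)
      have "Q t holomorphic_on cball (z j) r"
      proof (cases "t = 0")
        case False
        then show ?thesis
          unfolding Q_def using 2[of "z i + t"] 2[of "z i"] t r zi
          by (auto intro!: holomorphic_intros simp: dist_norm)
      qed (simp add: Q_def[abs_def])
      moreover have "cball (z j) (r/2) \<subseteq> cball (z j) r" "ball (z j) (r/2) \<subseteq> cball (z j) r"
        using r by auto
      ultimately show ?thesis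
        using holomorphic_on_imp_continuous_on holomorphic_on_subset by blast
    qed
    have contG: "continuous_on (cball (z i) r \<times> ?C) (\<lambda>(u, w). partial_deriv i f (z(j := w, i := u)))"
    proof -
      have "continuous_on (cball (z i) r \<times> ?C) (\<lambda>p. z(j := snd p, i := fst p))"
        by (intro continuous_on_fun_upd continuous_intros)
      from continuous_on_compose2[OF c this] upd r
      show ?thesis by (force simp: case_prod_unfold)
    qed
    have ul: "uniform_limit ?C Q G (at 0)"
    proof (rule uniform_limitI)
      fix e :: real assume e: "e > 0"
      have zin: "z i \<in> cball (z i) r" using r by simp
      have cC: "compact ?C" by simp
      obtain X0 where X0: "z i \<in> X0" "open X0"
        "\<forall>u\<in>X0 \<inter> cball (z i) r. \<forall>w\<in>?C. dist ((\<lambda>(u, w). partial_deriv i f (z(j := w, i := u))) (u, w))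
            ((\<lambda>(u, w). partial_deriv i f (z(j := w, i := u))) (z i, w)) \<le> e/2"
        by (rule continuous_on_prod_compactE[OF contG cC zin, of "e/2"]) (use e in auto)
      obtain d0 where d0: "d0 > 0" "cball (z i) d0 \<subseteq> X0" using X0 open_contains_cball by blast
      define d where "d = min d0 r"
      have d: "d > 0" "cball (z i) d \<subseteq> X0 \<inter> cball (z i) r" 
        using d0 r by (auto simp: d_def)
      have "eventually (\<lambda>t. t \<in> ball 0 d) (at (0::complex))"
        using eventually_at_ball[OF d(1), of 0 UNIV] by (simp only: UNIV_I simp_thms)
      moreover have "eventually (\<lambda>t. t \<noteq> 0) (at (0::complex))" by (simp add: eventually_at_filter)
      ultimately show "\<forall>\<^sub>F t in at 0. \<forall>w\<in>?C. dist (Q t w) (G w) < e"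
      proof eventually_elim
        case (elim t)
        show ?case
        proof
          fix w assume w: "w \<in> ?C"
          then have w': "w \<in> cball (z j) r" using r by auto
          \<comment> \<open>The derivative of \<open>F\<close> is the deviation of the partial
            derivative from \<open>G w\<close>, at most \<open>e/2\<close> uniformly in
            \<open>w\<close>; the increment of \<open>F\<close> is \<open>t\<close> times the error
            of the difference quotient.\<close>
          define F where "F u = f (z(j := w, i := u)) - u * G w" for u
          have dF: "(F has_field_derivative partial_deriv i f (z(j := w, i := u)) - G w)
            (at u within cball (z i) d)" if "u \<in> cball (z i) d" for u
          proof -
            have "z(j := w, i := u) \<in> D" using upd[OF w'] that d(2) by auto
            from holomorphic_Cn_line'[OF f this i] show ?thesis unfolding F_def
              by (auto intro!: derivative_eq_intros intro: has_field_derivative_at_within)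
          qed
          have bF: "cmod (partial_deriv i f (z(j := w, i := u)) - G w) \<le> e/2"
            if "u \<in> cball (z i) d" for u
            using X0(3) d(2) that w zi unfolding G_def by (force simp: dist_norm)
          have "cmod (F (z i + t) - F (z i)) \<le> e/2 * cmod (z i + t - z i)"
            by (rule field_differentiable_bound[OF _ dF bF]) (use elim d in \<open>auto simp: dist_norm\<close>)
          moreover have "F (z i + t) - F (z i) = t * (Q t w - G w)"
            using elim(2) zi by (simp add: F_def Q_def field_simps)
          ultimately have "cmod t * cmod (Q t w - G w) \<le> cmod t * (e/2)"
            by (simp add: norm_mult mult.commute)
          then have "cmod (Q t w - G w) \<le> e/2" using elim(2) by simp
          then show "dist (Q t w) (G w) < e" using e by (simp add: dist_norm)
        qed
      qed
    qed
    have "eventually (\<lambda>t. t \<in> ball 0 r) (at (0::complex))"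
      using eventually_at_ball[OF r(1), of 0 UNIV] by (simp only: UNIV_I simp_thms)
    then have ev: "eventually (\<lambda>t. continuous_on ?C (Q t) \<and> Q t holomorphic_on ball (z j) (r/2)) (at 0)"
      by eventually_elim (rule hol, auto)
    have "G holomorphic_on ball (z j) (r/2)"
      by (rule holomorphic_uniform_limit[OF ev ul]) auto
    then show ?thesis using r unfolding G_def
      by (metis centre_in_ball half_gt_zero holomorphic_on_imp_differentiable_at open_ball)
  qed
qed

section \<open>Locality and closure properties of holomorphy\<close>

lemma partial_deriv_cong:
  assumes D: "open_Cn n D" and z: "z \<in> D" and i: "i < n" and eq: "\<And>y. y \<in> D \<Longrightarrow> f y = g y"
  shows "partial_deriv i f z = partial_deriv i g z"
    and "(\<lambda>w. f (z(i := w))) field_differentiable (at (z i)) \<longleftrightarrow>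
         (\<lambda>w. g (z(i := w))) field_differentiable (at (z i))"
proof -
  obtain r where r: "r > 0" "cbox_Cn n z r \<subseteq> D" using open_contains_cbox_Cn[OF D z] .
  have zb: "z \<in> cbox_Cn n z r" using z D r open_Cn_subset by (force simp: cbox_Cn_def)
  have "eventually (\<lambda>w. w \<in> ball (z i) r) (nhds (z i))"
    by (rule eventually_nhds_in_open) (use r(1) in auto)
  then have ev: "eventually (\<lambda>w. f (z(i := w)) = g (z(i := w))) (nhds (z i))"
  proof eventually_elim
    case (elim w)
    then have "z(i := w) \<in> cbox_Cn n z r"
      by (intro cbox_Cn_upd[OF zb i]) (auto simp: dist_norm norm_minus_commute)
    then show ?case using r eq by auto
  qed
  show "partial_deriv i f z = partial_deriv i g z"
    unfolding partial_deriv_def by (rule deriv_cong_ev[OF ev]) simp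
  show "(\<lambda>w. f (z(i := w))) field_differentiable (at (z i)) \<longleftrightarrow>
         (\<lambda>w. g (z(i := w))) field_differentiable (at (z i))"
    unfolding field_differentiable_def using DERIV_cong_ev[OF refl ev refl] by blast
qed

lemma holomorphic_Cn_cong:
  assumes D: "open_Cn n D" and eq: "\<And>y. y \<in> D \<Longrightarrow> f y = g y" and f: "holomorphic_Cn n D f"
  shows "holomorphic_Cn n D g"
  unfolding holomorphic_Cn_def
proof (intro conjI ballI allI impI)
  show "continuous_on D g"
    using f continuous_on_cong[of D D f g, OF refl eq] by (simp add: holomorphic_Cn_def)
  show "(\<lambda>w. g (z(i := w))) field_differentiable at (z i)" if "z \<in> D" "i < n" for z i
    using f that partial_deriv_cong(2)[OF D that, of f g] eq by (auto simp: holomorphic_Cn_def)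
qed

lemma holomorphic_Cn_subset: "holomorphic_Cn n D f \<Longrightarrow> D' \<subseteq> D \<Longrightarrow> holomorphic_Cn n D' f"
  by (auto simp: holomorphic_Cn_def intro: continuous_on_subset)

lemma holomorphic_Cn_const: "holomorphic_Cn n D (\<lambda>z. c)"
  by (auto simp: holomorphic_Cn_def)

lemma holomorphic_Cn_add:
  "holomorphic_Cn n D f \<Longrightarrow> holomorphic_Cn n D g \<Longrightarrow> holomorphic_Cn n D (\<lambda>z. f z + g z)"
  by (auto simp: holomorphic_Cn_def intro!: continuous_intros field_differentiable_add)

lemma holomorphic_Cn_mult:
  "holomorphic_Cn n D f \<Longrightarrow> holomorphic_Cn n D g \<Longrightarrow> holomorphic_Cn n D (\<lambda>z. f z * g z)"
  by (auto simp: holomorphic_Cn_def intro!: continuous_intros field_differentiable_mult)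


section \<open>Functions on a complex manifold\<close>

lemma chart_props:
  assumes M: "complex_manifold M" and c: "c \<in> charts M"
  shows "open (fst c)" "inj_on (snd c) (fst c)"
    "x \<in> fst c \<Longrightarrow> chart_inv c (snd c x) = x"
    "open W \<Longrightarrow> open_Cn (mdim M) (snd c ` (fst c \<inter> W))"
proof -
  obtain U \<phi> where c': "c = (U, \<phi>)" by (cases c)
  have *: "open U" "open_Cn (mdim M) (\<phi> ` U)" "homeomorphism U (\<phi> ` U) \<phi> (inv_into U \<phi>)"
    using M c unfolding complex_manifold_def c' by auto
  show "open (fst c)" using * c' by simp
  show inj: "inj_on (snd c) (fst c)" using *(3) c'
    by (metis fst_conv homeomorphism_apply1 inj_on_inverseI snd_conv)
  show "x \<in> fst c \<Longrightarrow> chart_inv c (snd c x) = x" using inj by simp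
  show "open_Cn (mdim M) (snd c ` (fst c \<inter> W))" if "open W"
  proof -
    have "openin (top_of_set (\<phi> ` U)) (\<phi> ` (U \<inter> W))"
      using homeomorphism_imp_open_map[OF *(3)] that by (simp add: openin_open_Int)
    then show ?thesis using *(2) c' openin_trans by auto
  qed
qed

lemma chart_covers:
  assumes "complex_manifold M"
  obtains c where "c \<in> charts M" "x \<in> fst c"
  using assms unfolding complex_manifold_def by (metis UNIV_I UN_E)

lemma ref_chart:
  assumes "complex_manifold M"
  shows "ref_chart M x \<in> charts M" "x \<in> fst (ref_chart M x)"
proof -
  have "\<exists>c. c \<in> charts M \<and> x \<in> fst c" using chart_covers[OF assms] by metis
  then show "ref_chart M x \<in> charts M" "x \<in> fst (ref_chart M x)"
    unfolding ref_chart_def by (metis (mono_tags, lifting) someI_ex)+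
qed

lemma holo_fun_cong:
  assumes "complex_manifold M" "open W" "\<And>x. x \<in> W \<Longrightarrow> f x = g x" "holo_fun M W f"
  shows "holo_fun M W g"
  unfolding holo_fun_def
proof
  fix c assume c: "c \<in> charts M"
  show "holomorphic_Cn (mdim M) (snd c ` (fst c \<inter> W)) (g \<circ> chart_inv c)"
  proof (rule holomorphic_Cn_cong[OF chart_props(4)[OF assms(1) c assms(2)]])
    show "holomorphic_Cn (mdim M) (snd c ` (fst c \<inter> W)) (f \<circ> chart_inv c)"
      using assms(4) c by (simp add: holo_fun_def)
  next
    fix y assume "y \<in> snd c ` (fst c \<inter> W)"
    then have "chart_inv c y \<in> W" using chart_props(3)[OF assms(1) c] by auto
    then show "(f \<circ> chart_inv c) y = (g \<circ> chart_inv c) y" using assms(3) by simp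
  qed
qed

lemma holo_fun_subset: "holo_fun M W f \<Longrightarrow> W' \<subseteq> W \<Longrightarrow> holo_fun M W' f"
  unfolding holo_fun_def
proof
  fix c assume *: "\<forall>c\<in>charts M. holomorphic_Cn (mdim M) (snd c ` (fst c \<inter> W)) (f \<circ> chart_inv c)"
    "W' \<subseteq> W" and c: "c \<in> charts M"
  show "holomorphic_Cn (mdim M) (snd c ` (fst c \<inter> W')) (f \<circ> chart_inv c)"
    by (rule holomorphic_Cn_subset[OF bspec[OF *(1) c]]) (use *(2) in auto)
qed

lemma holo_fun_const: "holo_fun M W (\<lambda>x. a)"
  using holomorphic_Cn_const by (auto simp: holo_fun_def comp_def)

lemma holo_fun_add: "holo_fun M W f \<Longrightarrow> holo_fun M W g \<Longrightarrow> holo_fun M W (\<lambda>x. f x + g x)"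
  by (auto simp: holo_fun_def comp_def intro!: holomorphic_Cn_add)

lemma holo_fun_mult: "holo_fun M W f \<Longrightarrow> holo_fun M W g \<Longrightarrow> holo_fun M W (\<lambda>x. f x * g x)"
  by (auto simp: holo_fun_def comp_def intro!: holomorphic_Cn_mult)

lemma holo_fun_sum:
  "(\<And>i. i \<in> I \<Longrightarrow> holo_fun M W (f i)) \<Longrightarrow> holo_fun M W (\<lambda>x. \<Sum>i\<in>I. f i x)"
  by (induction I rule: infinite_finite_induct) (auto intro: holo_fun_const holo_fun_add)

lemma transition_holomorphic:
  assumes M: "complex_manifold M" and c: "c \<in> charts M" and c': "c' \<in> charts M" and i: "i < mdim M"
    and D: "D \<subseteq> fst c \<inter> fst c'"
  shows "holomorphic_Cn (mdim M) (snd c ` D) (\<lambda>z. snd c' (chart_inv c z) i)"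
proof -
  have "holomorphic_Cn (mdim M) (snd c ` (fst c \<inter> fst c')) (\<lambda>z. snd c' (chart_inv c z) i)"
    using M c c' i unfolding complex_manifold_def by blast
  then show ?thesis by (rule holomorphic_Cn_subset) (use D in auto)
qed

text \<open>\<open>holo_fun\<close> quantifies over all charts, so a function given in the
  coordinates of one chart has to be carried to the others by the transition maps.\<close>

lemma holo_fun_chart:
  assumes M: "complex_manifold M" and c: "c \<in> charts M" and W: "open W"
    and F: "holomorphic_Cn (mdim M) (snd c ` (fst c \<inter> W)) F"
  shows "holo_fun M (fst c \<inter> W) (\<lambda>x. F (snd c x))"
  unfolding holo_fun_def comp_def
proof
  fix c' assume c': "c' \<in> charts M"
  have o: "open_Cn (mdim M) (snd c' ` (fst c' \<inter> (fst c \<inter> W)))"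
    using chart_props(4)[OF M c'] chart_props(1)[OF M c] W by blast
  show "holomorphic_Cn (mdim M) (snd c' ` (fst c' \<inter> (fst c \<inter> W))) (\<lambda>z. F (snd c (chart_inv c' z)))"
  proof (rule holomorphic_Cn_compose(1)[OF F chart_props(4)[OF M c W] o])
    show "snd c (chart_inv c' z) \<in> snd c ` (fst c \<inter> W)"
      if "z \<in> snd c' ` (fst c' \<inter> (fst c \<inter> W))" for z
      using that chart_props(3)[OF M c'] by auto
    show "holomorphic_Cn (mdim M) (snd c' ` (fst c' \<inter> (fst c \<inter> W))) (\<lambda>z. snd c (chart_inv c' z) k)"
      if "k < mdim M" for k
      by (rule transition_holomorphic[OF M c' c that]) auto
  qed
qed

section \<open>The differential of a function\<close>

lemma differential_cong:
  assumes M: "complex_manifold M" and V: "open V" "x \<in> V" and eq: "\<And>y. y \<in> V \<Longrightarrow> f y = g y"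
  shows "differential M f x = differential M g x"
proof
  fix i
  let ?c = "ref_chart M x"
  note c = ref_chart[OF M, of x]
  show "differential M f x i = differential M g x i"
    unfolding differential_def
  proof (rule if_cong[OF refl _ refl])
    assume i: "i < mdim M"
    show "partial_deriv i (f \<circ> chart_inv ?c) (snd ?c x) = partial_deriv i (g \<circ> chart_inv ?c) (snd ?c x)"
    proof (rule partial_deriv_cong(1)[OF chart_props(4)[OF M c(1) V(1)] _ i])
      show "snd ?c x \<in> snd ?c ` (fst ?c \<inter> V)" using c V by blast
      fix y assume "y \<in> snd ?c ` (fst ?c \<inter> V)"
      then have "chart_inv ?c y \<in> V" using chart_props(3)[OF M c(1)] by auto
      then show "(f \<circ> chart_inv ?c) y = (g \<circ> chart_inv ?c) y" using eq by simp
    qed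
  qed
qed

text \<open>\<open>differential\<close> is computed in the chart chosen at \<open>x\<close>. Along
  the coordinate lines of that chart the one-variable sum and product rules apply directly.\<close>

lemma holo_fun_line:
  assumes M: "complex_manifold M" and V: "x \<in> V" and f: "holo_fun M V f"
    and i: "i < mdim M"
  shows "((\<lambda>w. f (chart_inv (ref_chart M x) ((snd (ref_chart M x) x)(i := w)))) has_field_derivative
     differential M f x i) (at (snd (ref_chart M x) x i))"
proof -
  note c = ref_chart[OF M, of x]
  have "holomorphic_Cn (mdim M) (snd (ref_chart M x) ` (fst (ref_chart M x) \<inter> V)) (f \<circ> chart_inv (ref_chart M x))"
    using f c(1) by (auto simp: holo_fun_def)
  from holomorphic_Cn_line[OF this _ i, of "snd (ref_chart M x) x"] c V i
  show ?thesis by (simp add: differential_def comp_def)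
qed

lemma differential_mult:
  assumes M: "complex_manifold M" and x: "x \<in> V" and f: "holo_fun M V f" and g: "holo_fun M V g"
  shows "differential M (\<lambda>y. f y * g y) x = (\<lambda>i. f x * differential M g x i + g x * differential M f x i)"
proof
  fix i
  let ?\<phi> = "snd (ref_chart M x)" let ?h = "chart_inv (ref_chart M x)"
  show "differential M (\<lambda>y. f y * g y) x i = f x * differential M g x i + g x * differential M f x i"
  proof (cases "i < mdim M")
    case True
    note c = ref_chart[OF M, of x]
    have hx: "?h ((?\<phi> x)(i := ?\<phi> x i)) = x" using chart_props(3)[OF M c(1)] c(2) by simp
    from DERIV_mult[OF holo_fun_line[OF M x f True] holo_fun_line[OF M x g True]]
    have 1: "((\<lambda>w. f (?h ((?\<phi> x)(i := w))) * g (?h ((?\<phi> x)(i := w)))) has_field_derivative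
      differential M f x i * g x + differential M g x i * f x) (at (?\<phi> x i))"
      unfolding hx .
    have "((\<lambda>w. f (?h ((?\<phi> x)(i := w))) * g (?h ((?\<phi> x)(i := w)))) has_field_derivative
        differential M (\<lambda>y. f y * g y) x i) (at (?\<phi> x i))"
      by (rule holo_fun_line[OF M x holo_fun_mult[OF f g] True])
    from DERIV_unique[OF this 1] show ?thesis by (simp add: mult.commute)
  qed (simp add: differential_def)
qed

lemma differential_add:
  assumes M: "complex_manifold M" and x: "x \<in> V" and f: "holo_fun M V f" and g: "holo_fun M V g"
  shows "differential M (\<lambda>y. f y + g y) x = (\<lambda>i. differential M f x i + differential M g x i)"
proof
  fix i
  show "differential M (\<lambda>y. f y + g y) x i = differential M f x i + differential M g x i"
  proof (cases "i < mdim M")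
    case True
    from DERIV_add[OF holo_fun_line[OF M x f True] holo_fun_line[OF M x g True]]
      holo_fun_line[OF M x holo_fun_add[OF f g] True]
    show ?thesis by (rule DERIV_unique[rotated])
  qed (simp add: differential_def)
qed

lemma differential_const:
  assumes M: "complex_manifold M"
  shows "differential M (\<lambda>y. a) x = 0"
  by (auto simp: differential_def partial_deriv_def comp_def fun_eq_iff)

text \<open>The chart chosen at \<open>x\<close> may jump with \<open>x\<close>, so the components
  of \<open>differential\<close> have no regularity of their own. Expanding in the coordinate
  differentials of a fixed chart \<open>c\<close> removes the choice: by the chain rule the
  coefficients are partial derivatives in \<open>c\<close>, which are holomorphic.\<close>

theorem differential_chart:
  assumes M: "complex_manifold M" and V: "open V" and f: "holo_fun M V f" and c: "c \<in> charts M"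
  defines "a \<equiv> (\<lambda>k x. partial_deriv k (f \<circ> chart_inv c) (snd c x))"
  shows "k < mdim M \<Longrightarrow> holo_fun M (fst c \<inter> V) (a k)"
    and "x \<in> fst c \<inter> V \<Longrightarrow>
      differential M f x = (\<lambda>i. \<Sum>k<mdim M. a k x * differential M (\<lambda>y. snd c y k) x i)"
proof -
  let ?n = "mdim M"
  have hf: "holomorphic_Cn ?n (snd c ` (fst c \<inter> V)) (f \<circ> chart_inv c)"
    using f c by (auto simp: holo_fun_def)
  note oV = chart_props(4)[OF M c V]
  show "holo_fun M (fst c \<inter> V) (a k)" if "k < ?n"
    unfolding a_def using holo_fun_chart[OF M c V holomorphic_Cn_partial_deriv[OF hf oV that]] .
  assume x: "x \<in> fst c \<inter> V"
  show "differential M f x = (\<lambda>i. \<Sum>k<mdim M. a k x * differential M (\<lambda>y. snd c y k) x i)"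
  proof
    fix i
    let ?c0 = "ref_chart M x"
    note c0 = ref_chart[OF M, of x]
    let ?z = "snd ?c0 x"
    let ?D = "snd ?c0 ` (fst ?c0 \<inter> (fst c \<inter> V))"
    have o: "open_Cn ?n ?D" using chart_props(4)[OF M c0(1)] chart_props(1)[OF M c] V by blast
    have z: "?z \<in> ?D" using x c0 by auto
    let ?T = "\<lambda>z. snd c (chart_inv ?c0 z)"
    show "differential M f x i = (\<Sum>k<mdim M. a k x * differential M (\<lambda>y. snd c y k) x i)"
    proof (cases "i < ?n")
      case True
      have hT: "holomorphic_Cn ?n ?D (\<lambda>z. ?T z k)" if "k < ?n" for k
        by (rule transition_holomorphic[OF M c0(1) c that]) auto
      have TD: "?T y \<in> snd c ` (fst c \<inter> V)" if "y \<in> ?D" for y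
        using that chart_props(3)[OF M c0(1)] by auto
      \<comment> \<open>Near \<open>x\<close>, \<open>f\<close> read in the chosen chart is
        \<open>f\<close> read in \<open>c\<close> after the transition map
        \<open>?T\<close>.\<close>
      have "partial_deriv i (f \<circ> chart_inv ?c0) ?z = partial_deriv i (\<lambda>z. (f \<circ> chart_inv c) (?T z)) ?z"
        by (rule partial_deriv_cong(1)[OF o z True])
          (use chart_props(3)[OF M c0(1)] chart_props(3)[OF M c] in auto)
      also have "\<dots> = (\<Sum>k<?n. partial_deriv k (f \<circ> chart_inv c) (?T ?z) * partial_deriv i (\<lambda>z. ?T z k) ?z)"
        by (rule holomorphic_Cn_compose(2)[OF hf oV o TD hT z True])
      also have "\<dots> = (\<Sum>k<?n. a k x * differential M (\<lambda>y. snd c y k) x i)"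
        using chart_props(3)[OF M c0(1) c0(2)] True by (simp add: a_def differential_def comp_def)
      finally show ?thesis using True by (simp add: differential_def)
    qed (simp add: differential_def)
  qed
qed

lemma differential_in_vsec:
  assumes M: "complex_manifold M" and V: "open V" and f: "holo_fun M V f"
  shows "rsec V (differential M f) \<in> vsec M (cotangent M) V"
  unfolding vsec_def
proof (intro CollectI conjI allI impI ballI)
  show "rsec V (differential M f) x \<in> Cn (brank (cotangent M))" for x
    by (auto simp: rsec_def Cn_def cotangent_def differential_def)
  show "rsec V (differential M f) x = 0" if "x \<notin> V" for x using that by (simp add: rsec_def)
  fix p assume "p \<in> frames (cotangent M)"
  then obtain c where c: "c \<in> charts M" "p = (fst c, \<lambda>k. differential M (\<lambda>y. snd c y k))"
    by (auto simp: cotangent_def)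
  show "case p of (U, e) \<Rightarrow> \<exists>c. (\<forall>k<brank (cotangent M). holo_fun M (U \<inter> V) (c k)) \<and>
        (\<forall>x\<in>U \<inter> V. rsec V (differential M f) x = (\<lambda>i. \<Sum>k<brank (cotangent M). c k x * e k x i))"
    unfolding c(2) prod.case
    by (rule exI[of _ "\<lambda>k x. partial_deriv k (f \<circ> chart_inv c) (snd c x)"])
      (use differential_chart[OF M V f c(1)] in \<open>auto simp: cotangent_def rsec_def\<close>)
qed

section \<open>The exterior algebra\<close>

lemma sum_fun_apply: "(\<Sum>i\<in>I. f i) x = (\<Sum>i\<in>I. f i x)"
  by (induction I rule: infinite_finite_induct) auto

text \<open>The sign in \<open>\<epsilon>_A \<and> \<epsilon>_B = sign \<cdot> \<epsilon>_(A
  \<union> B)\<close> for disjoint \<open>A\<close> and \<open>B\<close>: the parity of the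
  permutation sorting \<open>A\<close> followed by \<open>B\<close>.\<close>

definition shuffle_sign :: "nat set \<Rightarrow> nat set \<Rightarrow> complex" where
  "shuffle_sign A B = (-1) ^ card {(i, j). i \<in> A \<and> j \<in> B \<and> j < i}"

lemma wedge_eq: "wedge a b S = (\<Sum>T\<in>Pow S. shuffle_sign T (S - T) * a T * b (S - T))"
  by (simp add: wedge_def shuffle_sign_def)

lemma finite_inversions: "finite A \<Longrightarrow> finite B \<Longrightarrow> finite {(i, j). i \<in> A \<and> j \<in> B \<and> j < (i::nat)}"
  by (rule finite_subset[of _ "A \<times> B"]) auto

lemma shuffle_sign_Un_left:
  assumes "finite A" "finite B" "finite C" "A \<inter> B = {}"
  shows "shuffle_sign (A \<union> B) C = shuffle_sign A C * shuffle_sign B C"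
proof -
  have "{(i, j). i \<in> A \<union> B \<and> j \<in> C \<and> j < i} =
      {(i, j). i \<in> A \<and> j \<in> C \<and> j < i} \<union> {(i, j). i \<in> B \<and> j \<in> C \<and> j < i}" by auto
  moreover have "{(i, j). i \<in> A \<and> j \<in> C \<and> j < i} \<inter> {(i, j). i \<in> B \<and> j \<in> C \<and> j < i} = {}"
    using assms by auto
  ultimately show ?thesis
    unfolding shuffle_sign_def
    using card_Un_disjoint[OF finite_inversions[OF assms(1,3)] finite_inversions[OF assms(2,3)]]
    by (simp add: power_add)
qed

lemma shuffle_sign_Un_right:
  assumes "finite A" "finite B" "finite C" "B \<inter> C = {}"
  shows "shuffle_sign A (B \<union> C) = shuffle_sign A B * shuffle_sign A C"
proof -
  have "{(i, j). i \<in> A \<and> j \<in> B \<union> C \<and> j < i} =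
      {(i, j). i \<in> A \<and> j \<in> B \<and> j < i} \<union> {(i, j). i \<in> A \<and> j \<in> C \<and> j < i}" by auto
  moreover have "{(i, j). i \<in> A \<and> j \<in> B \<and> j < i} \<inter> {(i, j). i \<in> A \<and> j \<in> C \<and> j < i} = {}"
    using assms by auto
  ultimately show ?thesis
    unfolding shuffle_sign_def
    using card_Un_disjoint[OF finite_inversions[OF assms(1,2)] finite_inversions[OF assms(1,3)]]
    by (simp add: power_add)
qed

lemma shuffle_sign_empty [simp]: "shuffle_sign {} B = 1" "shuffle_sign A {} = 1"
  by (simp_all add: shuffle_sign_def)

lemma shuffle_sign_min: "(\<And>s. s \<in> S \<Longrightarrow> i \<le> s) \<Longrightarrow> shuffle_sign {i} S = 1"
proof -
  assume "\<And>s. s \<in> S \<Longrightarrow> i \<le> s"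
  then have "{(x, j). x \<in> {i} \<and> j \<in> S \<and> j < x} = {}" by force
  then show ?thesis unfolding shuffle_sign_def by (simp only: card.empty power_0)
qed

lemma shuffle_sign_square: "shuffle_sign A B * shuffle_sign A B = 1"
  by (simp add: shuffle_sign_def flip: power_mult_distrib)

text \<open>Every pair in \<open>A \<times> B\<close> is an inversion in exactly one of the two
  orders, so the inversion numbers add up to \<open>card A * card B\<close>.\<close>

lemma shuffle_sign_swap:
  assumes "finite A" "finite B" "A \<inter> B = {}"
  shows "shuffle_sign B A = (-1) ^ (card A * card B) * shuffle_sign A B"
proof -
  let ?P = "{(i, j). i \<in> A \<and> j \<in> B \<and> j < i}" let ?Q = "{(i, j). i \<in> B \<and> j \<in> A \<and> j < i}"
  have "A \<times> B = ?P \<union> prod.swap ` ?Q"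
    using assms(3) by (force simp: image_iff)
  moreover have "?P \<inter> prod.swap ` ?Q = {}" by auto
  ultimately have "card (A \<times> B) = card ?P + card (prod.swap ` ?Q)"
    using card_Un_disjoint[OF finite_inversions[OF assms(1,2)] finite_imageI[OF finite_inversions[OF assms(2,1)]]]
    by simp
  also have "card (prod.swap ` ?Q) = card ?Q" by (rule card_image) auto
  finally have "(-1) ^ (card A * card B) = shuffle_sign A B * shuffle_sign B A"
    by (simp add: shuffle_sign_def card_cartesian_product power_add)
  then show ?thesis
    using shuffle_sign_square[of A B] by (simp add: algebra_simps)
qed

text \<open>The sum over \<open>Pow S\<close> is infinite and thus 0 by convention. This is why the
  unit laws below ask for coefficients vanishing at infinite sets.\<close>

lemma wedge_infinite: "infinite S \<Longrightarrow> wedge a b S = 0"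
  by (simp add: wedge_eq)

lemma wedge_add_left: "wedge (a + b) c = wedge a c + wedge b c"
  by (auto simp: wedge_eq fun_eq_iff algebra_simps sum.distrib)

lemma wedge_add_right: "wedge a (b + c) = wedge a b + wedge a c"
  by (auto simp: wedge_eq fun_eq_iff algebra_simps sum.distrib)

lemma wedge_scale_left: "wedge (\<lambda>S. x * a S) b = (\<lambda>S. x * wedge a b S)"
  by (auto simp: wedge_eq fun_eq_iff sum_distrib_left algebra_simps)

lemma wedge_scale_right: "wedge a (\<lambda>S. x * b S) = (\<lambda>S. x * wedge a b S)"
  by (auto simp: wedge_eq fun_eq_iff sum_distrib_left algebra_simps)

lemma wedge_zero [simp]: "wedge 0 b = 0" "wedge a 0 = 0"
  by (auto simp: wedge_eq fun_eq_iff)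

lemma wedge_diff_left: "wedge (a - b) c = wedge a c - wedge b c"
  using wedge_add_left[of "a - b" b c] by simp

lemma wedge_diff_right: "wedge a (b - c) = wedge a b - wedge a c"
  using wedge_add_right[of a "b - c" c] by simp

lemma wedge_sum_left: "wedge (\<Sum>i\<in>I. f i) c = (\<Sum>i\<in>I. wedge (f i) c)"
  by (induction I rule: infinite_finite_induct) (auto simp: wedge_add_left simp del: zero_fun_apply plus_fun_apply)

lemma wedge_sum_right: "wedge c (\<Sum>i\<in>I. f i) = (\<Sum>i\<in>I. wedge c (f i))"
  by (induction I rule: infinite_finite_induct) (auto simp: wedge_add_right simp del: zero_fun_apply plus_fun_apply)

lemma wedge_const_left: "(infinite S \<Longrightarrow> b S = 0) \<Longrightarrow> wedge (ext_const c) b S = c * b S"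
proof (cases "finite S")
  case True
  have "wedge (ext_const c) b S = (\<Sum>T\<in>Pow S. if T = {} then c * b S else 0)"
    unfolding wedge_eq by (rule sum.cong) (auto simp: ext_const_def)
  also have "\<dots> = c * b S" using True by (subst sum.delta) auto
  finally show ?thesis .
qed (auto simp: wedge_infinite)

lemma wedge_const_right: "(infinite S \<Longrightarrow> b S = 0) \<Longrightarrow> wedge b (ext_const c) S = c * b S"
proof (cases "finite S")
  case True
  have "wedge b (ext_const c) S = (\<Sum>T\<in>Pow S. if T = S then c * b S else 0)"
    unfolding wedge_eq by (rule sum.cong) (auto simp: ext_const_def)
  also have "\<dots> = c * b S" using True by (subst sum.delta) auto
  finally show ?thesis .
qed (auto simp: wedge_infinite)

text \<open>Both sides are sums over ordered partitions of \<open>S\<close> into three blocks, and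
  both signs factor into the shuffle signs of the three pairs of blocks.\<close>

lemma wedge_assoc: "wedge (wedge a b) c = wedge a (wedge b c)"
proof
  fix S
  show "wedge (wedge a b) c S = wedge a (wedge b c) S"
  proof (cases "finite S")
    case True
    have fin: "finite T" if "T \<subseteq> S" for T using True that finite_subset by blast
    have "wedge (wedge a b) c S =
      (\<Sum>T\<in>Pow S. \<Sum>R\<in>Pow T. shuffle_sign T (S - T) * shuffle_sign R (T - R) * a R * b (T - R) * c (S - T))"
      unfolding wedge_eq[of "wedge a b"] unfolding wedge_eq
      by (simp add: sum_distrib_left sum_distrib_right mult_ac)
    also have "\<dots> = (\<Sum>(T, R)\<in>Sigma (Pow S) Pow.
        shuffle_sign T (S - T) * shuffle_sign R (T - R) * a R * b (T - R) * c (S - T))"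
      using True by (subst sum.Sigma) (auto intro: fin)
    also have "\<dots> = (\<Sum>(R, Q)\<in>Sigma (Pow S) (\<lambda>R. Pow (S - R)).
        shuffle_sign R (S - R) * shuffle_sign Q (S - R - Q) * a R * b Q * c (S - R - Q))"
    \<comment> \<open>A chain \<open>R \<subseteq> T \<subseteq> S\<close> and its first two blocks
      \<open>R\<close> and \<open>T - R\<close> determine each other.\<close>
    proof (rule sum.reindex_bij_witness[of _ "\<lambda>(R, Q). (R \<union> Q, R)" "\<lambda>(T, R). (R, T - R)"])
      fix p assume "p \<in> Sigma (Pow S) Pow"
      then obtain T R where p: "p = (T, R)" "T \<subseteq> S" "R \<subseteq> T" by auto
      have 1: "S - R - (T - R) = S - T" "S - R = (T - R) \<union> (S - T)" "T = R \<union> (T - R)" using p by auto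
      have "shuffle_sign T (S - T) = shuffle_sign R (S - T) * shuffle_sign (T - R) (S - T)"
        using shuffle_sign_Un_left[of R "T - R" "S - T"] 1(3) p fin True by auto
      moreover have "shuffle_sign R (S - R) = shuffle_sign R (T - R) * shuffle_sign R (S - T)"
        using shuffle_sign_Un_right[of R "T - R" "S - T"] 1(2) p fin True
        by (metis Diff_disjoint Diff_subset Int_Diff Int_commute empty_Diff order_trans)
      ultimately show "(case (case p of (T, R) \<Rightarrow> (R, T - R)) of (R, Q) \<Rightarrow>
          shuffle_sign R (S - R) * shuffle_sign Q (S - R - Q) * a R * b Q * c (S - R - Q)) =
        (case p of (T, R) \<Rightarrow> shuffle_sign T (S - T) * shuffle_sign R (T - R) * a R * b (T - R) * c (S - T))"
        using 1(1) p by simp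
    qed auto
    also have "\<dots> = (\<Sum>R\<in>Pow S. \<Sum>Q\<in>Pow (S - R).
        shuffle_sign R (S - R) * shuffle_sign Q (S - R - Q) * a R * b Q * c (S - R - Q))"
      using True by (subst sum.Sigma) (auto intro: fin)
    also have "\<dots> = wedge a (wedge b c) S"
      unfolding wedge_eq[of a] unfolding wedge_eq
      by (simp add: sum_distrib_left sum_distrib_right mult_ac)
    finally show ?thesis .
  qed (simp add: wedge_infinite)
qed

section \<open>Parity, degree and the exterior algebra of rank \<open>r\<close>\<close>

definition even_ext :: "ext \<Rightarrow> bool" where
  "even_ext a \<longleftrightarrow> (\<forall>S. a S \<noteq> 0 \<longrightarrow> even (card S))"

definition odd_ext :: "ext \<Rightarrow> bool" where
  "odd_ext a \<longleftrightarrow> (\<forall>S. a S \<noteq> 0 \<longrightarrow> odd (card S))"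

text \<open>\<open>s\<close> is the common sign over all pairs of degrees that occur; it is 1 if one
  factor is even and -1 if both are odd.\<close>

lemma wedge_swap:
  assumes "\<And>A B. a A \<noteq> 0 \<Longrightarrow> b B \<noteq> 0 \<Longrightarrow> (-1) ^ (card A * card B) = (s::complex)"
  shows "wedge b a S = s * wedge a b S"
proof (cases "finite S")
  case True
  have "wedge b a S = (\<Sum>T\<in>Pow S. shuffle_sign (S - T) T * b (S - T) * a T)"
    unfolding wedge_eq
    by (rule sum.reindex_bij_witness[of _ "\<lambda>T. S - T" "\<lambda>T. S - T"]) (auto simp: double_diff)
  also have "\<dots> = (\<Sum>T\<in>Pow S. s * (shuffle_sign T (S - T) * a T * b (S - T)))"
  proof (rule sum.cong[OF refl])
    fix T assume "T \<in> Pow S"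
    then have "shuffle_sign (S - T) T = (-1) ^ (card T * card (S - T)) * shuffle_sign T (S - T)"
      using True by (intro shuffle_sign_swap) (auto intro: finite_subset)
    then show "shuffle_sign (S - T) T * b (S - T) * a T = s * (shuffle_sign T (S - T) * a T * b (S - T))"
      using assms[of T "S - T"] by (cases "a T = 0 \<or> b (S - T) = 0") auto
  qed
  finally show ?thesis by (simp add: wedge_eq sum_distrib_left)
qed (simp add: wedge_infinite)

lemma wedge_even_commute: "even_ext a \<Longrightarrow> wedge a b = wedge b a"
  using wedge_swap[of a b 1] by (auto simp: even_ext_def)

lemma wedge_odd_anticommute: "odd_ext a \<Longrightarrow> odd_ext b \<Longrightarrow> wedge a b = - wedge b a"
  using wedge_swap[of a b "-1"] by (auto simp: odd_ext_def fun_eq_iff)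

lemma wedge_odd_square: "odd_ext a \<Longrightarrow> wedge a a = 0"
  using wedge_odd_anticommute[of a a] by (auto simp: fun_eq_iff equation_minus_iff)

text \<open>Degree and parity bounds for products all reduce to this: a nonzero coefficient comes
  from a splitting of its index set, with additive cardinalities.\<close>

lemma wedge_nonzero:
  assumes "wedge a b S \<noteq> 0"
  obtains T where "finite S" "T \<subseteq> S" "a T \<noteq> 0" "b (S - T) \<noteq> 0" "card S = card T + card (S - T)"
proof -
  have fin: "finite S" using assms wedge_infinite by blast
  have "\<exists>T\<in>Pow S. shuffle_sign T (S - T) * a T * b (S - T) \<noteq> 0"
    using assms unfolding wedge_eq by (rule contrapos_np) (auto intro!: sum.neutral)
  then obtain T where T': "T \<in> Pow S" "shuffle_sign T (S - T) * a T * b (S - T) \<noteq> 0" by (rule bexE)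
  then have T: "T \<subseteq> S" "a T \<noteq> 0" "b (S - T) \<noteq> 0" by simp_all
  have "card S = card T + card (S - T)"
    using card_Diff_subset[OF finite_subset[OF T(1) fin] T(1)] card_mono[OF fin T(1)] by simp
  from that[OF fin T this] show ?thesis .
qed

definition degree_ge :: "nat \<Rightarrow> ext \<Rightarrow> bool" where
  "degree_ge d a \<longleftrightarrow> (\<forall>S. a S \<noteq> 0 \<longrightarrow> d \<le> card S)"

lemma degree_ge_wedge: "degree_ge d a \<Longrightarrow> degree_ge e b \<Longrightarrow> degree_ge (d + e) (wedge a b)"
  unfolding degree_ge_def by (metis wedge_nonzero add_mono)

lemma degree_ge_zero [simp]: "degree_ge 0 a" "degree_ge d 0"
  by (auto simp: degree_ge_def)

lemma degree_ge_mono: "degree_ge d a \<Longrightarrow> e \<le> d \<Longrightarrow> degree_ge e a"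
  by (force simp: degree_ge_def)

lemma degree_ge_add: "degree_ge d a \<Longrightarrow> degree_ge d b \<Longrightarrow> degree_ge d (a + b)"
  by (force simp: degree_ge_def)

lemma degree_ge_scale: "degree_ge d a \<Longrightarrow> degree_ge d (\<lambda>S. c * a S)"
  by (force simp: degree_ge_def)

lemma degree_ge_sum: "(\<And>i. i \<in> I \<Longrightarrow> degree_ge d (f i)) \<Longrightarrow> degree_ge d (\<Sum>i\<in>I. f i)"
  by (induction I rule: infinite_finite_induct) (auto intro: degree_ge_add)

text \<open>The type \<open>ext\<close> carries coefficients at all sets of naturals, infinite ones
  included; this carves out the exterior algebra of \<open>\<complex>^r\<close>, where the unit laws
  hold.\<close>

definition extalg :: "nat \<Rightarrow> ext set" where
  "extalg r = {a. \<forall>S. \<not> S \<subseteq> {..<r} \<longrightarrow> a S = 0}"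

lemma extalg_infinite: "a \<in> extalg r \<Longrightarrow> infinite S \<Longrightarrow> a S = 0"
  using finite_subset[of S "{..<r}"] by (auto simp: extalg_def)

lemma extalg_wedge: "a \<in> extalg r \<Longrightarrow> b \<in> extalg r \<Longrightarrow> wedge a b \<in> extalg r"
  unfolding extalg_def
proof (intro CollectI allI impI, rule ccontr)
  fix S assume *: "a \<in> {a. \<forall>S. \<not> S \<subseteq> {..<r} \<longrightarrow> a S = 0}" "b \<in> {a. \<forall>S. \<not> S \<subseteq> {..<r} \<longrightarrow> a S = 0}"
    "\<not> S \<subseteq> {..<r}" "wedge a b S \<noteq> 0"
  from *(4) obtain T where T: "finite S" "T \<subseteq> S" "a T \<noteq> 0" "b (S - T) \<noteq> 0"
    "card S = card T + card (S - T)" by (rule wedge_nonzero)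
  have "T \<subseteq> {..<r}" using *(1) T(3) by (simp only: mem_Collect_eq) metis
  moreover have "S - T \<subseteq> {..<r}" using *(2) T(4) by (simp only: mem_Collect_eq) metis
  ultimately have "S \<subseteq> {..<r}" by blast
  with *(3) show False ..
qed

lemma extalg_zero [simp]: "0 \<in> extalg r" by (auto simp: extalg_def)
lemma extalg_add: "a \<in> extalg r \<Longrightarrow> b \<in> extalg r \<Longrightarrow> a + b \<in> extalg r" by (auto simp: extalg_def)
lemma extalg_scale: "a \<in> extalg r \<Longrightarrow> (\<lambda>S. c * a S) \<in> extalg r" by (auto simp: extalg_def)
lemma extalg_sum: "(\<And>i. i \<in> I \<Longrightarrow> f i \<in> extalg r) \<Longrightarrow> (\<Sum>i\<in>I. f i) \<in> extalg r"
  by (induction I rule: infinite_finite_induct) (auto intro: extalg_add)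
lemma extalg_const [simp]: "ext_const c \<in> extalg r" by (auto simp: extalg_def ext_const_def)
lemma extalg_vec: "v \<in> Cn r \<Longrightarrow> ext_vec v \<in> extalg r"
proof -
  assume v: "v \<in> Cn r"
  have "ext_vec v S = 0" if S: "\<not> S \<subseteq> {..<r}" for S
  proof (cases "card S = 1")
    case True
    then obtain x where "S = {x}" by (auto simp: card_1_singleton_iff)
    then show ?thesis using v S by (auto simp: ext_vec_def Cn_def not_less)
  qed (simp add: ext_vec_def)
  then show ?thesis by (auto simp: extalg_def)
qed

lemma wedge_one_left: "a \<in> extalg r \<Longrightarrow> wedge (ext_const 1) a = a"
  using wedge_const_left[of _ a 1] extalg_infinite[of a r] by (auto simp: fun_eq_iff)

lemma wedge_one_right: "a \<in> extalg r \<Longrightarrow> wedge a (ext_const 1) = a"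
  using wedge_const_right[of _ a 1] extalg_infinite[of a r] by (auto simp: fun_eq_iff)

text \<open>The end point of the nilpotency arguments: no index set has more than \<open>r\<close>
  elements.\<close>

lemma degree_ge_top: "a \<in> extalg r \<Longrightarrow> degree_ge (Suc r) a \<Longrightarrow> a = 0"
proof
  fix S assume a: "a \<in> extalg r" "degree_ge (Suc r) a"
  show "a S = 0 S"
  proof (rule ccontr)
    assume "a S \<noteq> 0 S"
    then have "S \<subseteq> {..<r}" "Suc r \<le> card S" using a by (auto simp: extalg_def degree_ge_def)
    then show False using card_mono[of "{..<r}" S] by simp
  qed
qed

text \<open>\<open>wedge_family\<close> with arbitrary factors in place of vectors, since an
  automorphism sends generators to elements with parts of higher degree.\<close>

definition wedge_prod :: "(nat \<Rightarrow> ext) \<Rightarrow> nat set \<Rightarrow> ext" where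
  "wedge_prod v S = foldr (\<lambda>k. wedge (v k)) (sorted_list_of_set S) (ext_const 1)"

lemma wedge_family_eq: "wedge_family v S = wedge_prod (\<lambda>k. ext_vec (v k)) S"
  by (simp add: wedge_family_def wedge_prod_def)

lemma wedge_prod_empty [simp]: "wedge_prod v {} = ext_const 1"
  by (simp add: wedge_prod_def)

lemma wedge_prod_insert:
  assumes "finite S" "\<And>s. s \<in> S \<Longrightarrow> i < s"
  shows "wedge_prod v (insert i S) = wedge (v i) (wedge_prod v S)"
proof -
  have "i \<notin> S" using assms(2) by blast
  then have "sorted_list_of_set (insert i S) = insort i (sorted_list_of_set S)"
    using assms(1) by simp
  also have "\<dots> = i # sorted_list_of_set S"
    using assms by (intro insort_is_Cons) (auto simp: less_imp_le)
  finally show ?thesis by (simp add: wedge_prod_def)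
qed

text \<open>Adding a new minimum matches the fold over the sorted list, where the least index is the
  outermost factor.\<close>

lemma finite_set_min_induct [consumes 1, case_names empty insert]:
  fixes S :: "nat set"
  assumes "finite S" "P {}" "\<And>i S. finite S \<Longrightarrow> (\<And>s. s \<in> S \<Longrightarrow> i < s) \<Longrightarrow> P S \<Longrightarrow> P (insert i S)"
  shows "P S"
  using finite_linorder_min_induct[OF assms(1), of P] assms(2,3) by blast

lemma wedge_prod_extalg:
  assumes "finite S" "\<And>k. k \<in> S \<Longrightarrow> v k \<in> extalg r"
  shows "wedge_prod v S \<in> extalg r"
  using assms by (induction rule: finite_set_min_induct) (auto simp: wedge_prod_insert intro: extalg_wedge)

lemma degree_ge_wedge_prod:
  assumes "finite S" "\<And>k. k \<in> S \<Longrightarrow> degree_ge 1 (v k)"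
  shows "degree_ge (card S) (wedge_prod v S)"
  using assms
proof (induction rule: finite_set_min_induct)
  case (insert i S)
  then have "degree_ge (1 + card S) (wedge (v i) (wedge_prod v S))"
    by (intro degree_ge_wedge) auto
  moreover have "i \<notin> S" using insert.hyps by blast
  ultimately show ?case using insert.hyps by (simp add: wedge_prod_insert)
qed simp

lemma wedge_prod_parity:
  assumes "finite S" "\<And>k. k \<in> S \<Longrightarrow> odd_ext (v k)" "wedge_prod v S T \<noteq> 0"
  shows "even (card T) \<longleftrightarrow> even (card S)"
  using assms
proof (induction arbitrary: T rule: finite_set_min_induct)
  case empty
  then show ?case by (auto simp: ext_const_def split: if_splits)
next
  case (insert i S)
  have "wedge (v i) (wedge_prod v S) T \<noteq> 0"
    using insert.prems(2) insert.hyps by (simp add: wedge_prod_insert)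
  then obtain R where R: "finite T" "R \<subseteq> T" "v i R \<noteq> 0" "wedge_prod v S (T - R) \<noteq> 0"
     "card T = card R + card (T - R)"
    by (rule wedge_nonzero)
  have "odd (card R)" using insert.prems(1)[of i] R(3) by (auto simp: odd_ext_def)
  moreover have "even (card (T - R)) \<longleftrightarrow> even (card S)" using insert.IH[OF _ R(4)] insert.prems(1) by blast
  moreover have "i \<notin> S" using insert.hyps by blast
  ultimately show ?case using R(5) insert.hyps(1) by auto
qed

lemma wedge_prod_cong: "finite S \<Longrightarrow> (\<And>k. k \<in> S \<Longrightarrow> v k = w k) \<Longrightarrow> wedge_prod v S = wedge_prod w S"
  by (induction rule: finite_set_min_induct) (auto simp: wedge_prod_insert)

text \<open>The factor \<open>v i\<close> is moved to its sorted place: each smaller index passed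
  costs a sign, and meeting its own copy gives a square, which is zero.\<close>

lemma wedge_prod_vec_mult:
  assumes "finite S" "\<And>k. k \<in> S \<Longrightarrow> odd_ext (v k)" "odd_ext (v i)"
  shows "wedge (v i) (wedge_prod v S) =
    (if i \<in> S then 0 else (\<lambda>T. shuffle_sign {i} S * wedge_prod v (insert i S) T))"
  using assms(1,2)
proof (induction rule: finite_set_min_induct)
  case empty
  then show ?case using wedge_prod_insert[of "{}" i v] by simp
next
  case (insert m S)
  have m: "m \<notin> S" using insert.hyps by blast
  note IH = insert.IH
  consider "i < m" | "i = m" | "m < i" by linarith
  then show ?case
  proof cases
    case 1
    then have "\<And>s. s \<in> insert m S \<Longrightarrow> i < s" using insert.hyps(2) by force
    moreover from this have "shuffle_sign {i} (insert m S) = 1"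
      by (intro shuffle_sign_min) (simp add: less_imp_le)
    ultimately show ?thesis using insert.hyps(1) wedge_prod_insert[of "insert m S" i v] by auto
  next
    case 2
    then show ?thesis
      using insert.hyps wedge_odd_square[OF assms(3)]
      by (simp add: wedge_prod_insert flip: wedge_assoc)
  next
    case 3
    have "wedge (v i) (wedge_prod v (insert m S)) = wedge (wedge (v i) (v m)) (wedge_prod v S)"
      using insert.hyps by (simp add: wedge_prod_insert wedge_assoc)
    also have "wedge (v i) (v m) = - wedge (v m) (v i)"
      using wedge_odd_anticommute[OF assms(3)] insert.prems by auto
    also have "wedge (- wedge (v m) (v i)) (wedge_prod v S) = - wedge (v m) (wedge (v i) (wedge_prod v S))"
      using wedge_diff_left[of 0 "wedge (v m) (v i)"] by (simp add: wedge_assoc)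
    also have "\<dots> = (if i \<in> insert m S then 0 else (\<lambda>T. shuffle_sign {i} (insert m S) * wedge_prod v (insert i (insert m S)) T))"
    proof (cases "i \<in> S")
      case True
      then show ?thesis using IH insert.prems by (simp del: zero_fun_apply)
    next
      case False
      have "shuffle_sign {i} (insert m S) = shuffle_sign {i} {m} * shuffle_sign {i} S"
        using shuffle_sign_Un_right[of "{i}" "{m}" S] insert.hyps(1) m by simp
      moreover have "{(x, j). x = i \<and> j = m \<and> j < x} = {(i, m)}" using 3 by auto
      then have "shuffle_sign {i} {m} = -1" by (simp add: shuffle_sign_def)
      moreover have "wedge_prod v (insert m (insert i S)) = wedge (v m) (wedge_prod v (insert i S))"
        using insert.hyps 3 by (intro wedge_prod_insert) auto
      moreover have "wedge (v i) (wedge_prod v S) = (\<lambda>T. shuffle_sign {i} S * wedge_prod v (insert i S) T)"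
        using IH insert.prems False by auto
      ultimately show ?thesis
        using False 3 by (auto simp: wedge_scale_right insert_commute)
    qed
    finally show ?thesis .
  qed
qed

text \<open>The multiplication table of the standard basis holds for products of any odd elements,
  because only anticommutation and vanishing squares enter.\<close>

lemma wedge_prod_mult:
  assumes "finite A" "finite B" "\<And>k. k \<in> A \<union> B \<Longrightarrow> odd_ext (v k)" "\<And>k. k \<in> A \<union> B \<Longrightarrow> v k \<in> extalg r"
  shows "wedge (wedge_prod v A) (wedge_prod v B) =
    (if A \<inter> B = {} then (\<lambda>T. shuffle_sign A B * wedge_prod v (A \<union> B) T) else 0)"
  using assms(1,3,4)
proof (induction rule: finite_set_min_induct)
  case empty
  then have "wedge_prod v B \<in> extalg r" using assms(2) by (intro wedge_prod_extalg) auto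
  then show ?case using wedge_one_left by simp
next
  case (insert i A)
  have i: "i \<notin> A" using insert.hyps by blast
  have IH: "wedge (wedge_prod v A) (wedge_prod v B) =
    (if A \<inter> B = {} then (\<lambda>T. shuffle_sign A B * wedge_prod v (A \<union> B) T) else 0)"
    using insert.IH insert.prems by auto
  have "wedge (wedge_prod v (insert i A)) (wedge_prod v B) =
     wedge (v i) (wedge (wedge_prod v A) (wedge_prod v B))"
    using insert.hyps by (simp add: wedge_prod_insert wedge_assoc)
  also have "\<dots> = (if insert i A \<inter> B = {} then (\<lambda>T. shuffle_sign (insert i A) B * wedge_prod v (insert i A \<union> B) T) else 0)"
  proof (cases "A \<inter> B = {}")
    case False
    then show ?thesis using IH by auto
  next
    case True
    have *: "wedge (v i) (wedge_prod v (A \<union> B)) =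
      (if i \<in> A \<union> B then 0 else (\<lambda>T. shuffle_sign {i} (A \<union> B) * wedge_prod v (insert i (A \<union> B)) T))"
      using insert.hyps(1) assms(2) insert.prems by (intro wedge_prod_vec_mult) auto
    have iA: "shuffle_sign {i} A = 1"
      using insert.hyps(2) by (intro shuffle_sign_min) (simp add: less_imp_le)
    have s1: "shuffle_sign {i} (A \<union> B) = shuffle_sign {i} B"
      using shuffle_sign_Un_right[of "{i}" A B] insert.hyps(1) assms(2) True iA by simp
    have s2: "shuffle_sign (insert i A) B = shuffle_sign {i} B * shuffle_sign A B"
      using shuffle_sign_Un_left[of "{i}" A B] insert.hyps(1) assms(2) i by simp
    show ?thesis using IH True * s1 s2 i
      by (auto simp: wedge_scale_right mult_ac)
  qed
  finally show ?case .
qed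

text \<open>The algebra homomorphism given by the universal property of the exterior algebra: the
  \<open>k\<close>-th generator goes to \<open>v k\<close>.\<close>

definition ext_hom :: "nat \<Rightarrow> (nat \<Rightarrow> ext) \<Rightarrow> ext \<Rightarrow> ext" where
  "ext_hom r v a = (\<lambda>T. \<Sum>S\<in>Pow {..<r}. a S * wedge_prod v S T)"

lemma ext_hom_eq: "ext_hom r v a = (\<Sum>S\<in>Pow {..<r}. (\<lambda>T. a S * wedge_prod v S T))"
  by (auto simp: ext_hom_def fun_eq_iff sum_fun_apply)

lemma finite_index: "S \<in> Pow {..<r::nat} \<Longrightarrow> finite S"
  using finite_subset by blast

text \<open>Expand both factors bilinearly and use \<open>wedge_prod_mult\<close>: pairs of
  overlapping index sets contribute nothing, and the remaining ones are sorted by their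
  union.\<close>

lemma ext_hom_wedge:
  assumes "\<And>k. k < r \<Longrightarrow> odd_ext (v k)" "\<And>k. k < r \<Longrightarrow> v k \<in> extalg s"
  shows "ext_hom r v (wedge a b) = wedge (ext_hom r v a) (ext_hom r v b)"
proof
  fix T
  let ?P = "Pow {..<r}"
  have *: "wedge (\<lambda>T. a A * wedge_prod v A T) (\<lambda>T. b B * wedge_prod v B T) T =
     (if A \<inter> B = {} then a A * b B * shuffle_sign A B * wedge_prod v (A \<union> B) T else 0)"
    if "A \<in> ?P" "B \<in> ?P" for A B
  proof -
    have "wedge (wedge_prod v A) (wedge_prod v B) =
        (if A \<inter> B = {} then (\<lambda>T. shuffle_sign A B * wedge_prod v (A \<union> B) T) else 0)"
      using that assms by (intro wedge_prod_mult[of _ _ _ s]) (auto intro: finite_index)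
    then show ?thesis by (simp add: wedge_scale_left wedge_scale_right)
  qed
  have "wedge (ext_hom r v a) (ext_hom r v b) T =
     (\<Sum>A\<in>?P. \<Sum>B\<in>?P. wedge (\<lambda>T. a A * wedge_prod v A T) (\<lambda>T. b B * wedge_prod v B T) T)"
    unfolding ext_hom_eq wedge_sum_left wedge_sum_right by (simp add: sum_fun_apply) (rule sum.swap)
  also have "\<dots> = (\<Sum>A\<in>?P. \<Sum>B\<in>?P. if A \<inter> B = {} then a A * b B * shuffle_sign A B * wedge_prod v (A \<union> B) T else 0)"
    by (intro sum.cong refl *)
  also have "\<dots> = (\<Sum>A\<in>?P. \<Sum>B\<in>{B\<in>?P. A \<inter> B = {}}. a A * b B * shuffle_sign A B * wedge_prod v (A \<union> B) T)"
    by (rule sum.cong[OF refl], rule sum.inter_filter[symmetric]) simp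
  also have "\<dots> = (\<Sum>(A, B)\<in>Sigma ?P (\<lambda>A. {B\<in>?P. A \<inter> B = {}}). a A * b B * shuffle_sign A B * wedge_prod v (A \<union> B) T)"
    by (subst sum.Sigma) auto
  also have "\<dots> = (\<Sum>(S, A)\<in>Sigma ?P Pow. shuffle_sign A (S - A) * a A * b (S - A) * wedge_prod v S T)"
  \<comment> \<open>A disjoint pair corresponds to its union together with the first set as a subset
    of it.\<close>
  proof (rule sum.reindex_bij_witness[of _ "\<lambda>(S, A). (A, S - A)" "\<lambda>(A, B). (A \<union> B, A)"])
    fix p assume "p \<in> Sigma ?P (\<lambda>A. {B\<in>?P. A \<inter> B = {}})"
    then obtain A B where p: "p = (A, B)" "A \<inter> B = {}" by auto
    then have "A \<union> B - A = B" by auto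
    with p show "(case case p of (A, B) \<Rightarrow> (A \<union> B, A) of (S, A) \<Rightarrow> shuffle_sign A (S - A) * a A * b (S - A) * wedge_prod v S T) =
      (case p of (A, B) \<Rightarrow> a A * b B * shuffle_sign A B * wedge_prod v (A \<union> B) T)" by simp
  qed auto
  also have "\<dots> = (\<Sum>S\<in>?P. \<Sum>A\<in>Pow S. shuffle_sign A (S - A) * a A * b (S - A) * wedge_prod v S T)"
    by (subst sum.Sigma) (auto intro: finite_index)
  also have "\<dots> = ext_hom r v (wedge a b) T"
    by (simp add: ext_hom_def wedge_eq sum_distrib_right)
  finally show "ext_hom r v (wedge a b) T = wedge (ext_hom r v a) (ext_hom r v b) T" by simp
qed

lemma ext_hom_add: "ext_hom r v (a + b) = ext_hom r v a + ext_hom r v b"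
  by (auto simp: ext_hom_def fun_eq_iff algebra_simps sum.distrib)

lemma ext_hom_scale: "ext_hom r v (\<lambda>S. c * a S) = (\<lambda>S. c * ext_hom r v a S)"
  by (auto simp: ext_hom_def fun_eq_iff sum_distrib_left algebra_simps)

lemma ext_hom_zero [simp]: "ext_hom r v 0 = 0"
  by (auto simp: ext_hom_def fun_eq_iff)

lemma ext_hom_sum: "ext_hom r v (\<Sum>i\<in>I. f i) = (\<Sum>i\<in>I. ext_hom r v (f i))"
  by (induction I rule: infinite_finite_induct) (auto simp: ext_hom_add simp del: zero_fun_apply plus_fun_apply)

lemma ext_hom_const [simp]: "ext_hom r v (ext_const c) = ext_const c"
proof
  fix T
  have "ext_hom r v (ext_const c) T = (\<Sum>S\<in>Pow {..<r}. if S = {} then c * ext_const 1 T else 0)"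
    unfolding ext_hom_def by (rule sum.cong) (auto simp: ext_const_def)
  then show "ext_hom r v (ext_const c) T = ext_const c T"
    by (auto simp: ext_const_def)
qed

lemma ext_hom_extalg: "(\<And>k. k < r \<Longrightarrow> v k \<in> extalg s) \<Longrightarrow> ext_hom r v a \<in> extalg s"
  unfolding ext_hom_eq
  by (intro extalg_sum extalg_scale wedge_prod_extalg) (auto intro: finite_index)

lemma ext_hom_vec:
  assumes "w \<in> Cn r" "\<And>k. k < r \<Longrightarrow> v k \<in> extalg s"
  shows "ext_hom r v (ext_vec w) = (\<lambda>T. \<Sum>k<r. w k * v k T)"
proof
  fix T
  have "ext_hom r v (ext_vec w) T = (\<Sum>S\<in>(\<lambda>k. {k}) ` {..<r}. ext_vec w S * wedge_prod v S T)"
    unfolding ext_hom_def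
    by (rule sum.mono_neutral_right) (auto simp: ext_vec_def card_1_singleton_iff)
  also have "\<dots> = (\<Sum>k<r. w k * wedge_prod v {k} T)"
    by (subst sum.reindex) (auto simp: ext_vec_def inj_on_def)
  also have "\<dots> = (\<Sum>k<r. w k * v k T)"
    using wedge_prod_insert[of "{}" _ v] assms(2) wedge_one_right[of "v _" s]
    by (intro sum.cong refl) simp
  finally show "ext_hom r v (ext_vec w) T = (\<Sum>k<r. w k * v k T)" .
qed

lemma ext_hom_wedge_prod:
  assumes "\<And>k. k < r \<Longrightarrow> odd_ext (v k)" "\<And>k. k < r \<Longrightarrow> v k \<in> extalg s" "finite S"
  shows "ext_hom r v (wedge_prod w S) = wedge_prod (\<lambda>k. ext_hom r v (w k)) S"
  using assms(3)
  by (induction rule: finite_set_min_induct) (auto simp: wedge_prod_insert ext_hom_wedge[OF assms(1,2)])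

lemma ext_hom_comp:
  assumes "\<And>k. k < r \<Longrightarrow> odd_ext (v k)" "\<And>k. k < r \<Longrightarrow> v k \<in> extalg s"
  shows "ext_hom r v (ext_hom q w a) = ext_hom q (\<lambda>k. ext_hom r v (w k)) a"
proof -
  have "ext_hom r v (ext_hom q w a) = (\<Sum>S\<in>Pow {..<q}. ext_hom r v (\<lambda>T. a S * wedge_prod w S T))"
    by (simp add: ext_hom_eq[of q] ext_hom_sum)
  also have "\<dots> = (\<Sum>S\<in>Pow {..<q}. (\<lambda>T. a S * wedge_prod (\<lambda>k. ext_hom r v (w k)) S T))"
    using ext_hom_wedge_prod[OF assms finite_index]
    by (intro sum.cong refl) (simp add: ext_hom_scale)
  finally show ?thesis by (simp add: ext_hom_eq)
qed

abbreviation unit_vec :: "nat \<Rightarrow> nat \<Rightarrow> complex" where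
  "unit_vec k \<equiv> (\<lambda>i. if i = k then 1 else 0)"

lemma odd_ext_vec: "odd_ext (ext_vec w)"
  by (auto simp: odd_ext_def ext_vec_def)

text \<open>Products of unit vectors are the basis elements, so \<open>ext_hom\<close> along the
  unit vectors is the identity.\<close>

lemma wedge_prod_unit:
  assumes "finite S"
  shows "wedge_prod (\<lambda>k. ext_vec (unit_vec k)) S = (\<lambda>T. if T = S then 1 else 0)"
  using assms
proof (induction rule: finite_set_min_induct)
  case empty
  then show ?case by (auto simp: ext_const_def)
next
  case (insert i S)
  have i: "i \<notin> S" using insert.hyps by blast
  have "wedge (ext_vec (unit_vec i)) (\<lambda>T. if T = S then 1 else 0) T = (if T = insert i S then 1 else 0)" for T
  proof (cases "finite T")
    case True
    have "wedge (ext_vec (unit_vec i)) (\<lambda>T. if T = S then 1 else 0) T =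
      (\<Sum>R\<in>Pow T. if R = {i} then (if T = insert i S then 1 else 0) else 0)"
      unfolding wedge_eq
    proof (rule sum.cong[OF refl])
      fix R assume R: "R \<in> Pow T"
      have v: "ext_vec (unit_vec i) R = (if R = {i} then 1 else 0)"
        by (auto simp: ext_vec_def card_1_singleton_iff)
      have "shuffle_sign {i} S = 1"
        using insert.hyps(2) by (intro shuffle_sign_min) (simp add: less_imp_le)
      moreover have "T - {i} = S \<longleftrightarrow> T = insert i S" if "i \<in> T" using that i by auto
      ultimately show "shuffle_sign R (T - R) * ext_vec (unit_vec i) R * (if T - R = S then 1 else 0) =
         (if R = {i} then if T = insert i S then 1 else 0 else 0)"
        using v R by auto
    qed
    also have "\<dots> = (if T = insert i S then 1 else 0)"
      using True by (subst sum.delta) auto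
    finally show ?thesis .
  next
    case False
    then show ?thesis using insert.hyps(1) by (auto simp: wedge_infinite)
  qed
  then show ?case using insert.hyps insert.IH by (simp add: wedge_prod_insert)
qed

lemma ext_hom_unit: "a \<in> extalg r \<Longrightarrow> ext_hom r (\<lambda>k. ext_vec (unit_vec k)) a = a"
proof
  fix T assume a: "a \<in> extalg r"
  have "ext_hom r (\<lambda>k. ext_vec (unit_vec k)) a T = (\<Sum>S\<in>Pow {..<r}. if T = S then a S else 0)"
    unfolding ext_hom_def by (rule sum.cong) (auto simp: wedge_prod_unit finite_index)
  also have "\<dots> = a T" using a by (auto simp: sum.delta' extalg_def)
  finally show "ext_hom r (\<lambda>k. ext_vec (unit_vec k)) a T = a T" .
qed

lemma ext_hom_cong: "(\<And>k. k < r \<Longrightarrow> v k = w k) \<Longrightarrow> (\<And>S. S \<subseteq> {..<r} \<Longrightarrow> a S = b S) \<Longrightarrow> ext_hom r v a = ext_hom r w b"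
  unfolding ext_hom_eq
  by (intro sum.cong refl ext arg_cong2[of _ _ _ _ times] fun_cong[OF wedge_prod_cong])
    (auto intro: finite_index)

text \<open>Supplies bases and dimension counts, for frames here and for the separating functional
  at the end.\<close>

interpretation fun_vs: vector_space "\<lambda>(c::complex) (v::nat \<Rightarrow> complex) i. c * v i"
  by unfold_locales (auto simp: algebra_simps fun_eq_iff)

lemma lin_indepD: "lin_indep r v \<Longrightarrow> (\<And>i. (\<Sum>k<r. c k * v k i) = 0) \<Longrightarrow> k < r \<Longrightarrow> c k = 0"
  unfolding lin_indep_def by blast

text \<open>The inverse of the matrix with rows \<open>e k\<close>. Independence of \<open>r\<close>
  vectors in \<open>\<complex>^r\<close> makes them span, which gives a left inverse; independence
  once more makes it a right inverse.\<close>

lemma lin_indep_dual: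
  assumes e: "\<And>k. k < r \<Longrightarrow> e k \<in> Cn r" and li: "lin_indep r e"
  obtains m where "\<And>i. i < r \<Longrightarrow> m i \<in> Cn r" "\<And>i j. i < r \<Longrightarrow> (\<Sum>k<r. m i k * e k j) = unit_vec i j"
    "\<And>k l. k < r \<Longrightarrow> (\<Sum>i<r. e k i * m i l) = unit_vec k l"
proof -
  let ?s = "\<lambda>(c::complex) (v::nat \<Rightarrow> complex) i. c * v i"
  let ?E = "e ` {..<r}" let ?B = "unit_vec ` {..<r}"
  have inj: "inj_on e {..<r}"
  proof (rule inj_onI, rule ccontr)
    fix a b assume ab: "a \<in> {..<r}" "b \<in> {..<r}" "e a = e b" "a \<noteq> b"
    let ?c = "\<lambda>k. if k = a then 1 else if k = b then -1 else (0::complex)"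
    have "(\<Sum>k<r. ?c k * e k i) = 0" for i
    proof -
      have "(\<Sum>k<r. ?c k * e k i) = (\<Sum>k\<in>{a, b}. ?c k * e k i)"
        using ab by (intro sum.mono_neutral_right) auto
      then show ?thesis using ab by simp
    qed
    from lin_indepD[OF li this, of a] ab(1) show False by simp
  qed
  have ind: "fun_vs.independent ?E"
  proof (rule fun_vs.independent_if_scalars_zero)
    fix f x assume s: "(\<Sum>x\<in>?E. (\<lambda>i. f x * x i)) = 0" and x: "x \<in> ?E"
    have "(\<Sum>k<r. f (e k) * e k i) = 0" for i
      using fun_cong[OF s, of i] by (simp add: sum.reindex[OF inj] sum_fun_apply)
    from lin_indepD[OF li this] show "f x = 0" using x by auto
  qed simp
  have CB: "w \<in> fun_vs.span ?B" if "w \<in> Cn r" for w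
  proof -
    have "w = (\<Sum>k<r. ?s (w k) (unit_vec k))"
      using that by (auto simp: fun_eq_iff sum_fun_apply Cn_def if_distrib cong: if_cong)
    moreover have "(\<Sum>k<r. ?s (w k) (unit_vec k)) \<in> fun_vs.span ?B"
      by (intro fun_vs.span_sum fun_vs.span_scale fun_vs.span_base) auto
    ultimately show ?thesis by simp
  qed
  have ES: "?E \<subseteq> fun_vs.span ?B" using CB e by auto
  have "\<exists>m. m \<in> Cn r \<and> (\<forall>j. (\<Sum>k<r. m k * e k j) = unit_vec i j)" if i: "i < r" for i
  proof -
    have "unit_vec i \<in> fun_vs.span ?E"
    proof (rule ccontr)
      \<comment> \<open>Otherwise \<open>r + 1\<close> independent vectors would lie in the span of
        \<open>r\<close> unit vectors.\<close>
      assume n: "unit_vec i \<notin> fun_vs.span ?E"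
      then have ni: "unit_vec i \<notin> ?E" using fun_vs.span_base[of "unit_vec i" ?E] by (rule contrapos_nn)
      have "fun_vs.independent (insert (unit_vec i) ?E)" using n ind by (rule fun_vs.independent_insertI)
      moreover have "insert (unit_vec i) ?E \<subseteq> fun_vs.span ?B" using ES fun_vs.span_base[of "unit_vec i" ?B] i by simp
      ultimately have "card (insert (unit_vec i) ?E) \<le> card ?B"
        using fun_vs.independent_span_bound[of ?B] by blast
      also have "\<dots> \<le> r" using card_image_le[of "{..<r}" unit_vec] by simp
      finally show False using ni card_image[OF inj] by simp
    qed
    then have "unit_vec i \<in> range (\<lambda>u. \<Sum>v\<in>?E. ?s (u v) v)"
      by (simp only: fun_vs.span_finite[OF finite_imageI[OF finite_lessThan]])
    then obtain u where u: "unit_vec i = (\<Sum>v\<in>?E. ?s (u v) v)" by (rule rangeE)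
    have "(\<Sum>k<r. (if k < r then u (e k) else 0) * e k j) = unit_vec i j" for j
      using fun_cong[OF u, of j] by (simp add: sum.reindex[OF inj] sum_fun_apply)
    then show ?thesis by (intro exI[of _ "\<lambda>k. if k < r then u (e k) else 0"]) (simp add: Cn_def)
  qed
  then obtain m where m: "\<And>i. i < r \<Longrightarrow> m i \<in> Cn r" "\<And>i j. i < r \<Longrightarrow> (\<Sum>k<r. m i k * e k j) = unit_vec i j"
    by metis
  have "(\<Sum>i<r. e k i * m i l) = unit_vec k l" if k: "k < r" for k l
  proof (cases "l < r")
    case True
    \<comment> \<open>A row of the product \<open>e m\<close> minus the identity; it is the
      coefficient vector of a linear relation among the \<open>e l\<close>, hence zero.\<close>
    let ?c = "\<lambda>l. (\<Sum>i<r. e k i * m i l) - unit_vec k l"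
    have "(\<Sum>l<r. ?c l * e l j) = 0" for j
    proof -
      have "(\<Sum>l<r. (\<Sum>i<r. e k i * m i l) * e l j) = (\<Sum>i<r. e k i * (\<Sum>l<r. m i l * e l j))"
        unfolding sum_distrib_left sum_distrib_right by (subst sum.swap) (simp add: mult.assoc)
      also have "\<dots> = (\<Sum>i<r. e k i * unit_vec i j)" using m(2) by simp
      also have "\<dots> = e k j" using e[OF k] by (auto simp: Cn_def if_distrib cong: if_cong)
      finally show ?thesis using k by (simp add: left_diff_distrib sum_subtractf if_distrib[of "\<lambda>x. x * _"] cong: if_cong)
    qed
    from lin_indepD[OF li this True] show ?thesis by simp
  next
    case False
    then show ?thesis using m(1) k by (auto simp: Cn_def)
  qed
  with m that show ?thesis by blast
qed

section \<open>The exterior algebra expressed in a frame\<close>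

definition frame_hom :: "nat \<Rightarrow> (nat \<Rightarrow> nat \<Rightarrow> complex) \<Rightarrow> ext \<Rightarrow> ext" where
  "frame_hom r e = ext_hom r (\<lambda>k. ext_vec (e k))"

text \<open>The inverse is taken on \<open>extalg r\<close>: off this set \<open>frame_hom\<close>
  is not injective, as it ignores coefficients at sets not contained in
  \<open>{..<r}\<close>.\<close>

definition frame_coeff :: "nat \<Rightarrow> (nat \<Rightarrow> nat \<Rightarrow> complex) \<Rightarrow> ext \<Rightarrow> ext" where
  "frame_coeff r e = inv_into (extalg r) (frame_hom r e)"

lemma ext_vec_sum:
  assumes "w \<in> Cn r" "\<And>k. k < r \<Longrightarrow> e k \<in> Cn s"
  shows "frame_hom r e (ext_vec w) = ext_vec (\<lambda>i. \<Sum>k<r. w k * e k i)"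
  unfolding frame_hom_def
  using ext_hom_vec[OF assms(1), of "\<lambda>k. ext_vec (e k)" s] assms(2) extalg_vec
  by (auto simp: ext_vec_def fun_eq_iff)

lemma frame_hom_bij:
  assumes e: "\<And>k. k < r \<Longrightarrow> e k \<in> Cn r" and li: "lin_indep r e"
  shows "bij_betw (frame_hom r e) (extalg r) (extalg r)"
proof -
  from lin_indep_dual[OF assms] obtain m where m: "\<And>i. i < r \<Longrightarrow> m i \<in> Cn r"
    "\<And>i j. i < r \<Longrightarrow> (\<Sum>k<r. m i k * e k j) = unit_vec i j"
    "\<And>k l. k < r \<Longrightarrow> (\<Sum>i<r. e k i * m i l) = unit_vec k l" by blast
  have inv: "frame_hom r f (frame_hom r g a) = a"
    if "\<And>k. k < r \<Longrightarrow> f k \<in> Cn r" "\<And>k. k < r \<Longrightarrow> g k \<in> Cn r"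
      "\<And>i j. i < r \<Longrightarrow> (\<Sum>k<r. g i k * f k j) = unit_vec i j" "a \<in> extalg r" for f g a
  proof -
    have "frame_hom r f (frame_hom r g a) = ext_hom r (\<lambda>k. frame_hom r f (ext_vec (g k))) a"
      unfolding frame_hom_def using that(1) extalg_vec odd_ext_vec by (intro ext_hom_comp) auto
    also have "\<dots> = ext_hom r (\<lambda>k. ext_vec (unit_vec k)) a"
      using that(3) ext_vec_sum[OF that(2) that(1)] by (intro ext_hom_cong) simp_all
    finally show ?thesis using ext_hom_unit that(4) by simp
  qed
  have ex: "frame_hom r f a \<in> extalg r" if "\<And>k. k < r \<Longrightarrow> f k \<in> Cn r" for f a
    unfolding frame_hom_def using that extalg_vec by (intro ext_hom_extalg) auto
  show ?thesis
    by (rule bij_betw_byWitness[where f' = "frame_hom r m"])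
      (use inv[OF e m(1) m(2)] inv[OF m(1) e m(3)] ex e m(1) in auto)
qed

lemma frame_coeff:
  assumes "\<And>k. k < r \<Longrightarrow> e k \<in> Cn r" "lin_indep r e"
  shows "a \<in> extalg r \<Longrightarrow> frame_coeff r e a \<in> extalg r"
    "a \<in> extalg r \<Longrightarrow> frame_hom r e (frame_coeff r e a) = a"
    "c \<in> extalg r \<Longrightarrow> frame_coeff r e (frame_hom r e c) = c"
  unfolding frame_coeff_def
  using bij_betw_apply[OF bij_betw_inv_into[OF frame_hom_bij[OF assms]]]
    bij_betw_inv_into_right[OF frame_hom_bij[OF assms]] bij_betw_inv_into_left[OF frame_hom_bij[OF assms]]
  by blast+

lemma frame_hom_linear:
  "frame_hom r e (a + b) = frame_hom r e a + frame_hom r e b"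
  "frame_hom r e (\<lambda>S. c * a S) = (\<lambda>S. c * frame_hom r e a S)"
  "frame_hom r e 0 = 0" "frame_hom r e (ext_const c) = ext_const c"
  by (simp_all add: frame_hom_def ext_hom_add ext_hom_scale)

lemma frame_hom_wedge:
  assumes "\<And>k. k < r \<Longrightarrow> e k \<in> Cn r"
  shows "frame_hom r e (wedge a b) = wedge (frame_hom r e a) (frame_hom r e b)"
  unfolding frame_hom_def using assms extalg_vec odd_ext_vec by (intro ext_hom_wedge) auto

lemma frame_hom_extalg: "(\<And>k. k < r \<Longrightarrow> e k \<in> Cn r) \<Longrightarrow> frame_hom r e a \<in> extalg r"
  unfolding frame_hom_def using extalg_vec by (intro ext_hom_extalg) auto

lemma wedge_prod_vec_card:
  assumes "finite S" "wedge_prod (\<lambda>k. ext_vec (v k)) S T \<noteq> 0"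
  shows "card T = card S"
  using assms
proof (induction arbitrary: T rule: finite_set_min_induct)
  case empty
  then show ?case by (auto simp: ext_const_def split: if_splits)
next
  case (insert i S)
  have "wedge (ext_vec (v i)) (wedge_prod (\<lambda>k. ext_vec (v k)) S) T \<noteq> 0"
    using insert.prems insert.hyps by (simp add: wedge_prod_insert)
  then obtain R where R: "finite T" "R \<subseteq> T" "ext_vec (v i) R \<noteq> 0" "wedge_prod (\<lambda>k. ext_vec (v k)) S (T - R) \<noteq> 0"
     "card T = card R + card (T - R)"
    by (rule wedge_nonzero)
  have "card R = 1" using R(3) by (auto simp: ext_vec_def split: if_splits)
  moreover have "card (T - R) = card S" using insert.IH[OF R(4)] .
  moreover have "i \<notin> S" using insert.hyps by blast
  ultimately show ?case using R(5) insert.hyps(1) by auto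
qed

lemma frame_hom_card:
  assumes "frame_hom r e a T \<noteq> 0"
  obtains S where "S \<subseteq> {..<r}" "card S = card T" "a S \<noteq> 0"
proof -
  have "\<exists>S\<in>Pow {..<r}. a S * wedge_prod (\<lambda>k. ext_vec (e k)) S T \<noteq> 0"
    using assms unfolding frame_hom_def ext_hom_def by (rule contrapos_np) (auto intro!: sum.neutral)
  then obtain S where S: "S \<in> Pow {..<r}" "a S * wedge_prod (\<lambda>k. ext_vec (e k)) S T \<noteq> 0" by (rule bexE)
  then have "wedge_prod (\<lambda>k. ext_vec (e k)) S T \<noteq> 0" "a S \<noteq> 0" "S \<subseteq> {..<r}" by simp_all
  then show ?thesis using that[of S] wedge_prod_vec_card[OF finite_index[OF S(1)]] by force
qed

text \<open>The inverse of a frame homomorphism is the frame homomorphism of the inverse matrix, so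
  linearity, multiplicativity and preservation of degree carry over to coefficients.\<close>

lemma frame_coeff_hom:
  assumes e: "\<And>k. k < r \<Longrightarrow> e k \<in> Cn r" and li: "lin_indep r e"
  obtains m where "\<And>k. k < r \<Longrightarrow> m k \<in> Cn r" "\<And>a. a \<in> extalg r \<Longrightarrow> frame_coeff r e a = frame_hom r m a"
proof -
  from lin_indep_dual[OF assms] obtain m where m: "\<And>i. i < r \<Longrightarrow> m i \<in> Cn r"
    "\<And>i j. i < r \<Longrightarrow> (\<Sum>k<r. m i k * e k j) = unit_vec i j"
    "\<And>k l. k < r \<Longrightarrow> (\<Sum>i<r. e k i * m i l) = unit_vec k l" by blast
  have "frame_hom r e (frame_hom r m a) = a" if "a \<in> extalg r" for a
  proof -
    have "frame_hom r e (frame_hom r m a) = ext_hom r (\<lambda>k. frame_hom r e (ext_vec (m k))) a"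
      unfolding frame_hom_def using e extalg_vec odd_ext_vec by (intro ext_hom_comp) auto
    also have "\<dots> = ext_hom r (\<lambda>k. ext_vec (unit_vec k)) a"
      using m ext_vec_sum[OF m(1) e] by (intro ext_hom_cong) simp_all
    finally show ?thesis using ext_hom_unit that by simp
  qed
  moreover have "frame_coeff r e (frame_hom r e (frame_hom r m a)) = frame_hom r m a" for a
    by (rule frame_coeff(3)[OF assms frame_hom_extalg[OF m(1)]])
  ultimately have "frame_coeff r e a = frame_hom r m a" if "a \<in> extalg r" for a
    using that by metis
  with m(1) that show ?thesis by blast
qed

lemma frame_coeff_linear:
  assumes "\<And>k. k < r \<Longrightarrow> e k \<in> Cn r" "lin_indep r e" "a \<in> extalg r" "b \<in> extalg r"
  shows "frame_coeff r e (a + b) = frame_coeff r e a + frame_coeff r e b"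
    "frame_coeff r e (\<lambda>S. c * a S) = (\<lambda>S. c * frame_coeff r e a S)"
    "frame_coeff r e (wedge a b) = wedge (frame_coeff r e a) (frame_coeff r e b)"
proof -
  obtain m where m: "\<And>k. k < r \<Longrightarrow> m k \<in> Cn r" "\<And>a. a \<in> extalg r \<Longrightarrow> frame_coeff r e a = frame_hom r m a"
    using frame_coeff_hom[OF assms(1,2)] by blast
  show "frame_coeff r e (a + b) = frame_coeff r e a + frame_coeff r e b"
    "frame_coeff r e (\<lambda>S. c * a S) = (\<lambda>S. c * frame_coeff r e a S)"
    "frame_coeff r e (wedge a b) = wedge (frame_coeff r e a) (frame_coeff r e b)"
    using assms(3,4) by (simp_all only: m(2) extalg_add extalg_scale extalg_wedge frame_hom_linear frame_hom_wedge[OF m(1)])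
qed

lemma frame_coeff_const:
  assumes "\<And>k. k < r \<Longrightarrow> e k \<in> Cn r" "lin_indep r e"
  shows "frame_coeff r e (ext_const c) = ext_const c" "frame_coeff r e 0 = 0"
proof -
  obtain m where m: "\<And>k. k < r \<Longrightarrow> m k \<in> Cn r" "\<And>a. a \<in> extalg r \<Longrightarrow> frame_coeff r e a = frame_hom r m a"
    using frame_coeff_hom[OF assms(1,2)] by blast
  show "frame_coeff r e (ext_const c) = ext_const c" "frame_coeff r e 0 = 0"
    by (simp_all only: m(2) extalg_const extalg_zero frame_hom_linear)
qed

lemma frame_coeff_card:
  assumes "\<And>k. k < r \<Longrightarrow> e k \<in> Cn r" "lin_indep r e" "a \<in> extalg r" "frame_coeff r e a T \<noteq> 0"
  obtains S where "S \<subseteq> {..<r}" "card S = card T" "a S \<noteq> 0"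
proof -
  obtain m where m: "\<And>k. k < r \<Longrightarrow> m k \<in> Cn r" "\<And>a. a \<in> extalg r \<Longrightarrow> frame_coeff r e a = frame_hom r m a"
    using frame_coeff_hom[OF assms(1,2)] by blast
  have "frame_hom r m a T \<noteq> 0" using assms(3,4) m(2) by simp
  then show ?thesis by (rule frame_hom_card) (rule that)
qed

text \<open>Telescoping: the factors are exchanged one at a time, and each resulting term contains
  one difference of degree at least \<open>j\<close>.\<close>

lemma degree_ge_wedge_prod_diff:
  assumes "finite S" "\<And>k. k \<in> S \<Longrightarrow> degree_ge 1 (v k)" "\<And>k. k \<in> S \<Longrightarrow> degree_ge j (u k - v k)"
  shows "degree_ge j (wedge_prod u S - wedge_prod v S)"
  using assms
proof (induction rule: finite_set_min_induct)
  case (insert i S)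
  have "wedge_prod u (insert i S) - wedge_prod v (insert i S) =
    wedge (u i - v i) (wedge_prod u S) + wedge (v i) (wedge_prod u S - wedge_prod v S)"
    using insert.hyps by (simp add: wedge_prod_insert wedge_diff_left wedge_diff_right)
  moreover have "degree_ge (j + 0) (wedge (u i - v i) (wedge_prod u S))"
    by (intro degree_ge_wedge insert.prems degree_ge_zero) simp
  moreover have "degree_ge (0 + j) (wedge (v i) (wedge_prod u S - wedge_prod v S))"
    by (intro degree_ge_wedge insert.IH insert.prems degree_ge_zero) simp_all
  ultimately show ?case by (simp only: degree_ge_add add_0 add_0_right)
qed simp


section \<open>Sections of bundles and of the exterior algebra\<close>

locale model =
  fixes M :: "'x::{t2_space,second_countable_topology} cmfd" and E :: "'x vbundle"
  assumes M: "complex_manifold M" and E: "holo_vbundle M E"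
begin

abbreviation "r \<equiv> brank E"

lemma osecD: "f \<in> osec M W \<Longrightarrow> holo_fun M W f" "f \<in> osec M W \<Longrightarrow> x \<notin> W \<Longrightarrow> f x = 0"
  by (auto simp: osec_def)

lemma osec_rsec: "open W \<Longrightarrow> holo_fun M W f \<Longrightarrow> rsec W f \<in> osec M W"
  using holo_fun_cong[OF M, of W f "rsec W f"] by (auto simp: osec_def rsec_def)

lemma frame_props:
  assumes "(U, e) \<in> frames E"
  shows "open U" "x \<in> U \<Longrightarrow> lin_indep r (\<lambda>k. e k x)" "x \<in> U \<Longrightarrow> k < r \<Longrightarrow> e k x \<in> Cn r"
    "k < r \<Longrightarrow> rsec U (e k) \<in> vsec M E U"
proof -
  have *: "open U \<and> (\<forall>x\<in>U. lin_indep r (\<lambda>k. e k x)) \<and> (\<forall>k<r. rsec U (e k) \<in> vsec M E U)"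
    using E assms unfolding holo_vbundle_def by blast
  then show "open U" "x \<in> U \<Longrightarrow> lin_indep r (\<lambda>k. e k x)" "k < r \<Longrightarrow> rsec U (e k) \<in> vsec M E U"
    by blast+
  assume "x \<in> U" "k < r"
  then have "rsec U (e k) x \<in> Cn r" using * unfolding vsec_def by blast
  then show "e k x \<in> Cn r" using \<open>x \<in> U\<close> by (simp add: rsec_def)
qed

lemma frame_covers:
  obtains U e where "(U, e) \<in> frames E" "x \<in> U"
proof -
  have "x \<in> (\<Union>(fst ` frames E))" using E unfolding holo_vbundle_def by auto
  then show ?thesis using that by force
qed

lemma frame_coeff_at:
  assumes "(U, e) \<in> frames E" "x \<in> U"
  shows "a \<in> extalg r \<Longrightarrow> frame_coeff r (\<lambda>k. e k x) a \<in> extalg r"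
    "a \<in> extalg r \<Longrightarrow> frame_hom r (\<lambda>k. e k x) (frame_coeff r (\<lambda>k. e k x) a) = a"
    "c \<in> extalg r \<Longrightarrow> frame_coeff r (\<lambda>k. e k x) (frame_hom r (\<lambda>k. e k x) c) = c"
    "a \<in> extalg r \<Longrightarrow> b \<in> extalg r \<Longrightarrow>
      frame_coeff r (\<lambda>k. e k x) (a + b) = frame_coeff r (\<lambda>k. e k x) a + frame_coeff r (\<lambda>k. e k x) b"
    "a \<in> extalg r \<Longrightarrow>
      frame_coeff r (\<lambda>k. e k x) (\<lambda>S. y * a S) = (\<lambda>S. y * frame_coeff r (\<lambda>k. e k x) a S)"
    "a \<in> extalg r \<Longrightarrow> b \<in> extalg r \<Longrightarrow> frame_coeff r (\<lambda>k. e k x) (wedge a b) =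
      wedge (frame_coeff r (\<lambda>k. e k x) a) (frame_coeff r (\<lambda>k. e k x) b)"
    "frame_coeff r (\<lambda>k. e k x) (ext_const y) = ext_const y"
    "frame_coeff r (\<lambda>k. e k x) 0 = 0"
    "a \<in> extalg r \<Longrightarrow> frame_coeff r (\<lambda>k. e k x) a T \<noteq> 0 \<Longrightarrow>
      \<exists>S. S \<subseteq> {..<r} \<and> card S = card T \<and> a S \<noteq> 0"
proof -
  note p = frame_props(3)[OF assms] frame_props(2)[OF assms]
  show "a \<in> extalg r \<Longrightarrow> frame_coeff r (\<lambda>k. e k x) a \<in> extalg r"
    "a \<in> extalg r \<Longrightarrow> frame_hom r (\<lambda>k. e k x) (frame_coeff r (\<lambda>k. e k x) a) = a"
    "c \<in> extalg r \<Longrightarrow> frame_coeff r (\<lambda>k. e k x) (frame_hom r (\<lambda>k. e k x) c) = c"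
    using frame_coeff[OF p] by blast+
  show "a \<in> extalg r \<Longrightarrow> b \<in> extalg r \<Longrightarrow>
      frame_coeff r (\<lambda>k. e k x) (a + b) = frame_coeff r (\<lambda>k. e k x) a + frame_coeff r (\<lambda>k. e k x) b"
    by (rule frame_coeff_linear(1)[OF p])
  show "a \<in> extalg r \<Longrightarrow>
      frame_coeff r (\<lambda>k. e k x) (\<lambda>S. y * a S) = (\<lambda>S. y * frame_coeff r (\<lambda>k. e k x) a S)"
    by (rule frame_coeff_linear(2)[OF p, of a 0]) simp_all
  show "a \<in> extalg r \<Longrightarrow> b \<in> extalg r \<Longrightarrow> frame_coeff r (\<lambda>k. e k x) (wedge a b) =
      wedge (frame_coeff r (\<lambda>k. e k x) a) (frame_coeff r (\<lambda>k. e k x) b)"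
    by (rule frame_coeff_linear(3)[OF p])
  show "frame_coeff r (\<lambda>k. e k x) (ext_const y) = ext_const y"
    by (rule frame_coeff_const(1)[OF p])
  show "frame_coeff r (\<lambda>k. e k x) 0 = 0"
    by (rule frame_coeff_const(2)[OF p])
  show "\<exists>S. S \<subseteq> {..<r} \<and> card S = card T \<and> a S \<noteq> 0"
    if "a \<in> extalg r" "frame_coeff r (\<lambda>k. e k x) a T \<noteq> 0"
    by (rule frame_coeff_card[OF p that]) auto
qed

text \<open>Coefficients in a frame are unique, so the existential in \<open>esec\<close> can be
  replaced by the coordinates \<open>frame_coeff\<close>. Closure under the algebra operations then
  becomes a pointwise computation.\<close>

lemma esec_iff:
  assumes W: "open W"
  shows "s \<in> esec M E W \<longleftrightarrow> (\<forall>x. s x \<in> extalg r) \<and> (\<forall>x. x \<notin> W \<longrightarrow> s x = 0) \<and>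
    (\<forall>(U, e)\<in>frames E. \<forall>S. holo_fun M (U \<inter> W) (\<lambda>x. frame_coeff r (\<lambda>k. e k x) (s x) S))"
proof -
  have eq: "(\<exists>c. (\<forall>S\<in>Pow {..<r}. holo_fun M (U \<inter> W) (c S)) \<and>
        (\<forall>x\<in>U \<inter> W. s x = (\<lambda>T. \<Sum>S\<in>Pow {..<r}. c S x * wedge_family (\<lambda>k. e k x) S T))) \<longleftrightarrow>
      (\<forall>S. holo_fun M (U \<inter> W) (\<lambda>x. frame_coeff r (\<lambda>k. e k x) (s x) S))"
    if U: "(U, e) \<in> frames E" and s: "\<forall>x. s x \<in> extalg r" for U e
  proof
    assume "\<exists>c. (\<forall>S\<in>Pow {..<r}. holo_fun M (U \<inter> W) (c S)) \<and>
        (\<forall>x\<in>U \<inter> W. s x = (\<lambda>T. \<Sum>S\<in>Pow {..<r}. c S x * wedge_family (\<lambda>k. e k x) S T))"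
    then obtain c where c: "\<And>S. S \<subseteq> {..<r} \<Longrightarrow> holo_fun M (U \<inter> W) (c S)"
      "\<And>x. x \<in> U \<inter> W \<Longrightarrow> s x = (\<lambda>T. \<Sum>S\<in>Pow {..<r}. c S x * wedge_family (\<lambda>k. e k x) S T)" by auto
    show "\<forall>S. holo_fun M (U \<inter> W) (\<lambda>x. frame_coeff r (\<lambda>k. e k x) (s x) S)"
    proof
      fix S
      \<comment> \<open>The given \<open>c\<close> is arbitrary at sets outside
        \<open>{..<r}\<close>; cut off, it lies in \<open>extalg r\<close>, where
        \<open>frame_coeff\<close> inverts \<open>frame_hom\<close>.\<close>
      define c' where "c' x = (\<lambda>S. if S \<subseteq> {..<r} then c S x else 0)" for x
      have c'x: "c' x \<in> extalg r" for x by (simp add: c'_def extalg_def)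
      have "s x = frame_hom r (\<lambda>k. e k x) (c' x)" if "x \<in> U \<inter> W" for x
        unfolding c(2)[OF that] frame_hom_def ext_hom_def wedge_family_eq c'_def
        by (intro ext sum.cong) auto
      then have fc: "c' x = frame_coeff r (\<lambda>k. e k x) (s x)" if "x \<in> U \<inter> W" for x
        using that frame_coeff_at(3)[OF U _ c'x] by simp
      have hc: "holo_fun M (U \<inter> W) (\<lambda>x. c' x S)"
        using c(1)[of S] holo_fun_const by (cases "S \<subseteq> {..<r}") (auto simp: c'_def)
      show "holo_fun M (U \<inter> W) (\<lambda>x. frame_coeff r (\<lambda>k. e k x) (s x) S)"
        by (rule holo_fun_cong[OF M _ _ hc]) (use frame_props(1)[OF U] W fc in auto)
    qed
  next
    assume *: "\<forall>S. holo_fun M (U \<inter> W) (\<lambda>x. frame_coeff r (\<lambda>k. e k x) (s x) S)"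
    have "s x = (\<lambda>T. \<Sum>S\<in>Pow {..<r}. frame_coeff r (\<lambda>k. e k x) (s x) S * wedge_family (\<lambda>k. e k x) S T)"
      if "x \<in> U \<inter> W" for x
      using frame_coeff_at(2)[OF U, of x "s x"] s that
      by (simp add: frame_hom_def ext_hom_def wedge_family_eq)
    with * show "\<exists>c. (\<forall>S\<in>Pow {..<r}. holo_fun M (U \<inter> W) (c S)) \<and>
        (\<forall>x\<in>U \<inter> W. s x = (\<lambda>T. \<Sum>S\<in>Pow {..<r}. c S x * wedge_family (\<lambda>k. e k x) S T))"
      by (intro exI[of _ "\<lambda>S x. frame_coeff r (\<lambda>k. e k x) (s x) S"]) auto
  qed
  have 1: "(\<forall>x S. \<not> S \<subseteq> {..<r} \<longrightarrow> s x S = 0) \<longleftrightarrow> (\<forall>x. s x \<in> extalg r)"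
    by (auto simp: extalg_def)
  show ?thesis
    unfolding esec_def mem_Collect_eq 1
    by (intro conj_cong refl ball_cong) (simp only: case_prod_beta, rule eq, simp_all)
qed

lemma esecD:
  assumes "s \<in> esec M E W"
  shows "s x \<in> extalg r" "x \<notin> W \<Longrightarrow> s x = 0"
  using assms unfolding esec_def extalg_def by auto

lemma esec_coeff:
  assumes "open W" "s \<in> esec M E W" "(U, e) \<in> frames E"
  shows "holo_fun M (U \<inter> W) (\<lambda>x. frame_coeff r (\<lambda>k. e k x) (s x) S)"
  using esec_iff[OF assms(1), of s] assms(2,3) by auto

lemma esecI:
  assumes "open W" "\<And>x. s x \<in> extalg r" "\<And>x. x \<notin> W \<Longrightarrow> s x = 0"
    "\<And>U e S. (U, e) \<in> frames E \<Longrightarrow> holo_fun M (U \<inter> W) (\<lambda>x. frame_coeff r (\<lambda>k. e k x) (s x) S)"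
  shows "s \<in> esec M E W"
  using esec_iff[OF assms(1), of s] assms(2-) by auto

text \<open>A formula for the coefficients is asked for over \<open>U \<inter> W\<close> only:
  outside \<open>U\<close> the frame need not be independent.\<close>

lemma esecI':
  assumes "open W" "\<And>x. s x \<in> extalg r" "\<And>x. x \<notin> W \<Longrightarrow> s x = 0"
    "\<And>U e S x. (U, e) \<in> frames E \<Longrightarrow> x \<in> U \<inter> W \<Longrightarrow> frame_coeff r (\<lambda>k. e k x) (s x) S = c U e S x"
    "\<And>U e S. (U, e) \<in> frames E \<Longrightarrow> holo_fun M (U \<inter> W) (c U e S)"
  shows "s \<in> esec M E W"
proof (rule esecI[OF assms(1-3)])
  fix U e S assume U: "(U, e) \<in> frames E"
  show "holo_fun M (U \<inter> W) (\<lambda>x. frame_coeff r (\<lambda>k. e k x) (s x) S)"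
    by (rule holo_fun_cong[OF M _ _ assms(5)[OF U, of S]])
      (use frame_props(1)[OF U] assms(1) assms(4)[OF U] in auto)
qed

section \<open>Closure properties of the sections of the exterior algebra\<close>

lemma esec_zero: "open W \<Longrightarrow> 0 \<in> esec M E W"
  by (rule esecI'[where c = "\<lambda>U e S x. 0"]) (auto simp: frame_coeff_at holo_fun_const)

lemma esec_add:
  assumes "open W" "s \<in> esec M E W" "t \<in> esec M E W"
  shows "s + t \<in> esec M E W"
proof (rule esecI'[OF assms(1), where
    c = "\<lambda>U e S x. frame_coeff r (\<lambda>k. e k x) (s x) S + frame_coeff r (\<lambda>k. e k x) (t x) S"])
  show "frame_coeff r (\<lambda>k. e k x) ((s + t) x) S = frame_coeff r (\<lambda>k. e k x) (s x) S + frame_coeff r (\<lambda>k. e k x) (t x) S"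
    if "(U, e) \<in> frames E" "x \<in> U \<inter> W" for U e S x
    using frame_coeff_at(4)[OF that(1) _ esecD(1)[OF assms(2)] esecD(1)[OF assms(3)], of x x x] that by simp
  show "holo_fun M (U \<inter> W) (\<lambda>x. frame_coeff r (\<lambda>k. e k x) (s x) S + frame_coeff r (\<lambda>k. e k x) (t x) S)"
    if "(U, e) \<in> frames E" for U e S
    using assms that by (intro holo_fun_add esec_coeff)
qed (use esecD[OF assms(2)] esecD[OF assms(3)] extalg_add in auto)

lemma esec_scale:
  assumes "open W" "s \<in> esec M E W" "holo_fun M W f"
  shows "scale_sec f s \<in> esec M E W"
proof (rule esecI'[OF assms(1), where c = "\<lambda>U e S x. f x * frame_coeff r (\<lambda>k. e k x) (s x) S"])
  show "frame_coeff r (\<lambda>k. e k x) (scale_sec f s x) S = f x * frame_coeff r (\<lambda>k. e k x) (s x) S"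
    if "(U, e) \<in> frames E" "x \<in> U \<inter> W" for U e S x
    using frame_coeff_at(5)[OF that(1) _ esecD(1)[OF assms(2)], of x "f x" x] that
    by (simp add: scale_sec_def)
  show "holo_fun M (U \<inter> W) (\<lambda>x. f x * frame_coeff r (\<lambda>k. e k x) (s x) S)" if "(U, e) \<in> frames E" for U e S
    using assms that holo_fun_subset[OF assms(3)] by (intro holo_fun_mult esec_coeff) auto
qed (use esecD[OF assms(2)] extalg_scale in \<open>auto simp: scale_sec_def\<close>)

lemma esec_const_scale: "open W \<Longrightarrow> s \<in> esec M E W \<Longrightarrow> scale_sec (\<lambda>x. a) s \<in> esec M E W"
  by (rule esec_scale) (auto intro: holo_fun_const)

lemma esec_diff:
  assumes "open W" "s \<in> esec M E W" "t \<in> esec M E W"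
  shows "s - t \<in> esec M E W"
proof -
  have eq: "s - t = s + scale_sec (\<lambda>x. -1) t" by (auto simp: scale_sec_def fun_eq_iff)
  show ?thesis unfolding eq by (rule esec_add[OF assms(1,2) esec_const_scale[OF assms(1,3)]])
qed

lemma esec_sum:
  "open W \<Longrightarrow> (\<And>i. i \<in> I \<Longrightarrow> s i \<in> esec M E W) \<Longrightarrow> (\<Sum>i\<in>I. s i) \<in> esec M E W"
  by (induction I rule: infinite_finite_induct) (auto intro: esec_zero esec_add)

lemma esec_wedge:
  assumes "open W" "s \<in> esec M E W" "t \<in> esec M E W"
  shows "wedge_sec s t \<in> esec M E W"
proof (rule esecI'[OF assms(1), where
    c = "\<lambda>U e S x. wedge (frame_coeff r (\<lambda>k. e k x) (s x)) (frame_coeff r (\<lambda>k. e k x) (t x)) S"])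
  show "frame_coeff r (\<lambda>k. e k x) (wedge_sec s t x) S =
      wedge (frame_coeff r (\<lambda>k. e k x) (s x)) (frame_coeff r (\<lambda>k. e k x) (t x)) S"
    if "(U, e) \<in> frames E" "x \<in> U \<inter> W" for U e S x
    using frame_coeff_at(6)[OF that(1) _ esecD(1)[OF assms(2)] esecD(1)[OF assms(3)], of x x x] that
    by (simp add: wedge_sec_def)
  show "holo_fun M (U \<inter> W) (\<lambda>x. wedge (frame_coeff r (\<lambda>k. e k x) (s x)) (frame_coeff r (\<lambda>k. e k x) (t x)) S)"
    if "(U, e) \<in> frames E" for U e S
    unfolding wedge_eq using assms that
    by (intro holo_fun_sum holo_fun_mult holo_fun_const esec_coeff)
qed (use esecD[OF assms(2)] esecD[OF assms(3)] extalg_wedge in \<open>auto simp: wedge_sec_def\<close>)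

lemma esec_rsec:
  assumes "open W" "open V" "V \<subseteq> W" "s \<in> esec M E W"
  shows "rsec V s \<in> esec M E V"
proof (rule esecI'[OF assms(2), where c = "\<lambda>U e S x. frame_coeff r (\<lambda>k. e k x) (s x) S"])
  show "holo_fun M (U \<inter> V) (\<lambda>x. frame_coeff r (\<lambda>k. e k x) (s x) S)" if "(U, e) \<in> frames E" for U e S
    by (rule holo_fun_subset[OF esec_coeff[OF assms(1,4) that]]) (use assms in auto)
qed (use esecD[OF assms(4)] in \<open>auto simp: rsec_def\<close>)

lemma esec_fun:
  assumes "open W" "f \<in> osec M W"
  shows "fun_sec f \<in> esec M E W"
proof (rule esecI'[OF assms(1), where c = "\<lambda>U e S x. if S = {} then f x else 0"])
  show "fun_sec f x = 0" if "x \<notin> W" for x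
    using osecD(2)[OF assms(2) that] by (auto simp: fun_sec_def ext_const_def)
  show "holo_fun M (U \<inter> W) (\<lambda>x. if S = {} then f x else 0)" for U and S :: "nat set"
    using holo_fun_subset[OF osecD(1)[OF assms(2)], of "U \<inter> W"] holo_fun_const
    by (cases "S = {}") auto
  show "frame_coeff r (\<lambda>k. e k x) (fun_sec f x) S = (if S = {} then f x else 0)"
    if "(U, e) \<in> frames E" "x \<in> U \<inter> W" for U e S x
    using frame_coeff_at(7)[OF that(1), of x "f x"] that(2) by (simp add: fun_sec_def ext_const_def)
qed (simp add: fun_sec_def)

lemma indicator_osec: "open W \<Longrightarrow> indicator W \<in> osec M W"
  using osec_rsec[OF _ holo_fun_const, of W 1]
  by (simp add: rsec_def indicator_def[abs_def] of_bool_def)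

lemma esec_vec:
  assumes "open W" "s \<in> vsec M E W"
  shows "vec_sec s \<in> esec M E W"
proof (rule esecI[OF assms(1)])
  show "vec_sec s x \<in> extalg r" for x
    using assms(2) by (auto simp: vsec_def vec_sec_def intro: extalg_vec)
  show "vec_sec s x = 0" if "x \<notin> W" for x
    using assms(2) that by (auto simp: vsec_def vec_sec_def ext_vec_def fun_eq_iff)
  fix U e S assume U: "(U, e) \<in> frames E"
  then have "\<exists>c. (\<forall>k<r. holo_fun M (U \<inter> W) (c k)) \<and> (\<forall>x\<in>U \<inter> W. s x = (\<lambda>i. \<Sum>k<r. c k x * e k x i))"
    using assms(2) unfolding vsec_def by blast
  then obtain c where c: "\<And>k. k < r \<Longrightarrow> holo_fun M (U \<inter> W) (c k)"
    "\<And>x. x \<in> U \<inter> W \<Longrightarrow> s x = (\<lambda>i. \<Sum>k<r. c k x * e k x i)" by blast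
  define c' where "c' x = (\<lambda>k. if k < r then c k x else 0)" for x
  have c'C: "c' x \<in> Cn r" for x by (simp add: c'_def Cn_def)
  have "frame_coeff r (\<lambda>k. e k x) (vec_sec s x) = ext_vec (c' x)" if x: "x \<in> U \<inter> W" for x
  proof -
    have "(\<Sum>k<r. c' x k * e k x i) = (\<Sum>k<r. c k x * e k x i)" for i
      by (intro sum.cong) (simp_all add: c'_def)
    then have "vec_sec s x = frame_hom r (\<lambda>k. e k x) (ext_vec (c' x))"
      using ext_vec_sum[OF c'C[of x], of "\<lambda>k. e k x" r] frame_props(3)[OF U] x c(2)[OF x]
      by (simp add: vec_sec_def)
    then show ?thesis using frame_coeff_at(3)[OF U _ extalg_vec[OF c'C]] x by simp
  qed
  moreover have "holo_fun M (U \<inter> W) (\<lambda>x. ext_vec (c' x) S)"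
  proof (cases "card S = 1 \<and> the_elem S < r")
    case True
    then show ?thesis using c(1) by (simp add: ext_vec_def c'_def)
  next
    case False
    then have "(\<lambda>x. ext_vec (c' x) S) = (\<lambda>x. 0)" by (auto simp: ext_vec_def c'_def)
    then show ?thesis by (simp add: holo_fun_const)
  qed
  ultimately show "holo_fun M (U \<inter> W) (\<lambda>x. frame_coeff r (\<lambda>k. e k x) (vec_sec s x) S)"
    by (intro holo_fun_cong[OF M _ _ \<open>holo_fun M (U \<inter> W) (\<lambda>x. ext_vec (c' x) S)\<close>])
      (use frame_props(1)[OF U] assms(1) in auto)
qed

lemma esec_wedge_prod:
  assumes "open V" "finite S" "\<And>k. k \<in> S \<Longrightarrow> u k \<in> esec M E V"
  shows "rsec V (\<lambda>x. wedge_prod (\<lambda>k. u k x) S) \<in> esec M E V"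
  using assms(2,3)
proof (induction rule: finite_set_min_induct)
  case empty
  have "rsec V (\<lambda>x. wedge_prod (\<lambda>k. u k x) {}) = fun_sec (indicator V)"
    by (auto simp: rsec_def fun_sec_def ext_const_def fun_eq_iff)
  then show ?case using esec_fun[OF assms(1) indicator_osec[OF assms(1)]] by simp
next
  case (insert i S)
  have "rsec V (\<lambda>x. wedge_prod (\<lambda>k. u k x) (insert i S)) = wedge_sec (u i) (rsec V (\<lambda>x. wedge_prod (\<lambda>k. u k x) S))"
    using insert.hyps by (auto simp: rsec_def wedge_sec_def wedge_prod_insert fun_eq_iff)
  then show ?case using insert esec_wedge[OF assms(1)] by simp
qed

text \<open>A homomorphism applied pointwise gives a section because the result is a finite sum of
  functions times products of sections. The explicit sum is kept, since an automorphism can be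
  applied to it termwise.\<close>

lemma esec_ext_hom:
  assumes V: "open V" and u: "\<And>k. k < r \<Longrightarrow> u k \<in> esec M E V"
    and c: "\<And>S. S \<subseteq> {..<r} \<Longrightarrow> holo_fun M V (\<lambda>x. c x S)"
  shows "rsec V (\<lambda>x. ext_hom r (\<lambda>k. u k x) (c x)) \<in> esec M E V"
    and "rsec V (\<lambda>x. ext_hom r (\<lambda>k. u k x) (c x)) =
      (\<Sum>S\<in>Pow {..<r}. wedge_sec (fun_sec (rsec V (\<lambda>x. c x S))) (rsec V (\<lambda>x. wedge_prod (\<lambda>k. u k x) S)))"
proof -
  show eq: "rsec V (\<lambda>x. ext_hom r (\<lambda>k. u k x) (c x)) =
      (\<Sum>S\<in>Pow {..<r}. wedge_sec (fun_sec (rsec V (\<lambda>x. c x S))) (rsec V (\<lambda>x. wedge_prod (\<lambda>k. u k x) S)))"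
  proof (rule ext, rule ext)
    fix x T
    have "wedge (ext_const (c x S)) (wedge_prod (\<lambda>k. u k x) S) T = c x S * wedge_prod (\<lambda>k. u k x) S T"
      if "S \<subseteq> {..<r}" for S
    proof (rule wedge_const_left)
      have "wedge_prod (\<lambda>k. u k x) S \<in> extalg r"
      proof (rule wedge_prod_extalg)
        show "u k x \<in> extalg r" if "k \<in> S" for k
          using \<open>S \<subseteq> {..<r}\<close> that by (intro esecD(1)[OF u]) auto
      qed (use finite_subset[OF that] in simp)
      then show "infinite T \<Longrightarrow> wedge_prod (\<lambda>k. u k x) S T = 0" by (rule extalg_infinite)
    qed
    then show "rsec V (\<lambda>x. ext_hom r (\<lambda>k. u k x) (c x)) x T =
      (\<Sum>S\<in>Pow {..<r}. wedge_sec (fun_sec (rsec V (\<lambda>x. c x S))) (rsec V (\<lambda>x. wedge_prod (\<lambda>k. u k x) S))) x T"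
      by (auto simp: sum_fun_apply rsec_def ext_hom_def wedge_sec_def fun_sec_def intro!: sum.cong)
  qed
  show "rsec V (\<lambda>x. ext_hom r (\<lambda>k. u k x) (c x)) \<in> esec M E V"
    unfolding eq
  proof (rule esec_sum[OF V])
    fix S assume S: "S \<in> Pow {..<r}"
    show "wedge_sec (fun_sec (rsec V (\<lambda>x. c x S))) (rsec V (\<lambda>x. wedge_prod (\<lambda>k. u k x) S)) \<in> esec M E V"
      using S u c finite_index[OF S] by (intro esec_wedge[OF V] esec_fun[OF V] osec_rsec[OF V] esec_wedge_prod[OF V]) auto
  qed
qed

section \<open>Operations on bundle sections\<close>

lemma vsec_rsec:
  assumes "open W" "V \<subseteq> W" "s \<in> vsec M F W"
  shows "rsec V s \<in> vsec M F V"
  unfolding vsec_def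
proof (intro CollectI conjI allI impI ballI)
  show "rsec V s x \<in> Cn (brank F)" for x using assms(3) by (auto simp: rsec_def vsec_def Cn_def)
  show "rsec V s x = 0" if "x \<notin> V" for x using that by (simp add: rsec_def)
  fix p assume p: "p \<in> frames F"
  obtain U e where Ue: "p = (U, e)" by (cases p)
  then have "\<exists>c. (\<forall>k<brank F. holo_fun M (U \<inter> W) (c k)) \<and> (\<forall>x\<in>U \<inter> W. s x = (\<lambda>i. \<Sum>k<brank F. c k x * e k x i))"
    using assms(3) p unfolding vsec_def by blast
  then obtain c where c: "\<forall>k<brank F. holo_fun M (U \<inter> W) (c k)"
    "\<forall>x\<in>U \<inter> W. s x = (\<lambda>i. \<Sum>k<brank F. c k x * e k x i)" by blast
  have sub: "U \<inter> V \<subseteq> U \<inter> W" using assms(2) by auto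
  show "case p of (U, e) \<Rightarrow> \<exists>c. (\<forall>k<brank F. holo_fun M (U \<inter> V) (c k)) \<and>
      (\<forall>x\<in>U \<inter> V. rsec V s x = (\<lambda>i. \<Sum>k<brank F. c k x * e k x i))"
    unfolding Ue prod.case using c sub holo_fun_subset[OF _ sub]
    by (intro exI[of _ c]) (auto simp: rsec_def)
qed

lemma vsec_add_scale:
  assumes "s \<in> vsec M F W" "t \<in> vsec M F W" "holo_fun M W f"
  shows "scale_sec f s + t \<in> vsec M F W"
  unfolding vsec_def
proof (intro CollectI conjI allI impI ballI)
  show "(scale_sec f s + t) x \<in> Cn (brank F)" for x
    using assms(1,2) by (auto simp: vsec_def Cn_def scale_sec_def)
  show "(scale_sec f s + t) x = 0" if "x \<notin> W" for x
    using that assms(1,2) by (auto simp: vsec_def scale_sec_def fun_eq_iff)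
  fix p assume p: "p \<in> frames F"
  obtain U e where Ue: "p = (U, e)" by (cases p)
  then have "\<exists>c. (\<forall>k<brank F. holo_fun M (U \<inter> W) (c k)) \<and> (\<forall>x\<in>U \<inter> W. s x = (\<lambda>i. \<Sum>k<brank F. c k x * e k x i))"
    "\<exists>c. (\<forall>k<brank F. holo_fun M (U \<inter> W) (c k)) \<and> (\<forall>x\<in>U \<inter> W. t x = (\<lambda>i. \<Sum>k<brank F. c k x * e k x i))"
    using assms(1,2) p unfolding vsec_def by blast+
  then obtain c d where c: "\<forall>k<brank F. holo_fun M (U \<inter> W) (c k)"
    "\<forall>x\<in>U \<inter> W. s x = (\<lambda>i. \<Sum>k<brank F. c k x * e k x i)"
    and d: "\<forall>k<brank F. holo_fun M (U \<inter> W) (d k)"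
    "\<forall>x\<in>U \<inter> W. t x = (\<lambda>i. \<Sum>k<brank F. d k x * e k x i)" by blast
  have "holo_fun M (U \<inter> W) f" using assms(3) by (rule holo_fun_subset) auto
  then show "case p of (U, e) \<Rightarrow> \<exists>c. (\<forall>k<brank F. holo_fun M (U \<inter> W) (c k)) \<and>
      (\<forall>x\<in>U \<inter> W. (scale_sec f s + t) x = (\<lambda>i. \<Sum>k<brank F. c k x * e k x i))"
    unfolding Ue prod.case using c d
    by (intro exI[of _ "\<lambda>k x. f x * c k x + d k x"])
      (auto simp: scale_sec_def fun_eq_iff sum_distrib_left sum.distrib algebra_simps
        intro!: holo_fun_add holo_fun_mult)
qed

lemma vsec_zero: "0 \<in> vsec M F W"
  unfolding vsec_def
  by (auto simp: Cn_def fun_eq_iff intro!: exI[of _ "\<lambda>k x. 0"] holo_fun_const)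

end

section \<open>The sheaves of automorphisms\<close>

lemma wedge_diff_wedge: "wedge a' b' - wedge a b = wedge (a' - a) b' + wedge a (b' - b)"
  by (simp add: wedge_diff_left wedge_diff_right)

lemma wedge_sec_zero: "wedge_sec 0 t = 0"
  by (rule ext) (simp only: wedge_sec_def zero_fun_apply wedge_zero)

lemma deg_ge_enat: "deg_ge (enat n) s \<longleftrightarrow> (\<forall>x. degree_ge n (s x))"
  by (auto simp: deg_ge_def degree_ge_def)

lemma deg_ge_mono: "deg_ge j s \<Longrightarrow> i \<le> j \<Longrightarrow> deg_ge i s"
  by (meson deg_ge_def order_trans)

lemma sec_support:
  fixes s t :: "'x extsec"
  shows "(s + t) x S \<noteq> 0 \<Longrightarrow> s x S \<noteq> 0 \<or> t x S \<noteq> 0" "(s - t) x S \<noteq> 0 \<Longrightarrow> s x S \<noteq> 0 \<or> t x S \<noteq> 0"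
  by auto

lemma deg_ge_add: "deg_ge j s \<Longrightarrow> deg_ge j t \<Longrightarrow> deg_ge j (s + t)"
  using sec_support[of s t] unfolding deg_ge_def by blast

lemma even_sec_diff: "even_sec s \<Longrightarrow> even_sec t \<Longrightarrow> even_sec (s - t)"
  using sec_support[of s t] unfolding even_sec_def by blast

lemma odd_sec_diff: "odd_sec s \<Longrightarrow> odd_sec t \<Longrightarrow> odd_sec (s - t)"
  using sec_support[of s t] unfolding odd_sec_def by blast

lemma even_sec_add: "even_sec s \<Longrightarrow> even_sec t \<Longrightarrow> even_sec (s + t)"
  using sec_support[of s t] unfolding even_sec_def by blast

lemma odd_sec_add: "odd_sec s \<Longrightarrow> odd_sec t \<Longrightarrow> odd_sec (s + t)"
  using sec_support[of s t] unfolding odd_sec_def by blast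

lemma even_sec_fun: "even_sec (fun_sec f)"
  by (auto simp: even_sec_def fun_sec_def ext_const_def)

lemma odd_sec_vec: "odd_sec (vec_sec v)"
  by (auto simp: odd_sec_def vec_sec_def ext_vec_def)

context model
begin

definition aut_on :: "enat \<Rightarrow> 'x alg_aut \<Rightarrow> 'x set \<Rightarrow> bool" where
  "aut_on j \<alpha> V \<longleftrightarrow>
        (\<forall>s\<in>esec M E V. \<alpha> V s \<in> esec M E V) \<and>
        \<alpha> V (fun_sec (indicator V)) = fun_sec (indicator V) \<and>
        (\<forall>s\<in>esec M E V. \<forall>t\<in>esec M E V. \<alpha> V (s + t) = \<alpha> V s + \<alpha> V t) \<and>
        (\<forall>s\<in>esec M E V. \<forall>t\<in>esec M E V. \<alpha> V (wedge_sec s t) = wedge_sec (\<alpha> V s) (\<alpha> V t)) \<and>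
        (\<forall>s\<in>esec M E V. \<forall>c. \<alpha> V (scale_sec (\<lambda>x. c) s) = scale_sec (\<lambda>x. c) (\<alpha> V s)) \<and>
        (\<forall>s\<in>esec M E V. (even_sec s \<longrightarrow> even_sec (\<alpha> V s)) \<and> (odd_sec s \<longrightarrow> odd_sec (\<alpha> V s))) \<and>
        (\<forall>s\<in>esec M E V. \<forall>V'. open V' \<and> V' \<subseteq> V \<longrightarrow> \<alpha> V' (rsec V' s) = rsec V' (\<alpha> V s)) \<and>
        (\<forall>s\<in>esec M E V. deg_ge j (\<alpha> V s - s))"

text \<open>The sections of \<open>\<G>\<^sup>(\<^sup>j\<^sup>)\<close> without the requirement of bijectivity, which is automatic for \<open>j \<ge> 2\<close>:
  \<open>\<alpha> - id\<close> raises the degree and is therefore nilpotent.\<close>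

definition pre_aut :: "enat \<Rightarrow> 'x set \<Rightarrow> 'x alg_aut \<Rightarrow> bool" where
  "pre_aut j W \<alpha> \<longleftrightarrow> (\<forall>V. open V \<and> V \<subseteq> W \<longrightarrow> aut_on j \<alpha> V)"

lemma aut_onI:
  assumes "\<And>s. s \<in> esec M E V \<Longrightarrow> \<alpha> V s \<in> esec M E V"
    "\<alpha> V (fun_sec (indicator V)) = fun_sec (indicator V)"
    "\<And>s t. s \<in> esec M E V \<Longrightarrow> t \<in> esec M E V \<Longrightarrow> \<alpha> V (s + t) = \<alpha> V s + \<alpha> V t"
    "\<And>s t. s \<in> esec M E V \<Longrightarrow> t \<in> esec M E V \<Longrightarrow> \<alpha> V (wedge_sec s t) = wedge_sec (\<alpha> V s) (\<alpha> V t)"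
    "\<And>s c. s \<in> esec M E V \<Longrightarrow> \<alpha> V (scale_sec (\<lambda>x. c) s) = scale_sec (\<lambda>x. c) (\<alpha> V s)"
    "\<And>s. s \<in> esec M E V \<Longrightarrow> even_sec s \<Longrightarrow> even_sec (\<alpha> V s)"
    "\<And>s. s \<in> esec M E V \<Longrightarrow> odd_sec s \<Longrightarrow> odd_sec (\<alpha> V s)"
    "\<And>s V'. s \<in> esec M E V \<Longrightarrow> open V' \<Longrightarrow> V' \<subseteq> V \<Longrightarrow> \<alpha> V' (rsec V' s) = rsec V' (\<alpha> V s)"
    "\<And>s. s \<in> esec M E V \<Longrightarrow> deg_ge j (\<alpha> V s - s)"
  shows "aut_on j \<alpha> V"
  unfolding aut_on_def by (intro conjI ballI allI impI) (simp_all add: assms)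

lemma pre_autD:
  assumes "pre_aut j W \<alpha>" "open V" "V \<subseteq> W"
  shows "s \<in> esec M E V \<Longrightarrow> \<alpha> V s \<in> esec M E V"
    "\<alpha> V (fun_sec (indicator V)) = fun_sec (indicator V)"
    "s \<in> esec M E V \<Longrightarrow> t \<in> esec M E V \<Longrightarrow> \<alpha> V (s + t) = \<alpha> V s + \<alpha> V t"
    "s \<in> esec M E V \<Longrightarrow> t \<in> esec M E V \<Longrightarrow> \<alpha> V (wedge_sec s t) = wedge_sec (\<alpha> V s) (\<alpha> V t)"
    "s \<in> esec M E V \<Longrightarrow> \<alpha> V (scale_sec (\<lambda>x. c) s) = scale_sec (\<lambda>x. c) (\<alpha> V s)"
    "s \<in> esec M E V \<Longrightarrow> even_sec s \<Longrightarrow> even_sec (\<alpha> V s)"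
    "s \<in> esec M E V \<Longrightarrow> odd_sec s \<Longrightarrow> odd_sec (\<alpha> V s)"
    "s \<in> esec M E V \<Longrightarrow> open V' \<Longrightarrow> V' \<subseteq> V \<Longrightarrow> \<alpha> V' (rsec V' s) = rsec V' (\<alpha> V s)"
    "s \<in> esec M E V \<Longrightarrow> deg_ge j (\<alpha> V s - s)"
  using mp[OF spec[OF assms(1)[unfolded pre_aut_def aut_on_def], of V] conjI[OF assms(2,3)]] by simp_all

lemma pre_aut_degree:
  assumes pa: "pre_aut j W \<alpha>" and W': "W' \<subseteq> W"
    and d: "\<And>V s. open V \<Longrightarrow> V \<subseteq> W' \<Longrightarrow> s \<in> esec M E V \<Longrightarrow> deg_ge i (\<alpha> V s - s)"
  shows "pre_aut i W' \<alpha>"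
  unfolding pre_aut_def
proof (intro allI impI)
  fix V assume "open V \<and> V \<subseteq> W'"
  then have V: "open V" "V \<subseteq> W'" "V \<subseteq> W" using W' by auto
  note A = pre_autD[OF pa V(1,3)]
  show "aut_on i \<alpha> V"
    by (rule aut_onI) (simp_all add: A(1-8) d V)
qed

lemma pre_aut_mono: "pre_aut j W \<alpha> \<Longrightarrow> W' \<subseteq> W \<Longrightarrow> i \<le> j \<Longrightarrow> pre_aut i W' \<alpha>"
  using pre_aut_degree[of j W \<alpha> W' i] deg_ge_mono[OF pre_autD(9)] by (meson order_trans)

lemma pre_aut_zero:
  assumes "pre_aut j W \<alpha>" "open V" "V \<subseteq> W"
  shows "\<alpha> V 0 = 0"
  using pre_autD(3)[OF assms esec_zero[OF assms(2)] esec_zero[OF assms(2)]] by simp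

lemma pre_aut_sum:
  assumes "pre_aut j W \<alpha>" "open V" "V \<subseteq> W" "\<And>i. i \<in> I \<Longrightarrow> s i \<in> esec M E V"
  shows "\<alpha> V (\<Sum>i\<in>I. s i) = (\<Sum>i\<in>I. \<alpha> V (s i))"
  using assms(4)
proof (induction I rule: infinite_finite_induct)
  case (insert i I)
  then show ?case
    using pre_autD(3)[OF assms(1-3), of "s i" "sum s I"] esec_sum[OF assms(2), of I s]
    by (simp del: plus_fun_apply)
qed (simp_all add: pre_aut_zero[OF assms(1-3)] del: zero_fun_apply)

lemma pre_aut_diff:
  assumes "pre_aut j W \<alpha>" "open V" "V \<subseteq> W" "s \<in> esec M E V" "t \<in> esec M E V"
  shows "\<alpha> V (s - t) = \<alpha> V s - \<alpha> V t"
proof -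
  have "\<alpha> V (s - t) + \<alpha> V t = \<alpha> V (s - t + t)"
    using pre_autD(3)[OF assms(1-3) esec_diff[OF assms(2,4,5)] assms(5)] by simp
  then show ?thesis by (simp add: eq_diff_eq)
qed

lemma frame_sec_props:
  assumes "(U, e) \<in> frames E" "open V" "V \<subseteq> U" "k < r"
  shows "rsec V (e k) \<in> vsec M E V" "vec_sec (rsec V (e k)) \<in> esec M E V"
    "x \<in> V \<Longrightarrow> vec_sec (rsec V (e k)) x = ext_vec (e k x)"
proof -
  have "rsec V (rsec U (e k)) \<in> vsec M E V"
    using frame_props(1,4)[OF assms(1)] assms by (intro vsec_rsec) auto
  moreover have "rsec V (rsec U (e k)) = rsec V (e k)" using assms(3) by (auto simp: rsec_def fun_eq_iff)
  ultimately show "rsec V (e k) \<in> vsec M E V" by simp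
  then show "vec_sec (rsec V (e k)) \<in> esec M E V" using esec_vec assms(2) by blast
qed (simp add: vec_sec_def rsec_def)

text \<open>An automorphism is controlled by its effect on functions and on sections of the bundle, since
  these generate the exterior algebra locally.\<close>

lemma aut_degree:
  assumes pa: "pre_aut j W \<alpha>" and V: "open V" "V \<subseteq> W" and s: "s \<in> esec M E V" and n: "1 \<le> n"
    and fn: "\<And>V f x. open V \<Longrightarrow> V \<subseteq> W \<Longrightarrow> f \<in> osec M V \<Longrightarrow> degree_ge n ((\<alpha> V (fun_sec f) - fun_sec f) x)"
    and vc: "\<And>V v x. open V \<Longrightarrow> V \<subseteq> W \<Longrightarrow> v \<in> vsec M E V \<Longrightarrow> degree_ge n ((\<alpha> V (vec_sec v) - vec_sec v) x)"
    and d: "\<And>x. degree_ge d (s x)"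
  shows "degree_ge (if d = 0 then n else d + n - 1) ((\<alpha> V s - s) x)" (is "degree_ge ?D _")
proof (cases "x \<in> V")
  case False
  then show ?thesis
    using esecD(2)[OF s False] esecD(2)[OF pre_autD(1)[OF pa V s] False] by simp
next
  case x: True
  obtain U e where U: "(U, e) \<in> frames E" "x \<in> U" using frame_covers .
  define V' where "V' = U \<inter> V"
  have V': "open V'" "V' \<subseteq> W" "V' \<subseteq> V" "V' \<subseteq> U" "x \<in> V'"
    using frame_props(1)[OF U(1)] V U x by (auto simp: V'_def)
  define u where "u k = vec_sec (rsec V' (e k))" for k
  have u: "u k \<in> esec M E V'" if "k < r" for k
    using frame_sec_props(2)[OF U(1) V'(1,4) that] by (simp add: u_def)
  have ux: "u k y = ext_vec (e k y)" if "y \<in> V'" for k y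
    using that by (simp add: u_def vec_sec_def rsec_def)
  define w where "w S = rsec V' (\<lambda>y. wedge_prod (\<lambda>k. u k y) S)" for S
  have w: "w S \<in> esec M E V'" if "S \<subseteq> {..<r}" for S
    unfolding w_def using that finite_subset[OF that] u by (intro esec_wedge_prod[OF V'(1)]) auto
  have wdeg: "degree_ge (card S) (w S y)" if "S \<subseteq> {..<r}" for S y
  proof (cases "y \<in> V'")
    case True
    have "degree_ge 1 (ext_vec v)" for v by (auto simp: degree_ge_def ext_vec_def)
    then show ?thesis using True finite_subset[OF that]
      by (simp add: w_def rsec_def ux degree_ge_wedge_prod)
  qed (simp add: w_def rsec_def)
  \<comment> \<open>In a product of generators one factor of degree 1 is exchanged for a difference
    of degree \<open>n\<close>, a gain of \<open>n - 1\<close>. In the base case the unit is fixed,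
    so the difference is 0.\<close>
  have wdiff: "degree_ge (card S + n - 1) ((\<alpha> V' (w S) - w S) y)" if "S \<subseteq> {..<r}" for S y
    using finite_subset[OF that finite_lessThan] that
  proof (induction arbitrary: y rule: finite_set_min_induct)
    case empty
    have "w {} = fun_sec (indicator V')"
      by (auto simp: w_def rsec_def fun_sec_def ext_const_def fun_eq_iff)
    then have "(\<alpha> V' (w {}) - w {}) y = 0"
      by (simp only: pre_autD(2)[OF pa V'(1,2)] diff_self zero_fun_apply)
    then show ?case by (simp only: degree_ge_zero)
  next
    case (insert i S)
    have iS: "i < r" "S \<subseteq> {..<r}" "i \<notin> S" using insert.prems insert.hyps by auto
    have "w (insert i S) = wedge_sec (u i) (w S)"
      using insert.hyps by (auto simp: w_def rsec_def wedge_sec_def wedge_prod_insert fun_eq_iff)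
    then have "(\<alpha> V' (w (insert i S)) - w (insert i S)) y =
       wedge (\<alpha> V' (u i) y) (\<alpha> V' (w S) y) - wedge (u i y) (w S y)"
      using pre_autD(4)[OF pa V'(1,2) u[OF iS(1)] w[OF iS(2)]] by (simp add: wedge_sec_def)
    also have "\<dots> = wedge ((\<alpha> V' (u i) - u i) y) (\<alpha> V' (w S) y) + wedge (u i y) ((\<alpha> V' (w S) - w S) y)"
      by (simp add: wedge_diff_wedge)
    finally have eq: "(\<alpha> V' (w (insert i S)) - w (insert i S)) y =
      wedge ((\<alpha> V' (u i) - u i) y) (\<alpha> V' (w S) y) + wedge (u i y) ((\<alpha> V' (w S) - w S) y)" .
    have "degree_ge n ((\<alpha> V' (u i) - u i) y)"
      unfolding u_def using vc[OF V'(1,2) frame_sec_props(1)[OF U(1) V'(1,4) iS(1)]] .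
    moreover have "degree_ge (card S) (\<alpha> V' (w S) y)"
    proof -
      have "degree_ge (card S) ((\<alpha> V' (w S) - w S) y + w S y)"
        using n by (intro degree_ge_add wdeg[OF iS(2)] degree_ge_mono[OF insert.IH[OF iS(2)]]) auto
      then show ?thesis by simp
    qed
    ultimately have 1: "degree_ge (n + card S) (wedge ((\<alpha> V' (u i) - u i) y) (\<alpha> V' (w S) y))"
      by (rule degree_ge_wedge)
    have "degree_ge 1 (u i y)" by (auto simp: u_def vec_sec_def degree_ge_def ext_vec_def)
    then have 2: "degree_ge (1 + (card S + n - 1)) (wedge (u i y) ((\<alpha> V' (w S) - w S) y))"
      using insert.IH[OF iS(2)] by (rule degree_ge_wedge)
    have c: "card (insert i S) + n - 1 = n + card S" "1 + (card S + n - 1) = n + card S"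
      using iS(3) insert.hyps(1) n by auto
    show ?case unfolding eq c(1) by (rule degree_ge_add[OF 1 2[unfolded c(2)]])
  qed
  define c where "c y = frame_coeff r (\<lambda>k. e k y) (s y)" for y
  have c: "holo_fun M V' (\<lambda>y. c y S)" for S
    unfolding c_def V'_def by (rule esec_coeff[OF V(1) s U(1)])
  define f where "f S = rsec V' (\<lambda>y. c y S)" for S
  have f: "f S \<in> osec M V'" for S unfolding f_def by (rule osec_rsec[OF V'(1) c])
  have fs: "fun_sec (f S) \<in> esec M E V'" for S by (rule esec_fun[OF V'(1) f])
  have s': "rsec V' s = (\<Sum>S\<in>Pow {..<r}. wedge_sec (fun_sec (f S)) (w S))"
  proof -
    have "rsec V' s = rsec V' (\<lambda>y. ext_hom r (\<lambda>k. u k y) (c y))"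
    proof
      fix y
      show "rsec V' s y = rsec V' (\<lambda>y. ext_hom r (\<lambda>k. u k y) (c y)) y"
      proof (cases "y \<in> V'")
        case True
        then have "ext_hom r (\<lambda>k. u k y) (c y) = s y"
          using frame_coeff_at(2)[OF U(1) _ esecD(1)[OF s], of y y] V'(4)
          by (auto simp: ux c_def frame_hom_def)
        then show ?thesis by (simp add: rsec_def)
      qed (simp add: rsec_def)
    qed
    also have "\<dots> = (\<Sum>S\<in>Pow {..<r}. wedge_sec (fun_sec (f S)) (w S))"
      unfolding f_def w_def by (rule esec_ext_hom(2)[OF V'(1) u c])
    finally show ?thesis .
  qed
  have fw: "wedge_sec (fun_sec (f S)) (w S) \<in> esec M E V'" if "S \<in> Pow {..<r}" for S
    using that by (intro esec_wedge[OF V'(1) fs] w) auto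
  have as': "\<alpha> V' (\<Sum>S\<in>Pow {..<r}. wedge_sec (fun_sec (f S)) (w S)) =
      (\<Sum>S\<in>Pow {..<r}. \<alpha> V' (wedge_sec (fun_sec (f S)) (w S)))"
    by (rule pre_aut_sum[OF pa V'(1,2)]) (rule fw)
  have "(\<alpha> V s - s) x = (\<alpha> V' (rsec V' s) - rsec V' s) x"
    using pre_autD(8)[OF pa V s V'(1,3)] V'(5) by (simp add: rsec_def)
  also have "\<dots> = (\<Sum>S\<in>Pow {..<r}. (\<alpha> V' (wedge_sec (fun_sec (f S)) (w S)) - wedge_sec (fun_sec (f S)) (w S)) x)"
    unfolding s' as' by (simp only: sum_subtractf[symmetric] sum_fun_apply)
  finally have eqx: "(\<alpha> V s - s) x = (\<Sum>S\<in>Pow {..<r}.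
      (\<alpha> V' (wedge_sec (fun_sec (f S)) (w S)) - wedge_sec (fun_sec (f S)) (w S)) x)" .
  show ?thesis unfolding eqx
  proof (rule degree_ge_sum)
    fix S assume S: "S \<in> Pow {..<r}"
    then have S': "S \<subseteq> {..<r}" by simp
    show "degree_ge ?D ((\<alpha> V' (wedge_sec (fun_sec (f S)) (w S)) - wedge_sec (fun_sec (f S)) (w S)) x)"
    proof (cases "card S < d")
      case True
      \<comment> \<open>Passing to frame coefficients preserves degree, so \<open>s\<close> has no
        coefficient at sets smaller than \<open>d\<close>.\<close>
      have "c y S = 0" if "y \<in> V'" for y
      proof (rule ccontr)
        assume "c y S \<noteq> 0"
        moreover have "y \<in> U" using that V'(4) by auto
        ultimately obtain T where "card T = card S" "s y T \<noteq> 0"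
          using frame_coeff_at(9)[OF U(1) _ esecD(1)[OF s], of y y S] by (auto simp: c_def)
        then show False using d[of y] True by (auto simp: degree_ge_def)
      qed
      then have "f S = (\<lambda>y. 0)" by (auto simp: f_def rsec_def)
      then have "fun_sec (f S) = 0" by (auto simp: fun_sec_def ext_const_def fun_eq_iff)
      then have "wedge_sec (fun_sec (f S)) (w S) = 0" by (simp only: wedge_sec_zero)
      then show ?thesis using pre_aut_zero[OF pa V'(1,2)] by simp
    next
      case False
      have eq: "(\<alpha> V' (wedge_sec (fun_sec (f S)) (w S)) - wedge_sec (fun_sec (f S)) (w S)) x =
        wedge ((\<alpha> V' (fun_sec (f S)) - fun_sec (f S)) x) (\<alpha> V' (w S) x) +
        wedge (fun_sec (f S) x) ((\<alpha> V' (w S) - w S) x)"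
        using pre_autD(4)[OF pa V'(1,2) fs w[OF S'], of S] by (simp add: wedge_sec_def wedge_diff_wedge)
      have "degree_ge (card S) ((\<alpha> V' (w S) - w S) x + w S x)"
        using n by (intro degree_ge_add wdeg[OF S'] degree_ge_mono[OF wdiff[OF S']]) auto
      then have "degree_ge (n + card S) (wedge ((\<alpha> V' (fun_sec (f S)) - fun_sec (f S)) x) (\<alpha> V' (w S) x))"
        by (intro degree_ge_wedge fn[OF V'(1,2) f]) simp
      then have 1: "degree_ge ?D (wedge ((\<alpha> V' (fun_sec (f S)) - fun_sec (f S)) x) (\<alpha> V' (w S) x))"
        by (rule degree_ge_mono) (use False n in auto)
      \<comment> \<open>For \<open>S = {}\<close>, which forces \<open>d = 0\<close>, the bound
        \<open>card S + n - 1\<close> would fall one short of \<open>n\<close>; but there the unit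
        is fixed and the term vanishes.\<close>
      have 2: "degree_ge ?D (wedge (fun_sec (f S) x) ((\<alpha> V' (w S) - w S) x))"
      proof (cases "S = {}")
        case True
        have "w {} = fun_sec (indicator V')"
          by (auto simp: w_def rsec_def fun_sec_def ext_const_def fun_eq_iff)
        then show ?thesis using True pre_autD(2)[OF pa V'(1,2)] by simp
      next
        case S0: False
        then have "card S > 0" using finite_subset[OF S'] by (simp add: card_gt_0_iff)
        moreover have "degree_ge (0 + (card S + n - 1)) (wedge (fun_sec (f S) x) ((\<alpha> V' (w S) - w S) x))"
          by (intro degree_ge_wedge wdiff[OF S'] degree_ge_zero)
        ultimately show ?thesis using False by (elim degree_ge_mono) auto
      qed
      show ?thesis unfolding eq by (rule degree_ge_add[OF 1 2])
    qed
  qed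
qed

text \<open>The case \<open>n = 2\<close> of \<open>aut_degree\<close>: in positive degree
  \<open>d\<close> the bound is d + 2 - 1, and in degree 0 it is 2, more than required.\<close>

lemma aut_raises_degree:
  assumes pa: "pre_aut j W \<alpha>" and j: "2 \<le> j" and V: "open V" "V \<subseteq> W" and s: "s \<in> esec M E V"
    and d: "\<And>x. degree_ge d (s x)"
  shows "degree_ge (Suc d) ((\<alpha> V s - s) x)"
proof -
  have 2: "degree_ge 2 ((\<alpha> V s - s) x)" if "open V" "V \<subseteq> W" "s \<in> esec M E V" for V s x
  proof -
    have "deg_ge (enat 2) (\<alpha> V s - s)"
      using deg_ge_mono[OF pre_autD(9)[OF pa that]] j by (simp add: numeral_eq_enat)
    then show ?thesis by (simp add: deg_ge_enat)
  qed
  have "degree_ge (if d = 0 then 2 else d + 2 - 1) ((\<alpha> V s - s) x)"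
    by (rule aut_degree[OF pa V s _ _ _ d]) (simp_all del: minus_apply add: 2 esec_fun esec_vec)
  then show ?thesis by (rule degree_ge_mono) auto
qed

text \<open>By parity, the degree \<open>k\<close> part of \<open>\<alpha> - id\<close> vanishes on
  functions for odd \<open>k\<close> and on bundle sections for even \<open>k\<close>; the
  assumptions treat the two complementary cases. From these generators the bound spreads to all
  sections by \<open>aut_degree\<close>.\<close>

lemma pre_aut_next:
  assumes pa: "pre_aut (enat k) W \<alpha>" and k: "2 \<le> k"
    and ev: "\<And>V f. even k \<Longrightarrow> open V \<Longrightarrow> V \<subseteq> W \<Longrightarrow> f \<in> osec M V \<Longrightarrow>
      deg_part k (\<alpha> V (fun_sec f) - fun_sec f) = 0"
    and od: "\<And>V v. odd k \<Longrightarrow> open V \<Longrightarrow> V \<subseteq> W \<Longrightarrow> v \<in> vsec M E V \<Longrightarrow>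
      deg_part k (\<alpha> V (vec_sec v) - vec_sec v) = 0"
  shows "pre_aut (enat (Suc k)) W \<alpha>"
proof -
  have step: "degree_ge (Suc k) ((\<alpha> V s - s) x)"
    if V: "open V" "V \<subseteq> W" and s: "s \<in> esec M E V" and z: "\<And>S. card S = k \<Longrightarrow> (\<alpha> V s - s) x S = 0" for V s x
  proof -
    have "degree_ge k ((\<alpha> V s - s) x)"
      using pre_autD(9)[OF pa V s] by (simp add: deg_ge_enat)
    then show ?thesis using z unfolding degree_ge_def by (metis le_neq_implies_less Suc_leI)
  qed
  have fn: "degree_ge (Suc k) ((\<alpha> V (fun_sec f) - fun_sec f) x)"
    if V: "open V" "V \<subseteq> W" and f: "f \<in> osec M V" for V f x
  proof (rule step[OF V esec_fun[OF V(1) f]])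
    fix S :: "nat set" assume S: "card S = k"
    show "(\<alpha> V (fun_sec f) - fun_sec f) x S = 0"
    proof (cases "even k")
      case True
      then show ?thesis using fun_cong[OF fun_cong[OF ev[OF True V f]], of x S] S
        by (simp add: deg_part_def)
    next
      case False
      have "even_sec (\<alpha> V (fun_sec f) - fun_sec f)"
        by (intro even_sec_diff pre_autD(6)[OF pa V] esec_fun V f even_sec_fun)
      then show ?thesis using False S unfolding even_sec_def by blast
    qed
  qed
  have vc: "degree_ge (Suc k) ((\<alpha> V (vec_sec v) - vec_sec v) x)"
    if V: "open V" "V \<subseteq> W" and v: "v \<in> vsec M E V" for V v x
  proof (rule step[OF V esec_vec[OF V(1) v]])
    fix S :: "nat set" assume S: "card S = k"
    show "(\<alpha> V (vec_sec v) - vec_sec v) x S = 0"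
    proof (cases "even k")
      case False
      then show ?thesis using fun_cong[OF fun_cong[OF od[OF False V v]], of x S] S
        by (simp add: deg_part_def)
    next
      case True
      have "odd_sec (\<alpha> V (vec_sec v) - vec_sec v)"
        by (intro odd_sec_diff pre_autD(7)[OF pa V] esec_vec V v odd_sec_vec)
      then show ?thesis using True S unfolding odd_sec_def by blast
    qed
  qed
  have "deg_ge (enat (Suc k)) (\<alpha> V s - s)" if V: "open V" "V \<subseteq> W" and s: "s \<in> esec M E V" for V s
    unfolding deg_ge_enat
  proof
    fix x
    \<comment> \<open>This is \<open>aut_degree\<close> with \<open>d = 0\<close>, which imposes no
      degree on \<open>s\<close>.\<close>
    have "degree_ge (if (0::nat) = 0 then Suc k else 0 + Suc k - 1) ((\<alpha> V s - s) x)"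
    proof (rule aut_degree[OF pa V s])
      show "degree_ge (Suc k) ((\<alpha> V (fun_sec f) - fun_sec f) x)"
        if "open V" "V \<subseteq> W" "f \<in> osec M V" for V f x using fn[OF that] .
      show "degree_ge (Suc k) ((\<alpha> V (vec_sec v) - vec_sec v) x)"
        if "open V" "V \<subseteq> W" "v \<in> vsec M E V" for V v x using vc[OF that] .
    qed simp_all
    then show "degree_ge (Suc k) ((\<alpha> V s - s) x)" by (simp only: if_True refl)
  qed
  then show ?thesis by (rule pre_aut_degree[OF pa order_refl])
qed

text \<open>Since \<open>s - \<alpha> s\<close> has higher degree than \<open>s\<close>, it has a
  preimage \<open>t\<close> by induction, and then \<open>t + s\<close> is a preimage of
  \<open>s\<close>. The induction starts beyond degree \<open>r\<close>, where sections vanish.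
  Parity is carried along to make the inverse parity-preserving.\<close>

lemma aut_inverse_exists:
  assumes pa: "pre_aut j W \<alpha>" and j: "2 \<le> j" and V: "open V" "V \<subseteq> W" and s: "s \<in> esec M E V"
  shows "\<exists>t\<in>esec M E V. \<alpha> V t = s \<and> (even_sec s \<longrightarrow> even_sec t) \<and> (odd_sec s \<longrightarrow> odd_sec t)"
proof -
  have "\<exists>t\<in>esec M E V. \<alpha> V t = s \<and> (even_sec s \<longrightarrow> even_sec t) \<and> (odd_sec s \<longrightarrow> odd_sec t)"
    if "s \<in> esec M E V" "\<And>x. degree_ge (Suc r - n) (s x)" for n s
    using that
  proof (induction n arbitrary: s)
    case 0
    have "s x = 0" for x using degree_ge_top[OF esecD(1)[OF 0(1)]] 0(2) by simp
    then have "s = 0" by (auto simp: fun_eq_iff)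
    then show ?case using 0(1) pre_aut_zero[OF pa V] by metis
  next
    case (Suc n)
    note as = pre_autD(1)[OF pa V Suc.prems(1)]
    define s' where "s' = s - \<alpha> V s"
    have s': "s' \<in> esec M E V" unfolding s'_def by (rule esec_diff[OF V(1) Suc.prems(1) as])
    have "degree_ge (Suc r - n) (s' x)" for x
    proof -
      have "degree_ge (Suc (Suc r - Suc n)) ((\<alpha> V s - s) x)"
        by (rule aut_raises_degree[OF pa j V Suc.prems])
      then have "degree_ge (Suc r - n) ((\<alpha> V s - s) x)" by (rule degree_ge_mono) auto
      moreover have "(\<alpha> V s - s) x S \<noteq> 0" if "s' x S \<noteq> 0" for S using that by (simp add: s'_def)
      ultimately show ?thesis unfolding degree_ge_def by blast
    qed
    with Suc.IH[OF s'] obtain t where t: "t \<in> esec M E V" "\<alpha> V t = s'"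
      "even_sec s' \<longrightarrow> even_sec t" "odd_sec s' \<longrightarrow> odd_sec t" by blast
    have "\<alpha> V (t + s) = s"
      using pre_autD(3)[OF pa V t(1) Suc.prems(1)] t(2) by (simp add: s'_def)
    moreover have "even_sec s \<longrightarrow> even_sec (t + s)"
      using t(3) pre_autD(6)[OF pa V Suc.prems(1)] by (auto simp: s'_def intro!: even_sec_add even_sec_diff)
    moreover have "odd_sec s \<longrightarrow> odd_sec (t + s)"
      using t(4) pre_autD(7)[OF pa V Suc.prems(1)] by (auto simp: s'_def intro!: odd_sec_add odd_sec_diff)
    ultimately show ?case using esec_add[OF V(1) t(1) Suc.prems(1)] by blast
  qed
  from this[of s "Suc r"] show ?thesis using s by simp
qed

text \<open>If \<open>\<alpha> u = 0\<close>, then \<open>-u\<close> is the value of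
  \<open>\<alpha> - id\<close> at \<open>u\<close> and so has higher degree than \<open>u\<close>;
  iteration pushes the degree of \<open>u\<close> beyond the rank.\<close>

lemma aut_injective:
  assumes pa: "pre_aut j W \<alpha>" and j: "2 \<le> j" and V: "open V" "V \<subseteq> W"
  shows "inj_on (\<alpha> V) (esec M E V)"
proof (rule inj_onI)
  fix s t assume st: "s \<in> esec M E V" "t \<in> esec M E V" "\<alpha> V s = \<alpha> V t"
  define u where "u = s - t"
  have u: "u \<in> esec M E V" unfolding u_def by (rule esec_diff[OF V(1) st(1,2)])
  have au: "\<alpha> V u = 0" unfolding u_def using pre_aut_diff[OF pa V st(1,2)] st(3) by simp
  have "degree_ge n (u x)" for n x
  proof (induction n arbitrary: x)
    case (Suc n)
    have "degree_ge (Suc n) ((\<alpha> V u - u) x)" by (rule aut_raises_degree[OF pa j V u Suc.IH])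
    then show ?case by (simp add: au degree_ge_def)
  qed simp
  then have "u x = 0" for x using degree_ge_top[OF esecD(1)[OF u]] by blast
  then have "u = 0" by (auto simp: fun_eq_iff)
  then show "s = t" by (simp add: u_def)
qed

lemma aut_bij:
  assumes "pre_aut j W \<alpha>" "2 \<le> j" "open V" "V \<subseteq> W"
  shows "bij_betw (\<alpha> V) (esec M E V) (esec M E V)"
  unfolding bij_betw_def
proof
  show "inj_on (\<alpha> V) (esec M E V)" by (rule aut_injective[OF assms])
  show "\<alpha> V ` esec M E V = esec M E V"
    using aut_inverse_exists[OF assms] pre_autD(1)[OF assms(1,3,4)] by (force simp: image_iff)
qed

lemma aut_sheaf_iff:
  assumes "2 \<le> j"
  shows "\<alpha> \<in> grp_sec (aut_sheaf M E j) W \<longleftrightarrow> pre_aut j W \<alpha>"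
proof
  assume "\<alpha> \<in> grp_sec (aut_sheaf M E j) W"
  note A = this[unfolded aut_sheaf_def grp_sheaf.select_convs mem_Collect_eq]
  have C: "\<alpha> V s \<in> esec M E V" if "open V \<and> V \<subseteq> W" "s \<in> esec M E V" for V s
    by (rule bij_betw_apply[OF conjunct1[OF mp[OF spec[OF A] that(1)]] that(2)])
  show "pre_aut j W \<alpha>"
    unfolding pre_aut_def aut_on_def
    by (intro allI, rule impI, rule conjI, intro ballI, erule C, assumption,
        rule conjunct2[OF mp[OF spec[OF A]]], assumption)
next
  assume pa: "pre_aut j W \<alpha>"
  show "\<alpha> \<in> grp_sec (aut_sheaf M E j) W"
    unfolding aut_sheaf_def grp_sheaf.select_convs mem_Collect_eq
    by (intro allI, rule impI, rule conjI, elim conjE, erule (1) aut_bij[OF pa assms],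
        rule conjunct2[OF mp[OF spec[OF pa[unfolded pre_aut_def aut_on_def]]]], assumption)
qed

section \<open>Composition, inverses and symbols of automorphisms\<close>

lemma pre_aut_comp:
  assumes a: "pre_aut j W \<alpha>" and b: "pre_aut j W \<beta>"
  shows "pre_aut j W (\<lambda>V s. \<alpha> V (\<beta> V s))"
  unfolding pre_aut_def
proof (intro allI impI)
  fix V assume V: "open V \<and> V \<subseteq> W"
  note A = pre_autD[OF a conjunct1[OF V] conjunct2[OF V]] and B = pre_autD[OF b conjunct1[OF V] conjunct2[OF V]]
  have d: "deg_ge j (\<alpha> V (\<beta> V s) - s)" if "s \<in> esec M E V" for s
  proof -
    have "deg_ge j ((\<alpha> V (\<beta> V s) - \<beta> V s) + (\<beta> V s - s))"
      by (intro deg_ge_add A(9) B(9) B(1) that)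
    then show ?thesis by simp
  qed
  show "aut_on j (\<lambda>V s. \<alpha> V (\<beta> V s)) V"
    by (rule aut_onI) (simp_all add: A(1-8) B(1-8) d)
qed

definition aut_inv :: "'x alg_aut \<Rightarrow> 'x alg_aut" where
  "aut_inv \<alpha> V = inv_into (esec M E V) (\<alpha> V)"

lemma aut_inv:
  assumes "pre_aut j W \<alpha>" "2 \<le> j" "open V" "V \<subseteq> W" "s \<in> esec M E V"
  shows "\<alpha> V (aut_inv \<alpha> V s) = s" "aut_inv \<alpha> V (\<alpha> V s) = s" "aut_inv \<alpha> V s \<in> esec M E V"
  using aut_bij[OF assms(1-4)] assms(5) unfolding aut_inv_def
  by (auto simp: bij_betw_inv_into_right bij_betw_inv_into_left bij_betw_def inv_into_into)

lemma aut_inv_eqI: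
  assumes "pre_aut j W \<alpha>" "2 \<le> j" "open V" "V \<subseteq> W" "t \<in> esec M E V" "\<alpha> V t = s"
  shows "aut_inv \<alpha> V s = t"
  using aut_inv(2)[OF assms(1-5)] assms(6) by simp

text \<open>The algebraic identities hold because the proposed value is a preimage and preimages are
  unique.\<close>

lemma pre_aut_inv:
  assumes a: "pre_aut j W \<alpha>" and j: "2 \<le> j"
  shows "pre_aut j W (aut_inv \<alpha>)"
  unfolding pre_aut_def
proof (intro allI impI)
  fix V assume V': "open V \<and> V \<subseteq> W"
  then have V: "open V" "V \<subseteq> W" by auto
  note A = pre_autD[OF a V] and I = aut_inv[OF a j V] and eqI = aut_inv_eqI[OF a j V]
  have one: "fun_sec (indicator V) \<in> esec M E V" by (rule esec_fun[OF V(1) indicator_osec[OF V(1)]])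
  have n1: "aut_inv \<alpha> V (fun_sec (indicator V)) = fun_sec (indicator V)"
    by (rule eqI[OF one A(2)])
  have n2: "aut_inv \<alpha> V (s + t) = aut_inv \<alpha> V s + aut_inv \<alpha> V t" if "s \<in> esec M E V" "t \<in> esec M E V" for s t
    by (rule eqI[OF esec_add[OF V(1)]]) (simp_all add: I A(3) that)
  have n3: "aut_inv \<alpha> V (wedge_sec s t) = wedge_sec (aut_inv \<alpha> V s) (aut_inv \<alpha> V t)"
    if "s \<in> esec M E V" "t \<in> esec M E V" for s t
    by (rule eqI[OF esec_wedge[OF V(1)]]) (simp_all add: I A(4) that)
  have n4: "aut_inv \<alpha> V (scale_sec (\<lambda>x. c) s) = scale_sec (\<lambda>x. c) (aut_inv \<alpha> V s)"
    if "s \<in> esec M E V" for s c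
    by (rule eqI[OF esec_const_scale[OF V(1)]]) (simp_all add: I A(5) that)
  \<comment> \<open>Uniqueness alone says nothing about parity; it identifies the inverse with the
    preimage of the right parity constructed before.\<close>
  have n5: "(even_sec s \<longrightarrow> even_sec (aut_inv \<alpha> V s)) \<and> (odd_sec s \<longrightarrow> odd_sec (aut_inv \<alpha> V s))"
    if "s \<in> esec M E V" for s
    using aut_inverse_exists[OF a j V that] eqI by metis
  have n6: "aut_inv \<alpha> V' (rsec V' s) = rsec V' (aut_inv \<alpha> V s)"
    if s: "s \<in> esec M E V" and W': "open V'" "V' \<subseteq> V" for s V'
  proof (rule aut_inv_eqI[OF a j W'(1)])
    show "V' \<subseteq> W" using W' V by auto
    show "rsec V' (aut_inv \<alpha> V s) \<in> esec M E V'" by (rule esec_rsec[OF V(1) W' I(3)[OF s]])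
    show "\<alpha> V' (rsec V' (aut_inv \<alpha> V s)) = rsec V' s"
      using A(8)[OF I(3)[OF s] W'] I(1)[OF s] by simp
  qed
  \<comment> \<open>The bound for \<open>\<alpha>\<close> at the preimage of \<open>s\<close> is, up
    to sign, the bound for the inverse at \<open>s\<close>.\<close>
  have n7: "deg_ge j (aut_inv \<alpha> V s - s)" if "s \<in> esec M E V" for s
  proof -
    have "deg_ge j (\<alpha> V (aut_inv \<alpha> V s) - aut_inv \<alpha> V s)" by (rule A(9)[OF I(3)[OF that]])
    then have "deg_ge j (s - aut_inv \<alpha> V s)" by (simp only: I(1)[OF that])
    moreover have "(s - aut_inv \<alpha> V s) x S \<noteq> 0" if "(aut_inv \<alpha> V s - s) x S \<noteq> 0" for x S using that by simp
    ultimately show ?thesis unfolding deg_ge_def by blast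
  qed
  show "aut_on j (aut_inv \<alpha>) V"
    by (rule aut_onI) (simp_all add: I(3) n1 n2 n3 n4 n5[THEN conjunct1, THEN mp] n5[THEN conjunct2, THEN mp] n6 n7)
qed

lemma pre_aut_id: "pre_aut j W (\<lambda>V s. s)"
  by (auto simp: pre_aut_def aut_on_def deg_ge_def)

text \<open>Defined on arbitrary sections, so that additivity under composition is proved once for
  functions and bundle sections.\<close>

definition symbol_part :: "nat \<Rightarrow> 'x alg_aut \<Rightarrow> 'x set \<Rightarrow> 'x extsec \<Rightarrow> 'x extsec" where
  "symbol_part k \<alpha> V s = deg_part k (\<alpha> V s - s)"

text \<open>With A = \<alpha> - id and B = \<beta> - id one has \<alpha>\<beta> - id = AB + A + B.
  Values of B have degree at least \<open>k\<close> and A raises degree, so AB leaves no trace in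
  degree \<open>k\<close>.\<close>

lemma symbol_part_comp:
  assumes a: "pre_aut (enat k) W \<alpha>" and b: "pre_aut (enat k) W \<beta>" and k: "2 \<le> k"
    and V: "open V" "V \<subseteq> W" and s: "s \<in> esec M E V"
  shows "symbol_part k (\<lambda>V s. \<alpha> V (\<beta> V s)) V s = symbol_part k \<alpha> V s + symbol_part k \<beta> V s"
proof -
  define t where "t = \<beta> V s - s"
  have bs: "\<beta> V s \<in> esec M E V" by (rule pre_autD(1)[OF b V s])
  have t: "t \<in> esec M E V" unfolding t_def by (rule esec_diff[OF V(1) bs s])
  have k': "2 \<le> enat k" using k by (simp add: numeral_eq_enat)
  have "degree_ge k (t x)" for x
    using pre_autD(9)[OF b V s] by (simp add: t_def deg_ge_enat)
  from aut_raises_degree[OF a k' V t this]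
  have z: "(\<alpha> V t - t) x S = 0" if "card S = k" for x S
    using that unfolding degree_ge_def by (metis not_less_eq_eq order_refl)
  have eq: "\<alpha> V (\<beta> V s) - s = (\<alpha> V t - t) + ((\<alpha> V s - s) + (\<beta> V s - s))"
    using pre_aut_diff[OF a V bs s] by (simp add: t_def)
  have "deg_part k (\<alpha> V (\<beta> V s) - s) x S = (deg_part k (\<alpha> V s - s) + deg_part k (\<beta> V s - s)) x S" for x S
    unfolding eq using z[of S x] by (simp add: deg_part_def)
  then show ?thesis unfolding symbol_part_def by blast
qed

end

section \<open>Local lifts of sections of the obstruction sheaf\<close>

lemma ext_hom_nonzero:
  assumes "ext_hom r v a T \<noteq> 0"
  obtains S where "S \<subseteq> {..<r}" "finite S" "a S \<noteq> 0" "wedge_prod v S T \<noteq> 0"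
proof -
  have "\<exists>S\<in>Pow {..<r}. a S * wedge_prod v S T \<noteq> 0"
    using assms unfolding ext_hom_def by (rule contrapos_np) (auto intro!: sum.neutral)
  then obtain S where S: "S \<in> Pow {..<r}" "a S * wedge_prod v S T \<noteq> 0" by (rule bexE)
  from S have "S \<subseteq> {..<r}" "a S \<noteq> 0" "wedge_prod v S T \<noteq> 0" by simp_all
  then show ?thesis using that[of S] finite_index[OF S(1)] by simp
qed

lemma ext_hom_parity:
  assumes "\<And>k. k < r \<Longrightarrow> odd_ext (v k)"
  shows "even_ext a \<Longrightarrow> even_ext (ext_hom r v a)" "odd_ext a \<Longrightarrow> odd_ext (ext_hom r v a)"
proof -
  have *: "\<exists>S. a S \<noteq> 0 \<and> (even (card T) \<longleftrightarrow> even (card S))" if "ext_hom r v a T \<noteq> 0" for T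
  proof -
    from that obtain S where S: "S \<subseteq> {..<r}" "finite S" "a S \<noteq> 0" "wedge_prod v S T \<noteq> 0"
      by (rule ext_hom_nonzero)
    have "even (card T) \<longleftrightarrow> even (card S)"
      using S by (intro wedge_prod_parity[of S v] assms) auto
    with S(3) show ?thesis by blast
  qed
  show "even_ext a \<Longrightarrow> even_ext (ext_hom r v a)" using * unfolding even_ext_def by blast
  show "odd_ext a \<Longrightarrow> odd_ext (ext_hom r v a)" using * unfolding odd_ext_def by blast
qed

lemma ext_hom_degree_diff:
  assumes "\<And>k. k < r \<Longrightarrow> degree_ge 1 (v k)" "\<And>k. k < r \<Longrightarrow> degree_ge j (u k - v k)"
  shows "degree_ge j (ext_hom r u a - ext_hom r v a)"
proof -
  have "ext_hom r u a - ext_hom r v a = (\<Sum>S\<in>Pow {..<r}. (\<lambda>T. a S * (wedge_prod u S - wedge_prod v S) T))"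
    by (auto simp: ext_hom_eq sum_fun_apply right_diff_distrib sum_subtractf fun_eq_iff)
  moreover have "degree_ge j (\<Sum>S\<in>Pow {..<r}. (\<lambda>T. a S * (wedge_prod u S - wedge_prod v S) T))"
  proof (intro degree_ge_sum degree_ge_scale)
    fix S assume S: "S \<in> Pow {..<r}"
    show "degree_ge j (wedge_prod u S - wedge_prod v S)"
      using S by (intro degree_ge_wedge_prod_diff[OF finite_index[OF S]] assms) auto
  qed
  ultimately show ?thesis by simp
qed

lemma frame_hom_parity:
  "even_ext a \<Longrightarrow> even_ext (frame_hom r e a)" "odd_ext a \<Longrightarrow> odd_ext (frame_hom r e a)"
  unfolding frame_hom_def by (intro ext_hom_parity odd_ext_vec; assumption)+

lemma frame_hom_degree: "degree_ge d a \<Longrightarrow> degree_ge d (frame_hom r e a)"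
  unfolding degree_ge_def
proof (intro allI impI)
  fix S assume *: "\<forall>S. a S \<noteq> 0 \<longrightarrow> d \<le> card S" "frame_hom r e a S \<noteq> 0"
  from *(2) obtain R where "R \<subseteq> {..<r}" "card R = card S" "a R \<noteq> 0" by (rule frame_hom_card)
  with *(1) show "d \<le> card S" by metis
qed

lemma even_sec_iff: "even_sec s \<longleftrightarrow> (\<forall>x. even_ext (s x))"
  by (simp add: even_sec_def even_ext_def)

lemma odd_sec_iff: "odd_sec s \<longleftrightarrow> (\<forall>x. odd_ext (s x))"
  by (simp add: odd_sec_def odd_ext_def)

lemma parity_zero [simp]: "even_ext 0" "odd_ext 0"
  by (simp_all add: even_ext_def odd_ext_def)

lemma parity_wedge:
  "even_ext a \<Longrightarrow> even_ext b \<Longrightarrow> even_ext (wedge a b)" "even_ext a \<Longrightarrow> odd_ext b \<Longrightarrow> odd_ext (wedge a b)"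
  unfolding even_ext_def odd_ext_def by (metis wedge_nonzero even_add)+

lemma parity_add:
  "even_ext a \<Longrightarrow> even_ext b \<Longrightarrow> even_ext (a + b)" "odd_ext a \<Longrightarrow> odd_ext b \<Longrightarrow> odd_ext (a + b)"
proof -
  have *: "(a + b) S \<noteq> 0 \<Longrightarrow> a S \<noteq> 0 \<or> b S \<noteq> 0" for S by auto
  show "even_ext a \<Longrightarrow> even_ext b \<Longrightarrow> even_ext (a + b)" using * unfolding even_ext_def by blast
  show "odd_ext a \<Longrightarrow> odd_ext b \<Longrightarrow> odd_ext (a + b)" using * unfolding odd_ext_def by blast
qed

context model
begin

lemma frame_coeff_parity:
  assumes "(U, e) \<in> frames E" "x \<in> U" "a \<in> extalg r"
  shows "even_ext a \<Longrightarrow> even_ext (frame_coeff r (\<lambda>k. e k x) a)"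
    "odd_ext a \<Longrightarrow> odd_ext (frame_coeff r (\<lambda>k. e k x) a)"
  using frame_coeff_at(9)[OF assms] unfolding even_ext_def odd_ext_def by metis+

section \<open>Sections of the obstruction sheaf and lifts in odd degree\<close>

lemma obs_sheafD:
  assumes "h \<in> grp_sec (obs_sheaf M E k) W" "open V" "V \<subseteq> W" "s \<in> vsec M (obs_dom M E k) V"
  shows "h V s \<in> esec M E V" "deg_part k (h V s) = h V s"
    "t \<in> vsec M (obs_dom M E k) V \<Longrightarrow> h V (s + t) = h V s + h V t"
    "f \<in> osec M V \<Longrightarrow> h V (scale_sec f s) = scale_sec f (h V s)"
    "open V' \<Longrightarrow> V' \<subseteq> V \<Longrightarrow> h V' (rsec V' s) = rsec V' (h V s)"
proof -
  note A = assms(1)[unfolded obs_sheaf_def grp_sheaf.select_convs mem_Collect_eq]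
  note B = bspec[OF mp[OF spec[OF A, of V] conjI[OF assms(2,3)]] assms(4)]
  show "h V s \<in> esec M E V" "deg_part k (h V s) = h V s"
    "t \<in> vsec M (obs_dom M E k) V \<Longrightarrow> h V (s + t) = h V s + h V t"
    "f \<in> osec M V \<Longrightarrow> h V (scale_sec f s) = scale_sec f (h V s)"
    "open V' \<Longrightarrow> V' \<subseteq> V \<Longrightarrow> h V' (rsec V' s) = rsec V' (h V s)"
    using B by simp_all
qed

lemma obs_zero:
  assumes "h \<in> grp_sec (obs_sheaf M E k) W" "open V" "V \<subseteq> W"
  shows "h V 0 = 0"
  using obs_sheafD(3)[OF assms vsec_zero vsec_zero] by simp

lemma vsec_add: "s \<in> vsec M F W \<Longrightarrow> t \<in> vsec M F W \<Longrightarrow> s + t \<in> vsec M F W"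
  using vsec_add_scale[OF _ _ holo_fun_const[of M W 1], of s F t] by (simp add: scale_sec_def)

lemma vsec_scale: "s \<in> vsec M F W \<Longrightarrow> holo_fun M W f \<Longrightarrow> scale_sec f s \<in> vsec M F W"
  using vsec_add_scale[OF _ vsec_zero] by (simp del: zero_fun_apply plus_fun_apply)

lemma vsec_sum: "(\<And>i. i \<in> I \<Longrightarrow> s i \<in> vsec M F W) \<Longrightarrow> (\<Sum>i\<in>I. s i) \<in> vsec M F W"
  by (induction I rule: infinite_finite_induct) (auto intro: vsec_zero vsec_add)

lemma obs_sum:
  assumes "h \<in> grp_sec (obs_sheaf M E k) W" "open V" "V \<subseteq> W"
    "\<And>i. i \<in> I \<Longrightarrow> s i \<in> vsec M (obs_dom M E k) V"
  shows "h V (\<Sum>i\<in>I. s i) = (\<Sum>i\<in>I. h V (s i))"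
  using assms(4)
proof (induction I rule: infinite_finite_induct)
  case (insert i I)
  have "h V (s i + sum s I) = h V (s i) + h V (sum s I)"
    using insert.prems by (intro obs_sheafD(3)[OF assms(1-3)] vsec_sum) auto
  then show ?case using insert by (simp del: plus_fun_apply)
qed (simp_all add: obs_zero[OF assms(1-3)] del: zero_fun_apply)

text \<open>For odd \<open>k\<close> the elements e_j + h(e_j) are odd, so the universal property
  extends e_j \<mapsto> e_j + h(e_j) to a homomorphism that is linear over functions. It differs
  from the identity in degrees at least \<open>k\<close>, by \<open>h\<close> on the frame.\<close>

lemma odd_lift:
  assumes U: "(U, e) \<in> frames E" and W: "open W" "W \<subseteq> U" and k: "2 \<le> k" "odd k"
    and h: "h \<in> grp_sec (obs_sheaf M E k) W"
  obtains H where "pre_aut (enat k) W H"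
    "\<And>V s. open V \<Longrightarrow> V \<subseteq> W \<Longrightarrow> s \<in> vsec M E V \<Longrightarrow> symbol_part k H V (vec_sec s) = h V s"
proof -
  have dom: "obs_dom M E k = E" using k by (simp add: obs_dom_def)
  have eW: "rsec W (e j) \<in> vsec M E W" if "j < r" for j
    by (rule frame_sec_props(1)[OF U W that])
  define p where "p j = h W (rsec W (e j))" for j
  have p: "p j \<in> esec M E W" "deg_part k (p j) = p j" if "j < r" for j
    using obs_sheafD(1,2)[OF h W(1) order_refl, unfolded dom, OF eW[OF that]] by (simp_all add: p_def)
  have pk: "p j x S = 0" if "j < r" "card S \<noteq> k" for j x S
    using fun_cong[OF fun_cong[OF p(2)[OF that(1)]], of x S] that(2) by (simp add: deg_part_def)
  define u where "u j = vec_sec (rsec W (e j)) + p j" for j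
  have u: "u j \<in> esec M E W" if "j < r" for j
    unfolding u_def by (intro esec_add[OF W(1)] p(1) frame_sec_props(2)[OF U W] that)
  have ux: "u j x = ext_vec (e j x) + p j x" if "x \<in> W" for j x
    using that by (simp add: u_def vec_sec_def rsec_def del: plus_fun_apply) (simp add: plus_fun_def)
  have podd: "odd_ext (p j x)" if "j < r" for j x
    using pk[OF that] k(2) unfolding odd_ext_def by metis
  have uodd: "odd_ext (u j x)" if "j < r" "x \<in> W" for j x
    unfolding ux[OF that(2)] by (intro parity_add(2) odd_ext_vec podd that)
  define c where "c s x = frame_coeff r (\<lambda>j. e j x) (s x)" for s :: "'x extsec" and x
  \<comment> \<open>The argument \<open>V\<close> is ignored and the cut-off is at \<open>W\<close>:
    a section over \<open>V\<close> is zero outside \<open>V\<close>, hence so are its coefficients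
    and its image.\<close>
  define H :: "'x alg_aut" where "H V s = rsec W (\<lambda>x. ext_hom r (\<lambda>j. u j x) (c s x))" for V s
  have Hx: "H V s x = ext_hom r (\<lambda>j. u j x) (c s x)" if "x \<in> W" for V s x
    using that by (simp add: H_def rsec_def)
  have Hx0: "H V s x = 0" if "x \<notin> W" for V s x
    using that by (simp add: H_def rsec_def)
  have cx: "c s x \<in> extalg r" "ext_hom r (\<lambda>j. ext_vec (e j x)) (c s x) = s x"
    if "x \<in> W" "s x \<in> extalg r" for s x
    using frame_coeff_at(1,2)[OF U _ that(2)] that W(2) by (auto simp: c_def frame_hom_def)
  have HC: "H V s \<in> esec M E V" if V: "open V" "V \<subseteq> W" and s: "s \<in> esec M E V" for V s
  proof -
    have "rsec V (\<lambda>x. ext_hom r (\<lambda>j. rsec V (u j) x) (c s x)) \<in> esec M E V"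
    proof (rule esec_ext_hom(1)[OF V(1)])
      show "rsec V (u j) \<in> esec M E V" if "j < r" for j by (rule esec_rsec[OF W(1) V u[OF that]])
      have "U \<inter> V = V" using V W by auto
      then show "holo_fun M V (\<lambda>x. c s x S)" for S
        using esec_coeff[OF V(1) s U, of S] by (simp add: c_def)
    qed
    also have "rsec V (\<lambda>x. ext_hom r (\<lambda>j. rsec V (u j) x) (c s x)) = H V s"
    proof
      fix x
      consider "x \<in> V" | "x \<in> W" "x \<notin> V" | "x \<notin> W" "x \<notin> V" using V(2) by blast
      then show "rsec V (\<lambda>x. ext_hom r (\<lambda>j. rsec V (u j) x) (c s x)) x = H V s x"
      proof cases
        case 1
        then show ?thesis using V(2) Hx by (auto simp: rsec_def)
      next
        case 2
        then have "s x = 0" using esecD(2)[OF s] by simp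
        moreover have "x \<in> U" using 2 W by auto
        ultimately have "c s x = 0" using frame_coeff_at(8)[OF U] by (simp add: c_def del: zero_fun_apply)
        then show ?thesis using 2 Hx[OF 2(1)] by (simp add: rsec_def del: zero_fun_apply)
      qed (simp add: rsec_def Hx0)
    qed
    finally show ?thesis .
  qed
  have Hdeg: "degree_ge k (H V s x - s x)" if "x \<in> W" "s x \<in> extalg r" for V s x
  proof -
    have "degree_ge k (ext_hom r (\<lambda>j. u j x) (c s x) - ext_hom r (\<lambda>j. ext_vec (e j x)) (c s x))"
    proof (rule ext_hom_degree_diff)
      show "degree_ge 1 (ext_vec (e j x))" for j by (auto simp: degree_ge_def ext_vec_def)
      show "degree_ge k (u j x - ext_vec (e j x))" if "j < r" for j
      proof -
        have "u j x - ext_vec (e j x) = p j x" using ux[OF \<open>x \<in> W\<close>] by simp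
        moreover have "degree_ge k (p j x)" using pk[OF that] by (metis degree_ge_def order_refl)
        ultimately show ?thesis by simp
      qed
    qed
    then show ?thesis using cx(2)[of x s] that Hx[OF that(1)] by simp
  qed
  have pa: "pre_aut (enat k) W H"
    unfolding pre_aut_def
  proof (intro allI impI)
    fix V assume "open V \<and> V \<subseteq> W"
    then have V: "open V" "V \<subseteq> W" by auto
    have eqI: "s = t" if "\<And>x. x \<in> W \<Longrightarrow> s x = t x" "\<And>x. x \<notin> W \<Longrightarrow> s x = t x" for s t :: "'x extsec"
      using that by blast
    have xU: "x \<in> U" if "x \<in> W" for x using that W by auto
    have n1: "H V (fun_sec (indicator V)) = fun_sec (indicator V)"
    proof (rule eqI)
      fix x
      show "x \<in> W \<Longrightarrow> H V (fun_sec (indicator V)) x = fun_sec (indicator V) x"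
        using frame_coeff_at(7)[OF U xU, of x] by (simp add: Hx c_def fun_sec_def)
      show "x \<notin> W \<Longrightarrow> H V (fun_sec (indicator V)) x = fun_sec (indicator V) x"
        using V(2) by (auto simp: indicator_def Hx0 fun_sec_def ext_const_def fun_eq_iff)
    qed
    have n2: "H V (s + t) = H V s + H V t" if "s \<in> esec M E V" "t \<in> esec M E V" for s t
    proof (rule eqI)
      fix x
      show "H V (s + t) x = (H V s + H V t) x" if x: "x \<in> W"
        unfolding plus_fun_apply[of "H V s"] Hx[OF x]
        using frame_coeff_at(4)[OF U xU[OF x] esecD(1)[OF \<open>s \<in> _\<close>] esecD(1)[OF \<open>t \<in> _\<close>], of x x]
        by (simp only: c_def plus_fun_apply[of s] ext_hom_add)
      show "x \<notin> W \<Longrightarrow> H V (s + t) x = (H V s + H V t) x" by (simp add: Hx0)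
    qed
    have n3: "H V (wedge_sec s t) = wedge_sec (H V s) (H V t)" if "s \<in> esec M E V" "t \<in> esec M E V" for s t
    proof (rule eqI)
      fix x
      show "H V (wedge_sec s t) x = wedge_sec (H V s) (H V t) x" if x: "x \<in> W"
      proof -
        have "ext_hom r (\<lambda>j. u j x) (wedge (c s x) (c t x)) =
            wedge (ext_hom r (\<lambda>j. u j x) (c s x)) (ext_hom r (\<lambda>j. u j x) (c t x))"
          by (rule ext_hom_wedge) (use uodd x esecD(1)[OF u] in auto)
        then show ?thesis
          using frame_coeff_at(6)[OF U xU[OF x] esecD(1)[OF \<open>s \<in> _\<close>] esecD(1)[OF \<open>t \<in> _\<close>], of x x]
          by (simp add: wedge_sec_def Hx[OF x] c_def)
      qed
      show "x \<notin> W \<Longrightarrow> H V (wedge_sec s t) x = wedge_sec (H V s) (H V t) x"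
        by (simp only: wedge_sec_def Hx0 wedge_zero not_False_eq_True)
    qed
    have n4: "H V (scale_sec (\<lambda>x. a) s) = scale_sec (\<lambda>x. a) (H V s)" if "s \<in> esec M E V" for s a
    proof (rule eqI)
      fix x
      show "H V (scale_sec (\<lambda>x. a) s) x = scale_sec (\<lambda>x. a) (H V s) x" if x: "x \<in> W"
        using frame_coeff_at(5)[OF U xU[OF x] esecD(1)[OF \<open>s \<in> _\<close>], of a x]
        by (simp add: scale_sec_def Hx[OF x] c_def ext_hom_scale)
      show "x \<notin> W \<Longrightarrow> H V (scale_sec (\<lambda>x. a) s) x = scale_sec (\<lambda>x. a) (H V s) x"
        by (auto simp: scale_sec_def Hx0 fun_eq_iff)
    qed
    have n5: "even_sec (H V s)" if "s \<in> esec M E V" "even_sec s" for s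
      unfolding even_sec_iff
    proof
      fix x
      show "even_ext (H V s x)"
      proof (cases "x \<in> W")
        case True
        then show ?thesis
          using ext_hom_parity(1)[of r "\<lambda>j. u j x" "c s x"] uodd
            frame_coeff_parity(1)[OF U xU esecD(1)[OF that(1)], of x x] that(2)
          by (simp add: Hx c_def even_sec_iff)
      qed (simp add: Hx0 del: zero_fun_apply)
    qed
    have n6: "odd_sec (H V s)" if "s \<in> esec M E V" "odd_sec s" for s
      unfolding odd_sec_iff
    proof
      fix x
      show "odd_ext (H V s x)"
      proof (cases "x \<in> W")
        case True
        then show ?thesis
          using ext_hom_parity(2)[of r "\<lambda>j. u j x" "c s x"] uodd
            frame_coeff_parity(2)[OF U xU esecD(1)[OF that(1)], of x x] that(2)
          by (simp add: Hx c_def odd_sec_iff)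
      qed (simp add: Hx0 del: zero_fun_apply)
    qed
    have n7: "H V' (rsec V' s) = rsec V' (H V s)" if "V' \<subseteq> V" for s V'
    proof (rule eqI)
      fix x
      show "H V' (rsec V' s) x = rsec V' (H V s) x" if x: "x \<in> W"
        using frame_coeff_at(8)[OF U xU[OF x]]
        by (cases "x \<in> V'") (simp_all add: Hx[OF x] c_def rsec_def del: zero_fun_apply)
      show "x \<notin> W \<Longrightarrow> H V' (rsec V' s) x = rsec V' (H V s) x"
        by (simp add: Hx0 rsec_def)
    qed
    have n8: "deg_ge (enat k) (H V s - s)" if "s \<in> esec M E V" for s
      unfolding deg_ge_enat
    proof
      fix x
      show "degree_ge k ((H V s - s) x)"
      proof (cases "x \<in> W")
        case True
        then show ?thesis using Hdeg[OF True esecD(1)[OF that], of V] by simp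
      next
        case False
        then have "s x = 0" using esecD(2)[OF that] V by auto
        then have "(H V s - s) x = 0" using Hx0[OF False] by simp
        then show ?thesis by (simp only: degree_ge_zero)
      qed
    qed
    show "aut_on (enat k) H V"
      by (rule aut_onI) (simp_all add: HC[OF V] n1 n2 n3 n4 n5 n6 n7 n8)
  qed
  have sym: "symbol_part k H V (vec_sec s) = h V s" if V: "open V" "V \<subseteq> W" and s: "s \<in> vsec M E V" for V s
  proof -
    have UV: "U \<inter> V = V" using V W by auto
    have "\<exists>c. (\<forall>k<r. holo_fun M (U \<inter> V) (c k)) \<and> (\<forall>x\<in>U \<inter> V. s x = (\<lambda>i. \<Sum>k<r. c k x * e k x i))"
      using s U unfolding vsec_def by blast
    then obtain b where b: "\<And>j. j < r \<Longrightarrow> holo_fun M V (b j)"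
      "\<And>x. x \<in> V \<Longrightarrow> s x = (\<lambda>i. \<Sum>j<r. b j x * e j x i)" unfolding UV by blast
    have b': "rsec V (b j) \<in> osec M V" if "j < r" for j by (rule osec_rsec[OF V(1) b(1)[OF that]])
    have eV: "rsec V (e j) \<in> vsec M E V" if "j < r" for j
      using frame_sec_props(1)[OF U V(1) _ that] V W by auto
    \<comment> \<open>Linearity of \<open>h\<close> over functions reduces its value at
      \<open>s\<close> to the values \<open>p j\<close> on the frame.\<close>
    have s_eq: "s = (\<Sum>j<r. scale_sec (rsec V (b j)) (rsec V (e j)))"
    proof (rule ext, rule ext)
      fix x i
      show "s x i = (\<Sum>j<r. scale_sec (rsec V (b j)) (rsec V (e j))) x i"
      proof (cases "x \<in> V")
        case True
        then show ?thesis by (simp add: b(2) sum_fun_apply scale_sec_def rsec_def)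
      next
        case False
        then show ?thesis using s by (simp add: vsec_def sum_fun_apply scale_sec_def rsec_def)
      qed
    qed
    have "h V (\<Sum>j<r. scale_sec (rsec V (b j)) (rsec V (e j))) =
       (\<Sum>j<r. h V (scale_sec (rsec V (b j)) (rsec V (e j))))"
      using eV osecD(1)[OF b'] by (intro obs_sum[OF h V]) (auto simp: dom intro: vsec_scale)
    also have "\<dots> = (\<Sum>j<r. scale_sec (rsec V (b j)) (rsec V (p j)))"
    proof (rule sum.cong[OF refl])
      fix j assume "j \<in> {..<r}"
      then have j: "j < r" by simp
      have "h V (scale_sec (rsec V (b j)) (rsec V (e j))) = scale_sec (rsec V (b j)) (h V (rsec V (e j)))"
        using obs_sheafD(4)[OF h V, unfolded dom, OF eV[OF j] b'[OF j]] .
      moreover have "h V (rsec V (rsec W (e j))) = rsec V (h W (rsec W (e j)))"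
        using obs_sheafD(5)[OF h W(1) order_refl, unfolded dom, OF eW[OF j] V] .
      moreover have "rsec V (rsec W (e j)) = rsec V (e j)" using V(2) by (auto simp: rsec_def fun_eq_iff)
      ultimately show "h V (scale_sec (rsec V (b j)) (rsec V (e j))) = scale_sec (rsec V (b j)) (rsec V (p j))"
        by (simp add: p_def)
    qed
    finally have hs: "h V s = (\<Sum>j<r. scale_sec (rsec V (b j)) (rsec V (p j)))" using s_eq by simp
    have "H V (vec_sec s) - vec_sec s = h V s"
    proof
      fix x
      show "(H V (vec_sec s) - vec_sec s) x = h V s x"
      proof (cases "x \<in> V")
        case True
        then have x: "x \<in> W" "x \<in> U" using V W by auto
        define b' where "b' j = (if j < r then b j x else 0)" for j
        have b'C: "b' \<in> Cn r" by (simp add: b'_def Cn_def)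
        have "(\<Sum>j<r. b' j * e j x i) = (\<Sum>j<r. b j x * e j x i)" for i
          by (intro sum.cong) (simp_all add: b'_def)
        then have v: "vec_sec s x = frame_hom r (\<lambda>j. e j x) (ext_vec b')"
          using ext_vec_sum[OF b'C, of "\<lambda>j. e j x" r] frame_props(3)[OF U x(2)] b(2)[OF True]
          by (simp add: vec_sec_def)
        have "c (vec_sec s) x = ext_vec b'"
          unfolding c_def v by (rule frame_coeff_at(3)[OF U x(2) extalg_vec[OF b'C]])
        then have "H V (vec_sec s) x = (\<lambda>T. \<Sum>j<r. b' j * u j x T)"
          using ext_hom_vec[OF b'C, of "\<lambda>j. u j x" r] esecD(1)[OF u] Hx[OF x(1)] by simp
        moreover have "vec_sec s x = (\<lambda>T. \<Sum>j<r. b' j * ext_vec (e j x) T)"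
          unfolding v frame_hom_def
          using ext_hom_vec[OF b'C, of "\<lambda>j. ext_vec (e j x)" r] extalg_vec[OF frame_props(3)[OF U x(2)]] by simp
        ultimately have "(H V (vec_sec s) - vec_sec s) x = (\<lambda>T. \<Sum>j<r. b' j * p j x T)"
          by (auto simp: ux[OF x(1)] fun_eq_iff algebra_simps sum.distrib)
        also have "\<dots> = h V s x"
          using True by (auto simp: hs sum_fun_apply scale_sec_def rsec_def b'_def fun_eq_iff intro!: sum.cong)
        finally show ?thesis .
      next
        case False
        have vs: "vec_sec s \<in> esec M E V" by (rule esec_vec[OF V(1) s])
        have "(H V (vec_sec s) - vec_sec s) x = 0"
          using esecD(2)[OF vs False] esecD(2)[OF HC[OF V vs] False] by simp
        moreover have "h V s x = 0"
          using esecD(2)[OF obs_sheafD(1)[OF h V, unfolded dom, OF s] False] .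
        ultimately show ?thesis by simp
      qed
    qed
    then show ?thesis
      unfolding symbol_part_def using obs_sheafD(2)[OF h V, unfolded dom, OF s] by simp
  qed
  from that[OF pa sym] show ?thesis .
qed

end

section \<open>Lifts in even degree\<close>

lemma wedge_unit_square: "T \<noteq> {} \<Longrightarrow> wedge (\<lambda>S. if S = T then 1 else 0) (\<lambda>S. if S = T then 1 else 0) = 0"
proof (rule ext, rule ccontr)
  fix S assume T: "T \<noteq> {}"
    and "wedge (\<lambda>S. if S = T then 1 else 0) (\<lambda>S. if S = T then 1 else 0) S \<noteq> 0 S"
  then have "wedge (\<lambda>S. if S = T then 1 else 0) (\<lambda>S. if S = T then 1 else 0) S \<noteq> 0" by simp
  then obtain R where "finite S" "R \<subseteq> S" "(if R = T then 1 else 0 :: complex) \<noteq> 0"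
    "(if S - R = T then 1 else 0 :: complex) \<noteq> 0" "card S = card R + card (S - R)"
    by (rule wedge_nonzero)
  then have "R = T" "S - R = T" by (auto split: if_splits)
  then show False using T by auto
qed

context model
begin

text \<open>The factor \<open>e\<^sub>T\<close> has square zero, so that \<open>id + e\<^sub>T \<and> D\<close> is multiplicative for a derivation \<open>D\<close>
  of functions, acting on coefficients.\<close>

lemma elementary_lift:
  assumes U: "(U, e) \<in> frames E" and W: "open W" "W \<subseteq> U" and T: "T \<subseteq> {..<r}" "T \<noteq> {}" "even (card T)"
    and D1: "\<And>V f. open V \<Longrightarrow> V \<subseteq> W \<Longrightarrow> f \<in> osec M V \<Longrightarrow> D V f \<in> osec M V"
    and D2: "\<And>V f g. open V \<Longrightarrow> V \<subseteq> W \<Longrightarrow> f \<in> osec M V \<Longrightarrow> g \<in> osec M V \<Longrightarrow> D V (\<lambda>x. f x + g x) = (\<lambda>x. D V f x + D V g x)"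
    and D3: "\<And>V f g. open V \<Longrightarrow> V \<subseteq> W \<Longrightarrow> f \<in> osec M V \<Longrightarrow> g \<in> osec M V \<Longrightarrow>
      D V (\<lambda>x. f x * g x) = (\<lambda>x. D V f x * g x + f x * D V g x)"
    and D4: "\<And>V f a. open V \<Longrightarrow> V \<subseteq> W \<Longrightarrow> f \<in> osec M V \<Longrightarrow> D V (\<lambda>x. a * f x) = (\<lambda>x. a * D V f x)"
    and D5: "\<And>V V' f. open V \<Longrightarrow> V \<subseteq> W \<Longrightarrow> open V' \<Longrightarrow> V' \<subseteq> V \<Longrightarrow> f \<in> osec M V \<Longrightarrow> D V' (rsec V' f) = rsec V' (D V f)"
    and D6: "\<And>V. open V \<Longrightarrow> V \<subseteq> W \<Longrightarrow> D V (indicator V) = (\<lambda>x. 0)"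
  obtains H where "pre_aut (enat (card T)) W H"
    "\<And>V f x. open V \<Longrightarrow> V \<subseteq> W \<Longrightarrow> f \<in> osec M V \<Longrightarrow> (H V (fun_sec f) - fun_sec f) x =
       (if x \<in> V then (\<lambda>S. D V f x * wedge_prod (\<lambda>j. ext_vec (e j x)) T S) else 0)"
proof -
  \<comment> \<open>The frame coefficients of e_T: even, hence central, and of square zero because
    \<open>T\<close> is nonempty.\<close>
  define \<tau> :: ext where "\<tau> = (\<lambda>S. if S = T then 1 else 0)"
  have finT: "finite T" using T(1) finite_subset by blast
  have \<tau>: "even_ext \<tau>" "wedge \<tau> \<tau> = 0" "degree_ge (card T) \<tau>" "\<tau> \<in> extalg r"
    using wedge_unit_square[OF T(2)] T by (auto simp: \<tau>_def even_ext_def degree_ge_def extalg_def)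
  define cf where "cf x a = frame_coeff r (\<lambda>j. e j x) a" for x a
  define fh where "fh x a = frame_hom r (\<lambda>j. e j x) a" for x a
  define co where "co V s S = rsec V (\<lambda>x. cf x (s x) S)" for V S and s :: "'x extsec"
  \<comment> \<open>\<open>D\<close> acts on functions over open sets, not on values at points, so
    the coefficients are first collected into the functions \<open>co V s S\<close>.\<close>
  define cD where "cD V s x = (\<lambda>S. D V (co V s S) x)" for V x and s :: "'x extsec"
  define H :: "'x alg_aut" where "H V s = rsec V (\<lambda>x. fh x (cf x (s x) + wedge \<tau> (cD V s x)))" for V s
  have Hx: "H V s x = fh x (cf x (s x) + wedge \<tau> (cD V s x))" if "x \<in> V" for V s x
    using that by (simp add: H_def rsec_def)
  have Hx0: "H V s x = 0" if "x \<notin> V" for V s x using that by (simp add: H_def rsec_def)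
  \<comment> \<open>Homogeneity with factor 0; additivity on finite sums needs this start.\<close>
  have D0: "D V (\<lambda>x. 0) = (\<lambda>x. 0)" if "open V" "V \<subseteq> W" for V
    using D4[OF that indicator_osec[OF that(1)], of 0] by simp
  have Dsum: "D V (\<lambda>x. \<Sum>i\<in>I. f i x) = (\<lambda>x. \<Sum>i\<in>I. D V (f i) x)"
    if V: "open V" "V \<subseteq> W" and f: "\<And>i. i \<in> I \<Longrightarrow> f i \<in> osec M V" for V I and f :: "nat set \<Rightarrow> 'x \<Rightarrow> complex"
    using f
  proof (induction I rule: infinite_finite_induct)
    case (insert i I)
    have "(\<lambda>x. \<Sum>i\<in>I. f i x) \<in> osec M V"
      using insert.prems by (auto simp: osec_def intro!: holo_fun_sum)
    then show ?case using insert D2[OF V, of "f i" "\<lambda>x. \<Sum>i\<in>I. f i x"] by simp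
  qed (simp_all add: D0[OF V])
  note fc = frame_coeff_at[OF U, folded cf_def fh_def]
  have fhA: "fh x a \<in> extalg r" if "x \<in> U" for x a
    unfolding fh_def using frame_props(3)[OF U that] by (rule frame_hom_extalg)
  have fhW: "fh x (wedge a b) = wedge (fh x a) (fh x b)" if "x \<in> U" for x a b
    unfolding fh_def using frame_props(3)[OF U that] by (rule frame_hom_wedge)
  note fhL = frame_hom_linear[of r "\<lambda>j. e j x" for x, folded fh_def]
  have co: "co V s S \<in> osec M V" if V: "open V" "V \<subseteq> W" and s: "s \<in> esec M E V" for V s S
  proof -
    have "U \<inter> V = V" using V W by auto
    then have "holo_fun M V (\<lambda>x. cf x (s x) S)"
      using esec_coeff[OF V(1) s U, of S] by (simp add: cf_def)
    then show ?thesis unfolding co_def by (rule osec_rsec[OF V(1)])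
  qed
  have xU: "x \<in> U" if "x \<in> V" "V \<subseteq> W" for x V using that W by auto
  have cox: "co V s S x = cf x (s x) S" if "x \<in> V" for V s S x
    using that by (simp add: co_def rsec_def)
  have co0: "co V s S = (\<lambda>x. 0)" if "\<And>x. x \<in> V \<Longrightarrow> cf x (s x) S = 0" for V s S
    using that by (auto simp: co_def rsec_def)
  have cDA: "cD V s x \<in> extalg r" if V: "open V" "V \<subseteq> W" and s: "s \<in> esec M E V" for V s x
    unfolding extalg_def
  proof (intro CollectI allI impI)
    fix S assume S: "\<not> S \<subseteq> {..<r}"
    have "co V s S = (\<lambda>x. 0)"
    proof (rule co0)
      fix y assume "y \<in> V"
      then show "cf y (s y) S = 0" using fc(1)[OF xU[OF _ V(2)] esecD(1)[OF s], of y y] S by (auto simp: extalg_def)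
    qed
    then show "cD V s x S = 0" using D0[OF V] by (simp add: cD_def)
  qed
  have argA: "cf x (s x) + wedge \<tau> (cD V s x) \<in> extalg r"
    if V: "open V" "V \<subseteq> W" "x \<in> V" and s: "s \<in> esec M E V" for V s x
    by (intro extalg_add extalg_wedge \<tau>(4) cDA[OF V(1,2) s] fc(1)[OF xU[OF V(3,2)] esecD(1)[OF s]])
  have HC: "H V s \<in> esec M E V" if V: "open V" "V \<subseteq> W" and s: "s \<in> esec M E V" for V s
  proof -
    have VU: "V \<subseteq> U" using V W by auto
    have "rsec V (\<lambda>x. ext_hom r (\<lambda>j. vec_sec (rsec V (e j)) x) (cf x (s x) + wedge \<tau> (cD V s x))) \<in> esec M E V"
    proof (rule esec_ext_hom(1)[OF V(1) frame_sec_props(2)[OF U V(1) VU]])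
      fix S
      have "holo_fun M V (\<lambda>x. co V s S x + (\<Sum>R\<in>Pow S. shuffle_sign R (S - R) * \<tau> R * D V (co V s (S - R)) x))"
        using osecD(1)[OF co[OF V s]] osecD(1)[OF D1[OF V co[OF V s]]]
        by (intro holo_fun_add holo_fun_sum holo_fun_mult holo_fun_const)
      then show "holo_fun M V (\<lambda>x. (cf x (s x) + wedge \<tau> (cD V s x)) S)"
        by (rule holo_fun_cong[OF M V(1), rotated]) (simp add: cox cD_def wedge_eq)
    qed
    also have "rsec V (\<lambda>x. ext_hom r (\<lambda>j. vec_sec (rsec V (e j)) x) (cf x (s x) + wedge \<tau> (cD V s x))) = H V s"
      unfolding H_def fh_def frame_hom_def by (auto simp: rsec_def vec_sec_def)
    finally show ?thesis .
  qed
  have pa: "pre_aut (enat (card T)) W H"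
    unfolding pre_aut_def
  proof (intro allI impI)
    fix V assume "open V \<and> V \<subseteq> W"
    then have V: "open V" "V \<subseteq> W" by auto
    have eqI: "s = t" if "\<And>x. x \<in> V \<Longrightarrow> s x = t x" "\<And>x. x \<notin> V \<Longrightarrow> s x = t x" for s t :: "'x extsec"
      using that by blast
    have n1: "H V (fun_sec (indicator V)) = fun_sec (indicator V)"
    proof (rule eqI)
      fix x
      show "H V (fun_sec (indicator V)) x = fun_sec (indicator V) x" if x: "x \<in> V"
      proof -
        have cfI: "cf y (fun_sec (indicator V) y) = ext_const (indicator V y)" if "y \<in> V" for y
          using fc(7)[OF xU[OF that V(2)]] by (simp add: fun_sec_def)
        have "co V (fun_sec (indicator V)) S = (if S = {} then indicator V else (\<lambda>x. 0))" for S
          by (auto simp: co_def rsec_def cfI ext_const_def fun_eq_iff)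
        then have "cD V (fun_sec (indicator V)) x = 0"
          by (intro ext) (simp add: cD_def D6[OF V] D0[OF V])
        then have "H V (fun_sec (indicator V)) x = ext_const (indicator V x)"
          by (simp only: Hx[OF x] wedge_zero add_0_right cfI[OF x] fhL(4))
        then show ?thesis by (simp only: fun_sec_def)
      qed
      show "x \<notin> V \<Longrightarrow> H V (fun_sec (indicator V)) x = fun_sec (indicator V) x"
        by (auto simp: Hx0 fun_sec_def ext_const_def fun_eq_iff)
    qed
    have n2: "H V (s + t) = H V s + H V t" if s: "s \<in> esec M E V" and t: "t \<in> esec M E V" for s t
    proof (rule eqI)
      fix x
      show "H V (s + t) x = (H V s + H V t) x" if x: "x \<in> V"
      proof -
        have cfs: "cf y ((s + t) y) = cf y (s y) + cf y (t y)" if "y \<in> V" for y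
          using fc(4)[OF xU[OF that V(2)] esecD(1)[OF s] esecD(1)[OF t], of y y] by (simp only: plus_fun_apply[of s])
        have "co V (s + t) S = (\<lambda>x. co V s S x + co V t S x)" for S
          by (auto simp: co_def rsec_def cfs fun_eq_iff simp del: plus_fun_apply) (simp add: plus_fun_def)
        then have "cD V (s + t) x = cD V s x + cD V t x"
          using D2[OF V co[OF V s] co[OF V t]] by (intro ext) (simp add: cD_def)
        then have "cf x ((s + t) x) + wedge \<tau> (cD V (s + t) x) =
          (cf x (s x) + wedge \<tau> (cD V s x)) + (cf x (t x) + wedge \<tau> (cD V t x))"
          by (simp only: cfs[OF x] wedge_add_right add_ac)
        then show ?thesis
          unfolding plus_fun_apply[of "H V s"] Hx[OF x] by (simp only: fhL(1))
      qed
      show "x \<notin> V \<Longrightarrow> H V (s + t) x = (H V s + H V t) x" by (simp add: Hx0)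
    qed
    have n3: "H V (wedge_sec s t) = wedge_sec (H V s) (H V t)"
      if s: "s \<in> esec M E V" and t: "t \<in> esec M E V" for s t
    proof (rule eqI)
      fix x
      show "H V (wedge_sec s t) x = wedge_sec (H V s) (H V t) x" if x: "x \<in> V"
      proof -
        have cfs: "cf y (wedge_sec s t y) = wedge (cf y (s y)) (cf y (t y))" if "y \<in> V" for y
          using fc(6)[OF xU[OF that V(2)] esecD(1)[OF s] esecD(1)[OF t], of y y] by (simp only: wedge_sec_def)
        \<comment> \<open>A coefficient of a product is a finite signed sum of products of
          coefficients. Additivity, homogeneity and the Leibniz rule of \<open>D\<close> therefore
          give a Leibniz rule for \<open>cD\<close> with respect to \<open>wedge\<close>.\<close>
        let ?g = "\<lambda>S R y. shuffle_sign R (S - R) * (co V s R y * co V t (S - R) y)"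
        have g: "(\<lambda>y. co V s R y * co V t Q y) \<in> osec M V" for R Q
          using co[OF V s, of R] co[OF V t, of Q] by (auto simp: osec_def intro: holo_fun_mult)
        have g': "?g S R \<in> osec M V" for S R
          using g[of R "S - R"] by (auto simp: osec_def intro: holo_fun_mult holo_fun_const)
        have "co V (wedge_sec s t) S = (\<lambda>y. \<Sum>R\<in>Pow S. ?g S R y)" for S
          by (auto simp: co_def rsec_def cfs wedge_eq fun_eq_iff mult.assoc)
        moreover have "D V (\<lambda>y. \<Sum>R\<in>Pow S. ?g S R y) = (\<lambda>y. \<Sum>R\<in>Pow S. D V (?g S R) y)" for S
          by (rule Dsum[OF V]) (rule g')
        ultimately have "cD V (wedge_sec s t) x S = (\<Sum>R\<in>Pow S. D V (?g S R) x)" for S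
          by (simp add: cD_def)
        moreover have "D V (?g S R) x = shuffle_sign R (S - R) * cD V s x R * cf x (t x) (S - R) +
            shuffle_sign R (S - R) * cf x (s x) R * cD V t x (S - R)" for S R
          using D4[OF V g, of "shuffle_sign R (S - R)" R "S - R"] D3[OF V co[OF V s] co[OF V t], of R "S - R"]
          by (simp add: cD_def cox[OF x] algebra_simps)
        ultimately have cDw: "cD V (wedge_sec s t) x = wedge (cD V s x) (cf x (t x)) + wedge (cf x (s x)) (cD V t x)"
          by (auto simp: fun_eq_iff wedge_eq sum.distrib)
        let ?a = "cf x (s x)" and ?b = "cf x (t x)" and ?p = "cD V s x" and ?q = "cD V t x"
        \<comment> \<open>Moving the two central factors together produces
          \<open>wedge \<tau> \<tau>\<close>, so the quadratic term drops out of the product of the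
          two images.\<close>
        have z: "wedge (wedge \<tau> ?p) (wedge \<tau> ?q) = 0"
        proof -
          have "wedge (wedge \<tau> ?p) (wedge \<tau> ?q) = wedge (wedge ?p (wedge \<tau> \<tau>)) ?q"
            by (simp only: wedge_even_commute[OF \<tau>(1), of ?p] wedge_assoc)
          then show ?thesis by (simp only: \<tau>(2) wedge_zero)
        qed
        have "wedge ?a (wedge \<tau> ?q) = wedge \<tau> (wedge ?a ?q)"
          by (simp only: wedge_assoc[symmetric] wedge_even_commute[OF \<tau>(1), of ?a])
        then have "wedge (?a + wedge \<tau> ?p) (?b + wedge \<tau> ?q) =
          wedge ?a ?b + wedge \<tau> (wedge ?p ?b + wedge ?a ?q)"
          by (simp only: wedge_add_left wedge_add_right z[unfolded wedge_assoc] wedge_assoc add_ac add_0 add_0_right)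
        then have "fh x (cf x (wedge_sec s t x) + wedge \<tau> (cD V (wedge_sec s t) x)) =
          wedge (fh x (?a + wedge \<tau> ?p)) (fh x (?b + wedge \<tau> ?q))"
          by (simp only: fhW[OF xU[OF x V(2)], symmetric] cfs[OF x] cDw)
        then show ?thesis by (simp only: wedge_sec_def Hx[OF x])
      qed
      show "x \<notin> V \<Longrightarrow> H V (wedge_sec s t) x = wedge_sec (H V s) (H V t) x"
        by (simp only: wedge_sec_def Hx0 wedge_zero not_False_eq_True)
    qed
    have n4: "H V (scale_sec (\<lambda>x. a) s) = scale_sec (\<lambda>x. a) (H V s)" if s: "s \<in> esec M E V" for s a
    proof (rule eqI)
      fix x
      show "H V (scale_sec (\<lambda>x. a) s) x = scale_sec (\<lambda>x. a) (H V s) x" if x: "x \<in> V"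
      proof -
        have cfs: "cf y (scale_sec (\<lambda>x. a) s y) = (\<lambda>S. a * cf y (s y) S)" if "y \<in> V" for y
          using fc(5)[OF xU[OF that V(2)] esecD(1)[OF s], of a y] by (simp only: scale_sec_def)
        have "co V (scale_sec (\<lambda>x. a) s) S = (\<lambda>x. a * co V s S x)" for S
          by (auto simp: co_def rsec_def cfs fun_eq_iff)
        then have "cD V (scale_sec (\<lambda>x. a) s) x = (\<lambda>S. a * cD V s x S)"
          using D4[OF V co[OF V s]] by (intro ext) (simp add: cD_def)
        then have "cf x (scale_sec (\<lambda>x. a) s x) + wedge \<tau> (cD V (scale_sec (\<lambda>x. a) s) x) =
          (\<lambda>S. a * (cf x (s x) + wedge \<tau> (cD V s x)) S)"
          by (intro ext) (simp add: cfs[OF x] wedge_scale_right distrib_left)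
        then have "H V (scale_sec (\<lambda>x. a) s) x = (\<lambda>S. a * H V s x S)"
          unfolding Hx[OF x] by (simp only: fhL(2))
        then show ?thesis by (simp add: scale_sec_def)
      qed
      show "x \<notin> V \<Longrightarrow> H V (scale_sec (\<lambda>x. a) s) x = scale_sec (\<lambda>x. a) (H V s) x"
        by (auto simp: scale_sec_def Hx0 fun_eq_iff)
    qed
    have n5: "even_sec (H V s)" if s: "s \<in> esec M E V" and ev: "even_sec s" for s
      unfolding even_sec_iff
    proof
      fix x
      show "even_ext (H V s x)"
      proof (cases "x \<in> V")
        case True
        have ec: "even_ext (cf y (s y))" if "y \<in> V" for y
          using frame_coeff_parity(1)[OF U xU[OF that V(2)] esecD(1)[OF s], of y] ev
          by (simp add: cf_def even_sec_iff)
        have "even_ext (cD V s x)"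
          unfolding even_ext_def
        proof (intro allI impI, rule ccontr)
          fix S :: "nat set" assume S: "cD V s x S \<noteq> 0" "odd (card S)"
          have "co V s S = (\<lambda>x. 0)" using ec S(2) unfolding even_ext_def by (intro co0) blast
          then show False using S(1) D0[OF V] by (simp add: cD_def)
        qed
        then have "even_ext (cf x (s x) + wedge \<tau> (cD V s x))"
          by (intro parity_add parity_wedge \<tau>(1) ec[OF True])
        then show ?thesis unfolding Hx[OF True] fh_def by (rule frame_hom_parity)
      qed (simp only: Hx0 parity_zero not_False_eq_True)
    qed
    have n6: "odd_sec (H V s)" if s: "s \<in> esec M E V" and od: "odd_sec s" for s
      unfolding odd_sec_iff
    proof
      fix x
      show "odd_ext (H V s x)"
      proof (cases "x \<in> V")
        case True
        have ec: "odd_ext (cf y (s y))" if "y \<in> V" for y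
          using frame_coeff_parity(2)[OF U xU[OF that V(2)] esecD(1)[OF s], of y] od
          by (simp add: cf_def odd_sec_iff)
        have "odd_ext (cD V s x)"
          unfolding odd_ext_def
        proof (intro allI impI notI)
          fix S :: "nat set" assume S: "cD V s x S \<noteq> 0" "even (card S)"
          have "co V s S = (\<lambda>x. 0)" using ec S(2) unfolding odd_ext_def by (intro co0) blast
          then show False using S(1) D0[OF V] by (simp add: cD_def)
        qed
        then have "odd_ext (cf x (s x) + wedge \<tau> (cD V s x))"
          by (intro parity_add parity_wedge \<tau>(1) ec[OF True])
        then show ?thesis unfolding Hx[OF True] fh_def by (rule frame_hom_parity)
      qed (simp only: Hx0 parity_zero not_False_eq_True)
    qed
    have n7: "H V' (rsec V' s) = rsec V' (H V s)" if s: "s \<in> esec M E V" and V': "open V'" "V' \<subseteq> V" for s V'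
    proof
      fix x
      show "H V' (rsec V' s) x = rsec V' (H V s) x"
      proof (cases "x \<in> V'")
        case True
        have "co V' (rsec V' s) S = rsec V' (co V s S)" for S
          using V'(2) by (auto simp: co_def rsec_def fun_eq_iff)
        then have "cD V' (rsec V' s) x = cD V s x"
          using D5[OF V V' co[OF V s]] True by (auto simp: cD_def rsec_def)
        then show ?thesis using True V' by (simp add: Hx rsec_def subset_iff)
      qed (simp add: Hx0 rsec_def)
    qed
    have n8: "deg_ge (enat (card T)) (H V s - s)" if s: "s \<in> esec M E V" for s
      unfolding deg_ge_enat
    proof
      fix x
      show "degree_ge (card T) ((H V s - s) x)"
      proof (cases "x \<in> V")
        case True
        have "(H V s - s) x = fh x (wedge \<tau> (cD V s x))"
          using fc(2)[OF xU[OF True V(2)] esecD(1)[OF s], of x] by (simp add: Hx[OF True] fhL(1))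
        moreover have "degree_ge (card T + 0) (wedge \<tau> (cD V s x))"
          by (intro degree_ge_wedge \<tau>(3) degree_ge_zero)
        ultimately show ?thesis using frame_hom_degree by (simp add: fh_def)
      next
        case False
        then have "(H V s - s) x = 0" using esecD(2)[OF s False] by (simp add: Hx0)
        then show ?thesis by (simp only: degree_ge_zero)
      qed
    qed
    show "aut_on (enat (card T)) H V"
      by (rule aut_onI) (simp_all add: HC[OF V] n1 n2 n3 n4 n5 n6 n7 n8)
  qed
  have "(H V (fun_sec f) - fun_sec f) x =
       (if x \<in> V then (\<lambda>S. D V f x * wedge_prod (\<lambda>j. ext_vec (e j x)) T S) else 0)"
    if V: "open V" "V \<subseteq> W" and f: "f \<in> osec M V" for V f x
  proof (cases "x \<in> V")
    case True
    have cff: "cf y (fun_sec f y) = ext_const (f y)" if "y \<in> V" for y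
      using fc(7)[OF xU[OF that V(2)]] by (simp add: fun_sec_def)
    have "co V (fun_sec f) S = (if S = {} then f else (\<lambda>x. 0))" for S
      using osecD(2)[OF f] by (auto simp: co_def rsec_def cff ext_const_def fun_eq_iff)
    then have "cD V (fun_sec f) x = ext_const (D V f x)"
      by (intro ext) (simp add: cD_def D0[OF V] ext_const_def)
    moreover have "wedge \<tau> (ext_const a) = (\<lambda>S. a * \<tau> S)" for a
      by (intro ext wedge_const_right) (rule extalg_infinite[OF \<tau>(4)])
    ultimately have "H V (fun_sec f) x = ext_const (f x) + (\<lambda>S. D V f x * fh x \<tau> S)"
      unfolding Hx[OF True] fhL(1) cff[OF True] fhL(4) by (simp only: fhL(2))
    moreover have "fh x \<tau> = wedge_prod (\<lambda>j. ext_vec (e j x)) T"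
    proof
      fix S
      have "fh x \<tau> S = (\<Sum>R\<in>Pow {..<r}. if R = T then wedge_prod (\<lambda>j. ext_vec (e j x)) T S else 0)"
        unfolding fh_def frame_hom_def ext_hom_def by (rule sum.cong) (auto simp: \<tau>_def)
      also have "\<dots> = wedge_prod (\<lambda>j. ext_vec (e j x)) T S"
        using T(1) by (subst sum.delta) auto
      finally show "fh x \<tau> S = wedge_prod (\<lambda>j. ext_vec (e j x)) T S" .
    qed
    ultimately show ?thesis using True by (auto simp: fun_sec_def fun_eq_iff)
  next
    case False
    then show ?thesis using Hx0[OF False] osecD(2)[OF f False] by (auto simp: fun_sec_def ext_const_def fun_eq_iff)
  qed
  from that[OF pa this] show ?thesis .
qed


lemma osec_const_mult: "f \<in> osec M V \<Longrightarrow> (\<lambda>x. a * f x) \<in> osec M V"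
  by (auto simp: osec_def intro: holo_fun_mult holo_fun_const)

lemma symbol_part_cong: "(\<And>x. (\<alpha> V s - s) x = p x) \<Longrightarrow> symbol_part k \<alpha> V s = deg_part k p"
proof -
  assume "\<And>x. (\<alpha> V s - s) x = p x"
  then have "\<alpha> V s - s = p" by (rule ext)
  then show ?thesis by (simp only: symbol_part_def)
qed

text \<open>Each component of f \<mapsto> h(df) along e_T with \<open>card T = k\<close> has an
  elementary lift; \<open>2 \<le> k\<close> and \<open>even k\<close> make \<open>T\<close> nonempty
  and of even size, as required there. Symbols add under composition, so the composite over all such
  \<open>T\<close> has symbol h(df).\<close>

lemma even_lift:
  assumes U: "(U, e) \<in> frames E" and W: "open W" "W \<subseteq> U" and k: "2 \<le> k" "even k"
    and h: "h \<in> grp_sec (obs_sheaf M E k) W"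
  obtains H where "pre_aut (enat k) W H"
    "\<And>V f. open V \<Longrightarrow> V \<subseteq> W \<Longrightarrow> f \<in> osec M V \<Longrightarrow>
      symbol_part k H V (fun_sec f) = h V (rsec V (differential M f))"
proof -
  have dom: "obs_dom M E k = cotangent M" using k by (simp add: obs_dom_def)
  define d where "d V f = rsec V (differential M f)" for V f
  have dC: "d V f \<in> vsec M (cotangent M) V" if "open V" "f \<in> osec M V" for V f
    unfolding d_def by (rule differential_in_vsec[OF M that(1) osecD(1)[OF that(2)]])
  have hd: "h V (d V f) \<in> esec M E V" "deg_part k (h V (d V f)) = h V (d V f)"
    if "open V" "V \<subseteq> W" "f \<in> osec M V" for V f
    using obs_sheafD(1,2)[OF h that(1,2), unfolded dom, OF dC[OF that(1,3)]] by simp_all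
  \<comment> \<open>The coefficient of h(df) at the frame product indexed by \<open>T\<close>: a
    derivation from functions to functions.\<close>
  define D where "D T V f = rsec V (\<lambda>x. frame_coeff r (\<lambda>j. e j x) (h V (d V f) x) T)" for T V f
  have xU: "x \<in> U" if "x \<in> V" "V \<subseteq> W" for x V using that W by auto
  have D1: "D T V f \<in> osec M V" if V: "open V" "V \<subseteq> W" and f: "f \<in> osec M V" for T V f
  proof -
    have "U \<inter> V = V" using V W by auto
    then show ?thesis unfolding D_def
      using osec_rsec[OF V(1)] esec_coeff[OF V(1) hd(1)[OF V f] U, of T] by simp
  qed
  \<comment> \<open>One transfer rule for all derivation laws: a linear relation among differentials
    with function coefficients passes through \<open>h\<close> and the frame coordinates. The sum,
    constant-multiple and product rules are instances.\<close>
  have dlin: "D T V f = (\<lambda>x. a x * D T V g x + b x * D T V g' x)"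
    if V: "open V" "V \<subseteq> W" and f: "f \<in> osec M V" and g: "g \<in> osec M V" and g': "g' \<in> osec M V"
      and a: "a \<in> osec M V" and b: "b \<in> osec M V"
      and eq: "d V f = scale_sec a (d V g) + scale_sec b (d V g')" for T V f g g' a b
  proof
    fix x
    have "h V (d V f) = scale_sec a (h V (d V g)) + scale_sec b (h V (d V g'))"
      unfolding eq using dC[OF V(1) g] dC[OF V(1) g'] osecD(1)[OF a] osecD(1)[OF b]
      by (simp add: obs_sheafD(3,4)[OF h V, unfolded dom] vsec_scale a b)
    then have *: "h V (d V f) x = (\<lambda>S. a x * h V (d V g) x S) + (\<lambda>S. b x * h V (d V g') x S)"
      by (auto simp: scale_sec_def fun_eq_iff)
    note gx = esecD(1)[OF hd(1)[OF V g], of x] and g'x = esecD(1)[OF hd(1)[OF V g'], of x]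
    show "D T V f x = a x * D T V g x + b x * D T V g' x"
    proof (cases "x \<in> V")
      case True
      note fc = frame_coeff_at[OF U xU[OF True V(2)]]
      have "frame_coeff r (\<lambda>j. e j x) (h V (d V f) x) =
          (\<lambda>S. a x * frame_coeff r (\<lambda>j. e j x) (h V (d V g) x) S) +
          (\<lambda>S. b x * frame_coeff r (\<lambda>j. e j x) (h V (d V g') x) S)"
        unfolding * fc(4)[OF extalg_scale[OF gx] extalg_scale[OF g'x]] fc(5)[OF gx] fc(5)[OF g'x] ..
      then show ?thesis using True by (simp add: D_def rsec_def)
    qed (simp add: D_def rsec_def)
  qed
  have one: "indicator V \<in> osec M V" if "open V" for V by (rule indicator_osec[OF that])
  have D0: "D T V (indicator V) = (\<lambda>x. 0)" if V: "open V" "V \<subseteq> W" for T V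
  proof -
    have "d V (indicator V) = 0"
    proof
      fix x
      show "d V (indicator V) x = 0 x"
        using differential_cong[OF M V(1), of x "indicator V" "\<lambda>x. 1"] differential_const[OF M, of 1 x]
        by (cases "x \<in> V") (simp_all add: d_def rsec_def indicator_def)
    qed
    then have z: "h V (d V (indicator V)) = 0" using obs_zero[OF h V] by simp
    show ?thesis
    proof
      fix x
      show "D T V (indicator V) x = 0"
        using frame_coeff_at(8)[OF U xU[OF _ V(2)], of x] unfolding D_def z
        by (cases "x \<in> V") (simp_all add: rsec_def)
    qed
  qed
  have elem: "\<exists>H. pre_aut (enat (card T)) W H \<and> (\<forall>V f x. open V \<and> V \<subseteq> W \<and> f \<in> osec M V \<longrightarrow>
      (H V (fun_sec f) - fun_sec f) x =
       (if x \<in> V then (\<lambda>S. D T V f x * wedge_prod (\<lambda>j. ext_vec (e j x)) T S) else 0))"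
    if T: "T \<subseteq> {..<r}" "T \<noteq> {}" "even (card T)" for T
  proof (rule elementary_lift[OF U W T, of "D T"])
      fix V assume V: "open V" "V \<subseteq> W"
      show "D T V (indicator V) = (\<lambda>x. 0)" by (rule D0[OF V])
      fix f assume f: "f \<in> osec M V"
      show "D T V f \<in> osec M V" by (rule D1[OF V f])
      show "D T V (\<lambda>x. a * f x) = (\<lambda>x. a * D T V f x)" for a
      proof -
        \<comment> \<open>Scaling in \<open>obs_sheaf\<close> is by elements of
          \<open>osec M V\<close>, which vanish outside \<open>V\<close>; hence the constant is cut
          off.\<close>
        have af: "(\<lambda>x. a * indicator V x) \<in> osec M V" by (rule osec_const_mult[OF one[OF V(1)]])
        have "d V (\<lambda>x. a * f x) = scale_sec (\<lambda>x. a * indicator V x) (d V f) + scale_sec (\<lambda>x. 0) (d V f)"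
        proof (rule ext, rule ext)
          fix x i
          show "d V (\<lambda>x. a * f x) x i = (scale_sec (\<lambda>x. a * indicator V x) (d V f) + scale_sec (\<lambda>x. 0) (d V f)) x i"
            using differential_mult[OF M _ holo_fun_const osecD(1)[OF f], of x a] differential_const[OF M, of a x]
            by (cases "x \<in> V") (simp_all add: d_def rsec_def scale_sec_def)
        qed
        moreover have "(\<lambda>x. 0) \<in> osec M V" by (auto simp: osec_def holo_fun_const)
        ultimately have "D T V (\<lambda>x. a * f x) = (\<lambda>x. (a * indicator V x) * D T V f x + 0 * D T V f x)"
          by (intro dlin[OF V osec_const_mult[OF f] f f af]) auto
        also have "\<dots> = (\<lambda>x. a * D T V f x)"
          using osecD(2)[OF D1[OF V f]] by (auto simp: indicator_def fun_eq_iff)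
        finally show ?thesis .
      qed
      show "D T V' (rsec V' f) = rsec V' (D T V f)" if V': "open V'" "V' \<subseteq> V" for V'
      proof -
        have "d V' (rsec V' f) = rsec V' (d V f)"
        proof
          fix x
          show "d V' (rsec V' f) x = rsec V' (d V f) x"
            using differential_cong[OF M V'(1), of x "rsec V' f" f] V'(2)
            by (cases "x \<in> V'") (auto simp: d_def rsec_def)
        qed
        then have eq: "h V' (d V' (rsec V' f)) = rsec V' (h V (d V f))"
          using obs_sheafD(5)[OF h V, unfolded dom, OF dC[OF V(1) f] V'] by simp
        have rin: "rsec A s x = s x" if "x \<in> A" for A x and s :: "'x \<Rightarrow> 'v::zero"
          using that by (simp add: rsec_def)
        show ?thesis
        proof
          fix x
          show "D T V' (rsec V' f) x = rsec V' (D T V f) x"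
          proof (cases "x \<in> V'")
            case True
            moreover from this have "x \<in> V" using V'(2) by auto
            ultimately show ?thesis by (simp only: D_def rin eq)
          qed (simp add: D_def rsec_def)
        qed
      qed
      fix g assume g: "g \<in> osec M V"
      show "D T V (\<lambda>x. f x + g x) = (\<lambda>x. D T V f x + D T V g x)"
      proof -
        have fg: "(\<lambda>x. f x + g x) \<in> osec M V" using f g by (auto simp: osec_def intro: holo_fun_add)
        have "d V (\<lambda>x. f x + g x) = scale_sec (indicator V) (d V f) + scale_sec (indicator V) (d V g)"
        proof (rule ext, rule ext)
          fix x i
          show "d V (\<lambda>x. f x + g x) x i = (scale_sec (indicator V) (d V f) + scale_sec (indicator V) (d V g)) x i"
            using differential_add[OF M _ osecD(1)[OF f] osecD(1)[OF g], of x]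
            by (cases "x \<in> V") (simp_all add: d_def rsec_def scale_sec_def)
        qed
        from dlin[OF V fg f g one[OF V(1)] one[OF V(1)] this]
        have "D T V (\<lambda>x. f x + g x) = (\<lambda>x. indicator V x * D T V f x + indicator V x * D T V g x)" .
        also have "\<dots> = (\<lambda>x. D T V f x + D T V g x)"
          using osecD(2)[OF D1[OF V f]] osecD(2)[OF D1[OF V g]] by (auto simp: indicator_def fun_eq_iff)
        finally show ?thesis .
      qed
      show "D T V (\<lambda>x. f x * g x) = (\<lambda>x. D T V f x * g x + f x * D T V g x)"
      proof -
        have fg: "(\<lambda>x. f x * g x) \<in> osec M V" using f g by (auto simp: osec_def intro: holo_fun_mult)
        have "d V (\<lambda>x. f x * g x) = scale_sec g (d V f) + scale_sec f (d V g)"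
        proof (rule ext, rule ext)
          fix x i
          show "d V (\<lambda>x. f x * g x) x i = (scale_sec g (d V f) + scale_sec f (d V g)) x i"
            using differential_mult[OF M _ osecD(1)[OF f] osecD(1)[OF g], of x]
            by (cases "x \<in> V") (simp_all add: d_def rsec_def scale_sec_def)
        qed
        from dlin[OF V fg f g g f this] show ?thesis by (simp add: mult.commute)
      qed
  next
    fix H assume "pre_aut (enat (card T)) W H"
      "\<And>V f x. open V \<Longrightarrow> V \<subseteq> W \<Longrightarrow> f \<in> osec M V \<Longrightarrow> (H V (fun_sec f) - fun_sec f) x =
       (if x \<in> V then (\<lambda>S. D T V f x * wedge_prod (\<lambda>j. ext_vec (e j x)) T S) else 0)"
    then show ?thesis by blast
  qed
  define X where "X T V f = rsec V (\<lambda>x S. D T V f x * wedge_prod (\<lambda>j. ext_vec (e j x)) T S)" for T V f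
  let ?I = "{T. T \<subseteq> {..<r} \<and> card T = k}"
  \<comment> \<open>Induction over a finite set of frame products. The lifts need not commute, but
    their symbols add in any order.\<close>
  have "\<exists>H. pre_aut (enat k) W H \<and> (\<forall>V f. open V \<and> V \<subseteq> W \<and> f \<in> osec M V \<longrightarrow>
      symbol_part k H V (fun_sec f) = (\<Sum>T\<in>F. X T V f))" if "finite F" "F \<subseteq> ?I" for F
    using that
  proof (induction F rule: finite_induct)
    case empty
    have "symbol_part k (\<lambda>V s. s) V (fun_sec f) = 0" for V f
      by (auto simp: symbol_part_def deg_part_def fun_eq_iff)
    then show ?case using pre_aut_id by (intro exI[of _ "\<lambda>V s. s"]) auto
  next
    case (insert T F)
    then obtain H where H: "pre_aut (enat k) W H"
      "\<And>V f. open V \<Longrightarrow> V \<subseteq> W \<Longrightarrow> f \<in> osec M V \<Longrightarrow> symbol_part k H V (fun_sec f) = (\<Sum>T\<in>F. X T V f)" by auto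
    have T: "T \<subseteq> {..<r}" "card T = k" using insert.prems by auto
    then have "T \<noteq> {}" "even (card T)" using k by auto
    from elem[OF T(1) this] obtain G where G: "pre_aut (enat k) W G"
      "\<And>V f x. open V \<Longrightarrow> V \<subseteq> W \<Longrightarrow> f \<in> osec M V \<Longrightarrow> (G V (fun_sec f) - fun_sec f) x =
       (if x \<in> V then (\<lambda>S. D T V f x * wedge_prod (\<lambda>j. ext_vec (e j x)) T S) else 0)"
      unfolding T(2) by blast
    have symG: "symbol_part k G V (fun_sec f) = X T V f" if "open V" "V \<subseteq> W" "f \<in> osec M V" for V f
    proof -
      have "(G V (fun_sec f) - fun_sec f) x = X T V f x" for x
        unfolding G(2)[OF that] by (simp add: X_def rsec_def)
      then have "symbol_part k G V (fun_sec f) = deg_part k (X T V f)" by (rule symbol_part_cong)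
      also have "\<dots> = X T V f"
      proof (rule ext, rule ext)
        fix x S
        have "finite T" using T(1) finite_subset by blast
        then have "wedge_prod (\<lambda>j. ext_vec (e j x)) T S = 0" if "card S \<noteq> k"
          using wedge_prod_vec_card[of T "\<lambda>j. e j x" S] T(2) that by auto
        then show "deg_part k (X T V f) x S = X T V f x S"
          by (auto simp: deg_part_def X_def rsec_def)
      qed
      finally show ?thesis .
    qed
    have "symbol_part k (\<lambda>V s. G V (H V s)) V (fun_sec f) = (\<Sum>T\<in>insert T F. X T V f)"
      if V: "open V" "V \<subseteq> W" and f: "f \<in> osec M V" for V f
      using symbol_part_comp[OF G(1) H(1) k(1) V esec_fun[OF V(1) f]] symG[OF V f] H(2)[OF V f] insert.hyps
      by (simp del: plus_fun_apply)
    then show ?case using pre_aut_comp[OF G(1) H(1)] by blast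
  qed
  from this[of ?I] obtain H where H: "pre_aut (enat k) W H"
    "\<And>V f. open V \<Longrightarrow> V \<subseteq> W \<Longrightarrow> f \<in> osec M V \<Longrightarrow> symbol_part k H V (fun_sec f) = (\<Sum>T\<in>?I. X T V f)" by auto
  have "(\<Sum>T\<in>?I. X T V f) = h V (d V f)" if V: "open V" "V \<subseteq> W" and f: "f \<in> osec M V" for V f
  proof (rule ext, rule ext)
    fix x S
    show "(\<Sum>T\<in>?I. X T V f) x S = h V (d V f) x S"
    proof (cases "x \<in> V")
      case True
      note fc = frame_coeff_at[OF U xU[OF True V(2)]]
      let ?c = "frame_coeff r (\<lambda>j. e j x) (h V (d V f) x)"
      note hx = esecD(1)[OF hd(1)[OF V f], of x]
      \<comment> \<open>\<open>h\<close> has values in degree \<open>k\<close> and frame coordinates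
        preserve degree, so the sum over \<open>?I\<close> is already the full frame
        expansion.\<close>
      have "?c T = 0" if "card T \<noteq> k" for T
      proof (rule ccontr)
        assume "?c T \<noteq> 0"
        then obtain R where R: "card R = card T" "h V (d V f) x R \<noteq> 0" using fc(9)[OF hx] by blast
        have "deg_part k (h V (d V f)) x R \<noteq> 0" using R(2) hd(2)[OF V f] by simp
        then show False using R(1) that by (auto simp: deg_part_def split: if_splits)
      qed
      then have "(\<Sum>T\<in>?I. ?c T * wedge_prod (\<lambda>j. ext_vec (e j x)) T S) =
          (\<Sum>T\<in>Pow {..<r}. ?c T * wedge_prod (\<lambda>j. ext_vec (e j x)) T S)"
        by (intro sum.mono_neutral_left) auto
      also have "\<dots> = frame_hom r (\<lambda>j. e j x) ?c S" by (simp add: frame_hom_def ext_hom_def)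
      also have "\<dots> = h V (d V f) x S" by (simp add: fc(2)[OF hx])
      finally show ?thesis using True by (simp add: sum_fun_apply X_def D_def rsec_def)
    next
      case False
      then show ?thesis using esecD(2)[OF hd(1)[OF V f] False] by (simp add: sum_fun_apply X_def rsec_def)
    qed
  qed
  with H that show ?thesis unfolding d_def by simp
qed

end

section \<open>\v{C}ech cohomology classes\<close>

text \<open>Covers are indexed by their own members, and the same set may arise from several
  intersections; the refinement maps are therefore chosen.\<close>

lemma common_refinement:
  assumes "open_cover \<V>1" "open_cover \<V>2"
  obtains \<V> \<pi>1 \<pi>2 where "refinement \<V> \<pi>1 \<V>1" "refinement \<V> \<pi>2 \<V>2"
proof -
  define \<V> where "\<V> = {V1 \<inter> V2 | V1 V2. V1 \<in> \<V>1 \<and> V2 \<in> \<V>2}"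
  have "\<forall>V\<in>\<V>. \<exists>V1 V2. V1 \<in> \<V>1 \<and> V2 \<in> \<V>2 \<and> V \<subseteq> V1 \<and> V \<subseteq> V2" unfolding \<V>_def by blast
  then obtain \<pi>1 \<pi>2 where \<pi>: "\<forall>V\<in>\<V>. \<pi>1 V \<in> \<V>1 \<and> \<pi>2 V \<in> \<V>2 \<and> V \<subseteq> \<pi>1 V \<and> V \<subseteq> \<pi>2 V" by metis
  have "\<forall>V\<in>\<V>. open V" using assms unfolding \<V>_def open_cover_def by blast
  moreover have "\<Union>\<V> = UNIV"
  proof -
    have "x \<in> \<Union>\<V>" for x
    proof -
      obtain V1 V2 where "x \<in> V1" "V1 \<in> \<V>1" "x \<in> V2" "V2 \<in> \<V>2"
        using assms unfolding open_cover_def by (metis UNIV_I UnionE)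
      then have "x \<in> V1 \<inter> V2" "V1 \<inter> V2 \<in> \<V>" unfolding \<V>_def by auto
      then show ?thesis by (rule UnionI[rotated])
    qed
    then show ?thesis by auto
  qed
  ultimately have "open_cover \<V>" by (simp add: open_cover_def)
  then have "refinement \<V> \<pi>1 \<V>1" "refinement \<V> \<pi>2 \<V>2" using \<pi> unfolding refinement_def by blast+
  then show ?thesis by (rule that)
qed

lemma refinementD: "refinement \<V> \<tau> \<U> \<Longrightarrow> V \<in> \<V> \<Longrightarrow> \<tau> V \<in> \<U>" "refinement \<V> \<tau> \<U> \<Longrightarrow> V \<in> \<V> \<Longrightarrow> V \<subseteq> \<tau> V"
  by (auto simp: refinement_def)

lemma refinement_comp: "refinement \<V> \<pi> \<V>1 \<Longrightarrow> refinement \<V>1 \<tau> \<U> \<Longrightarrow> refinement \<V> (\<lambda>V. \<tau> (\<pi> V)) \<U>"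
  unfolding refinement_def by (meson order_trans)

lemma cech_relI:
  assumes "(\<U>, g) \<in> cech_cocycles G" "(\<U>', g') \<in> cech_cocycles G"
    "refinement \<V> \<tau> \<U>" "refinement \<V> \<tau>' \<U>'" "\<And>V. V \<in> \<V> \<Longrightarrow> h V \<in> grp_sec G V"
    "\<And>V W. V \<in> \<V> \<Longrightarrow> W \<in> \<V> \<Longrightarrow> grp_eq G (V \<inter> W)
           (grp_mul G (g' (\<tau>' V) (\<tau>' W)) (h W)) (grp_mul G (h V) (g (\<tau> V) (\<tau> W)))"
  shows "((\<U>, g), (\<U>', g')) \<in> cech_rel G"
  using assms unfolding cech_rel_def by blast

lemma cech_relE:
  assumes "((\<U>, g), (\<U>', g')) \<in> cech_rel G"
  obtains \<V> \<tau> \<tau>' h where "(\<U>, g) \<in> cech_cocycles G" "(\<U>', g') \<in> cech_cocycles G"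
    "refinement \<V> \<tau> \<U>" "refinement \<V> \<tau>' \<U>'" "\<forall>V\<in>\<V>. h V \<in> grp_sec G V"
    "\<forall>V\<in>\<V>. \<forall>W\<in>\<V>. grp_eq G (V \<inter> W)
           (grp_mul G (g' (\<tau>' V) (\<tau>' W)) (h W)) (grp_mul G (h V) (g (\<tau> V) (\<tau> W)))"
  using assms unfolding cech_rel_def by blast

text \<open>Elements are families whose values over sets not in \<open>W\<close> are irrelevant to
  \<open>W\<close>, so inverses exist only up to \<open>grp_eq\<close>, while associativity and the
  unit laws hold literally. In \<open>mul_cong\<close>, membership of \<open>b'\<close> matters for
  composition: \<open>a\<close> and \<open>a'\<close> can be compared at values of \<open>b'\<close>
  only if these are sections.\<close>

locale group_sheaf =
  fixes G :: "('x::topological_space, 'g) grp_sheaf" and one :: 'g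
  assumes sec_sub: "a \<in> grp_sec G W \<Longrightarrow> W' \<subseteq> W \<Longrightarrow> a \<in> grp_sec G W'"
    and eq_sub: "grp_eq G W a b \<Longrightarrow> W' \<subseteq> W \<Longrightarrow> grp_eq G W' a b"
    and eq_refl: "grp_eq G W a a"
    and eq_sym: "grp_eq G W a b \<Longrightarrow> grp_eq G W b a"
    and eq_trans: "grp_eq G W a b \<Longrightarrow> grp_eq G W b c \<Longrightarrow> grp_eq G W a c"
    and mul_sec: "a \<in> grp_sec G W \<Longrightarrow> b \<in> grp_sec G W \<Longrightarrow> grp_mul G a b \<in> grp_sec G W"
    and mul_cong: "a \<in> grp_sec G W \<Longrightarrow> b \<in> grp_sec G W \<Longrightarrow> b' \<in> grp_sec G W \<Longrightarrow>
      grp_eq G W a a' \<Longrightarrow> grp_eq G W b b' \<Longrightarrow> grp_eq G W (grp_mul G a b) (grp_mul G a' b')"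
    and mul_assoc: "grp_mul G (grp_mul G a b) c = grp_mul G a (grp_mul G b c)"
    and one_sec: "one \<in> grp_sec G W"
    and mul_one: "grp_mul G a one = a" "grp_mul G one a = a"
    and inverse_ex: "a \<in> grp_sec G W \<Longrightarrow>
      \<exists>b\<in>grp_sec G W. grp_eq G W (grp_mul G a b) one \<and> grp_eq G W (grp_mul G b a) one"
begin

lemma cocycleD:
  assumes "(\<U>, g) \<in> cech_cocycles G"
  shows "open_cover \<U>" "U \<in> \<U> \<Longrightarrow> V \<in> \<U> \<Longrightarrow> X \<subseteq> U \<inter> V \<Longrightarrow> g U V \<in> grp_sec G X"
    "U \<in> \<U> \<Longrightarrow> V \<in> \<U> \<Longrightarrow> W \<in> \<U> \<Longrightarrow> X \<subseteq> U \<inter> V \<inter> W \<Longrightarrow> grp_eq G X (grp_mul G (g U V) (g V W)) (g U W)"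
  using assms sec_sub eq_sub unfolding cech_cocycles_def by blast+

lemma cech_rel_refl:
  assumes "p \<in> cech_cocycles G" shows "(p, p) \<in> cech_rel G"
proof -
  obtain \<U> g where p: "p = (\<U>, g)" by (cases p)
  have "refinement \<U> id \<U>" using cocycleD(1) assms p by (auto simp: refinement_def)
  then show ?thesis unfolding p using assms p
    by (intro cech_relI[where \<V> = \<U> and \<tau> = id and \<tau>' = id and h = "\<lambda>V. one"])
      (auto simp: mul_one eq_refl one_sec)
qed

text \<open>The relation g' h_W = h_V g is multiplied by an inverse of h_V on the left and of h_W on
  the right.\<close>

lemma cech_rel_sym:
  assumes "(p, q) \<in> cech_rel G" shows "(q, p) \<in> cech_rel G"
proof -
  obtain \<U> g \<U>' g' where pq: "p = (\<U>, g)" "q = (\<U>', g')" by (cases p, cases q)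
  from assms[unfolded pq] obtain \<V> \<tau> \<tau>' h where c: "(\<U>, g) \<in> cech_cocycles G" "(\<U>', g') \<in> cech_cocycles G"
    and rf: "refinement \<V> \<tau> \<U>" "refinement \<V> \<tau>' \<U>'" and h': "\<forall>V\<in>\<V>. h V \<in> grp_sec G V"
    and rel': "\<forall>V\<in>\<V>. \<forall>W\<in>\<V>. grp_eq G (V \<inter> W)
           (grp_mul G (g' (\<tau>' V) (\<tau>' W)) (h W)) (grp_mul G (h V) (g (\<tau> V) (\<tau> W)))"
    by (rule cech_relE)
  note h = bspec[OF h'] and rel = bspec[OF bspec[OF rel']]
  define k where "k V = (SOME b. b \<in> grp_sec G V \<and> grp_eq G V (grp_mul G (h V) b) one \<and> grp_eq G V (grp_mul G b (h V)) one)" for V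
  have k: "k V \<in> grp_sec G V" "grp_eq G V (grp_mul G (h V) (k V)) one" "grp_eq G V (grp_mul G (k V) (h V)) one"
    if "V \<in> \<V>" for V
  proof -
    have "\<exists>b. b \<in> grp_sec G V \<and> grp_eq G V (grp_mul G (h V) b) one \<and> grp_eq G V (grp_mul G b (h V)) one"
      using inverse_ex[OF h[OF that]] by blast
    from someI_ex[OF this] show "k V \<in> grp_sec G V" "grp_eq G V (grp_mul G (h V) (k V)) one" "grp_eq G V (grp_mul G (k V) (h V)) one"
      unfolding k_def by blast+
  qed
  show ?thesis unfolding pq
  proof (rule cech_relI[OF c(2,1) rf(2,1) k(1)])
    fix V W assume VW: "V \<in> \<V>" "W \<in> \<V>"
    let ?X = "V \<inter> W" let ?g = "g (\<tau> V) (\<tau> W)" let ?g' = "g' (\<tau>' V) (\<tau>' W)"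
    have sub: "?X \<subseteq> \<tau> V \<inter> \<tau> W" "?X \<subseteq> \<tau>' V \<inter> \<tau>' W" and m: "\<tau> V \<in> \<U>" "\<tau> W \<in> \<U>" "\<tau>' V \<in> \<U>'" "\<tau>' W \<in> \<U>'"
      using rf VW unfolding refinement_def by blast+
    have s: "?g \<in> grp_sec G ?X" "?g' \<in> grp_sec G ?X" "h V \<in> grp_sec G ?X" "h W \<in> grp_sec G ?X" "k V \<in> grp_sec G ?X" "k W \<in> grp_sec G ?X"
      using cocycleD(2)[OF c(1) m(1,2) sub(1)] cocycleD(2)[OF c(2) m(3,4) sub(2)]
        sec_sub[OF h[OF VW(1)]] sec_sub[OF h[OF VW(2)]] sec_sub[OF k(1)[OF VW(1)]] sec_sub[OF k(1)[OF VW(2)]] by simp_all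
    have kV: "grp_eq G ?X (grp_mul G (k V) (h V)) one" using k(3)[OF VW(1)] by (rule eq_sub) simp
    have kW: "grp_eq G ?X (grp_mul G (h W) (k W)) one" using k(2)[OF VW(2)] by (rule eq_sub) simp
    let ?a = "grp_mul G (k V) (grp_mul G (grp_mul G (h V) ?g) (k W))"
    let ?b = "grp_mul G (k V) (grp_mul G (grp_mul G ?g' (h W)) (k W))"
    have "grp_eq G ?X ?b ?a"
      by (rule mul_cong[OF s(5) _ _ eq_refl]) (rule mul_sec mul_cong[OF _ _ _ rel[OF VW] eq_refl] s)+
    moreover have "grp_eq G ?X ?a (grp_mul G ?g (k W))"
    proof -
      have "?a = grp_mul G (grp_mul G (k V) (h V)) (grp_mul G ?g (k W))" by (simp add: mul_assoc)
      moreover have "grp_eq G ?X (grp_mul G (grp_mul G (k V) (h V)) (grp_mul G ?g (k W))) (grp_mul G one (grp_mul G ?g (k W)))"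
        by (rule mul_cong[OF _ _ _ kV eq_refl]) (rule mul_sec s)+
      ultimately show ?thesis by (simp add: mul_one)
    qed
    moreover have "grp_eq G ?X ?b (grp_mul G (k V) ?g')"
    proof -
      have "?b = grp_mul G (grp_mul G (k V) ?g') (grp_mul G (h W) (k W))" by (simp add: mul_assoc)
      moreover have "grp_eq G ?X (grp_mul G (grp_mul G (k V) ?g') (grp_mul G (h W) (k W))) (grp_mul G (grp_mul G (k V) ?g') one)"
        by (rule mul_cong[OF _ _ _ eq_refl kW]) (rule mul_sec s one_sec)+
      ultimately show ?thesis by (simp add: mul_one)
    qed
    ultimately show "grp_eq G ?X (grp_mul G ?g (k W)) (grp_mul G (k V) ?g')"
      using eq_sym eq_trans by blast
  qed
qed

text \<open>On a common refinement the two relations see the middle cocycle through different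
  refinement maps. Its value between the two indices of a set is inserted between \<open>h2\<close>
  and \<open>h1\<close> to compensate.\<close>

lemma cech_rel_trans:
  assumes "(p, q) \<in> cech_rel G" "(q, s) \<in> cech_rel G" shows "(p, s) \<in> cech_rel G"
proof -
  obtain \<U>1 g1 \<U>2 g2 \<U>3 g3 where pq: "p = (\<U>1, g1)" "q = (\<U>2, g2)" "s = (\<U>3, g3)" by (cases p, cases q, cases s)
  from assms(1)[unfolded pq] obtain \<V>1 \<tau>1 \<tau>1' h1 where c: "(\<U>1, g1) \<in> cech_cocycles G" "(\<U>2, g2) \<in> cech_cocycles G"
    and rf1: "refinement \<V>1 \<tau>1 \<U>1" "refinement \<V>1 \<tau>1' \<U>2" and h1': "\<forall>V\<in>\<V>1. h1 V \<in> grp_sec G V"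
    and rel1': "\<forall>V\<in>\<V>1. \<forall>W\<in>\<V>1. grp_eq G (V \<inter> W)
           (grp_mul G (g2 (\<tau>1' V) (\<tau>1' W)) (h1 W)) (grp_mul G (h1 V) (g1 (\<tau>1 V) (\<tau>1 W)))"
    by (rule cech_relE)
  from assms(2)[unfolded pq] obtain \<V>2 \<tau>2 \<tau>2' h2 where c3: "(\<U>2, g2) \<in> cech_cocycles G" "(\<U>3, g3) \<in> cech_cocycles G"
    and rf2: "refinement \<V>2 \<tau>2 \<U>2" "refinement \<V>2 \<tau>2' \<U>3" and h2': "\<forall>V\<in>\<V>2. h2 V \<in> grp_sec G V"
    and rel2': "\<forall>V\<in>\<V>2. \<forall>W\<in>\<V>2. grp_eq G (V \<inter> W)
           (grp_mul G (g3 (\<tau>2' V) (\<tau>2' W)) (h2 W)) (grp_mul G (h2 V) (g2 (\<tau>2 V) (\<tau>2 W)))"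
    by (rule cech_relE)
  note h1 = bspec[OF h1'] and rel1 = bspec[OF bspec[OF rel1']]
  note h2 = bspec[OF h2'] and rel2 = bspec[OF bspec[OF rel2']]
  obtain \<V> \<pi>1 \<pi>2 where \<pi>: "refinement \<V> \<pi>1 \<V>1" "refinement \<V> \<pi>2 \<V>2"
    by (rule common_refinement[of \<V>1 \<V>2]) (use rf1 rf2 in \<open>auto simp: refinement_def\<close>)
  have P: "\<pi>1 V \<in> \<V>1" "\<pi>2 V \<in> \<V>2" "V \<subseteq> \<pi>1 V" "V \<subseteq> \<pi>2 V" "\<tau>1 (\<pi>1 V) \<in> \<U>1" "\<tau>1' (\<pi>1 V) \<in> \<U>2" "\<tau>2 (\<pi>2 V) \<in> \<U>2" "\<tau>2' (\<pi>2 V) \<in> \<U>3"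
    "V \<subseteq> \<tau>1 (\<pi>1 V)" "V \<subseteq> \<tau>1' (\<pi>1 V)" "V \<subseteq> \<tau>2 (\<pi>2 V)" "V \<subseteq> \<tau>2' (\<pi>2 V)" if "V \<in> \<V>" for V
  proof -
    note a = refinementD[OF \<pi>(1) that] and b = refinementD[OF \<pi>(2) that]
    show "\<pi>1 V \<in> \<V>1" "\<pi>2 V \<in> \<V>2" "V \<subseteq> \<pi>1 V" "V \<subseteq> \<pi>2 V" by (rule a b)+
    show "\<tau>1 (\<pi>1 V) \<in> \<U>1" "\<tau>1' (\<pi>1 V) \<in> \<U>2" "\<tau>2 (\<pi>2 V) \<in> \<U>2" "\<tau>2' (\<pi>2 V) \<in> \<U>3"
      by (rule refinementD[OF rf1(1) a(1)] refinementD[OF rf1(2) a(1)]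
          refinementD[OF rf2(1) b(1)] refinementD[OF rf2(2) b(1)])+
    show "V \<subseteq> \<tau>1 (\<pi>1 V)" "V \<subseteq> \<tau>1' (\<pi>1 V)" "V \<subseteq> \<tau>2 (\<pi>2 V)" "V \<subseteq> \<tau>2' (\<pi>2 V)"
      using a(2) b(2) refinementD(2)[OF rf1(1) a(1)] refinementD(2)[OF rf1(2) a(1)]
          refinementD(2)[OF rf2(1) b(1)] refinementD(2)[OF rf2(2) b(1)] by simp_all
  qed
  define h where "h V = grp_mul G (h2 (\<pi>2 V)) (grp_mul G (g2 (\<tau>2 (\<pi>2 V)) (\<tau>1' (\<pi>1 V))) (h1 (\<pi>1 V)))" for V
  show ?thesis unfolding pq
  proof (rule cech_relI[OF c(1) c3(2) refinement_comp[OF \<pi>(1) rf1(1)] refinement_comp[OF \<pi>(2) rf2(2)]])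
    fix V assume V: "V \<in> \<V>"
    show "h V \<in> grp_sec G V" unfolding h_def
      using sec_sub[OF h2 P(4)[OF V]] sec_sub[OF h1 P(3)[OF V]] P[OF V]
        cocycleD(2)[OF c(2), of "\<tau>2 (\<pi>2 V)" "\<tau>1' (\<pi>1 V)" V] by (intro mul_sec) auto
    fix W assume W: "W \<in> \<V>"
    let ?X = "V \<inter> W"
    note PV = P[OF V] and PW = P[OF W]
    let ?g1 = "g1 (\<tau>1 (\<pi>1 V)) (\<tau>1 (\<pi>1 W))" and ?g3 = "g3 (\<tau>2' (\<pi>2 V)) (\<tau>2' (\<pi>2 W))"
    let ?a = "g2 (\<tau>2 (\<pi>2 V)) (\<tau>1' (\<pi>1 V))" and ?b = "g2 (\<tau>2 (\<pi>2 W)) (\<tau>1' (\<pi>1 W))"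
    let ?c = "g2 (\<tau>2 (\<pi>2 V)) (\<tau>2 (\<pi>2 W))" and ?d = "g2 (\<tau>1' (\<pi>1 V)) (\<tau>1' (\<pi>1 W))"
    let ?e = "g2 (\<tau>2 (\<pi>2 V)) (\<tau>1' (\<pi>1 W))"
    let ?hV1 = "h1 (\<pi>1 V)" and ?hW1 = "h1 (\<pi>1 W)" and ?hV2 = "h2 (\<pi>2 V)" and ?hW2 = "h2 (\<pi>2 W)"
    have sh: "?hV1 \<in> grp_sec G ?X" "?hW1 \<in> grp_sec G ?X" "?hV2 \<in> grp_sec G ?X" "?hW2 \<in> grp_sec G ?X"
      using PV PW by (auto intro: sec_sub[OF h1] sec_sub[OF h2])
    have sg: "?a \<in> grp_sec G ?X" "?b \<in> grp_sec G ?X" "?c \<in> grp_sec G ?X" "?d \<in> grp_sec G ?X" "?e \<in> grp_sec G ?X"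
      using PV PW by (auto intro!: cocycleD(2)[OF c(2)])
    have sg': "?g1 \<in> grp_sec G ?X" "?g3 \<in> grp_sec G ?X"
      using PV PW by (auto intro!: cocycleD(2)[OF c(1)] cocycleD(2)[OF c3(2)])
    note s = sh sg sg'
    have r1: "grp_eq G ?X (grp_mul G ?d ?hW1) (grp_mul G ?hV1 ?g1)"
      by (rule eq_sub[OF rel1[OF PV(1) PW(1)]]) (use PV PW in auto)
    have r2: "grp_eq G ?X (grp_mul G ?g3 ?hW2) (grp_mul G ?hV2 ?c)"
      by (rule eq_sub[OF rel2[OF PV(2) PW(2)]]) (use PV PW in auto)
    have r3: "grp_eq G ?X (grp_mul G ?c ?b) ?e" by (rule cocycleD(3)[OF c(2)]) (use PV PW in auto)
    have r4: "grp_eq G ?X (grp_mul G ?a ?d) ?e" by (rule cocycleD(3)[OF c(2)]) (use PV PW in auto)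
    \<comment> \<open>The chain is g3 h2 b h1 = h2 c b h1 = h2 e h1 = h2 a d h1 = h2 a h1 g1, by
      \<open>r2\<close>, \<open>r3\<close>, \<open>r4\<close> and \<open>r1\<close>.\<close>
    have "grp_eq G ?X (grp_mul G (grp_mul G ?g3 ?hW2) (grp_mul G ?b ?hW1)) (grp_mul G (grp_mul G ?hV2 ?c) (grp_mul G ?b ?hW1))"
      by (rule mul_cong[OF _ _ _ r2 eq_refl]) (rule mul_sec s)+
    moreover have "grp_eq G ?X (grp_mul G ?hV2 (grp_mul G (grp_mul G ?c ?b) ?hW1)) (grp_mul G ?hV2 (grp_mul G ?e ?hW1))"
      by (rule mul_cong[OF _ _ _ eq_refl mul_cong[OF _ _ _ r3 eq_refl]]) (rule mul_sec s)+
    moreover have "grp_eq G ?X (grp_mul G ?hV2 (grp_mul G (grp_mul G ?a ?d) ?hW1)) (grp_mul G ?hV2 (grp_mul G ?e ?hW1))"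
      by (rule mul_cong[OF _ _ _ eq_refl mul_cong[OF _ _ _ r4 eq_refl]]) (rule mul_sec s)+
    moreover have "grp_eq G ?X (grp_mul G (grp_mul G ?hV2 ?a) (grp_mul G ?d ?hW1)) (grp_mul G (grp_mul G ?hV2 ?a) (grp_mul G ?hV1 ?g1))"
      by (rule mul_cong[OF _ _ _ eq_refl r1]) (rule mul_sec s)+
    ultimately have "grp_eq G ?X (grp_mul G ?g3 (grp_mul G ?hW2 (grp_mul G ?b ?hW1))) (grp_mul G ?hV2 (grp_mul G ?a (grp_mul G ?hV1 ?g1)))"
      unfolding mul_assoc using eq_trans eq_sym by blast
    then show "grp_eq G ?X (grp_mul G ?g3 (h W)) (grp_mul G (h V) ?g1)"
      unfolding h_def mul_assoc .
  qed
qed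

text \<open>A trivialisation on one refinement moves to any finer cover and any refinement map into
  \<open>\<U>\<close>: multiply by the cocycle between the new and the old index. This allows
  trivialisations of two cocycles to be compared on one cover.\<close>

lemma trivial_class_refine:
  assumes c: "(\<U>, g) \<in> cech_cocycles G"
    and rf1: "refinement \<V>1 \<tau>1 \<U>" and h1: "\<And>V. V \<in> \<V>1 \<Longrightarrow> h1 V \<in> grp_sec G V"
    and rel1: "\<And>V W. V \<in> \<V>1 \<Longrightarrow> W \<in> \<V>1 \<Longrightarrow> grp_eq G (V \<inter> W) (grp_mul G (g (\<tau>1 V) (\<tau>1 W)) (h1 W)) (h1 V)"
    and rf: "refinement \<V> \<pi> \<V>1" "refinement \<V> \<tau> \<U>"
  obtains h where "\<And>V. V \<in> \<V> \<Longrightarrow> h V \<in> grp_sec G V"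
    "\<And>V W. V \<in> \<V> \<Longrightarrow> W \<in> \<V> \<Longrightarrow> grp_eq G (V \<inter> W) (grp_mul G (g (\<tau> V) (\<tau> W)) (h W)) (h V)"
proof -
  have P: "\<pi> V \<in> \<V>1" "V \<subseteq> \<pi> V" "\<tau>1 (\<pi> V) \<in> \<U>" "V \<subseteq> \<tau>1 (\<pi> V)" "\<tau> V \<in> \<U>" "V \<subseteq> \<tau> V" if "V \<in> \<V>" for V
    using rf rf1 that unfolding refinement_def by (blast intro: order_trans)+
  define h where "h V = grp_mul G (g (\<tau> V) (\<tau>1 (\<pi> V))) (h1 (\<pi> V))" for V
  have hs: "h V \<in> grp_sec G V" if V: "V \<in> \<V>" for V unfolding h_def
    using sec_sub[OF h1 P(2)[OF V]] P[OF V] cocycleD(2)[OF c, of "\<tau> V" "\<tau>1 (\<pi> V)" V] by (intro mul_sec) auto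
  have "grp_eq G (V \<inter> W) (grp_mul G (g (\<tau> V) (\<tau> W)) (h W)) (h V)" if V: "V \<in> \<V>" and W: "W \<in> \<V>" for V W
  proof -
    let ?X = "V \<inter> W"
    note PV = P[OF V] and PW = P[OF W]
    let ?a = "g (\<tau> V) (\<tau> W)" and ?b = "g (\<tau> W) (\<tau>1 (\<pi> W))" and ?c = "g (\<tau> V) (\<tau>1 (\<pi> W))"
    let ?d = "g (\<tau> V) (\<tau>1 (\<pi> V))" and ?e = "g (\<tau>1 (\<pi> V)) (\<tau>1 (\<pi> W))"
    have s: "?a \<in> grp_sec G ?X" "?b \<in> grp_sec G ?X" "?c \<in> grp_sec G ?X" "?d \<in> grp_sec G ?X" "?e \<in> grp_sec G ?X"
      "h1 (\<pi> V) \<in> grp_sec G ?X" "h1 (\<pi> W) \<in> grp_sec G ?X"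
      using PV PW by (auto intro!: cocycleD(2)[OF c] intro: sec_sub[OF h1])
    have r: "grp_eq G ?X (grp_mul G ?e (h1 (\<pi> W))) (h1 (\<pi> V))"
      by (rule eq_sub[OF rel1[OF PV(1) PW(1)]]) (use PV PW in auto)
    have r1: "grp_eq G ?X (grp_mul G ?a ?b) ?c" by (rule cocycleD(3)[OF c]) (use PV PW in auto)
    have r2: "grp_eq G ?X (grp_mul G ?d ?e) ?c" by (rule cocycleD(3)[OF c]) (use PV PW in auto)
    have "grp_eq G ?X (grp_mul G (grp_mul G ?a ?b) (h1 (\<pi> W))) (grp_mul G ?c (h1 (\<pi> W)))"
      by (rule mul_cong[OF _ _ _ r1 eq_refl]) (rule mul_sec s)+
    moreover have "grp_eq G ?X (grp_mul G (grp_mul G ?d ?e) (h1 (\<pi> W))) (grp_mul G ?c (h1 (\<pi> W)))"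
      by (rule mul_cong[OF _ _ _ r2 eq_refl]) (rule mul_sec s)+
    moreover have "grp_eq G ?X (grp_mul G ?d (grp_mul G ?e (h1 (\<pi> W)))) (grp_mul G ?d (h1 (\<pi> V)))"
      by (rule mul_cong[OF _ _ _ eq_refl r]) (rule mul_sec s)+
    ultimately show ?thesis unfolding h_def mul_assoc using eq_trans eq_sym by blast
  qed
  with hs that show ?thesis by blast
qed

end

section \<open>Automorphisms and obstructions as sheaves of groups\<close>

lemma grp_eq_aut: "grp_eq (aut_sheaf M E j) W \<alpha> \<beta> \<longleftrightarrow>
    (\<forall>V. open V \<and> V \<subseteq> W \<longrightarrow> (\<forall>s\<in>esec M E V. \<alpha> V s = \<beta> V s))"
  and grp_mul_aut: "grp_mul (aut_sheaf M E j) \<alpha> \<beta> = (\<lambda>V s. \<alpha> V (\<beta> V s))"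
  by (simp_all add: aut_sheaf_def)

lemma grp_eq_obs: "grp_eq (obs_sheaf M E k) W \<phi> \<psi> \<longleftrightarrow>
    (\<forall>V. open V \<and> V \<subseteq> W \<longrightarrow> (\<forall>s\<in>vsec M (obs_dom M E k) V. \<phi> V s = \<psi> V s))"
  and grp_mul_obs: "grp_mul (obs_sheaf M E k) \<phi> \<psi> = \<phi> + \<psi>"
  by (simp_all add: obs_sheaf_def)

context model
begin

lemma group_sheaf_aut:
  assumes "2 \<le> j"
  shows "group_sheaf (aut_sheaf M E j) (\<lambda>V s. s)"
proof
  note iff = aut_sheaf_iff[OF assms]
  show "a \<in> grp_sec (aut_sheaf M E j) W'" if "a \<in> grp_sec (aut_sheaf M E j) W" "W' \<subseteq> W" for a W W'
    using that pre_aut_mono[of j W a W' j] by (simp add: iff)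
  show "grp_mul (aut_sheaf M E j) a b \<in> grp_sec (aut_sheaf M E j) W"
    if "a \<in> grp_sec (aut_sheaf M E j) W" "b \<in> grp_sec (aut_sheaf M E j) W" for a b W
    using that pre_aut_comp by (simp add: iff grp_mul_aut)
  show "(\<lambda>V s. s) \<in> grp_sec (aut_sheaf M E j) W" for W
    by (simp add: iff pre_aut_id)
  show "grp_eq (aut_sheaf M E j) W (grp_mul (aut_sheaf M E j) a b) (grp_mul (aut_sheaf M E j) a' b')"
    if "a \<in> grp_sec (aut_sheaf M E j) W" "b \<in> grp_sec (aut_sheaf M E j) W" "b' \<in> grp_sec (aut_sheaf M E j) W"
      "grp_eq (aut_sheaf M E j) W a a'" "grp_eq (aut_sheaf M E j) W b b'" for W a b a' b'
    unfolding grp_eq_aut grp_mul_aut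
  proof (intro allI impI ballI)
    fix V s assume V: "open V \<and> V \<subseteq> W" and s: "s \<in> esec M E V"
    have "b' V s \<in> esec M E V" using pre_autD(1)[of j W b' V s] that(3) V s by (simp add: iff)
    then show "a V (b V s) = a' V (b' V s)" using that(4,5) V s by (simp add: grp_eq_aut)
  qed
  show "\<exists>b\<in>grp_sec (aut_sheaf M E j) W. grp_eq (aut_sheaf M E j) W (grp_mul (aut_sheaf M E j) a b) (\<lambda>V s. s) \<and>
      grp_eq (aut_sheaf M E j) W (grp_mul (aut_sheaf M E j) b a) (\<lambda>V s. s)"
    if "a \<in> grp_sec (aut_sheaf M E j) W" for a W
  proof (rule bexI[of _ "aut_inv a"])
    have a: "pre_aut j W a" using that by (simp add: iff)
    show "aut_inv a \<in> grp_sec (aut_sheaf M E j) W"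
      using pre_aut_inv[OF a assms] by (simp add: iff)
    show "grp_eq (aut_sheaf M E j) W (grp_mul (aut_sheaf M E j) a (aut_inv a)) (\<lambda>V s. s) \<and>
      grp_eq (aut_sheaf M E j) W (grp_mul (aut_sheaf M E j) (aut_inv a) a) (\<lambda>V s. s)"
      using aut_inv(1,2)[OF a assms] by (simp add: grp_eq_aut grp_mul_aut)
  qed
qed (auto simp: grp_eq_aut grp_mul_aut)

lemma obs_sheafI:
  assumes "\<And>V s. open V \<Longrightarrow> V \<subseteq> W \<Longrightarrow> s \<in> vsec M (obs_dom M E k) V \<Longrightarrow> h V s \<in> esec M E V"
    "\<And>V s. open V \<Longrightarrow> V \<subseteq> W \<Longrightarrow> s \<in> vsec M (obs_dom M E k) V \<Longrightarrow> deg_part k (h V s) = h V s"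
    "\<And>V s t. open V \<Longrightarrow> V \<subseteq> W \<Longrightarrow> s \<in> vsec M (obs_dom M E k) V \<Longrightarrow> t \<in> vsec M (obs_dom M E k) V \<Longrightarrow>
      h V (s + t) = h V s + h V t"
    "\<And>V s f. open V \<Longrightarrow> V \<subseteq> W \<Longrightarrow> s \<in> vsec M (obs_dom M E k) V \<Longrightarrow> f \<in> osec M V \<Longrightarrow>
      h V (scale_sec f s) = scale_sec f (h V s)"
    "\<And>V V' s. open V \<Longrightarrow> V \<subseteq> W \<Longrightarrow> s \<in> vsec M (obs_dom M E k) V \<Longrightarrow> open V' \<Longrightarrow> V' \<subseteq> V \<Longrightarrow>
      h V' (rsec V' s) = rsec V' (h V s)"
  shows "h \<in> grp_sec (obs_sheaf M E k) W"
  unfolding obs_sheaf_def grp_sheaf.select_convs mem_Collect_eq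
  by (intro allI impI ballI conjI; elim conjE) (simp_all only: assms)

text \<open>Sums, negatives and the zero section are the cases of two, one and no summands, so this
  one closure property yields the group structure and, later, linear combinations of
  cochains.\<close>

lemma obs_lincomb_sec:
  assumes "\<And>i. i \<in> I \<Longrightarrow> h i \<in> grp_sec (obs_sheaf M E k) W"
  shows "(\<lambda>V s x S. \<Sum>i\<in>I. c i * h i V s x S) \<in> grp_sec (obs_sheaf M E k) W"
proof -
  have eq: "(\<lambda>x S. \<Sum>i\<in>I. c i * h i V s x S) = (\<Sum>i\<in>I. scale_sec (\<lambda>x. c i) (h i V s))" for V s
    by (auto simp: scale_sec_def sum_fun_apply fun_eq_iff)
  show ?thesis
  proof (rule obs_sheafI)
    fix V s assume V: "open V" "V \<subseteq> W" and s: "s \<in> vsec M (obs_dom M E k) V"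
    note H = obs_sheafD[OF assms V s]
    show "(\<lambda>x S. \<Sum>i\<in>I. c i * h i V s x S) \<in> esec M E V"
      unfolding eq by (intro esec_sum[OF V(1)] esec_const_scale[OF V(1)] H(1))
    have "h i V s x S = 0" if "i \<in> I" "card S \<noteq> k" for i x S
      using fun_cong[OF fun_cong[OF H(2)[OF that(1)]], of x S] that(2) by (simp add: deg_part_def)
    then show "deg_part k (\<lambda>x S. \<Sum>i\<in>I. c i * h i V s x S) = (\<lambda>x S. \<Sum>i\<in>I. c i * h i V s x S)"
      by (auto simp: deg_part_def fun_eq_iff)
    show "(\<lambda>x S. \<Sum>i\<in>I. c i * h i V (s + t) x S) =
        (\<lambda>x S. \<Sum>i\<in>I. c i * h i V s x S) + (\<lambda>x S. \<Sum>i\<in>I. c i * h i V t x S)"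
      if "t \<in> vsec M (obs_dom M E k) V" for t
    proof (rule ext, rule ext)
      fix x S
      have "(\<Sum>i\<in>I. c i * h i V (s + t) x S) = (\<Sum>i\<in>I. c i * h i V s x S + c i * h i V t x S)"
        by (rule sum.cong[OF refl]) (simp only: H(3)[OF _ that] plus_fun_apply distrib_left)
      then show "(\<Sum>i\<in>I. c i * h i V (s + t) x S) =
          ((\<lambda>x S. \<Sum>i\<in>I. c i * h i V s x S) + (\<lambda>x S. \<Sum>i\<in>I. c i * h i V t x S)) x S"
        by (simp add: sum.distrib)
    qed
    show "(\<lambda>x S. \<Sum>i\<in>I. c i * h i V (scale_sec f s) x S) = scale_sec f (\<lambda>x S. \<Sum>i\<in>I. c i * h i V s x S)"
      if "f \<in> osec M V" for f
    proof (rule ext, rule ext)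
      fix x S
      have "(\<Sum>i\<in>I. c i * h i V (scale_sec f s) x S) = (\<Sum>i\<in>I. f x * (c i * h i V s x S))"
        by (rule sum.cong[OF refl], simp only: H(4)[OF _ that]) (simp add: scale_sec_def)
      then show "(\<Sum>i\<in>I. c i * h i V (scale_sec f s) x S) = scale_sec f (\<lambda>x S. \<Sum>i\<in>I. c i * h i V s x S) x S"
        by (simp add: scale_sec_def sum_distrib_left)
    qed
    show "(\<lambda>x S. \<Sum>i\<in>I. c i * h i V' (rsec V' s) x S) = rsec V' (\<lambda>x S. \<Sum>i\<in>I. c i * h i V s x S)"
      if "open V'" "V' \<subseteq> V" for V'
    proof (rule ext, rule ext)
      fix x S
      have "(\<Sum>i\<in>I. c i * h i V' (rsec V' s) x S) = (\<Sum>i\<in>I. c i * rsec V' (h i V s) x S)"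
        by (rule sum.cong[OF refl]) (simp only: H(5)[OF _ that])
      then show "(\<Sum>i\<in>I. c i * h i V' (rsec V' s) x S) = rsec V' (\<lambda>x S. \<Sum>i\<in>I. c i * h i V s x S) x S"
        by (simp add: rsec_def)
    qed
  qed
qed

lemma group_sheaf_obs: "group_sheaf (obs_sheaf M E k) 0"
proof
  let ?G = "obs_sheaf M E k"
  show "a \<in> grp_sec ?G W'" if "a \<in> grp_sec ?G W" "W' \<subseteq> W" for a W W'
    using that by (auto simp: obs_sheaf_def)
  show "grp_mul ?G a b \<in> grp_sec ?G W" if "a \<in> grp_sec ?G W" "b \<in> grp_sec ?G W" for a b W
  proof -
    have "(\<lambda>V s x S. \<Sum>i\<in>{0, 1::nat}. 1 * (if i = 0 then a else b) V s x S) \<in> grp_sec ?G W"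
      using that by (intro obs_lincomb_sec) auto
    moreover have "(\<lambda>V s x S. \<Sum>i\<in>{0, 1::nat}. 1 * (if i = 0 then a else b) V s x S) = a + b"
      by (auto simp: fun_eq_iff)
    ultimately show ?thesis by (simp add: grp_mul_obs)
  qed
  show "0 \<in> grp_sec ?G W" for W
    using obs_lincomb_sec[of "{}" "\<lambda>i. 0"] by (simp add: zero_fun_def)
  show "\<exists>b\<in>grp_sec ?G W. grp_eq ?G W (grp_mul ?G a b) 0 \<and> grp_eq ?G W (grp_mul ?G b a) 0"
    if "a \<in> grp_sec ?G W" for a W
  proof (rule bexI)
    show "(\<lambda>V s x S. \<Sum>i\<in>{0::nat}. (-1) * a V s x S) \<in> grp_sec ?G W"
      using that by (intro obs_lincomb_sec) auto
    have "a + (\<lambda>V s x S. \<Sum>i\<in>{0::nat}. (-1) * a V s x S) = 0" "(\<lambda>V s x S. \<Sum>i\<in>{0::nat}. (-1) * a V s x S) + a = 0"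
      by (auto simp: fun_eq_iff)
    then show "grp_eq ?G W (grp_mul ?G a (\<lambda>V s x S. \<Sum>i\<in>{0::nat}. (-1) * a V s x S)) 0 \<and>
        grp_eq ?G W (grp_mul ?G (\<lambda>V s x S. \<Sum>i\<in>{0::nat}. (-1) * a V s x S) a) 0"
      by (simp only: grp_mul_obs) (simp add: grp_eq_obs)
  qed
qed (auto simp: grp_eq_obs grp_mul_obs add.assoc)

text \<open>Each pair couples an argument of an automorphism with the argument at which its symbol
  is compared with a bundle homomorphism. The gluing argument thereby runs without a case
  distinction on the parity of \<open>k\<close>.\<close>

definition symbol_test :: "nat \<Rightarrow> 'x set \<Rightarrow> ('x extsec \<times> ('x \<Rightarrow> nat \<Rightarrow> complex)) set" where
  "symbol_test k V = (if even k then (\<lambda>f. (fun_sec f, rsec V (differential M f))) ` osec M V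
     else (\<lambda>v. (vec_sec v, v)) ` vsec M E V)"

lemma symbol_test_sec:
  assumes "(u, w) \<in> symbol_test k V" "open V"
  shows "u \<in> esec M E V" "w \<in> vsec M (obs_dom M E k) V"
  using assms esec_fun esec_vec differential_in_vsec[OF M] osecD(1)
  by (auto simp: symbol_test_def obs_dom_def split: if_splits)

lemma obs_symbol_test:
  assumes "obs_symbol M E k W \<alpha> \<phi>" "open V" "V \<subseteq> W" "(u, w) \<in> symbol_test k V"
  shows "symbol_part k \<alpha> V u = \<phi> V w"
  using assms by (auto simp: obs_symbol_def symbol_test_def symbol_part_def split: if_splits)

lemma lift_symbol:
  assumes "(U, e) \<in> frames E" "open W" "W \<subseteq> U" "2 \<le> k" "h \<in> grp_sec (obs_sheaf M E k) W"
  shows "\<exists>H. pre_aut (enat k) W H \<and>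
    (\<forall>V u w. open V \<and> V \<subseteq> W \<and> (u, w) \<in> symbol_test k V \<longrightarrow> symbol_part k H V u = h V w)"
proof (cases "even k")
  case True
  obtain H where "pre_aut (enat k) W H"
    "\<And>V f. open V \<Longrightarrow> V \<subseteq> W \<Longrightarrow> f \<in> osec M V \<Longrightarrow>
      symbol_part k H V (fun_sec f) = h V (rsec V (differential M f))"
    using even_lift[OF assms(1-4) True assms(5)] by blast
  then show ?thesis using True by (intro exI[of _ H]) (auto simp: symbol_test_def)
next
  case False
  obtain H where "pre_aut (enat k) W H"
    "\<And>V s. open V \<Longrightarrow> V \<subseteq> W \<Longrightarrow> s \<in> vsec M E V \<Longrightarrow> symbol_part k H V (vec_sec s) = h V s"
    using odd_lift[OF assms(1-4) False assms(5)] by blast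
  then show ?thesis using False by (intro exI[of _ H]) (auto simp: symbol_test_def)
qed

lemma pre_aut_next_test:
  assumes "pre_aut (enat k) W \<alpha>" "2 \<le> k"
    "\<And>V u w. open V \<Longrightarrow> V \<subseteq> W \<Longrightarrow> (u, w) \<in> symbol_test k V \<Longrightarrow> symbol_part k \<alpha> V u = 0"
  shows "pre_aut (enat (Suc k)) W \<alpha>"
proof (rule pre_aut_next[OF assms(1,2)])
  fix V assume V: "open V" "V \<subseteq> W"
  show "deg_part k (\<alpha> V (fun_sec f) - fun_sec f) = 0" if "even k" "f \<in> osec M V" for f
    using assms(3)[OF V, of "fun_sec f" "rsec V (differential M f)"] that by (simp add: symbol_test_def symbol_part_def)
  show "deg_part k (\<alpha> V (vec_sec v) - vec_sec v) = 0" if "odd k" "v \<in> vsec M E V" for v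
    using assms(3)[OF V, of "vec_sec v" v] that by (simp add: symbol_test_def symbol_part_def)
qed

text \<open>Equality and multiplication in \<open>aut_sheaf\<close> do not depend on the degree, and
  a higher degree only shrinks the sets of sections; cocycles and relations carry over
  unchanged.\<close>

lemma cech_rel_next: "cech_rel (aut_sheaf M E (enat (Suc k))) \<subseteq> cech_rel (aut_sheaf M E (enat k))"
  and cech_cocycles_next: "cech_cocycles (aut_sheaf M E (enat (Suc k))) \<subseteq> cech_cocycles (aut_sheaf M E (enat k))"
  if "2 \<le> k"
proof -
  have j: "2 \<le> enat k" "2 \<le> enat (Suc k)" using that by (auto simp: numeral_eq_enat)
  have sec: "a \<in> grp_sec (aut_sheaf M E (enat k)) W" if "a \<in> grp_sec (aut_sheaf M E (enat (Suc k))) W" for a W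
    using that pre_aut_mono[of "enat (Suc k)" W a W "enat k"] by (simp add: aut_sheaf_iff[OF j(1)] aut_sheaf_iff[OF j(2)])
  have eq: "grp_eq (aut_sheaf M E (enat (Suc k))) = grp_eq (aut_sheaf M E (enat k))"
    "grp_mul (aut_sheaf M E (enat (Suc k))) = grp_mul (aut_sheaf M E (enat k))"
    by (simp_all add: aut_sheaf_def)
  show 1: "cech_cocycles (aut_sheaf M E (enat (Suc k))) \<subseteq> cech_cocycles (aut_sheaf M E (enat k))"
    unfolding cech_cocycles_def eq using sec by blast
  show "cech_rel (aut_sheaf M E (enat (Suc k))) \<subseteq> cech_rel (aut_sheaf M E (enat k))"
    unfolding cech_rel_def eq using 1 sec by blast
qed

text \<open>Triviality means a_VW + h_W = h_V on some refinement. With local lifts H_V of h_V, the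
  cohomologous cocycle \<open>H_V^-1 g H_W\<close> has symbol -h_V + a_VW + h_W = 0, so it takes
  values one degree higher.\<close>

theorem trivial_obstruction_lifts:
  assumes k: "2 \<le> k" and p: "p \<in> cech_cocycles (aut_sheaf M E (enat k))"
    and g: "(\<U>, g) \<in> cech_class (aut_sheaf M E (enat k)) p"
    and sym: "\<And>U V. U \<in> \<U> \<Longrightarrow> V \<in> \<U> \<Longrightarrow> obs_symbol M E k (U \<inter> V) (g U V) (a U V)"
    and triv: "(({UNIV}, \<lambda>U V. 0), (\<U>, a)) \<in> cech_rel (obs_sheaf M E k)"
  shows "cech_class (aut_sheaf M E (enat k)) p
    \<in> cech_incl (aut_sheaf M E (enat k)) ` cech_H1 (aut_sheaf M E (enat k + 1))"
proof -
  let ?G = "aut_sheaf M E (enat k)" and ?G' = "aut_sheaf M E (enat (Suc k))" and ?A = "obs_sheaf M E k"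
  have j: "2 \<le> enat k" "2 \<le> enat (Suc k)" using k by (auto simp: numeral_eq_enat)
  interpret G: group_sheaf ?G "\<lambda>V s. s" by (rule group_sheaf_aut[OF j(1)])
  interpret G': group_sheaf ?G' "\<lambda>V s. s" by (rule group_sheaf_aut[OF j(2)])
  interpret A: group_sheaf ?A 0 by (rule group_sheaf_obs)
  note iff = aut_sheaf_iff[OF j(1)] and iff' = aut_sheaf_iff[OF j(2)]
  have pg: "(p, (\<U>, g)) \<in> cech_rel ?G" using g by (simp add: cech_class_def)
  then have cg: "(\<U>, g) \<in> cech_cocycles ?G" by (auto simp: cech_rel_def)
  from triv obtain \<V> \<tau>0 \<tau> h where rf: "refinement \<V> \<tau> \<U>" and h: "\<forall>V\<in>\<V>. h V \<in> grp_sec ?A V"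
    and rel: "\<forall>V\<in>\<V>. \<forall>W\<in>\<V>. grp_eq ?A (V \<inter> W) (grp_mul ?A (a (\<tau> V) (\<tau> W)) (h W)) (grp_mul ?A (h V) 0)"
    by (rule cech_relE)
  \<comment> \<open>Intersecting with frame domains, since \<open>lift_symbol\<close> works inside
    the domain of a frame.\<close>
  define \<V>' where "\<V>' = {V \<inter> U | V U. V \<in> \<V> \<and> U \<in> fst ` frames E}"
  have "\<forall>V\<in>\<V>'. \<exists>V1 U. V1 \<in> \<V> \<and> U \<in> fst ` frames E \<and> V \<subseteq> V1 \<and> V \<subseteq> U" unfolding \<V>'_def by blast
  then obtain \<pi> \<upsilon> where \<pi>: "\<And>V. V \<in> \<V>' \<Longrightarrow> \<pi> V \<in> \<V>" "\<And>V. V \<in> \<V>' \<Longrightarrow> V \<subseteq> \<pi> V"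
    "\<And>V. V \<in> \<V>' \<Longrightarrow> \<upsilon> V \<in> fst ` frames E" "\<And>V. V \<in> \<V>' \<Longrightarrow> V \<subseteq> \<upsilon> V" by metis
  have oV: "open V" if "V \<in> \<V>" for V using rf that by (auto simp: refinement_def open_cover_def)
  have oV': "open V" if "V \<in> \<V>'" for V
  proof -
    from that obtain V1 p where "V = V1 \<inter> fst p" "V1 \<in> \<V>" "p \<in> frames E" unfolding \<V>'_def by blast
    then show ?thesis using oV frame_props(1)[of "fst p" "snd p"] by (simp add: open_Int)
  qed
  have "x \<in> \<Union>\<V>'" for x
  proof -
    obtain V where V: "V \<in> \<V>" "x \<in> V" using rf unfolding refinement_def open_cover_def by (metis UNIV_I UnionE)
    obtain U e where U: "(U, e) \<in> frames E" "x \<in> U" by (rule frame_covers)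
    have "U \<in> fst ` frames E" using imageI[OF U(1), of fst] by simp
    with V(1) have "V \<inter> U \<in> \<V>'" unfolding \<V>'_def by blast
    moreover have "x \<in> V \<inter> U" using V(2) U(2) by simp
    ultimately show ?thesis by (rule UnionI)
  qed
  then have cover: "open_cover \<V>'" using oV' by (auto simp: open_cover_def)
  define \<sigma> where "\<sigma> V = \<tau> (\<pi> V)" for V
  have \<sigma>: "\<sigma> V \<in> \<U>" "V \<subseteq> \<sigma> V" if "V \<in> \<V>'" for V
    using refinementD[OF rf \<pi>(1)[OF that]] \<pi>(2)[OF that] by (auto simp: \<sigma>_def)
  have "\<forall>V\<in>\<V>'. \<exists>H. pre_aut (enat k) V H \<and>
    (\<forall>X u w. open X \<and> X \<subseteq> V \<and> (u, w) \<in> symbol_test k X \<longrightarrow> symbol_part k H X u = h (\<pi> V) X w)"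
  proof
    fix V assume V: "V \<in> \<V>'"
    obtain e where e: "(\<upsilon> V, e) \<in> frames E" using \<pi>(3)[OF V] by auto
    show "\<exists>H. pre_aut (enat k) V H \<and>
      (\<forall>X u w. open X \<and> X \<subseteq> V \<and> (u, w) \<in> symbol_test k X \<longrightarrow> symbol_part k H X u = h (\<pi> V) X w)"
      by (rule lift_symbol[OF e oV'[OF V] \<pi>(4)[OF V] k A.sec_sub[OF bspec[OF h \<pi>(1)[OF V]] \<pi>(2)[OF V]]])
  qed
  then obtain H where H': "\<forall>V\<in>\<V>'. pre_aut (enat k) V (H V) \<and>
    (\<forall>X u w. open X \<and> X \<subseteq> V \<and> (u, w) \<in> symbol_test k X \<longrightarrow> symbol_part k (H V) X u = h (\<pi> V) X w)"
    by (rule bchoice[THEN exE])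
  have H: "pre_aut (enat k) X (H V)" if "V \<in> \<V>'" "X \<subseteq> V" for V X
    using H' pre_aut_mono[OF _ that(2) order_refl] that(1) by blast
  have Hs: "symbol_part k (H V) X u = h (\<pi> V) X w"
    if "V \<in> \<V>'" "open X" "X \<subseteq> V" "(u, w) \<in> symbol_test k X" for V X u w
    using H' that by blast
  \<comment> \<open>The change of cocycle by the local lifts.\<close>
  define g' where "g' V W = (\<lambda>X s. aut_inv (H V) X (g (\<sigma> V) (\<sigma> W) X (H W X s)))" for V W
  have gp: "pre_aut (enat k) X (g (\<sigma> V) (\<sigma> W))" if "V \<in> \<V>'" "W \<in> \<V>'" "X \<subseteq> V \<inter> W" for V W X
    using G.cocycleD(2)[OF cg \<sigma>(1)[OF that(1)] \<sigma>(1)[OF that(2)], of X] \<sigma>(2)[OF that(1)] \<sigma>(2)[OF that(2)] that(3)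
    by (auto simp: iff)
  have gH: "pre_aut (enat k) X (\<lambda>X s. g (\<sigma> V) (\<sigma> W) X (H W X s))" if "V \<in> \<V>'" "W \<in> \<V>'" "X \<subseteq> V \<inter> W" for V W X
    by (rule pre_aut_comp[OF gp[OF that] H[OF that(2)]]) (use that(3) in auto)
  have Hi: "pre_aut (enat k) X (aut_inv (H V))" if "V \<in> \<V>'" "X \<subseteq> V" for V X
    by (rule pre_aut_inv[OF H[OF that] j(1)])
  have g'p: "pre_aut (enat k) X (g' V W)" if "V \<in> \<V>'" "W \<in> \<V>'" "X \<subseteq> V \<inter> W" for V W X
    unfolding g'_def by (rule pre_aut_comp[OF Hi[OF that(1)] gH[OF that]]) (use that(3) in auto)
  have g'n: "pre_aut (enat (Suc k)) (V \<inter> W) (g' V W)" if VW: "V \<in> \<V>'" "W \<in> \<V>'" for V W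
  proof (rule pre_aut_next_test[OF g'p[OF VW order_refl] k])
    fix X u w assume X: "open X" "X \<subseteq> V \<inter> W" and t: "(u, w) \<in> symbol_test k X"
    note u = symbol_test_sec(1)[OF t X(1)] and w = symbol_test_sec(2)[OF t X(1)]
    have XV: "X \<subseteq> V" "X \<subseteq> W" using X by auto
    \<comment> \<open>The symbol of the inverse comes from additivity: the composite of
      \<open>H V\<close> with its inverse is the identity and has symbol 0.\<close>
    have "symbol_part k (\<lambda>V' s. H V V' (aut_inv (H V) V' s)) X u = symbol_part k (H V) X u + symbol_part k (aut_inv (H V)) X u"
      by (rule symbol_part_comp[OF H[OF VW(1) XV(1)] Hi[OF VW(1) XV(1)] k X(1) order_refl u])
    moreover have "symbol_part k (\<lambda>V' s. H V V' (aut_inv (H V) V' s)) X u = 0"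
      using aut_inv(1)[OF H[OF VW(1) XV(1)] j(1) X(1) order_refl u]
      by (simp add: symbol_part_def deg_part_def fun_eq_iff)
    ultimately have i: "symbol_part k (aut_inv (H V)) X u = - h (\<pi> V) X w"
      unfolding Hs[OF VW(1) X(1) XV(1) t] by (simp add: eq_neg_iff_add_eq_0 add.commute)
    have gs: "symbol_part k (g (\<sigma> V) (\<sigma> W)) X u = a (\<sigma> V) (\<sigma> W) X w"
      by (rule obs_symbol_test[OF sym[OF \<sigma>(1)[OF VW(1)] \<sigma>(1)[OF VW(2)]] X(1) _ t])
        (use \<sigma>(2)[OF VW(1)] \<sigma>(2)[OF VW(2)] XV in auto)
    have "grp_eq ?A (\<pi> V \<inter> \<pi> W) (a (\<sigma> V) (\<sigma> W) + h (\<pi> W)) (h (\<pi> V) + 0)"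
      using bspec[OF bspec[OF rel \<pi>(1)[OF VW(1)]] \<pi>(1)[OF VW(2)]] by (simp only: grp_mul_obs \<sigma>_def)
    moreover have "X \<subseteq> \<pi> V" "X \<subseteq> \<pi> W" using \<pi>(2)[OF VW(1)] \<pi>(2)[OF VW(2)] XV by auto
    ultimately have r: "a (\<sigma> V) (\<sigma> W) X w + h (\<pi> W) X w = h (\<pi> V) X w"
      using X(1) w by (simp add: grp_eq_obs)
    have "symbol_part k (g' V W) X u = symbol_part k (aut_inv (H V)) X u +
        symbol_part k (\<lambda>X s. g (\<sigma> V) (\<sigma> W) X (H W X s)) X u"
      unfolding g'_def by (rule symbol_part_comp[OF Hi[OF VW(1) XV(1)] gH[OF VW X(2)] k X(1) order_refl u])
    also have "symbol_part k (\<lambda>X s. g (\<sigma> V) (\<sigma> W) X (H W X s)) X u =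
        symbol_part k (g (\<sigma> V) (\<sigma> W)) X u + symbol_part k (H W) X u"
      by (rule symbol_part_comp[OF gp[OF VW X(2)] H[OF VW(2) XV(2)] k X(1) order_refl u])
    also have "\<dots> = h (\<pi> V) X w" unfolding gs Hs[OF VW(2) X(1) XV(2) t] r ..
    finally show "symbol_part k (g' V W) X u = 0" unfolding i by (simp only: left_minus)
  qed
  have cg': "(\<V>', g') \<in> cech_cocycles ?G'"
    unfolding cech_cocycles_def
  proof (intro CollectI case_prodI conjI ballI)
    show "open_cover \<V>'" by (rule cover)
    show "g' V W \<in> grp_sec ?G' (V \<inter> W)" if "V \<in> \<V>'" "W \<in> \<V>'" for V W using g'n[OF that] by (simp add: iff')
    fix V W Z assume VWZ: "V \<in> \<V>'" "W \<in> \<V>'" "Z \<in> \<V>'"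
    show "grp_eq ?G' (V \<inter> W \<inter> Z) (grp_mul ?G' (g' V W) (g' W Z)) (g' V Z)"
      unfolding grp_eq_aut grp_mul_aut
    proof (intro allI impI ballI)
      fix X s assume X': "open X \<and> X \<subseteq> V \<inter> W \<inter> Z" and s: "s \<in> esec M E X"
      then have X: "open X" "X \<subseteq> V" "X \<subseteq> W" "X \<subseteq> Z" by auto
      have HZ: "H Z X s \<in> esec M E X" by (rule pre_autD(1)[OF H[OF VWZ(3) X(4)] X(1) order_refl s])
      have t: "g (\<sigma> W) (\<sigma> Z) X (H Z X s) \<in> esec M E X"
        by (rule pre_autD(1)[OF gp[OF VWZ(2,3)] X(1) order_refl HZ]) (use X in auto)
      have "H W X (g' W Z X s) = g (\<sigma> W) (\<sigma> Z) X (H Z X s)"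
        unfolding g'_def by (rule aut_inv(1)[OF H[OF VWZ(2) X(3)] j(1) X(1) order_refl t])
      moreover have "grp_eq ?G X (grp_mul ?G (g (\<sigma> V) (\<sigma> W)) (g (\<sigma> W) (\<sigma> Z))) (g (\<sigma> V) (\<sigma> Z))"
        by (rule G.cocycleD(3)[OF cg]) (use \<sigma>[OF VWZ(1)] \<sigma>[OF VWZ(2)] \<sigma>[OF VWZ(3)] X in auto)
      then have "g (\<sigma> V) (\<sigma> W) X (g (\<sigma> W) (\<sigma> Z) X (H Z X s)) = g (\<sigma> V) (\<sigma> Z) X (H Z X s)"
        using X(1) HZ by (simp add: grp_eq_aut grp_mul_aut)
      ultimately show "g' V W X (g' W Z X s) = g' V Z X s"
        by (simp add: g'_def[of V W] g'_def[of V Z])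
    qed
  qed
  have cg'k: "(\<V>', g') \<in> cech_cocycles ?G" using cg' cech_cocycles_next[OF k] by blast
  \<comment> \<open>The inverses of the lifts provide the cochain relating the two cocycles, still
    in degree \<open>k\<close>.\<close>
  have "((\<U>, g), (\<V>', g')) \<in> cech_rel ?G"
  proof (rule cech_relI[OF cg cg'k, where h = "\<lambda>V. aut_inv (H V)" and \<tau>' = id and \<tau> = \<sigma> and \<V> = \<V>'])
    show "refinement \<V>' \<sigma> \<U>" "refinement \<V>' id \<V>'" using cover \<sigma> by (auto simp: refinement_def)
    show "aut_inv (H V) \<in> grp_sec ?G V" if "V \<in> \<V>'" for V using Hi[OF that order_refl] by (simp add: iff)
    fix V W assume VW: "V \<in> \<V>'" "W \<in> \<V>'"
    show "grp_eq ?G (V \<inter> W) (grp_mul ?G (g' (id V) (id W)) (aut_inv (H W))) (grp_mul ?G (aut_inv (H V)) (g (\<sigma> V) (\<sigma> W)))"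
      unfolding grp_eq_aut grp_mul_aut
    proof (intro allI impI ballI)
      fix X s assume X': "open X \<and> X \<subseteq> V \<inter> W" and s: "s \<in> esec M E X"
      have "H W X (aut_inv (H W) X s) = s"
        using X' by (intro aut_inv(1)[OF H[OF VW(2)] j(1) _ order_refl s]) auto
      then show "g' (id V) (id W) X (aut_inv (H W) X s) = aut_inv (H V) X (g (\<sigma> V) (\<sigma> W) X s)"
        by (simp add: g'_def)
    qed
  qed
  with pg have pq: "(p, (\<V>', g')) \<in> cech_rel ?G" by (rule G.cech_rel_trans)
  \<comment> \<open>The class of \<open>g'\<close> in degree \<open>k + 1\<close> contains
    \<open>g'\<close> and consists of cocycles related to it already in degree \<open>k\<close>, so
    its image is the whole class of \<open>p\<close>.\<close>
  have "cech_class ?G p = cech_incl ?G (cech_class ?G' (\<V>', g'))"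
  proof
    show "cech_class ?G p \<subseteq> cech_incl ?G (cech_class ?G' (\<V>', g'))"
    proof
      fix y assume "y \<in> cech_class ?G p"
      then have "((\<V>', g'), y) \<in> cech_rel ?G"
        using G.cech_rel_trans[OF G.cech_rel_sym[OF pq]] by (simp add: cech_class_def)
      moreover have "(\<V>', g') \<in> cech_class ?G' (\<V>', g')"
        using G'.cech_rel_refl[OF cg'] by (simp add: cech_class_def)
      ultimately show "y \<in> cech_incl ?G (cech_class ?G' (\<V>', g'))" unfolding cech_incl_def by blast
    qed
    show "cech_incl ?G (cech_class ?G' (\<V>', g')) \<subseteq> cech_class ?G p"
    proof
      fix y assume "y \<in> cech_incl ?G (cech_class ?G' (\<V>', g'))"
      then obtain x where x: "((\<V>', g'), x) \<in> cech_rel ?G'" "(x, y) \<in> cech_rel ?G"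
        unfolding cech_incl_def cech_class_def by blast
      have "((\<V>', g'), x) \<in> cech_rel ?G" using x(1) cech_rel_next[OF k] by blast
      from G.cech_rel_trans[OF G.cech_rel_trans[OF pq this] x(2)] show "y \<in> cech_class ?G p"
        by (simp add: cech_class_def)
    qed
  qed
  moreover have "cech_class ?G' (\<V>', g') \<in> cech_H1 ?G'"
    unfolding cech_H1_def cech_class_def by (rule quotientI[OF cg'])
  moreover have "enat k + 1 = enat (Suc k)" by (simp add: one_enat_def)
  ultimately show ?thesis by simp
qed

end

section \<open>Local constancy of the splitting type\<close>

text \<open>Stands in for closedness of \<open>Z\<close>: the set where \<open>f\<close> is nonzero
  contains \<open>v\<close> and avoids \<open>Z\<close>. No continuity on the space of all sequences
  is claimed; \<open>f\<close> will be evaluated on combinations of finitely many unit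
  vectors.\<close>

lemma separating_functional:
  fixes Z :: "(nat \<Rightarrow> complex) set"
  assumes Z: "0 \<in> Z" "\<And>a x y. x \<in> Z \<Longrightarrow> y \<in> Z \<Longrightarrow> (\<lambda>i. a * x i) + y \<in> Z" and v: "v \<notin> Z"
  obtains f :: "(nat \<Rightarrow> complex) \<Rightarrow> complex" where "\<forall>x\<in>Z. f x = 0" "f v \<noteq> 0"
    "\<forall>x y. f (x + y) = f x + f y" "\<forall>a x. f (\<lambda>i. a * x i) = a * f x"
proof -
  have Zs: "fun_vs.subspace Z"
  proof (rule fun_vs.subspaceI)
    show "x + y \<in> Z" if "x \<in> Z" "y \<in> Z" for x y using Z(2)[OF that, of 1] by simp
    show "(\<lambda>i. a * x i) \<in> Z" if "x \<in> Z" for a x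
      using Z(2)[OF that Z(1), of a] by (simp del: zero_fun_apply plus_fun_apply)
  qed (rule Z(1))
  obtain B where B: "B \<subseteq> Z" "fun_vs.independent B" "Z \<subseteq> fun_vs.span B"
    by (rule fun_vs.maximal_independent_subset)
  have sB: "fun_vs.span B = Z"
    using B(3) fun_vs.span_minimal[OF B(1) Zs] by blast
  then have vB: "v \<notin> B" using v fun_vs.span_base by blast
  have ind: "fun_vs.independent (insert v B)"
    using v B(2) sB by (intro fun_vs.independent_insertI) auto
  define C where "C = fun_vs.extend_basis (insert v B)"
  have C: "fun_vs.independent C" "insert v B \<subseteq> C" "fun_vs.span C = UNIV"
    unfolding C_def
    by (rule fun_vs.independent_extend_basis[OF ind] fun_vs.extend_basis_superset[OF ind]
        fun_vs.span_extend_basis[OF ind])+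
  \<comment> \<open>The coordinate at \<open>v\<close> in a basis that extends a basis
    \<open>B\<close> of \<open>Z\<close> together with \<open>v\<close>. Elements of
    \<open>Z\<close> are represented by \<open>B\<close> alone, so this coordinate vanishes on
    them.\<close>
  define f where "f x = fun_vs.representation C x v" for x
  have "\<forall>x\<in>Z. f x = 0"
  proof (rule ballI, rule ccontr)
    fix x assume that: "x \<in> Z" and "f x \<noteq> 0"
    moreover have "fun_vs.representation C x = fun_vs.representation B x"
      using C that sB by (intro fun_vs.representation_extend) auto
    ultimately have "v \<in> B" using fun_vs.representation_ne_zero unfolding f_def by metis
    with vB show False ..
  qed
  moreover have "f v \<noteq> 0"
    unfolding f_def using fun_vs.representation_basis[OF C(1), of v] C(2) by simp
  moreover have "\<forall>x y. f (x + y) = f x + f y"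
    unfolding f_def using fun_vs.representation_add[OF C(1)] C(3) by simp
  moreover have "\<forall>a x. f (\<lambda>i. a * x i) = a * f x"
    unfolding f_def using fun_vs.representation_scale[OF C(1)] C(3) by simp
  ultimately show ?thesis by (rule that)
qed

lemma holo_fun_continuous:
  assumes M: "complex_manifold M" and f: "holo_fun M UNIV f"
  shows "continuous_on UNIV f"
proof -
  have "isCont f x" for x
  proof -
    obtain c where c: "c \<in> charts M" "x \<in> fst c" by (rule chart_covers[OF M])
    have "homeomorphism (fst c) (snd c ` fst c) (snd c) (chart_inv c)"
      using M c(1) unfolding complex_manifold_def by (cases c) auto
    then have 1: "continuous_on (fst c) (snd c)" by (simp add: homeomorphism_def)
    have 2: "continuous_on (snd c ` fst c) (f \<circ> chart_inv c)"
      using f c(1) by (auto simp: holo_fun_def holomorphic_Cn_def)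
    have "continuous_on (fst c) (\<lambda>y. (f \<circ> chart_inv c) (snd c y))"
      by (rule continuous_on_compose2[OF 2 1]) simp
    then have "continuous_on (fst c) f"
      by (rule continuous_on_eq) (simp add: chart_props(3)[OF M c(1)])
    then show ?thesis using chart_props(1)[OF M c(1)] c(2) by (simp add: continuous_on_eq_continuous_at)
  qed
  then show ?thesis by (simp add: continuous_on_eq_continuous_at)
qed

context model
begin

text \<open>With the zero cocycle on the left the relation reads a + h_W = h_V, exhibiting the
  \<open>k\<close>-th component as a coboundary.\<close>

abbreviation "trivial_in k \<U> x \<equiv> (({UNIV}, \<lambda>U V. 0), (\<U>, \<lambda>U V. x U V k)) \<in> cech_rel (obs_sheaf M E k)"

section \<open>Components and linear combinations of obstruction cocycles\<close>

lemma total_cocycle_component: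
  assumes "(\<U>, x) \<in> cech_cocycles (total_obs_sheaf M E)" "k \<in> {2..r}"
  shows "(\<U>, \<lambda>U V. x U V k) \<in> cech_cocycles (obs_sheaf M E k)"
  using assms unfolding cech_cocycles_def total_obs_sheaf_def
  by (simp add: grp_mul_obs)

lemma total_rel_component:
  assumes "((\<U>, x), (\<U>', y)) \<in> cech_rel (total_obs_sheaf M E)" "k \<in> {2..r}"
  shows "((\<U>, \<lambda>U V. x U V k), (\<U>', \<lambda>U V. y U V k)) \<in> cech_rel (obs_sheaf M E k)"
proof -
  interpret A: group_sheaf "obs_sheaf M E k" 0 by (rule group_sheaf_obs)
  from assms(1) obtain \<V> \<tau> \<tau>' h where c: "(\<U>, x) \<in> cech_cocycles (total_obs_sheaf M E)"
    "(\<U>', y) \<in> cech_cocycles (total_obs_sheaf M E)"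
    and rf: "refinement \<V> \<tau> \<U>" "refinement \<V> \<tau>' \<U>'"
    and h: "\<forall>V\<in>\<V>. h V \<in> grp_sec (total_obs_sheaf M E) V"
    and rel: "\<forall>V\<in>\<V>. \<forall>W\<in>\<V>. grp_eq (total_obs_sheaf M E) (V \<inter> W)
       (grp_mul (total_obs_sheaf M E) (y (\<tau>' V) (\<tau>' W)) (h W)) (grp_mul (total_obs_sheaf M E) (h V) (x (\<tau> V) (\<tau> W)))"
    by (rule cech_relE)
  show ?thesis
  proof (rule cech_relI[OF total_cocycle_component[OF c(1) assms(2)] total_cocycle_component[OF c(2) assms(2)] rf,
        where h = "\<lambda>V. h V k"])
    show "h V k \<in> grp_sec (obs_sheaf M E k) V" if "V \<in> \<V>" for V
      using bspec[OF h that] assms(2) by (simp add: total_obs_sheaf_def)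
    show "grp_eq (obs_sheaf M E k) (V \<inter> W) (grp_mul (obs_sheaf M E k) (y (\<tau>' V) (\<tau>' W) k) (h W k))
        (grp_mul (obs_sheaf M E k) (h V k) (x (\<tau> V) (\<tau> W) k))" if "V \<in> \<V>" "W \<in> \<V>" for V W
      using bspec[OF bspec[OF rel that(1)] that(2)] assms(2) by (simp add: total_obs_sheaf_def grp_mul_obs)
  qed
qed

lemma total_rel_refl:
  assumes "(\<U>, x) \<in> cech_cocycles (total_obs_sheaf M E)"
  shows "((\<U>, x), (\<U>, x)) \<in> cech_rel (total_obs_sheaf M E)"
proof -
  have "0 \<in> grp_sec (total_obs_sheaf M E) V" for V
    using group_sheaf.one_sec[OF group_sheaf_obs] by (simp add: total_obs_sheaf_def)
  moreover have "grp_eq (total_obs_sheaf M E) V z z" for V z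
    by (simp add: total_obs_sheaf_def grp_eq_obs)
  moreover have "grp_mul (total_obs_sheaf M E) z 0 = grp_mul (total_obs_sheaf M E) 0 z" for z
    by (simp add: total_obs_sheaf_def)
  moreover have "refinement \<U> id \<U>"
    using assms by (auto simp: refinement_def cech_cocycles_def)
  ultimately show ?thesis
    using assms by (intro cech_relI[where \<V> = \<U> and \<tau> = id and \<tau>' = id and h = "\<lambda>V. 0"]) auto
qed

lemma zero_cocycle: "open_cover \<U> \<Longrightarrow> (\<U>, \<lambda>U V. 0) \<in> cech_cocycles (obs_sheaf M E k)"
  using group_sheaf.one_sec[OF group_sheaf_obs, of k]
  by (simp add: cech_cocycles_def grp_mul_obs grp_eq_obs)

lemma zero_cocycle_rel:
  assumes "open_cover \<U>"
  shows "(({UNIV}, \<lambda>U V. 0), (\<U>, \<lambda>U V. 0)) \<in> cech_rel (obs_sheaf M E k)"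
proof -
  interpret A: group_sheaf "obs_sheaf M E k" 0 by (rule group_sheaf_obs)
  have "open_cover {UNIV :: 'x set}" by (simp add: open_cover_def)
  then show ?thesis
    using assms zero_cocycle A.one_sec
    by (intro cech_relI[where \<V> = \<U> and \<tau> = "\<lambda>V. UNIV" and \<tau>' = id and h = "\<lambda>V. 0"])
      (auto simp: refinement_def A.eq_refl)
qed

lemma lincomb_cocycle:
  assumes \<U>: "open_cover \<U>" and b: "\<And>i. i < m \<Longrightarrow> (\<U>, \<beta> i) \<in> cech_cocycles (total_obs_sheaf M E)"
  shows "(\<U>, obs_lincomb m c \<beta>) \<in> cech_cocycles (total_obs_sheaf M E)"
  unfolding cech_cocycles_def
proof (intro CollectI case_prodI conjI ballI)
  have comp: "(\<U>, \<lambda>U V. \<beta> i U V k) \<in> cech_cocycles (obs_sheaf M E k)" if "i < m" "k \<in> {2..r}" for i k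
    using total_cocycle_component[OF b[OF that(1)] that(2)] .
  show "obs_lincomb m c \<beta> U V \<in> grp_sec (total_obs_sheaf M E) (U \<inter> V)" if "U \<in> \<U>" "V \<in> \<U>" for U V
  proof -
    have "obs_lincomb m c \<beta> U V k \<in> grp_sec (obs_sheaf M E k) (U \<inter> V)" if k: "k \<in> {2..r}" for k
      unfolding obs_lincomb_def
      by (rule obs_lincomb_sec) (use comp[OF _ k] \<open>U \<in> \<U>\<close> \<open>V \<in> \<U>\<close> in \<open>auto simp: cech_cocycles_def\<close>)
    then show ?thesis by (simp add: total_obs_sheaf_def)
  qed
  show "grp_eq (total_obs_sheaf M E) (U \<inter> V \<inter> W)
     (grp_mul (total_obs_sheaf M E) (obs_lincomb m c \<beta> U V) (obs_lincomb m c \<beta> V W)) (obs_lincomb m c \<beta> U W)"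
    if UVW: "U \<in> \<U>" "V \<in> \<U>" "W \<in> \<U>" for U V W
  proof -
    have "obs_lincomb m c \<beta> U V k X w x S + obs_lincomb m c \<beta> V W k X w x S = obs_lincomb m c \<beta> U W k X w x S"
      if k: "k \<in> {2..r}" and X: "open X" "X \<subseteq> U \<inter> V \<inter> W" and w: "w \<in> vsec M (obs_dom M E k) X" for k X w x S
    proof -
      have "\<beta> i U V k X w x S + \<beta> i V W k X w x S = \<beta> i U W k X w x S" if "i < m" for i
      proof -
        have "grp_eq (obs_sheaf M E k) (U \<inter> V \<inter> W) (\<beta> i U V k + \<beta> i V W k) (\<beta> i U W k)"
          using comp[OF that k] UVW by (simp add: cech_cocycles_def grp_mul_obs)
        then have "\<beta> i U V k X w + \<beta> i V W k X w = \<beta> i U W k X w"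
          using X w by (simp add: grp_eq_obs)
        from fun_cong[OF fun_cong[OF this, of x], of S] show ?thesis by simp
      qed
      then show ?thesis
        unfolding obs_lincomb_def by (simp add: sum.distrib[symmetric] distrib_left[symmetric])
    qed
    then show ?thesis
      by (simp add: total_obs_sheaf_def grp_eq_obs fun_eq_iff)
  qed
qed (rule \<U>)

text \<open>The two coboundaries may live on different refinements with different maps into
  \<open>\<U>\<close>. Both are moved to one refinement with one map, where the trivialising
  cochains combine linearly.\<close>

lemma trivial_lincomb:
  assumes \<U>: "open_cover \<U>" and b: "\<And>i. i < m \<Longrightarrow> (\<U>, \<beta> i) \<in> cech_cocycles (total_obs_sheaf M E)"
    and k: "k \<in> {2..r}"
    and c: "trivial_in k \<U> (obs_lincomb m c \<beta>)" and d: "trivial_in k \<U> (obs_lincomb m d \<beta>)"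
  shows "trivial_in k \<U> (obs_lincomb m ((\<lambda>i. a * c i) + d) \<beta>)"
proof -
  let ?A = "obs_sheaf M E k"
  interpret A: group_sheaf ?A 0 by (rule group_sheaf_obs)
  note coc = total_cocycle_component[OF lincomb_cocycle[OF \<U> b] k]
  from c obtain \<V>1 \<sigma>1 \<tau>1 h1 where rf1: "refinement \<V>1 \<tau>1 \<U>" and h1: "\<forall>V\<in>\<V>1. h1 V \<in> grp_sec ?A V"
    and rel1: "\<forall>V\<in>\<V>1. \<forall>W\<in>\<V>1. grp_eq ?A (V \<inter> W)
       (grp_mul ?A (obs_lincomb m c \<beta> (\<tau>1 V) (\<tau>1 W) k) (h1 W)) (grp_mul ?A (h1 V) 0)"
    by (rule cech_relE)
  from d obtain \<V>2 \<sigma>2 \<tau>2 h2 where rf2: "refinement \<V>2 \<tau>2 \<U>" and h2: "\<forall>V\<in>\<V>2. h2 V \<in> grp_sec ?A V"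
    and rel2: "\<forall>V\<in>\<V>2. \<forall>W\<in>\<V>2. grp_eq ?A (V \<inter> W)
       (grp_mul ?A (obs_lincomb m d \<beta> (\<tau>2 V) (\<tau>2 W) k) (h2 W)) (grp_mul ?A (h2 V) 0)"
    by (rule cech_relE)
  obtain \<V> \<pi>1 \<pi>2 where \<pi>: "refinement \<V> \<pi>1 \<V>1" "refinement \<V> \<pi>2 \<V>2"
    by (rule common_refinement[of \<V>1 \<V>2]) (use rf1 rf2 in \<open>auto simp: refinement_def\<close>)
  \<comment> \<open>The map through \<open>\<V>1\<close> serves both trivialisations; the one coming
    from \<open>\<V>2\<close> is corrected to it.\<close>
  define \<tau> where "\<tau> V = \<tau>1 (\<pi>1 V)" for V
  have rf: "refinement \<V> \<tau> \<U>" unfolding \<tau>_def by (rule refinement_comp[OF \<pi>(1) rf1])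
  have eq0: "grp_mul ?A x 0 = x" for x by (simp add: A.mul_one)
  obtain u where u: "\<And>V. V \<in> \<V> \<Longrightarrow> u V \<in> grp_sec ?A V"
    "\<And>V W. V \<in> \<V> \<Longrightarrow> W \<in> \<V> \<Longrightarrow> grp_eq ?A (V \<inter> W) (grp_mul ?A (obs_lincomb m c \<beta> (\<tau> V) (\<tau> W) k) (u W)) (u V)"
    using A.trivial_class_refine[OF coc rf1 bspec[OF h1] bspec[OF bspec[OF rel1[unfolded eq0]]] \<pi>(1) rf]
    by blast
  obtain v where v: "\<And>V. V \<in> \<V> \<Longrightarrow> v V \<in> grp_sec ?A V"
    "\<And>V W. V \<in> \<V> \<Longrightarrow> W \<in> \<V> \<Longrightarrow> grp_eq ?A (V \<inter> W) (grp_mul ?A (obs_lincomb m d \<beta> (\<tau> V) (\<tau> W) k) (v W)) (v V)"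
    using A.trivial_class_refine[OF coc rf2 bspec[OF h2] bspec[OF bspec[OF rel2[unfolded eq0]]] \<pi>(2) rf]
    by blast
  define h where "h V = (\<lambda>X w x S. \<Sum>i\<in>{0, 1::nat}. (if i = 0 then a else 1) * (if i = 0 then u V else v V) X w x S)" for V
  have hx: "h V X w x S = a * u V X w x S + v V X w x S" for V X w x S
    by (simp add: h_def)
  have UN: "open_cover {UNIV :: 'x set}" by (simp add: open_cover_def)
  show ?thesis
  proof (rule cech_relI[OF zero_cocycle[OF UN] coc _ rf])
    show "refinement \<V> (\<lambda>V. UNIV) {UNIV}" using rf by (simp add: refinement_def)
    show "h V \<in> grp_sec ?A V" if "V \<in> \<V>" for V
      unfolding h_def by (rule obs_lincomb_sec) (use u(1)[OF that] v(1)[OF that] in auto)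
    fix V W assume VW: "V \<in> \<V>" "W \<in> \<V>"
    show "grp_eq ?A (V \<inter> W) (grp_mul ?A (obs_lincomb m ((\<lambda>i. a * c i) + d) \<beta> (\<tau> V) (\<tau> W) k) (h W)) (grp_mul ?A (h V) 0)"
      unfolding grp_eq_obs grp_mul_obs
    proof (intro allI impI ballI ext)
      fix X w x S assume X: "open X \<and> X \<subseteq> V \<inter> W" and w: "w \<in> vsec M (obs_dom M E k) X"
      have "obs_lincomb m c \<beta> (\<tau> V) (\<tau> W) k X w + u W X w = u V X w"
        "obs_lincomb m d \<beta> (\<tau> V) (\<tau> W) k X w + v W X w = v V X w"
        using u(2)[OF VW] v(2)[OF VW] X w by (simp_all add: grp_eq_obs grp_mul_obs)
      then have e: "obs_lincomb m c \<beta> (\<tau> V) (\<tau> W) k X w x S + u W X w x S = u V X w x S"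
        "obs_lincomb m d \<beta> (\<tau> V) (\<tau> W) k X w x S + v W X w x S = v V X w x S"
        by (metis plus_fun_apply)+
      have "obs_lincomb m ((\<lambda>i. a * c i) + d) \<beta> (\<tau> V) (\<tau> W) k X w x S =
        a * obs_lincomb m c \<beta> (\<tau> V) (\<tau> W) k X w x S + obs_lincomb m d \<beta> (\<tau> V) (\<tau> W) k X w x S"
        by (simp add: obs_lincomb_def sum_distrib_left sum.distrib distrib_right mult.assoc)
      then show "(obs_lincomb m ((\<lambda>i. a * c i) + d) \<beta> (\<tau> V) (\<tau> W) k + h W) X w x S = (h V + 0) X w x S"
        using e by (simp add: hx e[symmetric] algebra_simps)
    qed
  qed
qed

text \<open>For type \<infinity> the whole class is zero, and for a finite type l \<noteq> k it is
  represented by a cocycle concentrated in degree l. For type \<open>k\<close>, a trivial component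
  would make the class of \<open>p\<close> come from type \<open>k + 1\<close>, which
  \<open>supermanifold\<close> excludes.\<close>

lemma obstruction_component:
  assumes p: "supermanifold M E j p" and k: "k \<in> {2..r}"
    and L: "(\<U>, x) \<in> cech_cocycles (total_obs_sheaf M E)"
    and ob: "obstruction M E j p = cech_class (total_obs_sheaf M E) (\<U>, x)"
  shows "trivial_in k \<U> x \<longleftrightarrow> j \<noteq> enat k"
proof -
  let ?A = "obs_sheaf M E k"
  interpret A: group_sheaf ?A 0 by (rule group_sheaf_obs)
  have Lin: "(\<U>, x) \<in> obstruction M E j p"
    unfolding ob cech_class_def using total_rel_refl[OF L] by blast
  show ?thesis
  proof (cases j)
    case infinity
    then have "(({UNIV}, \<lambda>U V. 0), (\<U>, x)) \<in> cech_rel (total_obs_sheaf M E)"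
      using Lin by (simp add: obstruction_def cech_class_def)
    from total_rel_component[OF this k] show ?thesis using infinity by simp
  next
    case (enat l)
    let ?B = "obs_sheaf M E l"
    from Lin obtain \<U>1 a1 where 1: "(\<U>1, a1) \<in> obs_map M E l (cech_class (aut_sheaf M E j) p)"
      "((\<U>1, \<lambda>U V. (\<lambda>l. 0)(l := a1 U V)), (\<U>, x)) \<in> cech_rel (total_obs_sheaf M E)"
      unfolding obstruction_def obs_incl_def enat by auto
    note comp = total_rel_component[OF 1(2) k]
    show ?thesis
    proof (cases "l = k")
      case False
      then have r: "((\<U>1, \<lambda>U V. 0), (\<U>, \<lambda>U V. x U V k)) \<in> cech_rel ?A" using comp by simp
      then have "open_cover \<U>1" by (auto simp: cech_rel_def cech_cocycles_def)
      from A.cech_rel_trans[OF zero_cocycle_rel[OF this] r] show ?thesis using False enat by simp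
    next
      case True
      have r: "((\<U>1, a1), (\<U>, \<lambda>U V. x U V k)) \<in> cech_rel ?A" using comp True by simp
      from 1(1) obtain \<U>2 a2 g where 2: "((\<U>2, a2), (\<U>1, a1)) \<in> cech_rel ?A"
        "(\<U>2, g) \<in> cech_class (aut_sheaf M E j) p"
        "\<forall>U\<in>\<U>2. \<forall>V\<in>\<U>2. obs_symbol M E k (U \<inter> V) (g U V) (a2 U V)"
        unfolding obs_map_def True by auto
      have pc: "p \<in> cech_cocycles (aut_sheaf M E (enat k))"
        and np: "cech_class (aut_sheaf M E (enat k)) p \<notin> cech_incl (aut_sheaf M E (enat k)) ` cech_H1 (aut_sheaf M E (enat k + 1))"
        using p enat True by (auto simp: supermanifold_def)
      have "\<not> trivial_in k \<U> x"
      proof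
        assume "trivial_in k \<U> x"
        from A.cech_rel_trans[OF A.cech_rel_trans[OF this A.cech_rel_sym[OF r]] A.cech_rel_sym[OF 2(1)]]
        have "(({UNIV}, \<lambda>U V. 0), (\<U>2, a2)) \<in> cech_rel ?A" .
        from trivial_obstruction_lifts[OF _ pc 2(2)[unfolded enat True] _ this] 2(3) k
        have "cech_class (aut_sheaf M E (enat k)) p \<in> cech_incl (aut_sheaf M E (enat k)) ` cech_H1 (aut_sheaf M E (enat k + 1))"
          by auto
        with np show False ..
      qed
      then show ?thesis using enat True by simp
    qed
  qed
qed

end

theorem theorem1p4p4:
  fixes \<F> :: "('x::{t2_space,second_countable_topology}, 'x \<times> 'b,
               'b::{t2_space,second_countable_topology}) super_family"
    and j' :: enat and b :: 'b
  assumes "gtm_family \<F>" and "tot_type \<F> = j'"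
    and "connected (UNIV :: 'b set)" and "stein (base \<F>)"
    and "analytic_family \<F>"
    and "fib_type \<F> b < \<infinity>"
  shows "\<exists>V. open V \<and> b \<in> V \<and> (\<forall>b'\<in>V. fib_type \<F> b' = fib_type \<F> b)"
proof -
  let ?M = "fib_mfd \<F>" and ?E = "fib_odd \<F>"
  have fam: "super_family \<F>" using assms(1) by (simp add: gtm_family_def)
  interpret model ?M ?E using fam by unfold_locales (simp_all add: super_family_def)
  have B: "complex_manifold (base \<F>)" using fam by (simp add: super_family_def)
  have sm: "supermanifold ?M ?E (fib_type \<F> b') (fib_super \<F> b')" for b'
    using fam by (simp add: super_family_def)
  from assms(5) obtain m \<U> \<beta> c where \<U>: "open_cover \<U>" and basis: "obs_H1_basis ?M ?E m \<U> \<beta>"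
    and c: "\<And>i. i < m \<Longrightarrow> c i \<in> osec (base \<F>) UNIV"
    and diff: "\<And>b'. splitting_type_differential \<F> b' =
       cech_class (total_obs_sheaf ?M ?E) (\<U>, obs_lincomb m (\<lambda>i. c i b') \<beta>)"
    unfolding analytic_family_def by blast
  have \<beta>: "(\<U>, \<beta> i) \<in> cech_cocycles (total_obs_sheaf ?M ?E)" if "i < m" for i
    using basis that by (simp add: obs_H1_basis_def)
  obtain k where k: "fib_type \<F> b = enat k" using assms(6) by auto
  \<comment> \<open>A finite splitting type lies between 2 and the rank, so \<open>k\<close> labels
    a summand of the total obstruction sheaf.\<close>
  have kr: "k \<in> {2..r}" using sm[of b] by (auto simp: supermanifold_def k numeral_eq_enat)
  have comp: "trivial_in k \<U> (obs_lincomb m (\<lambda>i. c i b') \<beta>) \<longleftrightarrow> fib_type \<F> b' \<noteq> enat k" for b'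
    by (rule obstruction_component[OF sm kr lincomb_cocycle[OF \<U> \<beta>]])
      (simp_all add: diff[unfolded splitting_type_differential_def])
  define Z where "Z = {x. trivial_in k \<U> (obs_lincomb m x \<beta>)}"
  have Z0: "0 \<in> Z"
  proof -
    have "obs_lincomb m 0 \<beta> U V k = 0" for U V by (auto simp: obs_lincomb_def fun_eq_iff)
    then show ?thesis using zero_cocycle_rel[OF \<U>] by (simp add: Z_def)
  qed
  have Zlin: "(\<lambda>i. a * x i) + y \<in> Z" if "x \<in> Z" "y \<in> Z" for a x y
    using trivial_lincomb[OF \<U> \<beta> kr] that by (simp add: Z_def)
  \<comment> \<open>Truncation at \<open>m\<close> leaves the combination of the
    \<open>\<beta> i\<close> unchanged and makes \<open>v b'\<close> a finite combination of unit
    vectors.\<close>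
  define v where "v b' i = (if i < m then c i b' else 0)" for b' i
  have lv: "obs_lincomb m (v b') \<beta> = obs_lincomb m (\<lambda>i. c i b') \<beta>" for b'
    by (simp add: obs_lincomb_def v_def)
  have vZ: "v b' \<in> Z \<longleftrightarrow> fib_type \<F> b' \<noteq> enat k" for b'
    by (simp add: Z_def lv comp)
  then have vb: "v b \<notin> Z" by (simp add: k)
  obtain f where f': "\<forall>x\<in>Z. f x = 0" "f (v b) \<noteq> 0"
    "\<forall>x y. f (x + y) = f x + f y" "\<forall>a x. f (\<lambda>i. a * x i) = a * f x"
    by (rule separating_functional[OF Z0 _ vb], erule (1) Zlin)
  note f = bspec[OF f'(1)] f'(2) f'(3)[rule_format] f'(4)[rule_format]
  have f0: "f 0 = 0" using f(3)[of 0 0] by simp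
  have fsum: "f (\<Sum>i\<in>I. g i) = (\<Sum>i\<in>I. f (g i))" for I :: "nat set" and g
    by (induction I rule: infinite_finite_induct) (simp_all add: f0 f(3) del: zero_fun_apply plus_fun_apply)
  \<comment> \<open>Linearity alone turns \<open>f\<close> along the family into a finite
    combination of the holomorphic functions \<open>c i\<close>, which is continuous in
    \<open>b'\<close>.\<close>
  have fv: "f (v b') = (\<Sum>i<m. c i b' * f (unit_vec i))" for b'
  proof -
    have "v b' = (\<Sum>i<m. (\<lambda>l. c i b' * unit_vec i l))"
      by (auto simp: v_def sum_fun_apply fun_eq_iff if_distrib cong: if_cong)
    then show ?thesis by (simp add: fsum f(4))
  qed
  have "continuous_on UNIV (c i)" if "i < m" for i
    using holo_fun_continuous[OF B] c[OF that] by (simp add: osec_def)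
  then have "continuous_on UNIV (\<lambda>b'. f (v b'))"
    unfolding fv by (intro continuous_intros) auto
  \<comment> \<open>The required neighbourhood: where the functional is nonzero, \<open>v b'\<close>
    is outside \<open>Z\<close>, and this means splitting type \<open>k\<close>.\<close>
  then have "open ((\<lambda>b'. f (v b')) -` (- {0}))"
    by (intro open_vimage) auto
  moreover have "b \<in> (\<lambda>b'. f (v b')) -` (- {0})" using f(2) by simp
  moreover have "fib_type \<F> b' = fib_type \<F> b" if "b' \<in> (\<lambda>b'. f (v b')) -` (- {0})" for b'
  proof (rule ccontr)
    assume "fib_type \<F> b' \<noteq> fib_type \<F> b"
    then have "v b' \<in> Z" using vZ k by simp
    with that show False using f(1)[of "v b'"] by simp
  qed
  ultimately show ?thesis by blast
qed

end
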